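(* (Real case.) For every $\varepsilon>0$ there exists $\delta>0$ (depending only on $\varepsilon$, not on the matrix size) such that for every $n\ge1$ and every real matrix $X\in M_n$ with $\|X\|\le 1$ and $$\|XX^*-X^*X\|\le\delta,$$ there exists a normal real matrix $X'\in M_n$ such that $\|X'\|\le1$ and $\|X-X'\|\le\varepsilon$. (Quaternionic case.) For every $\varepsilon>0$ there exists $\delta>0$ (depending only on $\varepsilon$) such that for every $n\ge1$ and every quaternionic matrix $X\in M_n(\mathbb{H})$ with $\|X\|\le1$ and $\|XX^*-X^*X\|\le\delta$, there exists a normal quaternionic matrix $X'\in M_n(\mathbb{H})$ such that $\|X'\|\le1$ and $\|X-X'\|\le\varepsilon$.
   Context: $M_n=M_n(\mathbb{C})$ and $\|\cdot\|$ is the operator norm; a real matrix is one with real entries. The algebra $M_n(\mathbb{H})$ of quaternionic matrices is identified with the real $*$-subalgebra of $M_{2n}(\mathbb{C})$ consisting of those $X$ with $X^\sharp=X^*$, where in $n\times n$ blocks $$\begin{pmatrix}A&B\\C&D\end{pmatrix}^{\sharp}=\begin{pmatrix}D^{\mathrm T}&-B^{\mathrm T}\\-C^{\mathrm T}&A^{\mathrm T}\end{pmatrix},$$ and it carries the operator norm and adjoint of $M_{2n}(\mathbb{C})$. A matrix $X$ is normal if $XX^*=X^*X$. *)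

theory Defs
  imports
    "Jordan_Normal_Form.Schur_Decomposition"
    "HOL-Analysis.L2_Norm"
begin

text \<open>
  The matrix size is quantified inside the statement, so matrices are carrier-based
  (\<^typ>\<open>complex mat\<close> with \<^const>\<open>carrier_mat\<close>) and \<open>onorm\<close>,
  which needs normed vector spaces as types, is not applicable.
\<close>

definition vec_norm2 :: "complex vec \<Rightarrow> real" where
  "vec_norm2 v = L2_set (\<lambda>i. cmod (v $ i)) {..<dim_vec v}"

definition op_norm :: "complex mat \<Rightarrow> real" where
  "op_norm A = (SUP v\<in>{v \<in> carrier_vec (dim_col A). vec_norm2 v \<le> 1}. vec_norm2 (A *\<^sub>v v))"

definition real_matrix :: "complex mat \<Rightarrow> bool" where
  "real_matrix A \<longleftrightarrow> elements_mat A \<subseteq> \<real>"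

definition normal_matrix :: "complex mat \<Rightarrow> bool" where
  "normal_matrix A \<longleftrightarrow> A * mat_adjoint A = mat_adjoint A * A"

text \<open>The operation \<open>X\<^sup>\<sharp>\<close> on \<open>2n \<times> 2n\<close> matrices; the parameter is the block size \<open>n\<close>.\<close>

definition sharp :: "nat \<Rightarrow> complex mat \<Rightarrow> complex mat" where
  "sharp n X = (case split_block X n n of (A, B, C, D) \<Rightarrow>
     four_block_mat (transpose_mat D) (- transpose_mat B)
                    (- transpose_mat C) (transpose_mat A))"

text \<open>The \<open>n \<times> n\<close> quaternionic matrices, realised as a real *-subalgebra of the
  \<open>2n \<times> 2n\<close> complex matrices.\<close>

definition quaternionic_mat :: "nat \<Rightarrow> complex mat set" where
  "quaternionic_mat n = {X \<in> carrier_mat (2 * n) (2 * n). sharp n X = mat_adjoint X}"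

end

theory Submission
  imports "HOL-Analysis.Weierstrass_Theorems" Defs
begin

text \<open>
  A sequence of counterexamples is a normal element \<open>X = H + \<i> K\<close> of the algebra of bounded families
  of matrices modulo families that tend to \<open>0\<close> uniformly in the size.  Real and quaternionic
  matrices alike are the fixed points of an antilinear involution \<open>sig W\<close>; it fixes \<open>H\<close> and
  negates \<open>K\<close>.

  By polar decomposition, \<open>X\<close> can be moved slightly so that its spectrum avoids the points of a fine
  grid: \<open>f(H) g(K) = 0\<close> if \<open>f\<close> and \<open>g\<close> are supported near the two coordinates of a grid point.  In the
  column of holes above a grid line, the spectral band of \<open>K\<close> between two consecutive holes then
  behaves like a projection \<open>B\<close>, and \<open>1 + B (u - 1)\<close> is unitary where \<open>u\<close> is the function of \<open>H\<close> that
  winds once around the circle across the column.  A discontinuous function of this unitary turns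
  the smoothed step function of \<open>H\<close> into a projection on the band.  The bands of a column are
  exchanged in pairs by \<open>sig W\<close>, so that the sum over the column is a projection \<open>P\<close> fixed by \<open>sig W\<close>
  which separates the parts of the spectrum of \<open>H\<close> on the two sides; it commutes with \<open>H\<close> and with a
  step function \<open>K'\<close> of \<open>K\<close> that is constant on the bands.

  The differences \<open>R\<^sub>l\<close> of consecutive projections \<open>P\<close> add up to \<open>1\<close>, and \<open>X\<close> is close to
  \<open>(\<Sum>l. a\<^sub>l R\<^sub>l) + \<i> K'\<close>.  As \<open>R\<^sub>l\<close> is a spectral projection of \<open>\<Sum>l. l R\<^sub>l\<close>, it lifts to exact
  projections \<open>E\<^sub>l\<close> of matrices, and \<open>\<Sum>l. E\<^sub>l (a\<^sub>l + \<i> K') E\<^sub>l\<close> is exactly normal.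
\<close>

text \<open>The obstacle: projections do not in general come from continuous functions, while a
  discontinuous function depends on the representative on which it is evaluated; it need not commute
  with what commutes with its argument, nor be fixed by \<open>sig W\<close>. Each correction is
  therefore tied to one band between two holes. There \<open>H\<close> is locally a function of the
  unitary, which restores commutation with \<open>H\<close>; \<open>K\<close> is given up for a
  function that is a scalar on the band; and invariance under \<open>sig W\<close> is arranged by
  choice, a correction on one band and its image on the mirror band. The grid has points on the real
  axis so that no band is its own mirror image.

  Finite dimension enters twice: normal matrices are diagonalizable, which gives calculi for
  discontinuous functions, and invertible matrices are dense, so that polar factors can be taken
  unitary. The second point fails for general operators, as the shift shows.

  The lifts of \<open>K'\<close> and \<open>E\<close> need not commute; compressing the lift of
  \<open>K'\<close> to the blocks of \<open>E\<close> restores commutation exactly, and in the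
  quotient it changes nothing.\<close>

section \<open>The operator norm\<close>

lemma mat_adjoint_dim [simp]:
  "dim_row (mat_adjoint A) = dim_col A" "dim_col (mat_adjoint A) = dim_row A"
  by (simp_all add: mat_adjoint_def mat_of_rows_def)

lemma mat_adjoint_carrier [simp]:
  "A \<in> carrier_mat n m \<Longrightarrow> mat_adjoint A \<in> carrier_mat m n"
  by (metis carrier_matD carrier_matI mat_adjoint_dim)

lemma mat_adjoint_index [simp]:
  fixes A :: "complex mat"
  assumes "i < dim_col A" "j < dim_row A"
  shows "mat_adjoint A $$ (i, j) = cnj (A $$ (j, i))"
  using assms by (simp add: mat_adjoint_def mat_of_rows_def)

lemma mat_adjoint_adjoint [simp]: "mat_adjoint (mat_adjoint A) = (A :: complex mat)"
  by (intro eq_matI) auto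

lemma mat_adjoint_mult:
  fixes A B :: "complex mat"
  assumes "A \<in> carrier_mat n m" "B \<in> carrier_mat m k"
  shows "mat_adjoint (A * B) = mat_adjoint B * mat_adjoint A"
  using assms by (intro eq_matI) (auto simp: scalar_prod_def mult.commute)

lemma mat_adjoint_add:
  fixes A B :: "complex mat"
  assumes "A \<in> carrier_mat n m" "B \<in> carrier_mat n m"
  shows "mat_adjoint (A + B) = mat_adjoint A + mat_adjoint B"
  using assms by (intro eq_matI) auto

lemma mat_adjoint_minus:
  fixes A B :: "complex mat"
  assumes "A \<in> carrier_mat n m" "B \<in> carrier_mat n m"
  shows "mat_adjoint (A - B) = mat_adjoint A - mat_adjoint B"
  using assms by (intro eq_matI) auto

lemma mat_adjoint_uminus: "mat_adjoint (- A) = - mat_adjoint (A :: complex mat)"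
  by (intro eq_matI) auto

lemma mat_adjoint_smult: "mat_adjoint (c \<cdot>\<^sub>m A) = cnj c \<cdot>\<^sub>m mat_adjoint (A :: complex mat)"
  by (intro eq_matI) auto

lemma mat_adjoint_one [simp]: "mat_adjoint (1\<^sub>m n) = (1\<^sub>m n :: complex mat)"
  by (intro eq_matI) auto

lemma mat_adjoint_diag: "mat_adjoint (mat_diag n l) = mat_diag n (\<lambda>i. cnj (l i))"
  by (intro eq_matI) (auto simp: mat_diag_def)

lemma vec_norm2_nonneg [simp]: "0 \<le> vec_norm2 v"
  by (simp add: vec_norm2_def L2_set_nonneg)

lemma vec_norm2_0 [simp]: "vec_norm2 (0\<^sub>v n) = 0"
  by (simp add: vec_norm2_def L2_set_def)

lemma vec_norm2_eq_0: "v \<in> carrier_vec n \<Longrightarrow> vec_norm2 v = 0 \<longleftrightarrow> v = 0\<^sub>v n"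
  by (auto simp: vec_norm2_def L2_set_eq_0_iff)

lemma cscalar_self: "v \<bullet>c v = complex_of_real ((vec_norm2 v)\<^sup>2)"
  by (auto simp: scalar_prod_def vec_norm2_def L2_set_def real_sqrt_pow2 sum_nonneg
      complex_norm_square lessThan_atLeast0 intro!: sum.cong simp flip: of_real_power)

lemma cscalar_le: 
  assumes "v \<in> carrier_vec n" "w \<in> carrier_vec n"
  shows "cmod (v \<bullet>c w) \<le> vec_norm2 v * vec_norm2 w"
proof -
  have "cmod (v \<bullet>c w) \<le> (\<Sum>i<n. cmod (v $ i) * cmod (w $ i))"
    using assms by (auto simp: scalar_prod_def lessThan_atLeast0 norm_mult intro!: order.trans[OF norm_sum] sum_mono)
  also have "\<dots> \<le> vec_norm2 v * vec_norm2 w"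
    using assms L2_set_mult_ineq[of "\<lambda>i. cmod (v $ i)" "\<lambda>i. cmod (w $ i)" "{..<n}"]
    by (simp add: vec_norm2_def)
  finally show ?thesis .
qed

lemma vec_norm2_add:
  assumes "v \<in> carrier_vec n" "w \<in> carrier_vec n"
  shows "vec_norm2 (v + w) \<le> vec_norm2 v + vec_norm2 w"
proof -
  have "vec_norm2 (v + w) \<le> L2_set (\<lambda>i. cmod (v $ i) + cmod (w $ i)) {..<n}"
    using assms by (auto simp: vec_norm2_def intro!: L2_set_mono norm_triangle_ineq)
  also have "\<dots> \<le> vec_norm2 v + vec_norm2 w"
    using assms by (auto simp: vec_norm2_def intro!: L2_set_triangle_ineq)
  finally show ?thesis .
qed

lemma vec_norm2_smult: "vec_norm2 (c \<cdot>\<^sub>v v) = cmod c * vec_norm2 v"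
proof -
  have "vec_norm2 (c \<cdot>\<^sub>v v) = L2_set (\<lambda>i. cmod c * cmod (v $ i)) {..<dim_vec v}"
    by (auto simp: vec_norm2_def norm_mult intro!: L2_set_cong)
  thus ?thesis by (simp add: vec_norm2_def L2_set_right_distrib)
qed

lemma cscalar_adjoint:
  fixes A :: "complex mat"
  assumes "A \<in> carrier_mat n m" "v \<in> carrier_vec m" "w \<in> carrier_vec n"
  shows "(A *\<^sub>v v) \<bullet>c w = v \<bullet>c (mat_adjoint A *\<^sub>v w)"
proof -
  have "(A *\<^sub>v v) \<bullet>c w = (\<Sum>i<n. \<Sum>j<m. A $$ (i,j) * v $ j * cnj (w $ i))"
    using assms by (auto simp: scalar_prod_def lessThan_atLeast0 sum_distrib_right intro!: sum.cong)
  also have "\<dots> = (\<Sum>j<m. \<Sum>i<n. A $$ (i,j) * v $ j * cnj (w $ i))"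
    by (rule sum.swap)
  also have "\<dots> = v \<bullet>c (mat_adjoint A *\<^sub>v w)"
    using assms by (auto simp: scalar_prod_def lessThan_atLeast0 sum_distrib_left mult_ac intro!: sum.cong)
  finally show ?thesis .
qed

text \<open>\<open>op_norm\<close> is a supremum of reals, which is meaningful only for sets bounded
  above. Any crude bound, here the sum of the moduli of all entries, makes \<open>op_norm_ub\<close>
  available.\<close>

lemma mult_mat_vec_bounded:
  assumes A: "A \<in> carrier_mat n n"
  shows "\<exists>C. \<forall>v\<in>carrier_vec n. vec_norm2 (A *\<^sub>v v) \<le> C * vec_norm2 v"
proof (intro exI ballI)
  fix v :: "complex vec" assume v: "v \<in> carrier_vec n"
  have vi: "cmod (v $ i) \<le> vec_norm2 v" if "i < n" for i
    using v that member_le_L2_set[of "{..<n}" i "\<lambda>i. cmod (v $ i)"] by (simp add: vec_norm2_def)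
  have "vec_norm2 (A *\<^sub>v v) \<le> (\<Sum>i<n. cmod ((A *\<^sub>v v) $ i))"
    using A L2_set_le_sum[of "{..<n}" "\<lambda>i. cmod ((A *\<^sub>v v) $ i)"] by (simp add: vec_norm2_def del: index_mult_mat_vec)
  also have "\<dots> \<le> (\<Sum>i<n. \<Sum>j<n. cmod (A $$ (i,j)) * vec_norm2 v)"
  proof (rule sum_mono)
    fix i assume i: "i \<in> {..<n}"
    have "(A *\<^sub>v v) $ i = (\<Sum>j<n. A $$ (i,j) * v $ j)"
      using A v i by (auto simp: scalar_prod_def lessThan_atLeast0)
    thus "cmod ((A *\<^sub>v v) $ i) \<le> (\<Sum>j<n. cmod (A $$ (i,j)) * vec_norm2 v)"
      using vi by (auto simp: norm_mult intro!: order.trans[OF norm_sum] sum_mono mult_left_mono)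
  qed
  also have "\<dots> = (\<Sum>i<n. \<Sum>j<n. cmod (A $$ (i,j))) * vec_norm2 v"
    by (simp add: sum_distrib_right)
  finally show "vec_norm2 (A *\<^sub>v v) \<le> (\<Sum>i<n. \<Sum>j<n. cmod (A $$ (i,j))) * vec_norm2 v" .
qed

lemma op_norm_ub:
  assumes A: "A \<in> carrier_mat n n" and v: "v \<in> carrier_vec n"
  shows "vec_norm2 (A *\<^sub>v v) \<le> op_norm A * vec_norm2 v"
proof -
  obtain C where C: "\<And>v. v \<in> carrier_vec n \<Longrightarrow> vec_norm2 (A *\<^sub>v v) \<le> C * vec_norm2 v"
    using mult_mat_vec_bounded[OF A] by auto
  have bdd: "bdd_above ((\<lambda>v. vec_norm2 (A *\<^sub>v v)) ` {v \<in> carrier_vec (dim_col A). vec_norm2 v \<le> 1})"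
  proof (rule bdd_aboveI2)
    fix v assume "v \<in> {v \<in> carrier_vec (dim_col A). vec_norm2 v \<le> 1}"
    hence v: "v \<in> carrier_vec n" "vec_norm2 v \<le> 1" using A by auto
    show "vec_norm2 (A *\<^sub>v v) \<le> \<bar>C\<bar>"
      using C[OF v(1)] v(2) by (smt (verit) mult_left_le mult_right_mono vec_norm2_nonneg)
  qed
  show ?thesis
  proof (cases "vec_norm2 v = 0")
    case True
    hence "v = 0\<^sub>v n" using vec_norm2_eq_0[OF v] by simp
    thus ?thesis using C[OF v] True by simp
  next
    case False
    hence pos: "vec_norm2 v > 0" using vec_norm2_nonneg[of v] by linarith
    define w where "w = complex_of_real (1 / vec_norm2 v) \<cdot>\<^sub>v v"
    have w: "w \<in> carrier_vec n" "vec_norm2 w = 1" 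
      using v pos by (auto simp: w_def vec_norm2_smult norm_divide)
    have "vec_norm2 (A *\<^sub>v w) \<le> op_norm A"
      unfolding op_norm_def by (rule cSUP_upper[OF _ bdd]) (use w A in auto)
    moreover have "A *\<^sub>v w = complex_of_real (1 / vec_norm2 v) \<cdot>\<^sub>v (A *\<^sub>v v)"
      unfolding w_def by (rule mult_mat_vec[OF A v])
    ultimately have "vec_norm2 (A *\<^sub>v v) / vec_norm2 v \<le> op_norm A"
      using pos by (simp add: vec_norm2_smult norm_divide)
    thus ?thesis using pos by (simp add: field_simps)
  qed
qed

lemma op_norm_le:
  assumes A: "A \<in> carrier_mat n n" and "0 \<le> c"
    and "\<And>v. v \<in> carrier_vec n \<Longrightarrow> vec_norm2 (A *\<^sub>v v) \<le> c * vec_norm2 v"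
  shows "op_norm A \<le> c"
  unfolding op_norm_def
proof (rule cSUP_least)
  show "{v \<in> carrier_vec (dim_col A). vec_norm2 v \<le> 1} \<noteq> {}"
    by (auto intro!: exI[of _ "0\<^sub>v (dim_col A)"])
  fix v assume v: "v \<in> {v \<in> carrier_vec (dim_col A). vec_norm2 v \<le> 1}"
  hence "v \<in> carrier_vec n" using A by auto
  from assms(3)[OF this] show "vec_norm2 (A *\<^sub>v v) \<le> c"
    using v assms(2) by (smt (verit) mem_Collect_eq mult_left_le)
qed

lemma op_norm_nonneg:
  assumes A: "A \<in> carrier_mat n n"
  shows "0 \<le> op_norm A"
proof (cases "\<exists>v\<in>carrier_vec n. vec_norm2 v \<noteq> 0")
  case True
  then obtain v where "v \<in> carrier_vec n" "vec_norm2 v > 0" 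
    by (metis less_eq_real_def vec_norm2_nonneg)
  thus ?thesis using op_norm_ub[OF A, of v] vec_norm2_nonneg[of "A *\<^sub>v v"]
    by (smt (verit) mult_neg_pos)
next
  \<comment> \<open>The carrier may consist of the zero vector alone, as for \<open>n = 0\<close>;
    the supremum is then taken over the single value \<open>0\<close>.\<close>
  case False
  hence "vec_norm2 (A *\<^sub>v v) = 0" if "v \<in> carrier_vec n" for v
    using A mult_mat_vec_carrier[OF A that] by auto
  hence "op_norm A = (SUP v\<in>{v \<in> carrier_vec (dim_col A). vec_norm2 v \<le> 1}. 0)"
    unfolding op_norm_def using A by (intro SUP_cong) auto
  also have "\<dots> = 0" by (rule cSUP_const) (auto intro!: exI[of _ "0\<^sub>v (dim_col A)"])
  finally show ?thesis by simp
qed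

lemma op_norm_add:
  assumes A: "A \<in> carrier_mat n n" and B: "B \<in> carrier_mat n n"
  shows "op_norm (A + B) \<le> op_norm A + op_norm B"
proof (rule op_norm_le)
  fix v :: "complex vec" assume v: "v \<in> carrier_vec n"
  have "vec_norm2 ((A + B) *\<^sub>v v) = vec_norm2 (A *\<^sub>v v + B *\<^sub>v v)"
    using add_mult_distrib_mat_vec[OF A B v] by simp
  also have "\<dots> \<le> vec_norm2 (A *\<^sub>v v) + vec_norm2 (B *\<^sub>v v)"
    using A B v by (intro vec_norm2_add[of _ n]) auto
  also have "\<dots> \<le> (op_norm A + op_norm B) * vec_norm2 v"
    using op_norm_ub[OF A v] op_norm_ub[OF B v] by (simp add: algebra_simps)
  finally show "vec_norm2 ((A + B) *\<^sub>v v) \<le> (op_norm A + op_norm B) * vec_norm2 v" .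
qed (use A B op_norm_nonneg in auto)

lemma op_norm_smult:
  assumes A: "A \<in> carrier_mat n n"
  shows "op_norm (c \<cdot>\<^sub>m A) \<le> cmod c * op_norm A"
proof (rule op_norm_le)
  fix v :: "complex vec" assume v: "v \<in> carrier_vec n"
  have "(c \<cdot>\<^sub>m A) *\<^sub>v v = c \<cdot>\<^sub>v (A *\<^sub>v v)"
    using A v by (intro eq_vecI) (auto simp: scalar_prod_def sum_distrib_left mult_ac)
  thus "vec_norm2 ((c \<cdot>\<^sub>m A) *\<^sub>v v) \<le> cmod c * op_norm A * vec_norm2 v"
    using op_norm_ub[OF A v] by (simp add: vec_norm2_smult mult.assoc mult_left_mono)
qed (use A op_norm_nonneg in auto)

lemma op_norm_uminus:
  assumes A: "A \<in> carrier_mat n n"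
  shows "op_norm (- A) = op_norm A"
proof -
  have *: "op_norm (- A) \<le> op_norm A" if A: "A \<in> carrier_mat n n" for A
  proof -
    have "- A = (-1) \<cdot>\<^sub>m A" by (intro eq_matI) auto
    thus ?thesis using op_norm_smult[OF A, of "-1"] by simp
  qed
  show ?thesis using *[OF A] *[of "- A"] A by simp
qed

lemma op_norm_mult:
  assumes A: "A \<in> carrier_mat n n" and B: "B \<in> carrier_mat n n"
  shows "op_norm (A * B) \<le> op_norm A * op_norm B"
proof (rule op_norm_le)
  fix v :: "complex vec" assume v: "v \<in> carrier_vec n"
  have "vec_norm2 (A * B *\<^sub>v v) = vec_norm2 (A *\<^sub>v (B *\<^sub>v v))"
    using A B v by simp
  also have "\<dots> \<le> op_norm A * vec_norm2 (B *\<^sub>v v)"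
    using A B v by (intro op_norm_ub[OF A]) auto
  also have "\<dots> \<le> op_norm A * (op_norm B * vec_norm2 v)"
    using op_norm_ub[OF B v] op_norm_nonneg[OF A] by (rule mult_left_mono)
  finally show "vec_norm2 (A * B *\<^sub>v v) \<le> op_norm A * op_norm B * vec_norm2 v"
    by (simp add: mult.assoc)
qed (use A B op_norm_nonneg in auto)

lemma op_norm_zero [simp]: "op_norm (0\<^sub>m n n) = 0"
proof (rule antisym)
  have "0\<^sub>m n n *\<^sub>v v = 0\<^sub>v n" if "v \<in> carrier_vec n" for v :: "complex vec"
    using that by (intro eq_vecI) auto
  thus "op_norm (0\<^sub>m n n) \<le> 0" by (intro op_norm_le[of _ n]) auto
qed (auto intro: op_norm_nonneg[of _ n])

text \<open>For \<open>w\<close> the adjoint of \<open>A\<close> applied to \<open>v\<close>, the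
  squared norm of \<open>w\<close> is the pairing of \<open>A w\<close> with \<open>v\<close>, hence
  at most \<open>op_norm A\<close> times the norms of \<open>w\<close> and \<open>v\<close>.
  Dividing by the norm of \<open>w\<close> gives one inequality, and applying it to the adjoint
  gives the other.\<close>

lemma op_norm_adjoint:
  assumes A: "A \<in> carrier_mat n n"
  shows "op_norm (mat_adjoint A) = op_norm A"
proof -
  have *: "op_norm (mat_adjoint A) \<le> op_norm A" if A: "A \<in> carrier_mat n n" for A
  proof (rule op_norm_le[of _ n])
    fix v :: "complex vec" assume v: "v \<in> carrier_vec n"
    let ?w = "mat_adjoint A *\<^sub>v v"
    have w: "?w \<in> carrier_vec n" using A v by (metis mat_adjoint_carrier mult_mat_vec_carrier)
    have Aw: "A *\<^sub>v ?w \<in> carrier_vec n" using A w by (rule mult_mat_vec_carrier)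
    have "(vec_norm2 ?w)\<^sup>2 = cmod (?w \<bullet>c ?w)" unfolding cscalar_self norm_of_real by simp
    also have "?w \<bullet>c ?w = (A *\<^sub>v ?w) \<bullet>c v" by (rule cscalar_adjoint[OF A w v, symmetric])
    also have "cmod \<dots> \<le> vec_norm2 (A *\<^sub>v ?w) * vec_norm2 v" by (rule cscalar_le[OF Aw v])
    also have "\<dots> \<le> op_norm A * vec_norm2 ?w * vec_norm2 v"
      by (intro mult_right_mono op_norm_ub[OF A w]) auto
    finally have "vec_norm2 ?w * vec_norm2 ?w \<le> vec_norm2 ?w * (op_norm A * vec_norm2 v)" 
      by (simp add: power2_eq_square mult_ac)
    thus "vec_norm2 ?w \<le> op_norm A * vec_norm2 v"
      using op_norm_nonneg[OF A] by (cases "vec_norm2 ?w = 0") (auto simp: mult_le_cancel_left less_le)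
  qed (use A op_norm_nonneg in auto)
  show ?thesis using *[OF A] *[of "mat_adjoint A"] A by simp
qed

section \<open>Unitary matrices and diagonalization\<close>

definition unitary_mat :: "nat \<Rightarrow> complex mat \<Rightarrow> bool" where
  "unitary_mat n U \<longleftrightarrow> U \<in> carrier_mat n n \<and> mat_adjoint U * U = 1\<^sub>m n \<and> U * mat_adjoint U = 1\<^sub>m n"

lemma unitary_mat_norm:
  assumes "unitary_mat n U" "v \<in> carrier_vec n"
  shows "vec_norm2 (U *\<^sub>v v) = vec_norm2 v"
proof -
  have U: "U \<in> carrier_mat n n" "mat_adjoint U * U = 1\<^sub>m n" using assms(1) by (auto simp: unitary_mat_def)
  have "(U *\<^sub>v v) \<bullet>c (U *\<^sub>v v) = v \<bullet>c (mat_adjoint U *\<^sub>v (U *\<^sub>v v))"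
    using U assms(2) by (intro cscalar_adjoint[of _ n n]) auto
  also have "mat_adjoint U *\<^sub>v (U *\<^sub>v v) = (mat_adjoint U * U) *\<^sub>v v"
    using U assms(2) by (intro assoc_mult_mat_vec[symmetric, of _ n n _ n]) auto
  finally have "complex_of_real ((vec_norm2 (U *\<^sub>v v))\<^sup>2) = complex_of_real ((vec_norm2 v)\<^sup>2)"
    using U assms(2) by (simp only: cscalar_self one_mult_mat_vec)
  thus ?thesis by (simp only: of_real_eq_iff) simp
qed

lemma unitary_mat_adjoint: "unitary_mat n U \<Longrightarrow> unitary_mat n (mat_adjoint U)"
  by (auto simp: unitary_mat_def)

lemma op_norm_unitary: "unitary_mat n U \<Longrightarrow> op_norm U \<le> 1"
  by (rule op_norm_le[of _ n]) (auto simp: unitary_mat_norm unitary_mat_def)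

lemma unitary_mat_one [simp]: "unitary_mat n (1\<^sub>m n)"
  by (simp add: unitary_mat_def)

lemma unitary_mat_mult:
  assumes "unitary_mat n U" "unitary_mat n V"
  shows "unitary_mat n (U * V)"
proof -
  have c: "U \<in> carrier_mat n n" "V \<in> carrier_mat n n" "mat_adjoint U \<in> carrier_mat n n"
     "mat_adjoint V \<in> carrier_mat n n" using assms by (auto simp: unitary_mat_def)
  note a = assoc_mult_mat[of _ n n _ n _ n]
  have "mat_adjoint V * mat_adjoint U * (U * V) = mat_adjoint V * ((mat_adjoint U * U) * V)"
    using c by (metis a mult_carrier_mat)
  moreover have "U * V * (mat_adjoint V * mat_adjoint U) = U * ((V * mat_adjoint V) * mat_adjoint U)"
    using c by (metis a mult_carrier_mat)
  ultimately show ?thesis using assms c 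
    by (simp only: unitary_mat_def mat_adjoint_mult[of _ n n _ n] mult_carrier_mat left_mult_one_mat simp_thms)
qed

lemma op_norm_diag:
  assumes "\<And>i. i < n \<Longrightarrow> cmod (l i) \<le> c" "0 \<le> c"
  shows "op_norm (mat_diag n l) \<le> c"
proof (rule op_norm_le[of _ n])
  fix v :: "complex vec" assume v: "v \<in> carrier_vec n"
  have "(mat_diag n l *\<^sub>v v) $ i = l i * v $ i" if i: "i < n" for i
  proof -
    have "(mat_diag n l *\<^sub>v v) $ i = (\<Sum>j = 0..<n. (if i = j then l j else 0) * v $ j)"
      using v i by (simp add: mat_diag_def scalar_prod_def)
    also have "\<dots> = (\<Sum>j = 0..<n. if i = j then l j * v $ j else 0)" by (intro sum.cong) auto
    finally show ?thesis using i by simp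
  qed
  hence "vec_norm2 (mat_diag n l *\<^sub>v v) = L2_set (\<lambda>i. cmod (l i) * cmod (v $ i)) {..<n}"
    by (auto simp: vec_norm2_def mat_diag_def norm_mult intro!: L2_set_cong)
  also have "\<dots> \<le> L2_set (\<lambda>i. c * cmod (v $ i)) {..<n}"
    using assms by (intro L2_set_mono mult_right_mono) auto
  also have "\<dots> = c * vec_norm2 v" using v assms(2) by (simp add: vec_norm2_def L2_set_right_distrib)
  finally show "vec_norm2 (mat_diag n l *\<^sub>v v) \<le> c * vec_norm2 v" .
qed (use assms in auto)

lemma corthogonal_normalize:
  fixes ws :: "complex vec list"
  assumes ws: "set ws \<subseteq> carrier_vec n" "corthogonal ws" "length ws = n"
  defines "U \<equiv> mat n n (\<lambda>(i,j). ws ! j $ i / complex_of_real (vec_norm2 (ws ! j)))"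
  shows "unitary_mat n U"
proof -
  have U: "U \<in> carrier_mat n n" by (simp add: U_def)
  have wsc: "ws ! j \<in> carrier_vec n" if "j < n" for j using ws that by auto
  have ortho: "(ws ! i \<bullet>c ws ! j = 0) = (i \<noteq> j)" if "i < n" "j < n" for i j
    using ws that unfolding corthogonal_def by auto
  have nz: "vec_norm2 (ws ! j) \<noteq> 0" if "j < n" for j
    using ortho[OF that that] by (auto simp: cscalar_self)
  have "mat_adjoint U * U = 1\<^sub>m n"
  proof (rule eq_matI)
    fix i j assume "i < dim_row (1\<^sub>m n :: complex mat)" "j < dim_col (1\<^sub>m n :: complex mat)"
    hence ij: "i < n" "j < n" by auto
    have "(mat_adjoint U * U) $$ (i,j) = (\<Sum>k<n. cnj (U $$ (k,i)) * U $$ (k,j))"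
      using ij U by (simp add: scalar_prod_def lessThan_atLeast0)
    also have "\<dots> = (\<Sum>k<n. ws ! j $ k * cnj (ws ! i $ k)) / (vec_norm2 (ws ! i) * vec_norm2 (ws ! j))"
      using ij by (simp add: U_def sum_divide_distrib mult_ac)
    also have "(\<Sum>k<n. ws ! j $ k * cnj (ws ! i $ k)) = ws ! j \<bullet>c ws ! i"
      using wsc[OF ij(1)] by (simp add: scalar_prod_def lessThan_atLeast0)
    also have "\<dots> / (vec_norm2 (ws ! i) * vec_norm2 (ws ! j)) = (if i = j then 1 else 0)"
      using ortho[OF ij(2,1)] nz[OF ij(1)] by (auto simp: cscalar_self power2_eq_square)
    finally show "(mat_adjoint U * U) $$ (i,j) = 1\<^sub>m n $$ (i,j)" using ij by simp
  qed (use U in auto)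
  moreover from this have "U * mat_adjoint U = 1\<^sub>m n"
    using mat_mult_left_right_inverse[of "mat_adjoint U" n U] U by simp
  ultimately show ?thesis using U by (simp add: unitary_mat_def)
qed

text \<open>An eigenvector is completed to an orthogonal basis by Gram-Schmidt, which keeps the
  first vector. After normalization it is the first column of \<open>U\<close>, so the first column
  of the conjugated matrix is \<open>e\<close> times the first unit vector.\<close>

lemma eigenvector_unitary:
  fixes A :: "complex mat"
  assumes A: "A \<in> carrier_mat n n" and n: "n > 0"
  shows "\<exists>U e. unitary_mat n U \<and> (\<forall>i<n. (mat_adjoint U * A * U) $$ (i,0) = (if i = 0 then e else 0))"
proof -
  have "\<not> constant (poly (char_poly A))"
    using degree_monic_char_poly[OF A] n by (simp add: constant_degree)
  then obtain e where "poly (char_poly A) e = 0" using fundamental_theorem_of_algebra by blast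
  hence "eigenvalue A e" using eigenvalue_root_char_poly[OF A] by simp
  then obtain v where v: "v \<in> carrier_vec n" "v \<noteq> 0\<^sub>v n" "A *\<^sub>v v = e \<cdot>\<^sub>v v"
    using A unfolding eigenvalue_def eigenvector_def by auto
  interpret cof_vec_space n "TYPE(complex)" .
  define b where "b = basis_completion v"
  define ws where "ws = gram_schmidt n b"
  from basis_completion[OF v(1,2), folded b_def]
  have dist_b: "distinct b" and indep: "\<not> lin_dep (set b)" and b: "set b \<subseteq> carrier_vec n" 
    and hdb: "hd b = v" and len_b: "length b = n" by auto
  from hdb len_b n obtain vs where bv: "b = v # vs" by (cases b, auto)
  from gram_schmidt_result[OF b dist_b indep refl, folded ws_def]
  have ws: "set ws \<subseteq> carrier_vec n" "corthogonal ws" "length ws = n" 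
    by (auto simp: len_b)
  have "hd ws = v" unfolding ws_def bv using gram_schmidt_hd[OF v(1)] .
  hence ws0: "ws ! 0 = v" using ws(3) n by (metis hd_conv_nth list.size(3) less_irrefl)
  define U where "U = mat n n (\<lambda>(i,j). ws ! j $ i / complex_of_real (vec_norm2 (ws ! j)))"
  have uU: "unitary_mat n U" unfolding U_def by (rule corthogonal_normalize[OF ws])
  hence U: "U \<in> carrier_mat n n" "mat_adjoint U * U = 1\<^sub>m n" by (auto simp: unitary_mat_def)
  have col: "col U 0 = (1 / complex_of_real (vec_norm2 v)) \<cdot>\<^sub>v v"
    using n v(1) by (intro eq_vecI) (auto simp: U_def ws0)
  have cU: "col U 0 \<in> carrier_vec n" using U n by auto
  have "A *\<^sub>v col U 0 = e \<cdot>\<^sub>v col U 0"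
    unfolding col mult_mat_vec[OF A v(1)] v(3) using v(1) by (intro eq_vecI) auto
  hence AU: "col (A * U) 0 = e \<cdot>\<^sub>v col U 0" using col_mult2[OF A U(1) n] by simp
  have "(mat_adjoint U * A * U) $$ (i,0) = (if i = 0 then e else 0)" if i: "i < n" for i
  proof -
    have "(mat_adjoint U * A * U) $$ (i,0) = (mat_adjoint U * (A * U)) $$ (i,0)"
      using A U by (simp add: assoc_mult_mat[of _ n n _ n _ n])
    also have "\<dots> = row (mat_adjoint U) i \<bullet> col (A * U) 0" using A U i n by simp
    also have "\<dots> = e * (row (mat_adjoint U) i \<bullet> col U 0)" unfolding AU 
      using U i n cU by (intro scalar_prod_smult_distrib[of _ n]) auto
    also have "row (mat_adjoint U) i \<bullet> col U 0 = (mat_adjoint U * U) $$ (i,0)" using U(1) i n by simp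
    finally show ?thesis using U i n by (simp del: index_mult_mat)
  qed
  thus ?thesis using uU by blast
qed

section \<open>Unitarily diagonalized matrices and their functions\<close>

definition udiag :: "nat \<Rightarrow> complex mat \<Rightarrow> (nat \<Rightarrow> complex) \<Rightarrow> complex mat" where
  "udiag n U l = U * mat_diag n l * mat_adjoint U"

lemma udiag_carrier [simp]: "unitary_mat n U \<Longrightarrow> udiag n U l \<in> carrier_mat n n"
  unfolding udiag_def unitary_mat_def by (meson mat_adjoint_carrier mat_diag_dim mult_carrier_mat)

lemma udiag_index:
  assumes "U \<in> carrier_mat n n" "i < n" "j < n"
  shows "udiag n U l $$ (i,j) = (\<Sum>k<n. U $$ (i,k) * l k * cnj (U $$ (j,k)))"
  using assms by (simp add: udiag_def mat_diag_mult_right[of _ n n] scalar_prod_def lessThan_atLeast0)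

lemma unitary_conj_cancel:
  assumes U: "unitary_mat n U" and A: "A \<in> carrier_mat n n"
  shows "U * (mat_adjoint U * A * U) * mat_adjoint U = A" "mat_adjoint U * (U * A * mat_adjoint U) * U = A"
proof -
  have c: "U \<in> carrier_mat n n" "mat_adjoint U \<in> carrier_mat n n" 
    "mat_adjoint U * U = 1\<^sub>m n" "U * mat_adjoint U = 1\<^sub>m n" using U by (auto simp: unitary_mat_def)
  note a = assoc_mult_mat[of _ n n _ n _ n] mult_carrier_mat[of _ n n _ n]
  have "U * (mat_adjoint U * A * U) * mat_adjoint U = (U * mat_adjoint U) * A * (U * mat_adjoint U)"
    using c(1,2) A by (simp add: a del: assoc_mult_mat)
  thus "U * (mat_adjoint U * A * U) * mat_adjoint U = A" using A by (simp add: c del: assoc_mult_mat)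
  have "mat_adjoint U * (U * A * mat_adjoint U) * U = (mat_adjoint U * U) * A * (mat_adjoint U * U)"
    using c(1,2) A by (simp add: a del: assoc_mult_mat)
  thus "mat_adjoint U * (U * A * mat_adjoint U) * U = A" using A by (simp add: c del: assoc_mult_mat)
qed

lemma adj_conj:
  fixes U A :: "complex mat"
  assumes "U \<in> carrier_mat n n" "A \<in> carrier_mat n n"
  shows "mat_adjoint (U * A * mat_adjoint U) = U * mat_adjoint A * mat_adjoint U"
    "mat_adjoint (mat_adjoint U * A * U) = mat_adjoint U * mat_adjoint A * U"
  using assms by (simp_all add: mat_adjoint_mult[of _ n n _ n] assoc_mult_mat[of _ n n _ n _ n] mult_carrier_mat[of _ n n _ n])

lemma unitary_conj_mult:
  assumes U: "unitary_mat n U" and A: "A \<in> carrier_mat n n" and B: "B \<in> carrier_mat n n"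
  shows "(U * A * mat_adjoint U) * (U * B * mat_adjoint U) = U * (A * B) * mat_adjoint U"
proof -
  have c: "U \<in> carrier_mat n n" "mat_adjoint U \<in> carrier_mat n n" 
    "mat_adjoint U * U = 1\<^sub>m n" using U by (auto simp: unitary_mat_def)
  note a = assoc_mult_mat[of _ n n _ n _ n] mult_carrier_mat[of _ n n _ n]
  have "(U * A * mat_adjoint U) * (U * B * mat_adjoint U) = U * A * (mat_adjoint U * U) * B * mat_adjoint U"
    using c(1,2) A B by (simp add: a del: assoc_mult_mat)
  thus ?thesis using c A B by (simp add: a del: assoc_mult_mat)
qed

text \<open>Induction on the size. If the first column of a normal \<open>B\<close> is
  \<open>e\<close> times the first unit vector, comparing the \<open>(0,0)\<close> entries of the
  two products of \<open>B\<close> with its adjoint shows that first row and first column have the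
  same length. So the rest of the first row vanishes as well, and the remaining block
  \<open>C\<close> is again normal.\<close>

theorem normal_udiag:
  assumes "A \<in> carrier_mat n n" "A * mat_adjoint A = mat_adjoint A * A"
  shows "\<exists>U l. unitary_mat n U \<and> A = udiag n U l"
  using assms
proof (induction n arbitrary: A)
  case 0
  have "A = udiag 0 (1\<^sub>m 0) (\<lambda>_. 0)" using 0 by (intro eq_matI) (auto simp: udiag_def)
  thus ?case using unitary_mat_one by blast
next
  case (Suc m)
  let ?n = "Suc m"
  note A = Suc.prems(1)
  obtain U e where U: "unitary_mat ?n U" 
    and e: "\<And>i. i < ?n \<Longrightarrow> (mat_adjoint U * A * U) $$ (i,0) = (if i = 0 then e else 0)"
    using eigenvector_unitary[OF A] by auto
  have Uc: "U \<in> carrier_mat ?n ?n" using U by (simp add: unitary_mat_def)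
  define B where "B = mat_adjoint U * A * U"
  have B: "B \<in> carrier_mat ?n ?n" using A Uc by (auto simp: B_def)
  have Bs: "mat_adjoint B = mat_adjoint U * mat_adjoint A * U" unfolding B_def by (rule adj_conj[OF Uc A])
  have normB: "B * mat_adjoint B = mat_adjoint B * B"
    using unitary_conj_mult[OF unitary_mat_adjoint[OF U], of A "mat_adjoint A"]
      unitary_conj_mult[OF unitary_mat_adjoint[OF U], of "mat_adjoint A" A] A Suc.prems(2)
    unfolding Bs unfolding B_def by simp
  have BB: "(B * mat_adjoint B) $$ (i,j) = (\<Sum>k<?n. B $$ (i,k) * cnj (B $$ (j,k)))" 
    "(mat_adjoint B * B) $$ (i,j) = (\<Sum>k<?n. cnj (B $$ (k,i)) * B $$ (k,j))" if "i < ?n" "j < ?n" for i j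
    using that B by (simp_all add: scalar_prod_def lessThan_atLeast0)
  have col0: "B $$ (i,0) = (if i = 0 then e else 0)" if "i < ?n" for i using e[OF that] by (simp add: B_def)
  have "complex_of_real (\<Sum>k<?n. (cmod (B $$ (0,k)))\<^sup>2) = complex_of_real (\<Sum>k<?n. (cmod (B $$ (k,0)))\<^sup>2)"
  proof -
    have "complex_of_real (\<Sum>k<?n. (cmod (B $$ (0,k)))\<^sup>2) = (B * mat_adjoint B) $$ (0,0)"
      by (subst BB) (auto simp: complex_norm_square simp del: sum.lessThan_Suc simp flip: of_real_power)
    also have "\<dots> = complex_of_real (\<Sum>k<?n. (cmod (B $$ (k,0)))\<^sup>2)"
      by (subst normB, subst BB) (auto simp: complex_norm_square mult.commute simp del: sum.lessThan_Suc simp flip: of_real_power)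
    finally show ?thesis .
  qed
  hence "(\<Sum>k<?n. (cmod (B $$ (0,k)))\<^sup>2) = (\<Sum>k<?n. (cmod (B $$ (k,0)))\<^sup>2)" by (simp only: of_real_eq_iff)
  hence "(\<Sum>k<m. (cmod (B $$ (0,Suc k)))\<^sup>2) = 0"
    by (simp add: sum.lessThan_Suc_shift col0 del: sum.lessThan_Suc)
  hence row0: "B $$ (0, Suc k) = 0" if "k < m" for k
    using that by (subst (asm) sum_nonneg_eq_0_iff) auto
  define C where "C = mat m m (\<lambda>(i,j). B $$ (Suc i, Suc j))"
  have C: "C \<in> carrier_mat m m" by (simp add: C_def)
  have "C * mat_adjoint C = mat_adjoint C * C"
  proof (rule eq_matI)
    fix i j assume "i < dim_row (mat_adjoint C * C)" "j < dim_col (mat_adjoint C * C)"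
    hence ij: "i < m" "j < m" using C by auto
    have "(C * mat_adjoint C) $$ (i,j) = (B * mat_adjoint B) $$ (Suc i, Suc j)"
      using ij C by (simp add: BB scalar_prod_def sum.lessThan_Suc_shift col0 del: sum.lessThan_Suc)
        (simp add: C_def lessThan_atLeast0)
    also have "\<dots> = (mat_adjoint C * C) $$ (i,j)"
      using ij C by (simp add: normB BB scalar_prod_def sum.lessThan_Suc_shift row0 del: sum.lessThan_Suc)
        (simp add: C_def lessThan_atLeast0)
    finally show "(C * mat_adjoint C) $$ (i,j) = (mat_adjoint C * C) $$ (i,j)" .
  qed (use C in auto)
  from Suc.IH[OF C this] obtain V l where V: "unitary_mat m V" and CV: "C = udiag m V l" by blast
  have Vc: "V \<in> carrier_mat m m" using V by (simp add: unitary_mat_def)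
  \<comment> \<open>The diagonalization of \<open>C\<close> is extended by the eigenvalue
    \<open>e\<close> that has been split off.\<close>
  define W where "W = mat ?n ?n (\<lambda>(i,j). case i of 0 \<Rightarrow> (if j = 0 then 1 else 0) 
     | Suc i \<Rightarrow> (case j of 0 \<Rightarrow> 0 | Suc j \<Rightarrow> V $$ (i,j)))"
  have Wc: "W \<in> carrier_mat ?n ?n" by (simp add: W_def)
  have W0: "W $$ (0,0) = 1" "\<And>i. i < m \<Longrightarrow> W $$ (0,Suc i) = 0" "\<And>i. i < m \<Longrightarrow> W $$ (Suc i, 0) = 0"
    "\<And>i j. i < m \<Longrightarrow> j < m \<Longrightarrow> W $$ (Suc i, Suc j) = V $$ (i,j)" by (auto simp: W_def)
  have VV: "(\<Sum>k<m. cnj (V $$ (k,i)) * V $$ (k,j)) = (if i = j then 1 else 0)" if "i < m" "j < m" for i j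
  proof -
    have "(\<Sum>k<m. cnj (V $$ (k,i)) * V $$ (k,j)) = (mat_adjoint V * V) $$ (i,j)"
      using that Vc by (simp add: scalar_prod_def lessThan_atLeast0)
    thus ?thesis using V that by (simp add: unitary_mat_def)
  qed
  have "mat_adjoint W * W = 1\<^sub>m ?n"
  proof (rule eq_matI)
    fix i j assume "i < dim_row (1\<^sub>m ?n :: complex mat)" "j < dim_col (1\<^sub>m ?n :: complex mat)"
    hence ij: "i < ?n" "j < ?n" by auto
    have "(mat_adjoint W * W) $$ (i,j) = (\<Sum>k<?n. cnj (W $$ (k,i)) * W $$ (k,j))"
      using ij Wc by (simp add: scalar_prod_def lessThan_atLeast0 del: sum.lessThan_Suc sum.op_ivl_Suc)
    also have "\<dots> = 1\<^sub>m ?n $$ (i,j)"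
      using ij by (cases i; cases j) (auto simp: sum.lessThan_Suc_shift W0 VV simp del: sum.lessThan_Suc)
    finally show "(mat_adjoint W * W) $$ (i,j) = 1\<^sub>m ?n $$ (i,j)" .
  qed (use Wc in auto)
  moreover from this have "W * mat_adjoint W = 1\<^sub>m ?n"
    using mat_mult_left_right_inverse[of "mat_adjoint W" ?n W] Wc by simp
  ultimately have W: "unitary_mat ?n W" using Wc by (simp add: unitary_mat_def)
  define l' where "l' = (\<lambda>i. case i of 0 \<Rightarrow> e | Suc i \<Rightarrow> l i)"
  have "B = udiag ?n W l'"
  proof (rule eq_matI)
    fix i j assume "i < dim_row (udiag ?n W l')" "j < dim_col (udiag ?n W l')"
    hence ij: "i < ?n" "j < ?n" using udiag_carrier[OF W] by (metis carrier_matD)+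
    have C1: "C $$ (i,j) = (\<Sum>k<m. V $$ (i,k) * l k * cnj (V $$ (j,k)))" if "i < m" "j < m" for i j
      unfolding CV by (rule udiag_index[OF Vc that])
    have C2: "C $$ (i,j) = B $$ (Suc i, Suc j)" if "i < m" "j < m" for i j using that by (simp add: C_def)
    have "udiag ?n W l' $$ (i,j) = (\<Sum>k<?n. W $$ (i,k) * l' k * cnj (W $$ (j,k)))"
      by (rule udiag_index[OF Wc ij])
    also have "\<dots> = B $$ (i,j)"
      using ij by (cases i; cases j) 
        (auto simp: sum.lessThan_Suc_shift W0 row0 col0 l'_def C1 simp flip: C2 simp del: sum.lessThan_Suc)
    finally show "B $$ (i,j) = udiag ?n W l' $$ (i,j)" ..
  qed (use B udiag_carrier[OF W, of l'] in auto)
  hence "A = U * udiag ?n W l' * mat_adjoint U"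
    using unitary_conj_cancel(1)[OF U A] by (simp add: B_def)
  also have "\<dots> = udiag ?n (U * W) l'"
    using Uc Wc by (simp add: udiag_def mat_adjoint_mult[of _ ?n ?n _ ?n] assoc_mult_mat[of _ ?n ?n _ ?n _ ?n] mult_carrier_mat[of _ ?n ?n _ ?n])
  finally show ?case using unitary_mat_mult[OF U W] by blast
qed

lemma smult_one [simp]: "(1::complex) \<cdot>\<^sub>m A = A"
  by (intro eq_matI) auto

lemma udiag_add:
  assumes "unitary_mat n U"
  shows "udiag n U f + udiag n U g = udiag n U (\<lambda>i. f i + g i)"
proof -
  have U: "U \<in> carrier_mat n n" using assms by (simp add: unitary_mat_def)
  have d: "dim_row (udiag n U h) = n" "dim_col (udiag n U h) = n" for h
    using udiag_carrier[OF assms, of h] by auto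
  show ?thesis
    by (rule eq_matI) (auto simp: d udiag_index[OF U] algebra_simps sum.distrib)
qed

lemma udiag_cong: "(\<And>i. i < n \<Longrightarrow> f i = g i) \<Longrightarrow> udiag n U f = udiag n U g"
  unfolding udiag_def mat_diag_def by (intro arg_cong2[where f="(*)"] eq_matI) auto

lemma udiag_mult:
  assumes "unitary_mat n U"
  shows "udiag n U f * udiag n U g = udiag n U (\<lambda>i. f i * g i)"
  unfolding udiag_def by (subst unitary_conj_mult[OF assms]) auto

lemma udiag_adjoint:
  assumes "unitary_mat n U"
  shows "mat_adjoint (udiag n U f) = udiag n U (\<lambda>i. cnj (f i))"
  using assms unfolding udiag_def by (subst adj_conj[of _ n]) (auto simp: unitary_mat_def mat_adjoint_diag)

lemma udiag_const:
  assumes "unitary_mat n U"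
  shows "udiag n U (\<lambda>_. c) = c \<cdot>\<^sub>m 1\<^sub>m n"
proof -
  have U: "U \<in> carrier_mat n n" "U * mat_adjoint U = 1\<^sub>m n" using assms by (auto simp: unitary_mat_def)
  have "mat_diag n (\<lambda>_. c) = c \<cdot>\<^sub>m 1\<^sub>m n" by (intro eq_matI) (auto simp: mat_diag_def)
  hence "udiag n U (\<lambda>_. c) = U * (c \<cdot>\<^sub>m 1\<^sub>m n) * mat_adjoint U" by (simp add: udiag_def)
  also have "U * (c \<cdot>\<^sub>m 1\<^sub>m n) = c \<cdot>\<^sub>m U" using U by (simp add: mult_smult_distrib[of _ n n _ n])
  also have "\<dots> * mat_adjoint U = c \<cdot>\<^sub>m (U * mat_adjoint U)" using U by (intro mult_smult_assoc_mat[of _ n n _ n]) auto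
  finally show ?thesis using U by simp
qed

lemma op_norm_unitary_conj:
  assumes U: "unitary_mat n U" and A: "A \<in> carrier_mat n n"
  shows "op_norm (U * A * mat_adjoint U) \<le> op_norm A"
proof -
  have c: "U \<in> carrier_mat n n" "mat_adjoint U \<in> carrier_mat n n" using U by (auto simp: unitary_mat_def)
  have "op_norm (U * A * mat_adjoint U) \<le> op_norm (U * A) * op_norm (mat_adjoint U)"
    by (rule op_norm_mult) (use c A in auto)
  also have "\<dots> \<le> op_norm (U * A) * 1"
    by (rule mult_left_mono[OF op_norm_unitary[OF unitary_mat_adjoint[OF U]] op_norm_nonneg[of _ n]]) (use c A in auto)
  also have "\<dots> \<le> op_norm U * op_norm A" using op_norm_mult[OF c(1) A] by simp
  also have "\<dots> \<le> 1 * op_norm A" by (rule mult_right_mono[OF op_norm_unitary[OF U] op_norm_nonneg[OF A]])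
  finally show ?thesis by simp
qed

lemma op_norm_udiag:
  assumes "unitary_mat n U" "\<And>i. i < n \<Longrightarrow> cmod (l i) \<le> c" "0 \<le> c"
  shows "op_norm (udiag n U l) \<le> c"
  unfolding udiag_def
  by (rule order.trans[OF op_norm_unitary_conj[OF assms(1)] op_norm_diag]) (use assms in auto)

lemma mat_diag_udiag:
  assumes U: "unitary_mat n U"
  shows "mat_diag n l = mat_adjoint U * udiag n U l * U"
  unfolding udiag_def using unitary_conj_cancel(2)[OF U, of "mat_diag n l"] by simp

lemma cmod_le_op_norm_udiag:
  assumes U: "unitary_mat n U" and i: "i < n"
  shows "cmod (l i) \<le> op_norm (udiag n U l)"
proof -
  have "mat_diag n l *\<^sub>v unit_vec n i = l i \<cdot>\<^sub>v unit_vec n i"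
    using i by (intro eq_vecI) (auto simp: mat_diag_def scalar_prod_right_unit)
  moreover have "vec_norm2 (unit_vec n i) = 1"
  proof -
    have "unit_vec n i \<bullet>c unit_vec n i = (1 :: complex)"
      using i by (subst scalar_prod_left_unit) auto
    hence "complex_of_real ((vec_norm2 (unit_vec n i))\<^sup>2) = complex_of_real 1" by (simp only: cscalar_self of_real_1)
    hence "(vec_norm2 (unit_vec n i))\<^sup>2 = 1\<^sup>2" unfolding of_real_eq_iff by simp
    thus ?thesis by (rule power2_eq_imp_eq) auto
  qed
  ultimately have "cmod (l i) \<le> op_norm (mat_diag n l)"
    using op_norm_ub[of "mat_diag n l" n "unit_vec n i"] by (simp add: vec_norm2_smult)
  also have "\<dots> \<le> op_norm (udiag n U l)"
    unfolding mat_diag_udiag[OF U] 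
    using op_norm_unitary_conj[OF unitary_mat_adjoint[OF U] udiag_carrier[OF U]] by simp
  finally show ?thesis .
qed

lemma udiag_inj:
  assumes U: "unitary_mat n U" and eq: "udiag n U f = udiag n U g" and i: "i < n"
  shows "f i = g i"
proof -
  have "mat_diag n f $$ (i,i) = mat_diag n g $$ (i,i)"
    by (simp only: mat_diag_udiag[OF U] eq)
  thus ?thesis using i by (simp add: mat_diag_def)
qed

lemma udiag_hermitian:
  assumes "unitary_mat n U" "mat_adjoint (udiag n U l) = udiag n U l" "i < n"
  shows "l i \<in> \<real>"
  using udiag_inj[OF assms(1) _ assms(3), of "\<lambda>i. cnj (l i)" l] assms udiag_adjoint[OF assms(1), of l]
  by (simp add: Reals_cnj_iff)

lemma udiag_unitary:
  assumes "unitary_mat n U" "unitary_mat n (udiag n U l)" "i < n"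
  shows "cmod (l i) = 1"
proof -
  have "udiag n U (\<lambda>i. l i * cnj (l i)) = udiag n U (\<lambda>i. 1)"
    using assms(2) by (simp add: unitary_mat_def udiag_adjoint[OF assms(1)] udiag_mult[OF assms(1)] udiag_const[OF assms(1)])
  from udiag_inj[OF assms(1) this assms(3)] have "complex_of_real ((cmod (l i))\<^sup>2) = complex_of_real 1"
    by (simp only: complex_norm_square of_real_1)
  hence "(cmod (l i))\<^sup>2 = 1\<^sup>2" unfolding of_real_eq_iff by simp
  thus ?thesis by (rule power2_eq_imp_eq) auto
qed

lemma adjoint_mult_self_index:
  fixes M :: "complex mat"
  assumes "M \<in> carrier_mat n n" "i < n"
  shows "(mat_adjoint M * M) $$ (i,i) = col M i \<bullet>c col M i"
  using assms by (auto simp: scalar_prod_def intro!: sum.cong)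

text \<open>Eigenvalues appear as squared lengths, so they are real and nonnegative without a
  separate argument.\<close>

lemma udiag_adjoint_mult_self:
  assumes U: "unitary_mat n U" and T: "T \<in> carrier_mat n n" and eq: "mat_adjoint T * T = udiag n U l" and i: "i < n"
  shows "l i = complex_of_real ((vec_norm2 (T *\<^sub>v col U i))\<^sup>2)"
proof -
  have c: "U \<in> carrier_mat n n" "mat_adjoint U \<in> carrier_mat n n" "mat_adjoint T \<in> carrier_mat n n" 
    using U T by (auto simp: unitary_mat_def)
  have TU: "T * U \<in> carrier_mat n n" using T c by auto
  have "mat_diag n l = mat_adjoint U * (mat_adjoint T * T) * U" by (simp only: mat_diag_udiag[OF U] eq)
  also have "\<dots> = mat_adjoint (T * U) * (T * U)"
    using c T by (simp add: mat_adjoint_mult[of _ n n _ n] assoc_mult_mat[of _ n n _ n _ n] mult_carrier_mat[of _ n n _ n] del: assoc_mult_mat)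
  finally have eq': "mat_diag n l = mat_adjoint (T * U) * (T * U)" .
  have "l i = mat_diag n l $$ (i,i)" using i by (simp add: mat_diag_def)
  also have "\<dots> = (mat_adjoint (T * U) * (T * U)) $$ (i,i)" by (simp only: eq')
  also have "\<dots> = col (T * U) i \<bullet>c col (T * U) i" by (rule adjoint_mult_self_index[OF TU i])
  also have "col (T * U) i = T *\<^sub>v col U i" using col_mult2[OF T c(1) i] .
  finally show ?thesis by (simp only: cscalar_self)
qed

text \<open>In the two eigenbases the hypothesis reads \<open>f i * C(i,j) = C(i,j) * g j\<close>,
  so an entry is zero or sits between equal eigenvalues. Hence any function \<open>F\<close> may be
  applied, continuous or not. This is what makes unbounded or discontinuous functions of a single
  matrix compatible with a real structure.\<close>

lemma udiag_intertwine:
  assumes U: "unitary_mat n U" and W: "unitary_mat n W" and B: "B \<in> carrier_mat n n" 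
    and eq: "udiag n U f * B = B * udiag n W g"
  shows "udiag n U (\<lambda>i. F (f i)) * B = B * udiag n W (\<lambda>i. F (g i))"
proof -
  have c: "U \<in> carrier_mat n n" "mat_adjoint U \<in> carrier_mat n n" "W \<in> carrier_mat n n" "mat_adjoint W \<in> carrier_mat n n"
    "mat_adjoint U * U = 1\<^sub>m n" "U * mat_adjoint U = 1\<^sub>m n" "mat_adjoint W * W = 1\<^sub>m n" "W * mat_adjoint W = 1\<^sub>m n"
    using U W by (auto simp: unitary_mat_def)
  note a = assoc_mult_mat[of _ n n _ n _ n] mult_carrier_mat[of _ n n _ n]
  define C where "C = mat_adjoint U * B * W"
  have C: "C \<in> carrier_mat n n" using c B by (simp add: C_def a del: assoc_mult_mat)
  have l: "mat_adjoint U * (udiag n U h * B) * W = mat_diag n h * C" for h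
  proof -
    have "mat_adjoint U * (udiag n U h * B) * W = (mat_adjoint U * U) * (mat_diag n h * C)"
      unfolding udiag_def C_def using c(1-4) B by (simp add: a del: assoc_mult_mat)
    thus ?thesis using C by (simp add: c a left_mult_one_mat[of _ n n] right_mult_one_mat[of _ n n] del: assoc_mult_mat)
  qed
  have r: "mat_adjoint U * (B * udiag n W h) * W = C * mat_diag n h" for h
  proof -
    have "mat_adjoint U * (B * udiag n W h) * W = C * mat_diag n h * (mat_adjoint W * W)"
      unfolding udiag_def C_def using c(1-4) B by (simp add: a del: assoc_mult_mat)
    thus ?thesis using C by (simp add: c a left_mult_one_mat[of _ n n] right_mult_one_mat[of _ n n] del: assoc_mult_mat)
  qed
  have inj: "X = Y" if "mat_adjoint U * X * W = mat_adjoint U * Y * W" "X \<in> carrier_mat n n" "Y \<in> carrier_mat n n" for X Y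
  proof -
    have "(U * mat_adjoint U) * X * (W * mat_adjoint W) = U * (mat_adjoint U * X * W) * mat_adjoint W"
      using c(1-4) that(2) by (simp add: a del: assoc_mult_mat)
    also have "\<dots> = (U * mat_adjoint U) * Y * (W * mat_adjoint W)"
      unfolding that(1) using c(1-4) that(3) by (simp add: a del: assoc_mult_mat)
    finally show ?thesis using that by (simp add: c)
  qed
  have CD: "mat_diag n f * C = C * mat_diag n g" using l[of f] r[of g] eq by simp
  have "mat_diag n (\<lambda>i. F (f i)) * C = C * mat_diag n (\<lambda>i. F (g i))"
  proof (rule eq_matI)
    fix i j assume "i < dim_row (C * mat_diag n (\<lambda>i. F (g i)))" "j < dim_col (C * mat_diag n (\<lambda>i. F (g i)))"
    hence ij: "i < n" "j < n" using C by (auto simp: mat_diag_def)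
    have "f i * C $$ (i,j) = C $$ (i,j) * g j"
      using arg_cong[OF CD, of "\<lambda>M. M $$ (i,j)"] ij 
      unfolding mat_diag_mult_left[OF C] mat_diag_mult_right[OF C] by simp
    hence "F (f i) * C $$ (i,j) = C $$ (i,j) * F (g j)" by (cases "C $$ (i,j) = 0") auto
    thus "(mat_diag n (\<lambda>i. F (f i)) * C) $$ (i,j) = (C * mat_diag n (\<lambda>i. F (g i))) $$ (i,j)"
      using ij unfolding mat_diag_mult_left[OF C] mat_diag_mult_right[OF C] by simp
  qed (use C in \<open>auto simp: mat_diag_def\<close>)
  hence "mat_adjoint U * (udiag n U (\<lambda>i. F (f i)) * B) * W = mat_adjoint U * (B * udiag n W (\<lambda>i. F (g i))) * W"
    by (simp only: l r)
  from inj[OF this] show ?thesis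
    using U W B by (simp add: mult_carrier_mat[of _ n n _ n])
qed

text \<open>Only the real part of the quadratic form is constrained. This is what the Cauchy-Schwarz
  arguments in \<open>pos_cancel\<close> and \<open>nb_pos\<close> consume, and it passes to sums
  and conjugates directly.\<close>

definition psd_mat :: "nat \<Rightarrow> complex mat \<Rightarrow> bool" where
  "psd_mat n A \<longleftrightarrow> (\<forall>v\<in>carrier_vec n. Re ((A *\<^sub>v v) \<bullet>c v) \<ge> 0)"

lemma psd_mat_add:
  assumes "A \<in> carrier_mat n n" "B \<in> carrier_mat n n" "psd_mat n A" "psd_mat n B"
  shows "psd_mat n (A + B)"
proof -
  have "((A + B) *\<^sub>v v) \<bullet>c v = (A *\<^sub>v v) \<bullet>c v + (B *\<^sub>v v) \<bullet>c v" if "v \<in> carrier_vec n" for v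
    unfolding add_mult_distrib_mat_vec[OF assms(1,2) that] 
    using assms that by (intro add_scalar_prod_distrib[of _ n]) (auto intro!: mult_mat_vec_carrier)
  thus ?thesis using assms(3,4) by (auto simp: psd_mat_def)
qed

lemma psd_mat_adjoint_mult:
  assumes "A \<in> carrier_mat n n" "psd_mat n A" "B \<in> carrier_mat n n"
  shows "psd_mat n (mat_adjoint B * A * B)"
  unfolding psd_mat_def
proof
  fix v :: "complex vec" assume v: "v \<in> carrier_vec n"
  have c: "B *\<^sub>v v \<in> carrier_vec n" "A *\<^sub>v (B *\<^sub>v v) \<in> carrier_vec n" "mat_adjoint B \<in> carrier_mat n n"
    using assms v by (auto intro!: mult_mat_vec_carrier)
  have "(mat_adjoint B * A * B) *\<^sub>v v = mat_adjoint B *\<^sub>v (A *\<^sub>v (B *\<^sub>v v))"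
    using assms v c by (metis assoc_mult_mat_vec mult_carrier_mat)
  hence "((mat_adjoint B * A * B) *\<^sub>v v) \<bullet>c v = (A *\<^sub>v (B *\<^sub>v v)) \<bullet>c (B *\<^sub>v v)"
    using cscalar_adjoint[OF c(3) c(2) v] by simp
  thus "Re (((mat_adjoint B * A * B) *\<^sub>v v) \<bullet>c v) \<ge> 0"
    using assms(2) c(1) by (auto simp: psd_mat_def)
qed

lemma psd_mat_one: "psd_mat n (1\<^sub>m n)"
  unfolding psd_mat_def
proof
  fix v :: "complex vec" assume "v \<in> carrier_vec n"
  hence "1\<^sub>m n *\<^sub>v v = v" by simp
  thus "Re ((1\<^sub>m n *\<^sub>v v) \<bullet>c v) \<ge> 0" unfolding cscalar_self by (simp only: cscalar_self Re_complex_of_real) simp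
qed

lemma psd_mat_zero: "psd_mat n (0\<^sub>m n n)"
proof -
  have "0\<^sub>m n n *\<^sub>v v = 0\<^sub>v n" if "v \<in> carrier_vec n" for v :: "complex vec"
    using that by (intro eq_vecI) auto
  thus ?thesis by (simp add: psd_mat_def)
qed

text \<open>\<open>T + h\<close> is invertible unless \<open>- h\<close> is one of the finitely many
  roots of the characteristic polynomial. Taking \<open>h\<close> real keeps \<open>T + h\<close>
  fixed by any real structure that fixes \<open>T\<close>.\<close>

lemma perturb_invertible:
  assumes T: "T \<in> carrier_mat n n" and e: "(e::real) > 0"
  shows "\<exists>h. 0 < h \<and> h \<le> e \<and> det (T + complex_of_real h \<cdot>\<^sub>m 1\<^sub>m n) \<noteq> 0"
proof -
  have "char_poly T \<noteq> 0" using degree_monic_char_poly[OF T] by auto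
  hence "finite {k. poly (char_poly T) k = 0}" by (rule poly_roots_finite)
  hence fin: "finite ((\<lambda>h. - complex_of_real h) -` {k. poly (char_poly T) k = 0})"
    by (rule finite_vimageI) (auto simp: inj_on_def)
  have "\<not> {0<..e} \<subseteq> ((\<lambda>h. - complex_of_real h) -` {k. poly (char_poly T) k = 0})"
    using infinite_Ioc[OF e] finite_subset[OF _ fin] by blast
  then obtain h where "h \<in> {0<..e}" "h \<notin> (\<lambda>h. - complex_of_real h) -` {k. poly (char_poly T) k = 0}" by blast
  hence h: "0 < h" "h \<le> e" "poly (char_poly T) (- complex_of_real h) \<noteq> 0" by auto
  hence "\<not> eigenvalue T (- complex_of_real h)" using eigenvalue_root_char_poly[OF T] by simp
  thus ?thesis using h eigenvalue_det[OF T, of "- complex_of_real h"] T by (auto simp: char_matrix_def)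
qed

text \<open>The unitary factor is \<open>T\<close> times the inverse square root of the positive
  matrix; invertibility of \<open>T\<close> makes the eigenvalues \<open>l i\<close>, squared
  lengths of \<open>T\<close> on an eigenbasis, strictly positive.\<close>

lemma polar_mat:
  assumes T: "T \<in> carrier_mat n n" and d: "det T \<noteq> 0" 
  shows "\<exists>U l. unitary_mat n U \<and> (\<forall>i<n. l i > 0) \<and> mat_adjoint T * T = udiag n U (\<lambda>i. complex_of_real (l i)) \<and>
    unitary_mat n (T * udiag n U (\<lambda>i. complex_of_real (1 / sqrt (l i))))"
proof -
  have Ts: "mat_adjoint T \<in> carrier_mat n n" using T by simp
  have TT: "mat_adjoint T * T \<in> carrier_mat n n" using T Ts by auto
  have TTs: "mat_adjoint (mat_adjoint T * T) = mat_adjoint T * T" using T by (simp add: mat_adjoint_mult[of _ n n _ n])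
  obtain U m where U: "unitary_mat n U" and m: "mat_adjoint T * T = udiag n U m"
    using normal_udiag[OF TT] TTs by auto
  define l where "l = (\<lambda>i. (vec_norm2 (T *\<^sub>v col U i))\<^sup>2)"
  have ml: "m i = complex_of_real (l i)" if "i < n" for i
    using udiag_adjoint_mult_self[OF U T m that] by (simp add: l_def)
  have Ul: "mat_adjoint T * T = udiag n U (\<lambda>i. complex_of_real (l i))"
    unfolding m by (rule udiag_cong) (rule ml)
  have pos: "l i > 0" if i: "i < n" for i
  proof (rule ccontr)
    assume "\<not> ?thesis"
    hence "vec_norm2 (T *\<^sub>v col U i) = 0" by (simp add: l_def)
    have Uc: "U \<in> carrier_mat n n" "mat_adjoint U * U = 1\<^sub>m n" using U by (auto simp: unitary_mat_def)
    have cU: "col U i \<in> carrier_vec n" using Uc i by auto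
    have "T *\<^sub>v col U i = 0\<^sub>v n"
      using \<open>vec_norm2 (T *\<^sub>v col U i) = 0\<close> vec_norm2_eq_0 mult_mat_vec_carrier[OF T cU] by blast
    hence "col U i = 0\<^sub>v n" using det_0_iff_vec_prod_zero[OF T] d cU by blast
    hence "(mat_adjoint U * U) $$ (i,i) = 0" using Uc(1) i by simp
    thus False using Uc(2) i by simp
  qed
  define W where "W = udiag n U (\<lambda>i. complex_of_real (1 / sqrt (l i)))"
  have W: "W \<in> carrier_mat n n" using U by (simp add: W_def)
  have Ws: "mat_adjoint W = W" by (simp add: W_def udiag_adjoint[OF U])
  have TW: "T * W \<in> carrier_mat n n" using T W by auto
  have "mat_adjoint (T * W) * (T * W) = W * (mat_adjoint T * T) * W"
    using T Ts W by (simp add: mat_adjoint_mult[of _ n n _ n] Ws assoc_mult_mat[of _ n n _ n _ n] mult_carrier_mat[of _ n n _ n] del: assoc_mult_mat)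
  also have "\<dots> = udiag n U (\<lambda>i. complex_of_real (1 / sqrt (l i)) * complex_of_real (l i) * complex_of_real (1 / sqrt (l i)))"
    by (simp only: Ul W_def udiag_mult[OF U])
  also have "\<dots> = udiag n U (\<lambda>i. 1)"
  proof (intro udiag_cong)
    fix i assume "i < n"
    hence "sqrt (l i) \<noteq> 0" "l i = sqrt (l i) * sqrt (l i)" using pos[of i] by auto
    hence "1 / sqrt (l i) * l i * (1 / sqrt (l i)) = 1" by (metis mult.assoc nonzero_divide_eq_eq mult.left_neutral mult.commute)
    thus "complex_of_real (1 / sqrt (l i)) * complex_of_real (l i) * complex_of_real (1 / sqrt (l i)) = 1"
      by (metis of_real_1 of_real_mult)
  qed
  also have "\<dots> = 1\<^sub>m n" using udiag_const[OF U, of 1] by simp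
  finally have 1: "mat_adjoint (T * W) * (T * W) = 1\<^sub>m n" .
  hence "(T * W) * mat_adjoint (T * W) = 1\<^sub>m n"
    using mat_mult_left_right_inverse[of "mat_adjoint (T * W)" n "T * W"] TW by simp
  with 1 TW have "unitary_mat n (T * W)" by (simp add: unitary_mat_def)
  thus ?thesis using U pos Ul unfolding W_def by blast
qed

section \<open>Real structures\<close>

definition mat_cnj :: "complex mat \<Rightarrow> complex mat" where
  "mat_cnj A = map_mat cnj A"

lemma mat_cnj_carrier [simp]: "mat_cnj A \<in> carrier_mat n m \<longleftrightarrow> A \<in> carrier_mat n m"
  by (simp add: mat_cnj_def)

lemma mat_cnj_dim [simp]: "dim_row (mat_cnj A) = dim_row A" "dim_col (mat_cnj A) = dim_col A"
  by (simp_all add: mat_cnj_def)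

lemma mat_cnj_index [simp]: "i < dim_row A \<Longrightarrow> j < dim_col A \<Longrightarrow> mat_cnj A $$ (i,j) = cnj (A $$ (i,j))"
  by (simp add: mat_cnj_def)

lemma mat_cnj_mult: "A \<in> carrier_mat n m \<Longrightarrow> B \<in> carrier_mat m k \<Longrightarrow> mat_cnj (A * B) = mat_cnj A * mat_cnj B"
  by (intro eq_matI) (auto simp: scalar_prod_def)

lemma mat_cnj_add: "A \<in> carrier_mat n m \<Longrightarrow> B \<in> carrier_mat n m \<Longrightarrow> mat_cnj (A + B) = mat_cnj A + mat_cnj B"
  by (intro eq_matI) auto

lemma mat_cnj_smult: "mat_cnj (c \<cdot>\<^sub>m A) = cnj c \<cdot>\<^sub>m mat_cnj A"
  by (intro eq_matI) auto

lemma mat_cnj_adjoint: "mat_cnj (mat_adjoint A) = mat_adjoint (mat_cnj A)"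
  by (intro eq_matI) auto

lemma mat_cnj_cnj [simp]: "mat_cnj (mat_cnj A) = A"
  by (intro eq_matI) auto

lemma mat_cnj_one [simp]: "mat_cnj (1\<^sub>m n) = 1\<^sub>m n"
  by (intro eq_matI) auto

lemma mat_cnj_diag: "mat_cnj (mat_diag n l) = mat_diag n (\<lambda>i. cnj (l i))"
  by (intro eq_matI) (auto simp: mat_diag_def)

lemma unitary_mat_cnj: "unitary_mat n U \<Longrightarrow> unitary_mat n (mat_cnj U)"
  unfolding unitary_mat_def
  by (metis mat_cnj_adjoint mat_cnj_carrier mat_cnj_mult mat_cnj_one mat_adjoint_carrier)

lemma op_norm_mat_cnj:
  assumes A: "A \<in> carrier_mat n n"
  shows "op_norm (mat_cnj A) \<le> op_norm A"
proof (rule op_norm_le[of _ n])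
  fix v :: "complex vec" assume v: "v \<in> carrier_vec n"
  have n: "vec_norm2 (conjugate w) = vec_norm2 w" for w :: "complex vec"
    by (auto simp: vec_norm2_def intro!: L2_set_cong)
  have "mat_cnj A *\<^sub>v v = conjugate (A *\<^sub>v conjugate v)"
    using A v by (intro eq_vecI) (auto simp: scalar_prod_def intro!: sum.cong)
  hence "vec_norm2 (mat_cnj A *\<^sub>v v) = vec_norm2 (A *\<^sub>v conjugate v)" by (simp add: n)
  also have "\<dots> \<le> op_norm A * vec_norm2 (conjugate v)" using A v by (intro op_norm_ub) auto
  finally show "vec_norm2 (mat_cnj A *\<^sub>v v) \<le> op_norm A * vec_norm2 v" by (simp add: n)
qed (use A op_norm_nonneg in auto)

text \<open>Conjugation by a real orthogonal matrix of square \<open>\<plusminus>1\<close> turns entrywise conjugation into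
  an antilinear involution; its fixed points are the real matrices for \<open>W = 1\<close> and the
  quaternionic ones for the standard symplectic \<open>W\<close>.\<close>

definition real_structure :: "(nat \<Rightarrow> complex mat) \<Rightarrow> bool" where
  "real_structure W \<longleftrightarrow> (\<forall>n. unitary_mat n (W n) \<and> mat_cnj (W n) = W n \<and> 
     (W n * W n = 1\<^sub>m n \<or> W n * W n = - 1\<^sub>m n))"

definition conj_by :: "(nat \<Rightarrow> complex mat) \<Rightarrow> nat \<Rightarrow> complex mat \<Rightarrow> complex mat" where
  "conj_by W n A = W n * mat_cnj A * mat_adjoint (W n)"

context
  fixes W :: "nat \<Rightarrow> complex mat" assumes W: "real_structure W"
begin

lemma real_structureD: "unitary_mat n (W n)" "mat_cnj (W n) = W n" 
  "W n \<in> carrier_mat n n" "mat_adjoint (W n) \<in> carrier_mat n n"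
  using W by (auto simp: real_structure_def unitary_mat_def)

lemma conj_by_carrier [simp]: "A \<in> carrier_mat n n \<Longrightarrow> conj_by W n A \<in> carrier_mat n n"
  unfolding conj_by_def using real_structureD[of n] by (meson mat_cnj_carrier mult_carrier_mat)

lemma conj_by_mult:
  "A \<in> carrier_mat n n \<Longrightarrow> B \<in> carrier_mat n n \<Longrightarrow> conj_by W n (A * B) = conj_by W n A * conj_by W n B"
  unfolding conj_by_def using unitary_conj_mult[OF real_structureD(1)[of n], of "mat_cnj A" "mat_cnj B"]
  by (simp add: mat_cnj_mult[of _ n n _ n])

lemma conj_by_add:
  assumes "A \<in> carrier_mat n n" "B \<in> carrier_mat n n" 
  shows "conj_by W n (A + B) = conj_by W n A + conj_by W n B"
  using assms real_structureD[of n] unfolding conj_by_def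
  by (simp add: mat_cnj_add[of _ n n] mult_add_distrib_mat[of _ n n _ n] add_mult_distrib_mat[of _ n n _ _ n]
      mult_carrier_mat[of _ n n _ n] del: assoc_mult_mat)

lemma conj_by_smult: "A \<in> carrier_mat n n \<Longrightarrow> conj_by W n (c \<cdot>\<^sub>m A) = cnj c \<cdot>\<^sub>m conj_by W n A"
  using real_structureD[of n] unfolding conj_by_def
  by (simp add: mat_cnj_smult mult_smult_distrib[of _ n n _ n] mult_smult_assoc_mat[of _ n n _ n]
      mult_carrier_mat[of _ n n _ n] del: assoc_mult_mat)

lemma conj_by_adjoint: "A \<in> carrier_mat n n \<Longrightarrow> conj_by W n (mat_adjoint A) = mat_adjoint (conj_by W n A)"
  using real_structureD[of n] unfolding conj_by_def by (subst adj_conj[of _ n]) (auto simp: mat_cnj_adjoint)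

lemma conj_by_one: "conj_by W n (1\<^sub>m n) = 1\<^sub>m n"
  using real_structureD[of n] unfolding conj_by_def by (auto simp: unitary_mat_def)

text \<open>A fixed matrix with real eigenvalues acquires in this way a second diagonalization with
  the same list of eigenvalues; functions of the two are then compared by
  \<open>udiag_intertwine\<close>.\<close>

lemma conj_by_udiag:
  assumes "unitary_mat n U"
  shows "unitary_mat n (W n * mat_cnj U)" 
    "conj_by W n (udiag n U l) = udiag n (W n * mat_cnj U) (\<lambda>i. cnj (l i))"
proof -
  show "unitary_mat n (W n * mat_cnj U)" 
    by (rule unitary_mat_mult[OF real_structureD(1) unitary_mat_cnj[OF assms]])
  have "U \<in> carrier_mat n n" "mat_cnj U \<in> carrier_mat n n" "mat_adjoint U \<in> carrier_mat n n"
    "mat_adjoint (mat_cnj U) \<in> carrier_mat n n" using assms by (auto simp: unitary_mat_def)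
  thus "conj_by W n (udiag n U l) = udiag n (W n * mat_cnj U) (\<lambda>i. cnj (l i))"
    using real_structureD(3,4)[of n] unfolding conj_by_def udiag_def
    by (simp add: mat_cnj_mult[of _ n n _ n] mat_cnj_diag mat_cnj_adjoint mat_adjoint_mult[of _ n n _ n]
        assoc_mult_mat[of _ n n _ n _ n] mult_carrier_mat[of _ n n _ n])
qed

lemma conj_by_conj_by:
  assumes A: "A \<in> carrier_mat n n"
  shows "conj_by W n (conj_by W n A) = A"
proof -
  note w = real_structureD[of n]
  have cw: "mat_cnj (mat_adjoint (W n)) = mat_adjoint (W n)" using w by (simp add: mat_cnj_adjoint)
  \<comment> \<open>\<open>W n\<close> is real, so conjugating twice multiplies by its square on one
    side and by the adjoint of the square on the other; the sign of the square cancels.\<close>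
  have "conj_by W n (conj_by W n A) = (W n * W n) * A * mat_adjoint (W n * W n)"
    using w A unfolding conj_by_def
    by (simp add: mat_cnj_mult[of _ n n _ n] cw mat_adjoint_mult[of _ n n _ n]
        assoc_mult_mat[of _ n n _ n _ n] mult_carrier_mat[of _ n n _ n])
  also have "\<dots> = A"
  proof -
    consider "W n * W n = 1\<^sub>m n" | "W n * W n = - 1\<^sub>m n" using W by (auto simp: real_structure_def)
    thus ?thesis
    proof cases
      case 1 thus ?thesis using A by (simp del: assoc_mult_mat)
    next
      case 2
      have "(- 1\<^sub>m n) * A * mat_adjoint (- 1\<^sub>m n) = A"
        using A by (simp add: mat_adjoint_uminus del: assoc_mult_mat)
      thus ?thesis unfolding 2 .
    qed
  qed
  finally show ?thesis .
qed

lemma op_norm_conj_by: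
  assumes A: "A \<in> carrier_mat n n"
  shows "op_norm (conj_by W n A) \<le> op_norm A"
  using op_norm_unitary_conj[OF real_structureD(1)[of n], of "mat_cnj A"] op_norm_mat_cnj[OF A] A
  unfolding conj_by_def by simp

end

section \<open>The quotient algebra\<close>

text \<open>One-sided, without an absolute value: applied to \<open>op_norm (x i n) - c\<close> it
  says that the limit superior in \<open>i\<close>, uniform in the size \<open>n\<close>, is at most
  \<open>c\<close>.\<close>

definition evsmall :: "(nat \<Rightarrow> nat \<Rightarrow> real) \<Rightarrow> bool" where
  "evsmall f \<longleftrightarrow> (\<forall>e>0. \<exists>i0. \<forall>i\<ge>i0. \<forall>n. f i n \<le> e)"

lemma evsmall_mono: "evsmall f \<Longrightarrow> (\<And>i n. g i n \<le> f i n) \<Longrightarrow> evsmall g"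
  unfolding evsmall_def by (meson order.trans)

lemma evsmall_add:
  assumes "evsmall f" "evsmall g"
  shows "evsmall (\<lambda>i n. f i n + g i n)"
  unfolding evsmall_def
proof (intro allI impI)
  fix e :: real assume "e > 0"
  hence "e / 2 > 0" by simp
  with assms obtain a b where "\<And>i n. i \<ge> a \<Longrightarrow> f i n \<le> e / 2" "\<And>i n. i \<ge> b \<Longrightarrow> g i n \<le> e / 2"
    unfolding evsmall_def by meson
  thus "\<exists>i0. \<forall>i\<ge>i0. \<forall>n. f i n + g i n \<le> e" 
    by (intro exI[of _ "max a b"]) (smt (verit) field_sum_of_halves max.bounded_iff)
qed

lemma evsmall_cmult:
  assumes "evsmall f" "0 \<le> (c::real)"
  shows "evsmall (\<lambda>i n. c * f i n)"
proof (cases "c = 0")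
  case True thus ?thesis by (auto simp: evsmall_def)
next
  case False
  hence c: "c > 0" using assms by simp
  show ?thesis unfolding evsmall_def
  proof (intro allI impI)
    fix e :: real assume "e > 0"
    hence "e / c > 0" using c by simp
    then obtain a where "\<And>i n. i \<ge> a \<Longrightarrow> f i n \<le> e / c" using assms(1) unfolding evsmall_def by meson
    thus "\<exists>i0. \<forall>i\<ge>i0. \<forall>n. c * f i n \<le> e" using c by (auto simp: field_simps)
  qed
qed

lemma evsmall_nonpos: "(\<And>i n. f i n \<le> 0) \<Longrightarrow> evsmall f"
  unfolding evsmall_def by (meson order.trans less_imp_le)

text \<open>Every index \<open>i\<close> carries a matrix of every size \<open>n\<close> at once, so
  that one type holds all families. A sequence of matrices of varying sizes is entered by filling
  the other sizes with zero.\<close>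

definition fam :: "(nat \<Rightarrow> nat \<Rightarrow> complex mat) \<Rightarrow> bool" where
  "fam x \<longleftrightarrow> (\<forall>i n. x i n \<in> carrier_mat n n) \<and> (\<exists>C. \<forall>i n. op_norm (x i n) \<le> C)"

text \<open>Partial on purpose: it is bounded families that form a ring modulo null
  families.\<close>

definition fam_rel :: "(nat \<Rightarrow> nat \<Rightarrow> complex mat) \<Rightarrow> (nat \<Rightarrow> nat \<Rightarrow> complex mat) \<Rightarrow> bool" where
  "fam_rel x y \<longleftrightarrow> fam x \<and> fam y \<and> evsmall (\<lambda>i n. op_norm (x i n - y i n))"

lemma famI: "(\<And>i n. x i n \<in> carrier_mat n n) \<Longrightarrow> (\<And>i n. op_norm (x i n) \<le> C) \<Longrightarrow> fam x"
  by (auto simp: fam_def)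

lemma fam_carrier [simp]: "fam x \<Longrightarrow> x i n \<in> carrier_mat n n"
  by (auto simp: fam_def)

lemma fam_bound:
  assumes "fam x" obtains C where "C \<ge> 0" "\<And>i n. op_norm (x i n) \<le> C"
proof -
  obtain C where C: "\<And>i n. op_norm (x i n) \<le> C" using assms by (auto simp: fam_def)
  have "0 \<le> op_norm (x 0 0)" using assms by (intro op_norm_nonneg[of _ 0]) simp
  hence "C \<ge> 0" using C[of 0 0] by linarith
  thus ?thesis using that C by blast
qed

lemma fam_leI:
  assumes "fam x" "\<And>i n. y i n \<in> carrier_mat n n" "\<And>i n. op_norm (y i n) \<le> op_norm (x i n)"
  shows "fam y"
proof -
  obtain C where "\<And>i n. op_norm (x i n) \<le> C" using fam_bound[OF assms(1)] by blast
  thus ?thesis using assms(2,3) order.trans by (intro famI[of y C]) blast+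
qed

lemma minus_carrier_sq [simp]: "A \<in> carrier_mat n m \<Longrightarrow> B \<in> carrier_mat n m \<Longrightarrow> (A :: complex mat) - B \<in> carrier_mat n m"
  by (rule minus_carrier_mat)

lemma fam_add [simp]:
  assumes "fam x" "fam y" shows "fam (\<lambda>i n. x i n + y i n)"
proof -
  obtain C where C: "C \<ge> 0" "\<And>i n. op_norm (x i n) \<le> C" using fam_bound[OF assms(1)] by blast
  obtain D where D: "D \<ge> 0" "\<And>i n. op_norm (y i n) \<le> D" using fam_bound[OF assms(2)] by blast
  show ?thesis
  proof (rule famI[of _ "C + D"])
    fix i n
    note c = fam_carrier[OF assms(1), of i n] fam_carrier[OF assms(2), of i n]
    show "x i n + y i n \<in> carrier_mat n n" using c by simp
    show "op_norm (x i n + y i n) \<le> C + D" using op_norm_add[OF c] C(2)[of i n] D(2)[of i n] by linarith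
  qed
qed

lemma fam_uminus [simp]: "fam x \<Longrightarrow> fam (\<lambda>i n. - x i n)"
  by (rule fam_leI[of x]) (simp_all add: op_norm_uminus[OF fam_carrier])

lemma fam_minus [simp]:
  assumes "fam x" "fam y" shows "fam (\<lambda>i n. x i n - y i n)"
proof -
  have "x i n - y i n = x i n + - y i n" for i n 
    using assms by (intro add_uminus_minus_mat[symmetric, of _ n n]) auto
  thus ?thesis using fam_add[OF assms(1) fam_uminus[OF assms(2)]] by simp
qed

lemma fam_mult [simp]:
  assumes "fam x" "fam y" shows "fam (\<lambda>i n. x i n * y i n)"
proof -
  obtain C where C: "C \<ge> 0" "\<And>i n. op_norm (x i n) \<le> C" using fam_bound[OF assms(1)] by blast
  obtain D where D: "D \<ge> 0" "\<And>i n. op_norm (y i n) \<le> D" using fam_bound[OF assms(2)] by blast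
  show ?thesis
  proof (rule famI[of _ "C * D"])
    fix i n
    note c = fam_carrier[OF assms(1), of i n] fam_carrier[OF assms(2), of i n]
    show "x i n * y i n \<in> carrier_mat n n" using c by (rule mult_carrier_mat)
    have "op_norm (x i n) * op_norm (y i n) \<le> C * D"
      using C D op_norm_nonneg[OF c(2)] by (intro mult_mono) auto
    thus "op_norm (x i n * y i n) \<le> C * D" using op_norm_mult[OF c] by simp
  qed
qed

lemma fam_scalar [simp]: "fam (\<lambda>i n. c \<cdot>\<^sub>m 1\<^sub>m n)"
proof (rule famI[of _ "cmod c"])
  fix n show "op_norm (c \<cdot>\<^sub>m 1\<^sub>m n) \<le> cmod c"
    using op_norm_smult[of "1\<^sub>m n" n c] op_norm_unitary[OF unitary_mat_one, of n]
    by (smt (verit) mult_left_le norm_ge_zero one_carrier_mat)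
qed auto

lemma fam_one [simp]: "fam (\<lambda>i n. 1\<^sub>m n)" using fam_scalar[of 1] by simp

lemma fam_zero [simp]: "fam (\<lambda>i n. 0\<^sub>m n n)" by (rule famI[of _ 0]) auto

lemma fam_adjoint [simp]: "fam x \<Longrightarrow> fam (\<lambda>i n. mat_adjoint (x i n))"
  by (rule fam_leI[of x]) (simp_all add: op_norm_adjoint[OF fam_carrier])

lemma fam_conj_by [simp]: "real_structure W \<Longrightarrow> fam x \<Longrightarrow> fam (\<lambda>i n. conj_by W n (x i n))"
  by (rule fam_leI[of x]) (simp_all add: op_norm_conj_by)

lemma fam_comm_add: "fam x \<Longrightarrow> fam y \<Longrightarrow> (\<lambda>i n. x i n + y i n) = (\<lambda>i n. y i n + x i n)"
  by (intro ext comm_add_mat) (erule fam_carrier)+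

lemma fam_rel_eqI: "fam x \<Longrightarrow> (\<And>i n. x i n = y i n) \<Longrightarrow> fam_rel x y"
proof -
  assume x: "fam x" and eq: "\<And>i n. x i n = y i n"
  have *: "y i n - y i n = 0\<^sub>m n n" for i n using fam_carrier[OF x, of i n] eq by (intro eq_matI) auto
  have "y = x" using eq by (intro ext) simp
  hence "op_norm (x i n - y i n) = 0" for i n using * by simp
  thus ?thesis using x \<open>y = x\<close> evsmall_nonpos[of "\<lambda>i n. op_norm (x i n - y i n)"] by (simp add: fam_rel_def)
qed

lemma fam_rel_refl: "fam_rel x x \<longleftrightarrow> fam x"
  using fam_rel_eqI fam_rel_def by blast

lemma fam_rel_sym: "fam_rel x y \<Longrightarrow> fam_rel y x"
proof -
  assume xy: "fam_rel x y"
  have "op_norm (y i n - x i n) = op_norm (x i n - y i n)" for i n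
  proof -
    have c: "x i n \<in> carrier_mat n n" "y i n \<in> carrier_mat n n" using xy by (auto simp: fam_rel_def)
    have "y i n - x i n = - (x i n - y i n)" using c by (intro eq_matI) auto
    thus ?thesis using c op_norm_uminus[of "x i n - y i n" n] by simp
  qed
  thus ?thesis using xy by (simp add: fam_rel_def)
qed

lemma fam_rel_trans: "fam_rel x y \<Longrightarrow> fam_rel y z \<Longrightarrow> fam_rel x z"
proof -
  assume xy: "fam_rel x y" "fam_rel y z"
  have "op_norm (x i n - z i n) \<le> op_norm (x i n - y i n) + op_norm (y i n - z i n)" for i n
  proof -
    have c: "x i n \<in> carrier_mat n n" "y i n \<in> carrier_mat n n" "z i n \<in> carrier_mat n n" 
      using xy by (auto simp: fam_rel_def)
    have "x i n - z i n = (x i n - y i n) + (y i n - z i n)" using c by (intro eq_matI) auto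
    thus ?thesis using c op_norm_add[of "x i n - y i n" n "y i n - z i n"] by simp
  qed
  with evsmall_mono[OF evsmall_add, of "\<lambda>i n. op_norm (x i n - y i n)" "\<lambda>i n. op_norm (y i n - z i n)" "\<lambda>i n. op_norm (x i n - z i n)"]
  show ?thesis using xy by (auto simp: fam_rel_def)
qed

text \<open>The quotient of bounded families by null families turns every approximate identity into an
  exact one.  Uniformity in \<open>n\<close> gives bounds that do not depend on the matrix size.\<close>

quotient_type qalg = "nat \<Rightarrow> nat \<Rightarrow> complex mat" / partial: fam_rel
proof (rule part_equivpI)
  show "\<exists>x. fam_rel x x" using fam_rel_refl fam_zero by blast
  show "symp fam_rel" using fam_rel_sym by (auto intro: sympI)
  show "transp fam_rel" using fam_rel_trans by (blast intro: transpI)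
qed

lemma fam_rel_le:
  assumes "fam x" "fam y" "evsmall f" "\<And>i n. op_norm (x i n - y i n) \<le> f i n"
  shows "fam_rel x y"
  using assms evsmall_mono[OF assms(3,4)] by (simp add: fam_rel_def)

lemma fam_rel_add:
  assumes "fam_rel x x'" "fam_rel y y'"
  shows "fam_rel (\<lambda>i n. x i n + y i n) (\<lambda>i n. x' i n + y' i n)"
proof -
  have f: "fam x" "fam x'" "fam y" "fam y'" 
    and s: "evsmall (\<lambda>i n. op_norm (x i n - x' i n))" "evsmall (\<lambda>i n. op_norm (y i n - y' i n))"
    using assms by (auto simp: fam_rel_def)
  show ?thesis
  proof (rule fam_rel_le[OF _ _ evsmall_add[OF s]])
    fix i n
    have c: "x i n \<in> carrier_mat n n" "y i n \<in> carrier_mat n n" "x' i n \<in> carrier_mat n n" "y' i n \<in> carrier_mat n n"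
      using f by auto
    have "x i n + y i n - (x' i n + y' i n) = (x i n - x' i n) + (y i n - y' i n)"
      using c by (intro eq_matI) auto
    thus "op_norm (x i n + y i n - (x' i n + y' i n)) \<le> op_norm (x i n - x' i n) + op_norm (y i n - y' i n)"
      using c op_norm_add[of "x i n - x' i n" n "y i n - y' i n"] by simp
  qed (use f in auto)
qed

lemma fam_rel_uminus:
  assumes "fam_rel x x'" shows "fam_rel (\<lambda>i n. - x i n) (\<lambda>i n. - x' i n)"
proof -
  have f: "fam x" "fam x'" and s: "evsmall (\<lambda>i n. op_norm (x i n - x' i n))"
    using assms by (auto simp: fam_rel_def)
  show ?thesis
  proof (rule fam_rel_le[OF _ _ s])
    fix i n
    have c: "x i n \<in> carrier_mat n n" "x' i n \<in> carrier_mat n n" using f by auto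
    have "- x i n - - x' i n = - (x i n - x' i n)" using c by (intro eq_matI) auto
    thus "op_norm (- x i n - - x' i n) \<le> op_norm (x i n - x' i n)"
      using c op_norm_uminus[of "x i n - x' i n" n] by simp
  qed (use f in auto)
qed

lemma fam_rel_mult:
  assumes "fam_rel x x'" "fam_rel y y'"
  shows "fam_rel (\<lambda>i n. x i n * y i n) (\<lambda>i n. x' i n * y' i n)"
proof -
  have f: "fam x" "fam x'" "fam y" "fam y'" 
    and s: "evsmall (\<lambda>i n. op_norm (x i n - x' i n))" "evsmall (\<lambda>i n. op_norm (y i n - y' i n))"
    using assms by (auto simp: fam_rel_def)
  obtain C where C: "C \<ge> 0" "\<And>i n. op_norm (y i n) \<le> C" using fam_bound[OF f(3)] by blast
  obtain D where D: "D \<ge> 0" "\<And>i n. op_norm (x' i n) \<le> D" using fam_bound[OF f(2)] by blast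
  show ?thesis
  proof (rule fam_rel_le[OF _ _ evsmall_add[OF evsmall_cmult[OF s(1) C(1)] evsmall_cmult[OF s(2) D(1)]]])
    fix i n
    have c: "x i n \<in> carrier_mat n n" "y i n \<in> carrier_mat n n" "x' i n \<in> carrier_mat n n" "y' i n \<in> carrier_mat n n"
      using f by auto
    have c2: "x i n - x' i n \<in> carrier_mat n n" "y i n - y' i n \<in> carrier_mat n n" using c by auto
    have "x i n * y i n - x' i n * y' i n = (x i n * y i n - x' i n * y i n) + (x' i n * y i n - x' i n * y' i n)"
      using c by (intro eq_matI) auto
    also have "\<dots> = (x i n - x' i n) * y i n + x' i n * (y i n - y' i n)"
      using c by (simp add: minus_mult_distrib_mat[of _ n n _ _ n] mult_minus_distrib_mat[of _ n n _ n])
    finally have "op_norm (x i n * y i n - x' i n * y' i n) \<le> 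
       op_norm ((x i n - x' i n) * y i n) + op_norm (x' i n * (y i n - y' i n))"
      using op_norm_add[OF mult_carrier_mat[OF c2(1) c(2)] mult_carrier_mat[OF c(3) c2(2)]] by simp
    also have "\<dots> \<le> op_norm (x i n - x' i n) * op_norm (y i n) + op_norm (x' i n) * op_norm (y i n - y' i n)"
      by (intro add_mono op_norm_mult[of _ n]) (use c c2 in auto)
    also have "\<dots> \<le> op_norm (x i n - x' i n) * C + D * op_norm (y i n - y' i n)"
      by (intro add_mono mult_left_mono mult_right_mono C D op_norm_nonneg[of _ n] c2)
    finally show "op_norm (x i n * y i n - x' i n * y' i n) 
        \<le> C * op_norm (x i n - x' i n) + D * op_norm (y i n - y' i n)" by (simp add: mult.commute)
  qed (use f in auto)
qed

lemma fam_rel_adjoint: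
  assumes "fam_rel x x'" shows "fam_rel (\<lambda>i n. mat_adjoint (x i n)) (\<lambda>i n. mat_adjoint (x' i n))"
proof -
  have f: "fam x" "fam x'" and s: "evsmall (\<lambda>i n. op_norm (x i n - x' i n))"
    using assms by (auto simp: fam_rel_def)
  show ?thesis
  proof (rule fam_rel_le[OF _ _ s])
    fix i n
    have c: "x i n \<in> carrier_mat n n" "x' i n \<in> carrier_mat n n" using f by auto
    show "op_norm (mat_adjoint (x i n) - mat_adjoint (x' i n)) \<le> op_norm (x i n - x' i n)"
      using op_norm_adjoint[of "x i n - x' i n" n] c by (simp add: mat_adjoint_minus[OF c])
  qed (use f in auto)
qed

lemma fam_rel_conj_by:
  assumes W: "real_structure W" and "fam_rel x x'" 
  shows "fam_rel (\<lambda>i n. conj_by W n (x i n)) (\<lambda>i n. conj_by W n (x' i n))"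
proof -
  have f: "fam x" "fam x'" and s: "evsmall (\<lambda>i n. op_norm (x i n - x' i n))"
    using assms by (auto simp: fam_rel_def)
  show ?thesis
  proof (rule fam_rel_le[OF _ _ s])
    fix i n
    have c: "x i n \<in> carrier_mat n n" "x' i n \<in> carrier_mat n n" using f by auto
    have *: "A - B = A + (-1) \<cdot>\<^sub>m B" if "A \<in> carrier_mat n n" "B \<in> carrier_mat n n" for A B :: "complex mat"
      using that by (intro eq_matI) auto
    have "conj_by W n (x i n) - conj_by W n (x' i n) = conj_by W n (x i n - x' i n)"
      using c W by (simp add: * conj_by_add conj_by_smult)
    thus "op_norm (conj_by W n (x i n) - conj_by W n (x' i n)) \<le> op_norm (x i n - x' i n)"
      using op_norm_conj_by[OF W, of "x i n - x' i n" n] c by simp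
  qed (use f W in auto)
qed

instantiation qalg :: ring_1
begin

lift_definition zero_qalg :: qalg is "\<lambda>i n. 0\<^sub>m n n" by (simp add: fam_rel_refl)
lift_definition one_qalg :: qalg is "\<lambda>i n. 1\<^sub>m n" by (simp add: fam_rel_refl)
lift_definition plus_qalg :: "qalg \<Rightarrow> qalg \<Rightarrow> qalg" is "\<lambda>x y i n. x i n + y i n" by (rule fam_rel_add)
lift_definition uminus_qalg :: "qalg \<Rightarrow> qalg" is "\<lambda>x i n. - x i n" by (rule fam_rel_uminus)
lift_definition times_qalg :: "qalg \<Rightarrow> qalg \<Rightarrow> qalg" is "\<lambda>x y i n. x i n * y i n" by (rule fam_rel_mult)
definition minus_qalg :: "qalg \<Rightarrow> qalg \<Rightarrow> qalg" where "minus_qalg a b = a + - b"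

lemma qalg_cases:
  obtains x where "fam x" "q = abs_qalg x"
proof
  show "fam (rep_qalg q)" using Quotient_rep_reflp[OF Quotient_qalg, of q] by (simp only: fam_rel_refl)
  show "q = abs_qalg (rep_qalg q)" using Quotient_abs_rep[OF Quotient_qalg, of q] by simp
qed

lemma abs_qalg_eq_iff: "fam x \<Longrightarrow> fam y \<Longrightarrow> abs_qalg x = abs_qalg y \<longleftrightarrow> fam_rel x y"
  using Quotient_rel[OF Quotient_qalg, of x y] by (simp add: fam_rel_refl)

lemma abs_qalg_simps:
  "0 = abs_qalg (\<lambda>i n. 0\<^sub>m n n)" "1 = abs_qalg (\<lambda>i n. 1\<^sub>m n)"
  "fam x \<Longrightarrow> fam y \<Longrightarrow> abs_qalg x + abs_qalg y = abs_qalg (\<lambda>i n. x i n + y i n)"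
  "fam x \<Longrightarrow> fam y \<Longrightarrow> abs_qalg x * abs_qalg y = abs_qalg (\<lambda>i n. x i n * y i n)"
  "fam x \<Longrightarrow> - abs_qalg x = abs_qalg (\<lambda>i n. - x i n)"
      apply (rule zero_qalg.abs_eq)
     apply (rule one_qalg.abs_eq)
    apply (rule plus_qalg.abs_eq; simp only: fam_rel_refl)
   apply (rule times_qalg.abs_eq; simp only: fam_rel_refl)
  apply (rule uminus_qalg.abs_eq; simp only: fam_rel_refl)
  done

instance
proof
  fix a b c :: qalg
  show "a + b + c = a + (b + c)" 
    by (cases a rule: qalg_cases, cases b rule: qalg_cases, cases c rule: qalg_cases) (simp add: abs_qalg_simps assoc_add_mat[OF fam_carrier fam_carrier fam_carrier])
  show "a + b = b + a" 
  proof (cases a rule: qalg_cases, cases b rule: qalg_cases)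
    fix x y assume "fam x" "a = abs_qalg x" "fam y" "b = abs_qalg y" 
    thus ?thesis using fam_comm_add[of x y] by (simp add: abs_qalg_simps)
  qed
  show "0 + a = a" 
    by (cases a rule: qalg_cases) (simp add: abs_qalg_simps left_add_zero_mat[OF fam_carrier])
  show "- a + a = 0" 
    by (cases a rule: qalg_cases) (simp add: abs_qalg_simps uminus_l_inv_mat[OF fam_carrier])
  show "a - b = a + - b" by (rule minus_qalg_def)
  show "a * b * c = a * (b * c)" 
    by (cases a rule: qalg_cases, cases b rule: qalg_cases, cases c rule: qalg_cases) (simp add: abs_qalg_simps assoc_mult_mat[OF fam_carrier fam_carrier fam_carrier])
  show "1 * a = a" 
    by (cases a rule: qalg_cases) (simp add: abs_qalg_simps left_mult_one_mat[OF fam_carrier])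
  show "a * 1 = a" 
    by (cases a rule: qalg_cases) (simp add: abs_qalg_simps right_mult_one_mat[OF fam_carrier])
  show "(a + b) * c = a * c + b * c" 
    by (cases a rule: qalg_cases, cases b rule: qalg_cases, cases c rule: qalg_cases) (simp add: abs_qalg_simps add_mult_distrib_mat[OF fam_carrier fam_carrier fam_carrier])
  show "a * (b + c) = a * b + a * c" 
    by (cases a rule: qalg_cases, cases b rule: qalg_cases, cases c rule: qalg_cases) (simp add: abs_qalg_simps mult_add_distrib_mat[OF fam_carrier fam_carrier fam_carrier])
  show "(0::qalg) \<noteq> 1"
  proof -
    \<comment> \<open>Size \<open>1\<close> separates the two classes; at size \<open>0\<close> zero
      and identity coincide.\<close>
    have "\<not> fam_rel (\<lambda>i n. 0\<^sub>m n n) (\<lambda>i n. 1\<^sub>m n)"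
    proof
      assume "fam_rel (\<lambda>i n. 0\<^sub>m n n) (\<lambda>i n. 1\<^sub>m n)"
      hence "evsmall (\<lambda>i n. op_norm (0\<^sub>m n n - 1\<^sub>m n))" by (simp add: fam_rel_def)
      from this[unfolded evsmall_def, rule_format, of "1 / 2"]
      have "op_norm (0\<^sub>m 1 1 - 1\<^sub>m 1) \<le> 1 / 2" by auto
      moreover have "0\<^sub>m 1 1 - 1\<^sub>m 1 = udiag 1 (1\<^sub>m 1) (\<lambda>_. - 1)"
        using udiag_const[OF unitary_mat_one, of 1 "-1"] by (intro eq_matI) auto
      ultimately show False using cmod_le_op_norm_udiag[OF unitary_mat_one, of 0 1 "\<lambda>_. -1"] by simp
    qed
    thus ?thesis by (simp add: abs_qalg_simps(1,2) abs_qalg_eq_iff)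
  qed
qed

end

section \<open>Scalars, involutions, norm bounds and positivity in the quotient\<close>

lift_definition cof :: "complex \<Rightarrow> qalg" is "\<lambda>c i n. c \<cdot>\<^sub>m 1\<^sub>m n" by (simp add: fam_rel_refl)

lift_definition star :: "qalg \<Rightarrow> qalg" is "\<lambda>x i n. mat_adjoint (x i n)" by (rule fam_rel_adjoint)

text \<open>The lifting has to respect \<open>fam_rel\<close> for every \<open>W\<close>, so the
  identity map is the default value when \<open>W\<close> is not a real structure.\<close>

lift_definition sig :: "(nat \<Rightarrow> complex mat) \<Rightarrow> qalg \<Rightarrow> qalg" is
  "\<lambda>W x i n. if real_structure W then conj_by W n (x i n) else x i n"
  subgoal for W x y by (cases "real_structure W") (simp_all add: fam_rel_conj_by)
  done

lemma op_norm_diff_le: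
  assumes "A \<in> carrier_mat n n" "B \<in> carrier_mat n n"
  shows "op_norm A \<le> op_norm B + op_norm (A - B)"
proof -
  have "A = B + (A - B)" using assms by (intro eq_matI) auto
  thus ?thesis using op_norm_add[of B n "A - B"] assms by simp
qed

lemma op_norm_bound_respect:
  assumes "fam_rel x y"
  shows "evsmall (\<lambda>i n. op_norm (x i n) - c) = evsmall (\<lambda>i n. op_norm (y i n) - c)"
proof -
  have *: "evsmall (\<lambda>i n. op_norm (y i n) - c)" if "fam_rel x y" "evsmall (\<lambda>i n. op_norm (x i n) - c)" for x y
  proof -
    have "fam_rel y x" by (rule fam_rel_sym[OF that(1)])
    hence f: "fam y" "fam x" "evsmall (\<lambda>i n. op_norm (y i n - x i n))" by (auto simp: fam_rel_def)
    show ?thesis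
      using op_norm_diff_le[OF fam_carrier[OF f(1)] fam_carrier[OF f(2)]]
      by (intro evsmall_mono[OF evsmall_add[OF that(2) f(3)]]) (simp add: algebra_simps)
  qed
  show ?thesis using *[OF assms] *[OF fam_rel_sym[OF assms]] by blast
qed

text \<open>\<open>nb x c\<close> says that the quotient norm of \<open>x\<close> is at most \<open>c\<close>.\<close>

lift_definition nb :: "qalg \<Rightarrow> real \<Rightarrow> bool" is "\<lambda>x c. evsmall (\<lambda>i n. op_norm (x i n) - c)"
  by (rule op_norm_bound_respect | (rule ext, rule op_norm_bound_respect))+

text \<open>One representative witnesses positivity in every matrix, so order arguments can be
  carried out on vectors.\<close>

definition pos :: "qalg \<Rightarrow> bool" where
  "pos q \<longleftrightarrow> (\<exists>x. fam x \<and> q = abs_qalg x \<and> (\<forall>i n. psd_mat n (x i n)))"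

lemma abs_qalg_cof: "cof c = abs_qalg (\<lambda>i n. c \<cdot>\<^sub>m 1\<^sub>m n)"
  by (rule cof.abs_eq)

lemma abs_qalg_star: "fam x \<Longrightarrow> star (abs_qalg x) = abs_qalg (\<lambda>i n. mat_adjoint (x i n))"
  by (rule star.abs_eq) (simp only: fam_rel_refl)

lemma abs_qalg_sig: "real_structure W \<Longrightarrow> fam x \<Longrightarrow> sig W (abs_qalg x) = abs_qalg (\<lambda>i n. conj_by W n (x i n))"
  using sig.abs_eq[of x W] by (simp add: fam_rel_refl)

lemma abs_qalg_nb: "fam x \<Longrightarrow> nb (abs_qalg x) c \<longleftrightarrow> evsmall (\<lambda>i n. op_norm (x i n) - c)"
  using nb.abs_eq[of x] by (simp add: fam_rel_refl)

lemma abs_qalg_minus: "fam x \<Longrightarrow> fam y \<Longrightarrow> abs_qalg x - abs_qalg y = abs_qalg (\<lambda>i n. x i n - y i n)"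
proof -
  assume xy: "fam x" "fam y"
  have "x i n + - y i n = x i n - y i n" for i n
    using fam_carrier[OF xy(1)] fam_carrier[OF xy(2)] by (rule add_uminus_minus_mat)
  thus ?thesis using xy by (simp add: minus_qalg_def abs_qalg_simps)
qed

lemmas abs_qalg_ops = abs_qalg_simps abs_qalg_cof abs_qalg_star abs_qalg_minus

lemma cof_add: "cof (a + b) = cof a + cof b"
  by (simp add: abs_qalg_ops add_smult_distrib_right_mat[of _ n n for n])
    (simp add: add_smult_distrib_right_mat[OF one_carrier_mat])

lemma scalar_mat_mult: "A \<in> carrier_mat n n \<Longrightarrow> (c \<cdot>\<^sub>m 1\<^sub>m n) * A = c \<cdot>\<^sub>m (A :: complex mat)"
  by (subst mult_smult_assoc_mat[of _ n n _ n]) auto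

lemma mult_scalar_mat: "A \<in> carrier_mat n n \<Longrightarrow> A * (c \<cdot>\<^sub>m 1\<^sub>m n) = c \<cdot>\<^sub>m (A :: complex mat)"
  by (subst mult_smult_distrib[of _ n n _ n]) auto

lemma scalar_mat_mult_vec:
  assumes "v \<in> carrier_vec n" shows "(c \<cdot>\<^sub>m 1\<^sub>m n) *\<^sub>v v = c \<cdot>\<^sub>v (v :: complex vec)"
proof (rule eq_vecI)
  fix i assume "i < dim_vec (c \<cdot>\<^sub>v v)"
  hence i: "i < n" using assms by simp
  have "((c \<cdot>\<^sub>m 1\<^sub>m n) *\<^sub>v v) $ i = (\<Sum>j = 0..<n. (c * (if j = i then 1 else 0)) * v $ j)"
    using assms i by (simp add: scalar_prod_def)
  also have "\<dots> = (\<Sum>j = 0..<n. if j = i then c * v $ j else 0)" by (intro sum.cong) auto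
  finally show "((c \<cdot>\<^sub>m 1\<^sub>m n) *\<^sub>v v) $ i = (c \<cdot>\<^sub>v v) $ i" using assms i by simp
qed (use assms in auto)

lemma smult_smult_mat: "a \<cdot>\<^sub>m (b \<cdot>\<^sub>m A) = (a * b) \<cdot>\<^sub>m (A :: complex mat)"
  by (intro eq_matI) auto

lemma cof_mult: "cof (a * b) = cof a * cof b"
  by (simp add: abs_qalg_ops scalar_mat_mult[OF smult_carrier_mat[OF one_carrier_mat]] smult_smult_mat)

lemma cof_1 [simp]: "cof 1 = 1" by (simp add: abs_qalg_ops)

lemma cof_0 [simp]: "cof 0 = 0"
proof -
  have "0 \<cdot>\<^sub>m 1\<^sub>m n = (0\<^sub>m n n :: complex mat)" for n by (intro eq_matI) auto
  thus ?thesis by (simp add: abs_qalg_ops)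
qed

lemma cof_uminus: "cof (- a) = - cof a"
  using cof_add[of a "- a"] by (simp add: eq_neg_iff_add_eq_0 add.commute)

lemma cof_diff: "cof (a - b) = cof a - cof b"
  using cof_add[of a "- b"] by (simp add: cof_uminus)

lemma cof_commute: "x * cof c = cof c * x"
  by (cases x rule: qalg_cases) 
    (simp add: abs_qalg_ops scalar_mat_mult[OF fam_carrier] mult_scalar_mat[OF fam_carrier])

lemma star_add: "star (x + y) = star x + star y"
  by (cases x rule: qalg_cases, cases y rule: qalg_cases)
    (simp add: abs_qalg_ops mat_adjoint_add[OF fam_carrier fam_carrier])

lemma star_mult: "star (x * y) = star y * star x"
  by (cases x rule: qalg_cases, cases y rule: qalg_cases)
    (simp add: abs_qalg_ops mat_adjoint_mult[OF fam_carrier fam_carrier])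

lemma star_star [simp]: "star (star x) = x"
  by (cases x rule: qalg_cases) (simp add: abs_qalg_ops)

lemma star_cof: "star (cof c) = cof (cnj c)"
  by (simp add: abs_qalg_ops mat_adjoint_smult)

lemma star_0 [simp]: "star 0 = 0" using star_cof[of 0] by simp
lemma star_1 [simp]: "star 1 = 1" using star_cof[of 1] by simp

lemma star_uminus: "star (- x) = - star x"
  using star_add[of x "- x"] by (simp add: eq_neg_iff_add_eq_0 add.commute)

lemma star_diff: "star (x - y) = star x - star y"
  using star_add[of x "- y"] by (simp add: star_uminus)

lemma star_sum: "star (sum f A) = (\<Sum>a\<in>A. star (f a))"
  by (induction A rule: infinite_finite_induct) (auto simp: star_add)

lemma nb_mono: "nb x a \<Longrightarrow> a \<le> b \<Longrightarrow> nb x b"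
  by (cases x rule: qalg_cases) (auto simp: abs_qalg_nb elim!: evsmall_mono)

lemma nb_ex: "\<exists>c\<ge>0. nb x c"
proof (cases x rule: qalg_cases)
  case (1 a)
  obtain C where C: "C \<ge> 0" "\<And>i n. op_norm (a i n) \<le> C" using fam_bound[OF 1(1)] by blast
  show ?thesis using 1 C by (intro exI[of _ C]) (auto simp: abs_qalg_nb intro!: evsmall_nonpos)
qed

lemma nb_add: "nb x a \<Longrightarrow> nb y b \<Longrightarrow> nb (x + y) (a + b)"
proof (cases x rule: qalg_cases; cases y rule: qalg_cases)
  fix u v assume *: "nb x a" "nb y b" "fam u" "x = abs_qalg u" "fam v" "y = abs_qalg v"
  have "evsmall (\<lambda>i n. (op_norm (u i n) - a) + (op_norm (v i n) - b))"
    using * by (intro evsmall_add) (auto simp: abs_qalg_nb)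
  hence "evsmall (\<lambda>i n. op_norm (u i n + v i n) - (a + b))"
    using op_norm_add[OF fam_carrier[OF *(3)] fam_carrier[OF *(5)]] 
    by (elim evsmall_mono) (smt (verit))
  thus ?thesis using * by (simp add: abs_qalg_ops abs_qalg_nb)
qed

lemma nb_uminus: "nb x a \<Longrightarrow> nb (- x) a"
  by (cases x rule: qalg_cases) (simp add: abs_qalg_ops abs_qalg_nb op_norm_uminus[OF fam_carrier])

lemma nb_diff: "nb x a \<Longrightarrow> nb y b \<Longrightarrow> nb (x - y) (a + b)"
  using nb_add[OF _ nb_uminus] by (metis diff_conv_add_uminus)

lemma nb_star: "nb x a \<Longrightarrow> nb (star x) a"
  by (cases x rule: qalg_cases) (simp add: abs_qalg_ops abs_qalg_nb op_norm_adjoint[OF fam_carrier])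

lemma nb_cof: "nb (cof c) (cmod c)"
proof -
  have "op_norm (c \<cdot>\<^sub>m 1\<^sub>m n) \<le> cmod c" for n
    using op_norm_smult[of "1\<^sub>m n" n c] op_norm_unitary[OF unitary_mat_one, of n]
    by (smt (verit) mult_left_le norm_ge_zero one_carrier_mat)
  thus ?thesis by (auto simp: abs_qalg_ops abs_qalg_nb intro!: evsmall_nonpos)
qed

lemma nb_0: "0 \<le> c \<Longrightarrow> nb 0 c" using nb_mono[OF nb_cof[of 0]] by simp

lemma nb_mult: "nb x a \<Longrightarrow> nb y b \<Longrightarrow> 0 \<le> a \<Longrightarrow> 0 \<le> b \<Longrightarrow> nb (x * y) (a * b)"
proof (cases x rule: qalg_cases; cases y rule: qalg_cases)
  fix u v assume *: "nb x a" "nb y b" "0 \<le> a" "0 \<le> b" "fam u" "x = abs_qalg u" "fam v" "y = abs_qalg v"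
  obtain C where C: "C \<ge> 0" "\<And>i n. op_norm (u i n) \<le> C" using fam_bound[OF *(5)] by blast
  \<comment> \<open>The positive part is taken because \<open>op_norm (v i n) - b\<close> may be
    negative, where replacing the factor \<open>op_norm (u i n)\<close> by its bound
    \<open>C\<close> would go the wrong way.\<close>
  have "evsmall (\<lambda>i n. b * (op_norm (u i n) - a) + C * max 0 (op_norm (v i n) - b))"
  proof (intro evsmall_add evsmall_cmult * C)
    show "evsmall (\<lambda>i n. op_norm (u i n) - a)" using * by (simp add: abs_qalg_nb)
    have "evsmall (\<lambda>i n. op_norm (v i n) - b)" using * by (simp add: abs_qalg_nb)
    thus "evsmall (\<lambda>i n. max 0 (op_norm (v i n) - b))" by (auto simp: evsmall_def)
  qed
  hence "evsmall (\<lambda>i n. op_norm (u i n * v i n) - a * b)"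
  proof (rule evsmall_mono)
    fix i n
    note c = fam_carrier[OF *(5), of i n] fam_carrier[OF *(7), of i n]
    have "op_norm (u i n * v i n) \<le> op_norm (u i n) * op_norm (v i n)" by (rule op_norm_mult[OF c])
    also have "\<dots> = op_norm (u i n) * b + op_norm (u i n) * (op_norm (v i n) - b)" by (simp add: algebra_simps)
    also have "op_norm (u i n) * (op_norm (v i n) - b) \<le> op_norm (u i n) * max 0 (op_norm (v i n) - b)"
      using op_norm_nonneg[OF c(1)] by (intro mult_left_mono) auto
    also have "\<dots> \<le> C * max 0 (op_norm (v i n) - b)" by (intro mult_right_mono C) auto
    finally show "op_norm (u i n * v i n) - a * b \<le> b * (op_norm (u i n) - a) + C * max 0 (op_norm (v i n) - b)"
      by (simp add: algebra_simps)
  qed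
  thus ?thesis using * by (simp add: abs_qalg_ops abs_qalg_nb)
qed

lemma nb_sum: "(\<And>a. a \<in> A \<Longrightarrow> nb (f a) (c a)) \<Longrightarrow> nb (sum f A) (sum c A)"
  by (induction A rule: infinite_finite_induct) (auto intro: nb_add nb_0)

lemma nb_eq_0:
  assumes "\<And>e. e > 0 \<Longrightarrow> nb x e" shows "x = 0"
proof (cases x rule: qalg_cases)
  case (1 a)
  have m: "a i n - 0\<^sub>m n n = a i n" for i n using fam_carrier[OF 1(1), of i n] by (intro eq_matI) auto
  have "evsmall (\<lambda>i n. op_norm (a i n))"
    unfolding evsmall_def
  proof (intro allI impI)
    fix e :: real assume "e > 0"
    hence e2: "e / 2 > 0" by simp
    have "evsmall (\<lambda>i n. op_norm (a i n) - e / 2)" using assms[OF e2] 1 by (simp add: abs_qalg_nb)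
    then obtain i0 where "\<And>i n. i \<ge> i0 \<Longrightarrow> op_norm (a i n) - e / 2 \<le> e / 2" using e2 unfolding evsmall_def by meson
    thus "\<exists>i0. \<forall>i\<ge>i0. \<forall>n. op_norm (a i n) \<le> e" by (intro exI[of _ i0]) force
  qed
  hence "fam_rel a (\<lambda>i n. 0\<^sub>m n n)" using 1 by (simp add: fam_rel_def m)
  thus ?thesis using 1 by (simp add: abs_qalg_ops abs_qalg_eq_iff)
qed

lemma nb_0_eq_0: "nb x 0 \<Longrightarrow> x = 0"
  by (rule nb_eq_0) (auto intro: nb_mono)

text \<open>Iterating \<open>w = (y / t) w\<close> bounds the norm of \<open>w\<close> by
  \<open>(c / |t|)^m\<close> times a constant, for every \<open>m\<close>. It stands in for the
  invertibility of \<open>cof t - y\<close>.\<close>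

lemma nb_contract:
  assumes "cof t * w = y * w" "nb y c" "0 \<le> c" "c < cmod t"
  shows "w = 0"
proof (rule nb_eq_0)
  define k where "k = c / cmod t"
  have "cmod t > 0" using assms by linarith
  hence t: "cmod t > 0" "0 \<le> k" "k < 1" using assms by (auto simp: k_def)
  have "cof (1 / t) * (cof t * w) = w" using t by (simp add: cof_mult[symmetric] mult.assoc[symmetric])
  hence w: "w = (cof (1 / t) * y) * w" by (simp only: assms(1) mult.assoc)
  have nk: "nb (cof (1 / t) * y) k" 
    using nb_mult[OF nb_cof[of "1 / t"] assms(2)] assms(3) by (simp add: k_def norm_divide)
  obtain C where C: "C \<ge> 0" "nb w C" using nb_ex by blast
  have n: "nb w (k ^ m * C)" for m
  proof (induction m)
    case 0 thus ?case using C by simp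
  next
    case (Suc m)
    from nb_mult[OF nk Suc] t C have "nb ((cof (1 / t) * y) * w) (k * (k ^ m * C))" by simp
    thus ?case using w by (simp add: mult.assoc)
  qed
  fix e :: real assume "e > 0"
  have "(\<lambda>m. k ^ m * C) \<longlonglongrightarrow> 0 * C" using t by (intro tendsto_intros LIMSEQ_power_zero) auto
  hence "\<forall>\<^sub>F m in sequentially. k ^ m * C < e" using \<open>e > 0\<close> by (intro order_tendstoD) auto
  then obtain m where "k ^ m * C < e" by (meson eventually_sequentially order_refl)
  thus "nb w e" using nb_mono[OF n[of m]] by simp
qed

lemma pos_add:
  assumes "pos x" "pos y" shows "pos (x + y)"
proof -
  obtain u v where "fam u" "x = abs_qalg u" "\<And>i n. psd_mat n (u i n)" 
    "fam v" "y = abs_qalg v" "\<And>i n. psd_mat n (v i n)" using assms by (auto simp: pos_def)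
  thus ?thesis unfolding pos_def
    by (intro exI[of _ "\<lambda>i n. u i n + v i n"]) (auto simp: abs_qalg_ops intro!: psd_mat_add)
qed

lemma pos_conj:
  assumes "pos x" shows "pos (star y * x * y)"
proof -
  obtain u where u: "fam u" "x = abs_qalg u" "\<And>i n. psd_mat n (u i n)" using assms by (auto simp: pos_def)
  obtain v where v: "fam v" "y = abs_qalg v" using qalg_cases .
  show ?thesis unfolding pos_def using u v
    by (intro exI[of _ "\<lambda>i n. mat_adjoint (v i n) * u i n * v i n"]) 
      (auto simp: abs_qalg_ops intro!: psd_mat_adjoint_mult)
qed

lemma pos_1: "pos 1"
  unfolding pos_def by (intro exI[of _ "\<lambda>i n. 1\<^sub>m n"]) (auto simp: abs_qalg_ops psd_mat_one)

lemma pos_0: "pos 0"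
  unfolding pos_def by (intro exI[of _ "\<lambda>i n. 0\<^sub>m n n"]) (auto simp: abs_qalg_ops psd_mat_zero)

lemma pos_star_mult: "pos (star y * y)"
  using pos_conj[OF pos_1, of y] by simp

lemma pos_sum: "(\<And>a. a \<in> A \<Longrightarrow> pos (f a)) \<Longrightarrow> pos (sum f A)"
  by (induction A rule: infinite_finite_induct) (auto intro: pos_add pos_0)

text \<open>The representative \<open>?y\<close> of \<open>x\<close> has quadratic form at least
  \<open>c\<close> in every matrix, so Cauchy-Schwarz gives \<open>c |u| <= |?y u|\<close>: an
  element bounded below can be cancelled. This stands in for inverting \<open>x\<close>, and it
  turns inequalities into the vanishing statements about holes.\<close>

lemma pos_cancel:
  assumes p: "pos (x - cof (complex_of_real c))" and c: "c > 0" and xw: "x * w = 0"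
  shows "w = 0"
proof -
  obtain p where p: "fam p" "x - cof (complex_of_real c) = abs_qalg p" "\<And>i n. psd_mat n (p i n)"
    using p by (auto simp: pos_def)
  obtain v where v: "fam v" "w = abs_qalg v" using qalg_cases .
  let ?y = "\<lambda>i n. p i n + complex_of_real c \<cdot>\<^sub>m 1\<^sub>m n"
  have x: "x = abs_qalg ?y"
    using p(1,2) by (simp add: algebra_simps abs_qalg_ops fam_comm_add)
  have "fam_rel (\<lambda>i n. ?y i n * v i n) (\<lambda>i n. 0\<^sub>m n n)"
    using xw p(1) v x by (simp add: abs_qalg_ops abs_qalg_eq_iff)
  moreover have "?y i n * v i n - 0\<^sub>m n n = ?y i n * v i n" for i n 
  proof -
    have "?y i n * v i n \<in> carrier_mat n n" using p(1) v(1) by (intro mult_carrier_mat[of _ n n]) auto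
    thus ?thesis by (intro eq_matI) auto
  qed
  ultimately have "evsmall (\<lambda>i n. op_norm (?y i n * v i n))" by (simp add: fam_rel_def)
  hence "evsmall (\<lambda>i n. 1 / c * op_norm (?y i n * v i n))" by (rule evsmall_cmult) (use c in simp)
  moreover have "op_norm (v i n) \<le> 1 / c * op_norm (?y i n * v i n)" for i n
  proof (rule op_norm_le[of _ n])
    note pc = fam_carrier[OF p(1), of i n] and vc = fam_carrier[OF v(1), of i n]
    have yc: "?y i n \<in> carrier_mat n n" using pc by simp
    have yv: "?y i n * v i n \<in> carrier_mat n n" using yc vc by (rule mult_carrier_mat)
    show "v i n \<in> carrier_mat n n" by (rule vc)
    show "0 \<le> 1 / c * op_norm (?y i n * v i n)" using c op_norm_nonneg[OF yv] by simp
    fix z :: "complex vec" assume z: "z \<in> carrier_vec n"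
    define u where "u = v i n *\<^sub>v z"
    have u: "u \<in> carrier_vec n" using vc z by (simp add: u_def)
    have yu: "(?y i n * v i n) *\<^sub>v z = ?y i n *\<^sub>v u" unfolding u_def by (rule assoc_mult_mat_vec[OF yc vc z])
    have yuc: "?y i n *\<^sub>v u \<in> carrier_vec n" using yc u by (rule mult_mat_vec_carrier)
    have cu: "(complex_of_real c \<cdot>\<^sub>m 1\<^sub>m n) *\<^sub>v u = complex_of_real c \<cdot>\<^sub>v u"
      by (rule scalar_mat_mult_vec[OF u])
    have "?y i n *\<^sub>v u = p i n *\<^sub>v u + complex_of_real c \<cdot>\<^sub>v u"
      using add_mult_distrib_mat_vec[OF pc _ u, of "complex_of_real c \<cdot>\<^sub>m 1\<^sub>m n"] cu by simp
    hence "(?y i n *\<^sub>v u) \<bullet>c u = (p i n *\<^sub>v u) \<bullet>c u + complex_of_real c * (u \<bullet>c u)"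
      using u pc mult_mat_vec_carrier[OF pc u] by (simp add: add_scalar_prod_distrib[of _ n])
    hence "Re ((?y i n *\<^sub>v u) \<bullet>c u) = Re ((p i n *\<^sub>v u) \<bullet>c u) + c * (vec_norm2 u)\<^sup>2"
      by (simp add: cscalar_self flip: of_real_power)
    moreover have "Re ((p i n *\<^sub>v u) \<bullet>c u) \<ge> 0" using p(3)[of n i] u by (simp add: psd_mat_def)
    ultimately have "c * (vec_norm2 u)\<^sup>2 \<le> Re ((?y i n *\<^sub>v u) \<bullet>c u)" by simp
    also have "\<dots> \<le> cmod ((?y i n *\<^sub>v u) \<bullet>c u)" by (rule complex_Re_le_cmod)
    also have "\<dots> \<le> vec_norm2 (?y i n *\<^sub>v u) * vec_norm2 u" by (rule cscalar_le[OF yuc u])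
    finally have "c * vec_norm2 u * vec_norm2 u \<le> vec_norm2 (?y i n *\<^sub>v u) * vec_norm2 u" 
      by (simp add: power2_eq_square mult.assoc)
    hence "c * vec_norm2 u \<le> vec_norm2 (?y i n *\<^sub>v u)" 
      using vec_norm2_nonneg[of u] by (cases "vec_norm2 u = 0") (auto simp: less_le)
    also have "\<dots> \<le> op_norm (?y i n * v i n) * vec_norm2 z"
      using op_norm_ub[OF yv z] by (simp only: yu)
    finally show "vec_norm2 (v i n *\<^sub>v z) \<le> 1 / c * op_norm (?y i n * v i n) * vec_norm2 z"
      using c by (simp add: u_def field_simps)
  qed
  ultimately have ev: "evsmall (\<lambda>i n. op_norm (v i n))" by (rule evsmall_mono)
  show ?thesis
  proof (rule nb_0_eq_0)
    show "nb w 0" using ev v by (simp add: abs_qalg_nb)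
  qed
qed

text \<open>In the representatives the inequality holds only up to the null family \<open>d\<close>.
  Hence the bound \<open>sqrt (c^2 + |d|)\<close>, which exceeds \<open>c\<close> by at most
  \<open>e\<close> once \<open>|d| <= e^2\<close>.\<close>

lemma nb_pos:
  assumes p: "pos (cof (complex_of_real (c\<^sup>2)) - star z * z)" and c: "c \<ge> 0"
  shows "nb z c"
proof -
  obtain p where p: "fam p" "cof (complex_of_real (c\<^sup>2)) - star z * z = abs_qalg p" "\<And>i n. psd_mat n (p i n)"
    using p by (auto simp: pos_def)
  obtain v where v: "fam v" "z = abs_qalg v" using qalg_cases .
  define d where "d = (\<lambda>i n. complex_of_real (c\<^sup>2) \<cdot>\<^sub>m 1\<^sub>m n - mat_adjoint (v i n) * v i n - p i n)"
  have fd: "fam (\<lambda>i n. complex_of_real (c\<^sup>2) \<cdot>\<^sub>m 1\<^sub>m n - mat_adjoint (v i n) * v i n)" using v(1) by simp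
  have "abs_qalg (\<lambda>i n. complex_of_real (c\<^sup>2) \<cdot>\<^sub>m 1\<^sub>m n - mat_adjoint (v i n) * v i n) = abs_qalg p"
    using p(2) v by (simp add: abs_qalg_ops)
  hence ev: "evsmall (\<lambda>i n. op_norm (d i n))" 
    using abs_qalg_eq_iff[OF fd p(1)] by (simp add: fam_rel_def d_def)
  have b: "op_norm (v i n) \<le> sqrt (c\<^sup>2 + op_norm (d i n))" for i n
  proof (rule op_norm_le[of _ n])
    note pc = fam_carrier[OF p(1), of i n] and vc = fam_carrier[OF v(1), of i n]
    have vs: "mat_adjoint (v i n) \<in> carrier_mat n n" using vc by simp
    have vv: "mat_adjoint (v i n) * v i n \<in> carrier_mat n n" using vs vc by (rule mult_carrier_mat)
    have dc: "d i n \<in> carrier_mat n n" using vv pc by (simp add: d_def)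
    show "v i n \<in> carrier_mat n n" by (rule vc)
    show "0 \<le> sqrt (c\<^sup>2 + op_norm (d i n))" using op_norm_nonneg[OF dc] by simp
    fix u :: "complex vec" assume u: "u \<in> carrier_vec n"
    have cu: "(complex_of_real (c\<^sup>2) \<cdot>\<^sub>m 1\<^sub>m n) *\<^sub>v u = complex_of_real (c\<^sup>2) \<cdot>\<^sub>v u"
      by (rule scalar_mat_mult_vec[OF u])
    have eq: "complex_of_real (c\<^sup>2) \<cdot>\<^sub>m 1\<^sub>m n = d i n + (p i n + mat_adjoint (v i n) * v i n)"
      using vv pc unfolding d_def by (intro eq_matI) auto
    have vu: "v i n *\<^sub>v u \<in> carrier_vec n" using vc u by (rule mult_mat_vec_carrier)
    have "complex_of_real (c\<^sup>2) \<cdot>\<^sub>v u = d i n *\<^sub>v u + (p i n *\<^sub>v u + (mat_adjoint (v i n) * v i n) *\<^sub>v u)"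
      by (simp only: cu[symmetric] eq add_mult_distrib_mat_vec[OF dc add_carrier_mat[OF vv] u] add_mult_distrib_mat_vec[OF pc vv u])
    hence "(complex_of_real (c\<^sup>2) \<cdot>\<^sub>v u) \<bullet>c u = (d i n *\<^sub>v u) \<bullet>c u + ((p i n *\<^sub>v u) \<bullet>c u + ((mat_adjoint (v i n) * v i n) *\<^sub>v u) \<bullet>c u)"
      using mult_mat_vec_carrier[OF dc u] mult_mat_vec_carrier[OF pc u] mult_mat_vec_carrier[OF vv u] u
      by (simp add: add_scalar_prod_distrib[of _ n] del: assoc_mult_mat_vec)
    also have "((mat_adjoint (v i n) * v i n) *\<^sub>v u) = mat_adjoint (v i n) *\<^sub>v (v i n *\<^sub>v u)" by (rule assoc_mult_mat_vec[OF vs vc u])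
    also have "(mat_adjoint (v i n) *\<^sub>v (v i n *\<^sub>v u)) \<bullet>c u = (v i n *\<^sub>v u) \<bullet>c (v i n *\<^sub>v u)"
      using cscalar_adjoint[OF vs vu u] by simp
    finally have "c\<^sup>2 * (vec_norm2 u)\<^sup>2 = Re ((d i n *\<^sub>v u) \<bullet>c u) + (Re ((p i n *\<^sub>v u) \<bullet>c u) + (vec_norm2 (v i n *\<^sub>v u))\<^sup>2)"
      using u by (simp add: cscalar_self complex_eq_iff flip: of_real_power of_real_mult)
    moreover have "Re ((p i n *\<^sub>v u) \<bullet>c u) \<ge> 0" using p(3)[of n i] u by (simp add: psd_mat_def)
    moreover have "- Re ((d i n *\<^sub>v u) \<bullet>c u) \<le> op_norm (d i n) * vec_norm2 u * vec_norm2 u"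
    proof -
      have "- Re ((d i n *\<^sub>v u) \<bullet>c u) \<le> cmod ((d i n *\<^sub>v u) \<bullet>c u)" using abs_Re_le_cmod by (smt (verit))
      also have "\<dots> \<le> vec_norm2 (d i n *\<^sub>v u) * vec_norm2 u" by (rule cscalar_le[OF mult_mat_vec_carrier[OF dc u] u])
      also have "\<dots> \<le> op_norm (d i n) * vec_norm2 u * vec_norm2 u" by (intro mult_right_mono op_norm_ub[OF dc u]) auto
      finally show ?thesis .
    qed
    ultimately have "(vec_norm2 (v i n *\<^sub>v u))\<^sup>2 \<le> (c\<^sup>2 + op_norm (d i n)) * (vec_norm2 u)\<^sup>2"
      by (simp add: algebra_simps power2_eq_square)
    hence "sqrt ((vec_norm2 (v i n *\<^sub>v u))\<^sup>2) \<le> sqrt ((c\<^sup>2 + op_norm (d i n)) * (vec_norm2 u)\<^sup>2)" by (rule real_sqrt_le_mono)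
    thus "vec_norm2 (v i n *\<^sub>v u) \<le> sqrt (c\<^sup>2 + op_norm (d i n)) * vec_norm2 u"
      by (simp add: real_sqrt_mult)
  qed
  have "evsmall (\<lambda>i n. op_norm (v i n) - c)"
    unfolding evsmall_def
  proof (intro allI impI)
    fix e :: real assume e: "e > 0"
    hence "e\<^sup>2 > 0" by simp
    then obtain i0 where i0: "\<And>i n. i \<ge> i0 \<Longrightarrow> op_norm (d i n) \<le> e\<^sup>2" using ev unfolding evsmall_def by meson
    have "op_norm (v i n) - c \<le> e" if "i \<ge> i0" for i n
    proof -
      have "sqrt (c\<^sup>2 + op_norm (d i n)) \<le> sqrt ((c + e)\<^sup>2)"
        using i0[OF that, of n] c e by (intro real_sqrt_le_mono) (simp add: power2_sum add_increasing2)
      also have "\<dots> = c + e" using c e by simp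
      finally show ?thesis using b[of i n] by simp
    qed
    thus "\<exists>i0. \<forall>i\<ge>i0. \<forall>n. op_norm (v i n) - c \<le> e" by blast
  qed
  thus ?thesis using v by (simp add: abs_qalg_nb)
qed

context
  fixes W assumes W: "real_structure W"
begin

lemma sig_add: "sig W (x + y) = sig W x + sig W y"
  by (cases x rule: qalg_cases, cases y rule: qalg_cases)
    (simp add: abs_qalg_ops abs_qalg_sig W conj_by_add[OF W fam_carrier fam_carrier])

lemma sig_mult: "sig W (x * y) = sig W x * sig W y"
  by (cases x rule: qalg_cases, cases y rule: qalg_cases)
    (simp add: abs_qalg_ops abs_qalg_sig W conj_by_mult[OF W fam_carrier fam_carrier])

lemma sig_star: "sig W (star x) = star (sig W x)"
  by (cases x rule: qalg_cases)
    (simp add: abs_qalg_ops abs_qalg_sig W conj_by_adjoint[OF W fam_carrier])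

lemma sig_sig [simp]: "sig W (sig W x) = x"
  by (cases x rule: qalg_cases)
    (simp add: abs_qalg_ops abs_qalg_sig W conj_by_conj_by[OF W fam_carrier])

lemma sig_cof: "sig W (cof c) = cof (cnj c)"
  using W by (simp add: abs_qalg_ops abs_qalg_sig conj_by_smult[OF W one_carrier_mat] conj_by_one)

lemma sig_0 [simp]: "sig W 0 = 0" using sig_cof[of 0] by simp
lemma sig_1 [simp]: "sig W 1 = 1" using sig_cof[of 1] by simp

lemma sig_uminus: "sig W (- x) = - sig W x"
  using sig_add[of x "- x"] by (simp add: eq_neg_iff_add_eq_0 add.commute)

lemma sig_diff: "sig W (x - y) = sig W x - sig W y"
  using sig_add[of x "- y"] by (simp add: sig_uminus)

lemma sig_sum: "sig W (sum f A) = (\<Sum>a\<in>A. sig W (f a))"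
  by (induction A rule: infinite_finite_induct) (auto simp: sig_add)

lemma nb_sig: "nb x c \<Longrightarrow> nb (sig W x) c"
  by (cases x rule: qalg_cases)
    (auto simp: abs_qalg_sig W abs_qalg_nb elim!: evsmall_mono intro!: op_norm_conj_by[OF W fam_carrier])

end

section \<open>Functional calculus\<close>

text \<open>A functional calculus on \<open>S\<close> is defined for all functions bounded on \<open>S\<close>, also discontinuous
  ones; only its restriction to continuous functions is determined by \<open>x\<close>.\<close>

definition calc :: "complex set \<Rightarrow> qalg \<Rightarrow> ((complex \<Rightarrow> complex) \<Rightarrow> qalg) \<Rightarrow> bool" where
  "calc S x \<Phi> \<longleftrightarrow> compact S \<and> \<Phi> (\<lambda>z. z) = x \<and> (\<forall>c. \<Phi> (\<lambda>_. c) = cof c) \<and>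
    (\<forall>F G. bounded (F ` S) \<longrightarrow> bounded (G ` S) \<longrightarrow> 
       \<Phi> (\<lambda>z. F z + G z) = \<Phi> F + \<Phi> G \<and> \<Phi> (\<lambda>z. F z * G z) = \<Phi> F * \<Phi> G) \<and>
    (\<forall>F. bounded (F ` S) \<longrightarrow> \<Phi> (\<lambda>z. cnj (F z)) = star (\<Phi> F)) \<and>
    (\<forall>F G. (\<forall>z\<in>S. F z = G z) \<longrightarrow> \<Phi> F = \<Phi> G) \<and>
    (\<forall>F c. (\<forall>z\<in>S. cmod (F z) \<le> c) \<longrightarrow> 0 \<le> c \<longrightarrow> nb (\<Phi> F) c)"

lemma calcD:
  assumes "calc S x \<Phi>"
  shows calc_compact: "compact S"
    and calc_id: "\<Phi> (\<lambda>z. z) = x"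
    and calc_const: "\<And>c. \<Phi> (\<lambda>_. c) = cof c"
    and calc_add: "\<And>F G. bounded (F ` S) \<Longrightarrow> bounded (G ` S) \<Longrightarrow> \<Phi> (\<lambda>z. F z + G z) = \<Phi> F + \<Phi> G"
    and calc_mult: "\<And>F G. bounded (F ` S) \<Longrightarrow> bounded (G ` S) \<Longrightarrow> \<Phi> (\<lambda>z. F z * G z) = \<Phi> F * \<Phi> G"
    and calc_cnj: "\<And>F. bounded (F ` S) \<Longrightarrow> \<Phi> (\<lambda>z. cnj (F z)) = star (\<Phi> F)"
    and calc_cong: "\<And>F G. (\<And>z. z \<in> S \<Longrightarrow> F z = G z) \<Longrightarrow> \<Phi> F = \<Phi> G"
    and calc_nb: "\<And>F c. (\<And>z. z \<in> S \<Longrightarrow> cmod (F z) \<le> c) \<Longrightarrow> 0 \<le> c \<Longrightarrow> nb (\<Phi> F) c"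
  using assms unfolding calc_def by blast+

lemma calcI:
  assumes "compact S" "\<Phi> (\<lambda>z. z) = x" "\<And>c. \<Phi> (\<lambda>_. c) = cof c"
    "\<And>F G. bounded (F ` S) \<Longrightarrow> bounded (G ` S) \<Longrightarrow> \<Phi> (\<lambda>z. F z + G z) = \<Phi> F + \<Phi> G"
    "\<And>F G. bounded (F ` S) \<Longrightarrow> bounded (G ` S) \<Longrightarrow> \<Phi> (\<lambda>z. F z * G z) = \<Phi> F * \<Phi> G"
    "\<And>F. bounded (F ` S) \<Longrightarrow> \<Phi> (\<lambda>z. cnj (F z)) = star (\<Phi> F)"
    "\<And>F G. (\<And>z. z \<in> S \<Longrightarrow> F z = G z) \<Longrightarrow> \<Phi> F = \<Phi> G"
    "\<And>F c. (\<And>z. z \<in> S \<Longrightarrow> cmod (F z) \<le> c) \<Longrightarrow> 0 \<le> c \<Longrightarrow> nb (\<Phi> F) c"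
  shows "calc S x \<Phi>"
  unfolding calc_def using assms by (intro conjI allI impI) blast+

lemma bounded_image_cont: "compact S \<Longrightarrow> continuous_on S F \<Longrightarrow> bounded (F ` S)"
  by (intro compact_imp_bounded compact_continuous_image)

lemma bounded_image_add: "bounded (F ` S) \<Longrightarrow> bounded (G ` S) \<Longrightarrow> bounded ((\<lambda>z. F z + G z) ` S)"
  for F G :: "'a \<Rightarrow> complex" by (rule bounded_plus_comp)

lemma bounded_image_mult: "bounded (F ` S) \<Longrightarrow> bounded (G ` S) \<Longrightarrow> bounded ((\<lambda>z. F z * G z) ` S)"
  for F G :: "'a \<Rightarrow> complex"
proof -
  assume "bounded (F ` S)" "bounded (G ` S)"
  then obtain a b where ab: "\<And>z. z \<in> S \<Longrightarrow> cmod (F z) \<le> a" "\<And>z. z \<in> S \<Longrightarrow> cmod (G z) \<le> b"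
    unfolding bounded_iff by auto
  have "cmod (F z * G z) \<le> a * b" if "z \<in> S" for z
    using ab[OF that] unfolding norm_mult by (intro mult_mono') auto
  thus ?thesis unfolding bounded_iff by blast
qed

lemma bounded_image_const: "bounded ((\<lambda>_. c) ` S)" for c :: complex
  by (rule bounded_subset[of "{c}"]) auto

lemma calc_minus:
  assumes "calc S x \<Phi>" "bounded (F ` S)" "bounded (G ` S)"
  shows "\<Phi> (\<lambda>z. F z - G z) = \<Phi> F - \<Phi> G"
proof -
  note b = bounded_image_mult[OF bounded_image_const assms(3), of "-1"]
  have "\<Phi> (\<lambda>z. F z + (-1) * G z) = \<Phi> F + cof (-1) * \<Phi> G"
    by (simp only: calc_add[OF assms(1,2) b] calc_mult[OF assms(1) bounded_image_const assms(3)] calc_const[OF assms(1)])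
  thus ?thesis by (simp add: cof_uminus)
qed

text \<open>\<open>F\<close> is the square of a real function on \<open>S\<close>, so its image has
  the form \<open>star y * y\<close>.\<close>

lemma calc_pos:
  assumes c: "calc S x \<Phi>" and b: "bounded (F ` S)" and F: "\<And>z. z \<in> S \<Longrightarrow> F z \<in> \<real> \<and> Re (F z) \<ge> 0"
  shows "pos (\<Phi> F)"
proof -
  define G where "G = (\<lambda>z. complex_of_real (sqrt (Re (F z))))"
  obtain a where a: "\<And>z. z \<in> S \<Longrightarrow> cmod (F z) \<le> a" using b unfolding bounded_iff by auto
  have "cmod (G z) \<le> sqrt \<bar>a\<bar>" if "z \<in> S" for z
    using a[OF that] F[OF that] complex_Re_le_cmod[of "F z"] by (simp add: G_def)
  hence bG: "bounded (G ` S)" unfolding bounded_iff by auto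
  have bG': "bounded ((\<lambda>z. cnj (G z)) ` S)" using bG unfolding bounded_iff by simp
  have "\<Phi> F = \<Phi> (\<lambda>z. cnj (G z) * G z)"
  proof (rule calc_cong[OF c])
    fix z assume z: "z \<in> S"
    hence "F z = complex_of_real (Re (F z))" using F by (simp add: complex_is_Real_iff complex_eq_iff)
    also have "\<dots> = cnj (G z) * G z" using F[OF z] by (simp add: G_def flip: of_real_mult)
    finally show "F z = cnj (G z) * G z" .
  qed
  also have "\<dots> = star (\<Phi> G) * \<Phi> G" by (simp only: calc_mult[OF c bG' bG] calc_cnj[OF c bG])
  finally show ?thesis using pos_star_mult by simp
qed

text \<open>Applied to the curve around the circle, which turns functions of \<open>H\<close> into
  functions of a unitary, and to negation.\<close>

lemma calc_compose:
  assumes c: "calc S x \<Phi>" and E: "continuous_on S E"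
  shows "calc (E ` S) (\<Phi> E) (\<lambda>F. \<Phi> (\<lambda>z. F (E z)))"
proof -
  have b: "bounded ((\<lambda>z. F (E z)) ` S)" if "bounded (F ` (E ` S))" for F :: "complex \<Rightarrow> complex" 
    using that by (simp add: image_image)
  show ?thesis
  proof (rule calcI)
    show "compact (E ` S)" by (rule compact_continuous_image[OF E calc_compact[OF c]])
    fix F G :: "complex \<Rightarrow> complex"
    assume "\<And>z. z \<in> E ` S \<Longrightarrow> F z = G z"
    thus "\<Phi> (\<lambda>z. F (E z)) = \<Phi> (\<lambda>z. G (E z))" by (intro calc_cong[OF c]) auto
  next
    fix F :: "complex \<Rightarrow> complex" and k :: real
    assume "\<And>z. z \<in> E ` S \<Longrightarrow> cmod (F z) \<le> k" "0 \<le> k"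
    thus "nb (\<Phi> (\<lambda>z. F (E z))) k" by (intro calc_nb[OF c]) auto
  next
    fix F :: "complex \<Rightarrow> complex" assume "bounded (F ` E ` S)"
    thus "\<Phi> (\<lambda>z. cnj (F (E z))) = star (\<Phi> (\<lambda>z. F (E z)))" by (intro calc_cnj[OF c] b)
  qed (rule calc_const[OF c] refl calc_add[OF c b b] calc_mult[OF c b b]; assumption)+
qed

text \<open>As a partner in \<open>calc_intertwine\<close> it evaluates functions of
  \<open>x\<close> on the range of an element \<open>b\<close> on which \<open>x\<close> and its
  adjoint act as scalars.\<close>

lemma calc_scalar: "calc {a} (cof a) (\<lambda>F. cof (F a))"
  unfolding calc_def by (auto simp: cof_add cof_mult star_cof intro: nb_mono[OF nb_cof])

text \<open>It holds for polynomials in \<open>z\<close> and its conjugate, since the adjoints are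
  intertwined too, and passes to continuous \<open>F\<close> by Stone-Weierstrass on
  \<open>S \<union> T\<close>. With \<open>b = 1\<close> it says that a continuous function of
  \<open>x\<close> does not depend on the calculus chosen.\<close>

theorem calc_intertwine:
  assumes c: "calc S x \<Phi>" "calc T y \<Psi>" and xy: "x * b = b * y" "star x * b = b * star y"
    and F: "continuous_on (S \<union> T) F"
  shows "\<Phi> F * b = b * \<Psi> F"
proof -
  note cS = calc_compact[OF c(1)] and cT = calc_compact[OF c(2)]
  have bS: "bounded (G ` S)" and bT: "bounded (G ` T)" if "continuous_on (S \<union> T) G" for G :: "complex \<Rightarrow> complex"
    using that by (auto intro!: bounded_image_cont cS cT continuous_on_subset[OF that])
  have poly: "\<Phi> (\<lambda>z. complex_of_real (g z)) * b = b * \<Psi> (\<lambda>z. complex_of_real (g z))" 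
    if "real_polynomial_function g" for g :: "complex \<Rightarrow> real"
    using that
  proof (induction g rule: real_polynomial_function.induct)
    case (linear f)
    then interpret f: bounded_linear f .
    \<comment> \<open>A real-linear functional on the complex numbers has the form
      \<open>a z + a' cnj z\<close>.\<close>
    define a where "a = (complex_of_real (f 1) - \<i> * complex_of_real (f \<i>)) / 2"
    define a' where "a' = (complex_of_real (f 1) + \<i> * complex_of_real (f \<i>)) / 2"
    have f: "complex_of_real (f z) = a * z + a' * cnj z" for z
    proof -
      have "z = Re z *\<^sub>R 1 + Im z *\<^sub>R \<i>" by (simp add: complex_eq_iff)
      hence "f z = f (Re z *\<^sub>R 1 + Im z *\<^sub>R \<i>)" by (rule arg_cong)
      also have "\<dots> = Re z * f 1 + Im z * f \<i>" by (simp add: f.add f.scaleR)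
      finally show ?thesis by (simp add: complex_eq_iff a_def a'_def field_simps)
    qed
    have e: "\<Theta> (\<lambda>z. complex_of_real (f z)) = cof a * w + cof a' * star w" if "calc A w \<Theta>" for A w \<Theta>
    proof -
      have b: "bounded ((\<lambda>z. z) ` A)" "bounded ((\<lambda>z. cnj z) ` A)" 
        by (intro bounded_image_cont calc_compact[OF that] continuous_intros)+
      show ?thesis unfolding f
        by (simp only: calc_add[OF that bounded_image_mult[OF bounded_image_const b(1)] bounded_image_mult[OF bounded_image_const b(2)]]
            calc_mult[OF that bounded_image_const b(1)] calc_mult[OF that bounded_image_const b(2)]
            calc_const[OF that] calc_cnj[OF that b(1)] calc_id[OF that])
    qed
    have "cof a * x * b = b * (cof a * y)" "cof a' * star x * b = b * (cof a' * star y)"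
      by (metis cof_commute mult.assoc xy(1), metis cof_commute mult.assoc xy(2))
    thus ?case unfolding e[OF c(1)] e[OF c(2)] by (simp add: algebra_simps)
  next
    case (const k)
    show ?case by (simp add: calc_const[OF c(1)] calc_const[OF c(2)] cof_commute)
  next
    case (add f g)
    have "continuous_on (S \<union> T) f" "continuous_on (S \<union> T) g" 
      using add.hyps by (auto intro: continuous_on_polymonial_function simp: real_polynomial_function_eq)
    hence "continuous_on (S \<union> T) (\<lambda>z. complex_of_real (f z))" "continuous_on (S \<union> T) (\<lambda>z. complex_of_real (g z))"
      by (auto intro: continuous_intros)
    from bS[OF this(1)] bS[OF this(2)] bT[OF this(1)] bT[OF this(2)] show ?case using add.IH
      by (simp add: calc_add[OF c(1)] calc_add[OF c(2)] algebra_simps)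
  next
    case (mult f g)
    have "continuous_on (S \<union> T) f" "continuous_on (S \<union> T) g" 
      using mult.hyps by (auto intro: continuous_on_polymonial_function simp: real_polynomial_function_eq)
    hence "continuous_on (S \<union> T) (\<lambda>z. complex_of_real (f z))" "continuous_on (S \<union> T) (\<lambda>z. complex_of_real (g z))"
      by (auto intro: continuous_intros)
    from bS[OF this(1)] bS[OF this(2)] bT[OF this(1)] bT[OF this(2)] show ?case using mult.IH
      by (simp add: calc_mult[OF c(1)] calc_mult[OF c(2)]) (metis mult.assoc)
  qed
  have real: "\<Phi> (\<lambda>z. complex_of_real (f z)) * b = b * \<Psi> (\<lambda>z. complex_of_real (f z))" 
    if f: "continuous_on (S \<union> T) f" for f :: "complex \<Rightarrow> real"
  proof -
    obtain C where C: "C \<ge> 0" "nb b C" using nb_ex by blast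
    define d where "d = \<Phi> (\<lambda>z. complex_of_real (f z)) * b - b * \<Psi> (\<lambda>z. complex_of_real (f z))"
    have "d = 0"
    proof (rule nb_eq_0)
      fix e :: real assume e: "e > 0"
      define e' where "e' = e / (2 * C + 1)"
      have e': "e' > 0" using e C by (simp add: e'_def)
      have "compact (S \<union> T)" using cS cT by (rule compact_Un)
      from Stone_Weierstrass_real_polynomial_function[OF this f e'] 
      obtain g where g: "real_polynomial_function g" "\<And>z. z \<in> S \<union> T \<Longrightarrow> \<bar>f z - g z\<bar> < e'" by blast
      have cg: "continuous_on (S \<union> T) g"
        using g(1) by (auto intro: continuous_on_polymonial_function simp: real_polynomial_function_eq)
      let ?f = "\<lambda>z. complex_of_real (f z)" and ?g = "\<lambda>z. complex_of_real (g z)"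
      have cc: "continuous_on (S \<union> T) ?f" "continuous_on (S \<union> T) ?g" using f cg by (auto intro: continuous_intros)
      have "d = (\<Phi> ?f - \<Phi> ?g) * b - b * (\<Psi> ?f - \<Psi> ?g)" using poly[OF g(1)] by (simp add: d_def algebra_simps)
      also have "\<dots> = \<Phi> (\<lambda>z. ?f z - ?g z) * b - b * \<Psi> (\<lambda>z. ?f z - ?g z)"
        by (simp only: calc_minus[OF c(1) bS[OF cc(1)] bS[OF cc(2)]] calc_minus[OF c(2) bT[OF cc(1)] bT[OF cc(2)]])
      finally have d: "d = \<Phi> (\<lambda>z. ?f z - ?g z) * b - b * \<Psi> (\<lambda>z. ?f z - ?g z)" .
      have m: "cmod (?f z - ?g z) \<le> e'" if "z \<in> S \<union> T" for z
        using g(2)[OF that] by (simp flip: of_real_diff)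
      have "nb (\<Phi> (\<lambda>z. ?f z - ?g z)) e'" "nb (\<Psi> (\<lambda>z. ?f z - ?g z)) e'"
        using m e' by (auto intro!: calc_nb[OF c(1)] calc_nb[OF c(2)])
      hence "nb d (e' * C + C * e')" unfolding d using C e' by (intro nb_diff nb_mult) auto
      moreover have "e' * C + C * e' \<le> e"
      proof -
        have "e' * (2 * C + 1) = e" using C by (simp add: e'_def)
        thus ?thesis using e' by (simp add: algebra_simps)
      qed
      ultimately show "nb d e" by (rule nb_mono)
    qed
    thus ?thesis by (simp add: d_def)
  qed
  let ?R = "\<lambda>z. complex_of_real (Re (F z))" and ?I = "\<lambda>z. complex_of_real (Im (F z))"
  have cRI: "continuous_on (S \<union> T) (\<lambda>z. Re (F z))" "continuous_on (S \<union> T) (\<lambda>z. Im (F z))"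
    using F by (auto intro: continuous_intros)
  hence cc: "continuous_on (S \<union> T) ?R" "continuous_on (S \<union> T) ?I" by (auto intro: continuous_intros)
  have FRI: "F = (\<lambda>z. ?R z + \<i> * ?I z)" by (auto simp: complex_eq_iff)
  have "\<Phi> F = \<Phi> ?R + cof \<i> * \<Phi> ?I"
    by (subst FRI, simp only: calc_add[OF c(1) bS[OF cc(1)] bounded_image_mult[OF bounded_image_const bS[OF cc(2)]]]
        calc_mult[OF c(1) bounded_image_const bS[OF cc(2)]] calc_const[OF c(1)])
  moreover have "\<Psi> F = \<Psi> ?R + cof \<i> * \<Psi> ?I"
    by (subst FRI, simp only: calc_add[OF c(2) bT[OF cc(1)] bounded_image_mult[OF bounded_image_const bT[OF cc(2)]]]
        calc_mult[OF c(2) bounded_image_const bT[OF cc(2)]] calc_const[OF c(2)])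
  moreover have "cof \<i> * \<Phi> ?I * b = b * (cof \<i> * \<Psi> ?I)"
    using real[OF cRI(2)] by (metis cof_commute mult.assoc)
  ultimately show ?thesis using real[OF cRI(1)] by (simp add: algebra_simps)
qed

lemma calc_unique:
  assumes "calc S x \<Phi>" "calc T x \<Psi>" "continuous_on (S \<union> T) F"
  shows "\<Phi> F = \<Psi> F"
  using calc_intertwine[OF assms(1,2) _ _ assms(3), of 1] by simp

section \<open>Calculi obtained by diagonalizing representatives\<close>

lemma fam_udiag:
  assumes "\<And>i n. unitary_mat n (U i n)" "\<And>i n k. k < n \<Longrightarrow> l i n k \<in> S" "bounded (F ` S)"
  shows "fam (\<lambda>i n. udiag n (U i n) (\<lambda>k. F (l i n k)))"
proof -
  obtain a where a: "\<And>z. z \<in> S \<Longrightarrow> cmod (F z) \<le> a" using assms(3) unfolding bounded_iff by auto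
  have "cmod (F z) \<le> \<bar>a\<bar>" if "z \<in> S" for z using a[OF that] by linarith
  thus ?thesis
    by (intro famI[of _ "\<bar>a\<bar>"]) (use assms in \<open>auto intro!: op_norm_udiag\<close>)
qed

text \<open>Applying \<open>F\<close> to the eigenvalues of every matrix is multiplicative, and
  bounded by any bound of \<open>F\<close> on \<open>S\<close>; continuity never enters. This
  freedom is what later admits functions with a jump.\<close>

lemma calc_exists:
  assumes S: "compact S" and U: "\<And>i n. unitary_mat n (U i n)" and l: "\<And>i n k. k < n \<Longrightarrow> l i n k \<in> S"
  shows "calc S (abs_qalg (\<lambda>i n. udiag n (U i n) (l i n))) 
    (\<lambda>F. abs_qalg (\<lambda>i n. udiag n (U i n) (\<lambda>k. F (l i n k))))"
proof -
  note fu = fam_udiag[OF U l]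
  have nbb: "nb (abs_qalg (\<lambda>i n. udiag n (U i n) (\<lambda>k. F (l i n k)))) c" 
    if "\<forall>z\<in>S. cmod (F z) \<le> c" "0 \<le> c" for F c
  proof -
    have b: "bounded (F ` S)" using that by (auto simp: bounded_iff)
    have "op_norm (udiag n (U i n) (\<lambda>k. F (l i n k))) - c \<le> 0" for i n
      using op_norm_udiag[OF U, where l="\<lambda>k. F (l i n k)" and c=c] that l by simp
    hence "evsmall (\<lambda>i n. op_norm (udiag n (U i n) (\<lambda>k. F (l i n k))) - c)" by (rule evsmall_nonpos)
    moreover have "fam (\<lambda>i n. udiag n (U i n) (\<lambda>k. F (l i n k)))" by (rule fu[OF _ b])
    ultimately show ?thesis by (simp only: abs_qalg_nb)
  qed
  show ?thesis
  proof (rule calcI)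
    fix F G :: "complex \<Rightarrow> complex"
    let ?d = "\<lambda>F i n. udiag n (U i n) (\<lambda>k. F (l i n k))"
    { assume F: "bounded (F ` S)"
      have "fam (?d F)" by (rule fu[OF _ F])
      thus "abs_qalg (?d (\<lambda>z. cnj (F z))) = star (abs_qalg (?d F))"
        by (simp only: abs_qalg_star udiag_adjoint[OF U])
      assume G: "bounded (G ` S)"
      have f: "fam (?d F)" by (rule fu[OF _ F])
      have g: "fam (?d G)" by (rule fu[OF _ G])
      show "abs_qalg (?d (\<lambda>z. F z + G z)) = abs_qalg (?d F) + abs_qalg (?d G)"
        using f g by (simp only: abs_qalg_simps udiag_add[OF U])
      show "abs_qalg (?d (\<lambda>z. F z * G z)) = abs_qalg (?d F) * abs_qalg (?d G)"
        using f g by (simp only: abs_qalg_simps udiag_mult[OF U]) }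
    assume "\<And>z. z \<in> S \<Longrightarrow> F z = G z"
    hence "?d F i n = ?d G i n" for i n by (intro udiag_cong) (auto simp: l)
    thus "abs_qalg (?d F) = abs_qalg (?d G)" by simp
  qed (use S nbb in \<open>auto simp: abs_qalg_cof udiag_const[OF U]\<close>)
qed

lemma choice_pair:
  assumes "\<And>i n. \<exists>U l. P i n U l"
  shows "\<exists>U l. \<forall>i n. P i n (U i n) (l i n)"
proof -
  have "\<forall>p. \<exists>q. P (fst p) (snd p) (fst q) (snd q)" using assms by fastforce
  then obtain g where g: "\<And>p. P (fst p) (snd p) (fst (g p)) (snd (g p))" by metis
  have "P i n (fst (g (i, n))) (snd (g (i, n)))" for i n using g[of "(i, n)"] by simp
  thus ?thesis by (intro exI[of _ "\<lambda>i n. fst (g (i, n))"] exI[of _ "\<lambda>i n. snd (g (i, n))"]) blast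
qed

text \<open>A norm bound in the quotient holds for matrices only from some index on and up to a
  margin, so the earlier matrices are replaced by zero. Each new matrix is an old one or zero, which
  preserves self-adjointness.\<close>

lemma rep_nb:
  assumes y: "fam y" "nb (abs_qalg y) c" and c: "c < c'" "0 \<le> c'"
  shows "\<exists>z. fam z \<and> abs_qalg z = abs_qalg y \<and> (\<forall>i n. z i n = y i n \<or> z i n = 0\<^sub>m n n) \<and> (\<forall>i n. op_norm (z i n) \<le> c')"
proof -
  have "evsmall (\<lambda>i n. op_norm (y i n) - c)" using y by (simp add: abs_qalg_nb)
  moreover have "c' - c > 0" using c by simp
  ultimately obtain i0 where i0: "\<And>i n. i \<ge> i0 \<Longrightarrow> op_norm (y i n) - c \<le> c' - c" unfolding evsmall_def by meson
  define z where "z = (\<lambda>i n. if i \<ge> i0 then y i n else 0\<^sub>m n n)"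
  have b: "op_norm (z i n) \<le> c'" for i n using i0[of i n] c by (auto simp: z_def)
  have fz: "fam z" by (rule famI[of z c']) (use y b in \<open>auto simp: z_def\<close>)
  have "op_norm (z i n - y i n) \<le> 0" if "i \<ge> i0" for i n
  proof -
    have "z i n - y i n = 0\<^sub>m n n" using that fam_carrier[OF y(1), of i n] by (intro eq_matI) (auto simp: z_def)
    thus ?thesis by simp
  qed
  hence "evsmall (\<lambda>i n. op_norm (z i n - y i n))" unfolding evsmall_def by (meson less_imp_le order.trans)
  hence "abs_qalg z = abs_qalg y" using fz y by (simp add: abs_qalg_eq_iff fam_rel_def)
  thus ?thesis using fz b by (intro exI[of _ z]) (auto simp: z_def)
qed

lemma sa_rep:
  assumes "star q = q"
  obtains y where "fam y" "q = abs_qalg y" "\<And>i n. mat_adjoint (y i n) = y i n"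
proof -
  obtain x where x: "fam x" "q = abs_qalg x" using qalg_cases .
  define y where "y = (\<lambda>i n. (1/2) \<cdot>\<^sub>m 1\<^sub>m n * (x i n + mat_adjoint (x i n)))"
  have fy: "fam y" unfolding y_def using x by (intro fam_mult fam_add fam_adjoint) simp_all
  have "abs_qalg y = cof (1/2) * (q + star q)" using x by (simp add: y_def abs_qalg_ops)
  also have "\<dots> = cof (1/2 + 1/2) * q" by (simp only: assms cof_add distrib_left distrib_right)
  finally have q: "q = abs_qalg y" by simp
  have "mat_adjoint (y i n) = y i n" for i n
  proof -
    have xc: "x i n \<in> carrier_mat n n" using x(1) by simp
    have ym: "y i n = (1/2) \<cdot>\<^sub>m (x i n + mat_adjoint (x i n))" unfolding y_def
      using xc by (intro scalar_mat_mult) auto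
    show ?thesis unfolding ym using xc
      by (simp add: mat_adjoint_smult mat_adjoint_add[of _ n n] comm_add_mat[of "mat_adjoint (x i n)" n n])
  qed
  thus ?thesis using that fy q by blast
qed

text \<open>The margin \<open>c < c'\<close> is that of \<open>rep_nb\<close>: it lets all
  eigenvalues of one representative lie in the interval.\<close>

lemma sa_calc:
  assumes q: "star q = q" "nb q c" and c: "c < c'" "0 \<le> c'"
  shows "\<exists>\<Phi>. calc (complex_of_real ` {-c'..c'}) q \<Phi>"
proof -
  obtain y where y: "fam y" "q = abs_qalg y" "\<And>i n. mat_adjoint (y i n) = y i n" using sa_rep[OF q(1)] by blast
  obtain z where z: "fam z" "abs_qalg z = q" "\<And>i n. z i n = y i n \<or> z i n = 0\<^sub>m n n" "\<And>i n. op_norm (z i n) \<le> c'"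
    using rep_nb[OF y(1) _ c] q(2) y(2) by auto
  have h: "mat_adjoint (z i n) = z i n" for i n
  proof -
    have "mat_adjoint (0\<^sub>m n n) = (0\<^sub>m n n :: complex mat)" by (intro eq_matI) auto
    thus ?thesis using z(3)[of i n] y(3)[of i n] by auto
  qed
  have "\<exists>U l. unitary_mat n U \<and> z i n = udiag n U l" for i n
    using normal_udiag[OF fam_carrier[OF z(1)]] h by simp
  from choice_pair[of "\<lambda>i n U l. unitary_mat n U \<and> z i n = udiag n U l", OF this]
  obtain U l where U: "\<And>i n. unitary_mat n (U i n)" and l: "\<And>i n. z i n = udiag n (U i n) (l i n)" by blast
  have "l i n k \<in> complex_of_real ` {-c'..c'}" if "k < n" for i n k
  proof -
    have "l i n k \<in> \<real>" using udiag_hermitian[OF U _ that, of i "l i n"] h[of i n] by (simp only: l[symmetric])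
    moreover have "cmod (l i n k) \<le> c'" 
      using cmod_le_op_norm_udiag[OF U that, of "l i n" i] z(4)[of i n] by (simp only: l[symmetric])
    ultimately show ?thesis by (auto elim!: Reals_cases intro!: imageI simp: abs_le_iff)
  qed
  moreover have "compact (complex_of_real ` {-c'..c'})"
    by (intro compact_continuous_image continuous_intros) auto
  ultimately have "calc (complex_of_real ` {-c'..c'}) (abs_qalg (\<lambda>i n. udiag n (U i n) (l i n))) 
    (\<lambda>F. abs_qalg (\<lambda>i n. udiag n (U i n) (\<lambda>k. F (l i n k))))"
    using U by (intro calc_exists)
  moreover have "abs_qalg (\<lambda>i n. udiag n (U i n) (l i n)) = q" using z(2) by (simp only: l[symmetric])
  ultimately show ?thesis by auto
qed

text \<open>Perturbing a family to an invertible one does not change its class, so polar decompositions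
  with unitary factor exist in the quotient.\<close>

lemma polar_fam:
  assumes t: "fam t"
  shows "\<exists>u \<Phi> c. fam u \<and> (\<forall>i n. unitary_mat n (u i n)) \<and> 0 \<le> c \<and> 
    calc (complex_of_real ` {0..c}) (star (abs_qalg t) * abs_qalg t) \<Phi> \<and>
    abs_qalg t = abs_qalg u * \<Phi> (\<lambda>z. complex_of_real (sqrt (Re z))) \<and>
    (\<forall>W. real_structure W \<longrightarrow> (\<forall>i n. conj_by W n (t i n) = t i n) \<longrightarrow> (\<forall>i n. conj_by W n (u i n) = u i n))"
proof -
  \<comment> \<open>The shift tends to zero uniformly in the size, so the shifted family
    \<open>s\<close> has the class of \<open>t\<close> although every \<open>s i n\<close> is
    invertible.\<close>
  have "\<exists>h. 0 < h \<and> h \<le> 1 / real (Suc i) \<and> det (t i n + complex_of_real h \<cdot>\<^sub>m 1\<^sub>m n) \<noteq> 0" for i n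
    using perturb_invertible[OF fam_carrier[OF t], of "1 / real (Suc i)"] by simp
  then obtain h where h: "\<And>i n. 0 < h i n" "\<And>i n. h i n \<le> 1 / real (Suc i)" 
    "\<And>i n. det (t i n + complex_of_real (h i n) \<cdot>\<^sub>m 1\<^sub>m n) \<noteq> 0" by metis
  define s where "s = (\<lambda>i n. t i n + complex_of_real (h i n) \<cdot>\<^sub>m 1\<^sub>m n)"
  have on: "op_norm (complex_of_real (h i n) \<cdot>\<^sub>m 1\<^sub>m n) \<le> 1 / real (Suc i)" for i n
  proof -
    have "op_norm (complex_of_real (h i n) \<cdot>\<^sub>m 1\<^sub>m n) \<le> h i n * op_norm (1\<^sub>m n)"
      using op_norm_smult[of "1\<^sub>m n" n "complex_of_real (h i n)"] h(1)[of i n] by simp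
    also have "\<dots> \<le> h i n * 1" using h(1)[of i n] op_norm_unitary[OF unitary_mat_one] by (intro mult_left_mono) auto
    finally show ?thesis using h(2)[of i n] by simp
  qed
  have "fam (\<lambda>i n. complex_of_real (h i n) \<cdot>\<^sub>m 1\<^sub>m n)"
    by (rule famI[of _ 1]) (use on in \<open>auto intro: order.trans[OF on]\<close>)
  hence fs: "fam s" unfolding s_def using t by simp
  have "s i n - t i n = complex_of_real (h i n) \<cdot>\<^sub>m 1\<^sub>m n" for i n
    using fam_carrier[OF t, of i n] unfolding s_def by (intro eq_matI) auto
  moreover have "evsmall (\<lambda>i n. op_norm (complex_of_real (h i n) \<cdot>\<^sub>m 1\<^sub>m n))"
    unfolding evsmall_def
  proof (intro allI impI)
    fix e :: real assume "e > 0"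
    then obtain k where k: "inverse (real (Suc k)) < e" using reals_Archimedean by blast
    have "op_norm (complex_of_real (h i n) \<cdot>\<^sub>m 1\<^sub>m n) \<le> e" if "i \<ge> k" for i n
    proof -
      have "1 / real (Suc i) \<le> inverse (real (Suc k))" using that by (simp add: field_simps)
      thus ?thesis using on[of i n] k by linarith
    qed
    thus "\<exists>i0. \<forall>i\<ge>i0. \<forall>n. op_norm (complex_of_real (h i n) \<cdot>\<^sub>m 1\<^sub>m n) \<le> e" by blast
  qed
  ultimately have st: "abs_qalg s = abs_qalg t" using fs t by (simp add: abs_qalg_eq_iff fam_rel_def)
  have sc: "s i n \<in> carrier_mat n n" for i n using fs by simp
  have "\<exists>U l. unitary_mat n U \<and> (\<forall>k<n. l k > 0) \<and> mat_adjoint (s i n) * s i n = udiag n U (\<lambda>k. complex_of_real (l k)) \<and>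
    unitary_mat n (s i n * udiag n U (\<lambda>k. complex_of_real (1 / sqrt (l k))))" for i n
    using polar_mat[OF sc, of i n] h(3)[of i n] by (simp add: s_def)
  from choice_pair[of "\<lambda>i n U l. unitary_mat n U \<and> (\<forall>k<n. l k > 0) \<and> mat_adjoint (s i n) * s i n = udiag n U (\<lambda>k. complex_of_real (l k)) \<and>
    unitary_mat n (s i n * udiag n U (\<lambda>k. complex_of_real (1 / sqrt (l k))))", OF this]
  obtain U l where U: "\<And>i n. unitary_mat n (U i n)" and lp: "\<And>i n k. k < n \<Longrightarrow> l i n k > 0" 
    and ss: "\<And>i n. mat_adjoint (s i n) * s i n = udiag n (U i n) (\<lambda>k. complex_of_real (l i n k))"
    and uu: "\<And>i n. unitary_mat n (s i n * udiag n (U i n) (\<lambda>k. complex_of_real (1 / sqrt (l i n k))))"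
    by blast
  define u where "u = (\<lambda>i n. s i n * udiag n (U i n) (\<lambda>k. complex_of_real (1 / sqrt (l i n k))))"
  have u: "unitary_mat n (u i n)" for i n using uu by (simp add: u_def)
  have fu: "fam u" by (rule famI[of _ 1]) (use u op_norm_unitary in \<open>auto simp: unitary_mat_def\<close>)
  have fss: "fam (\<lambda>i n. mat_adjoint (s i n) * s i n)" using fs by simp
  obtain c where c: "c \<ge> 0" "\<And>i n. op_norm (mat_adjoint (s i n) * s i n) \<le> c" using fam_bound[OF fss] by blast
  have lS: "complex_of_real (l i n k) \<in> complex_of_real ` {0..c}" if "k < n" for i n k
  proof -
    have "cmod (complex_of_real (l i n k)) \<le> c" 
      using cmod_le_op_norm_udiag[OF U that, of "\<lambda>k. complex_of_real (l i n k)" i] c(2)[of i n] by (simp only: ss)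
    thus ?thesis using lp[OF that, of i] by auto
  qed
  define \<Phi> where "\<Phi> = (\<lambda>F. abs_qalg (\<lambda>i n. udiag n (U i n) (\<lambda>k. F (complex_of_real (l i n k)))))"
  have cS: "compact (complex_of_real ` {0..c})"
    by (intro compact_continuous_image continuous_intros) auto
  have "calc (complex_of_real ` {0..c}) (abs_qalg (\<lambda>i n. udiag n (U i n) (\<lambda>k. complex_of_real (l i n k)))) \<Phi>"
    unfolding \<Phi>_def using calc_exists[OF cS U lS] .
  moreover have "abs_qalg (\<lambda>i n. udiag n (U i n) (\<lambda>k. complex_of_real (l i n k))) = star (abs_qalg t) * abs_qalg t"
    using fs by (simp add: st[symmetric] abs_qalg_ops flip: ss)
  ultimately have calc: "calc (complex_of_real ` {0..c}) (star (abs_qalg t) * abs_qalg t) \<Phi>" by simp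
  have "bounded ((\<lambda>z. complex_of_real (sqrt (Re z))) ` complex_of_real ` {0..c})"
    by (intro bounded_image_cont cS continuous_intros)
  from fam_udiag[OF U lS this] have fr: "fam (\<lambda>i n. udiag n (U i n) (\<lambda>k. complex_of_real (sqrt (l i n k))))" by simp
  have us: "u i n * udiag n (U i n) (\<lambda>k. complex_of_real (sqrt (l i n k))) = s i n" for i n
  proof -
    have "u i n * udiag n (U i n) (\<lambda>k. complex_of_real (sqrt (l i n k))) = 
      s i n * (udiag n (U i n) (\<lambda>k. complex_of_real (1 / sqrt (l i n k))) * udiag n (U i n) (\<lambda>k. complex_of_real (sqrt (l i n k))))"
      unfolding u_def by (rule assoc_mult_mat[OF sc udiag_carrier[OF U] udiag_carrier[OF U]])
    also have "udiag n (U i n) (\<lambda>k. complex_of_real (1 / sqrt (l i n k))) * udiag n (U i n) (\<lambda>k. complex_of_real (sqrt (l i n k)))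
      = udiag n (U i n) (\<lambda>k. 1)" 
      unfolding udiag_mult[OF U] 
    proof (rule udiag_cong)
      fix k assume "k < n"
      hence "1 / sqrt (l i n k) * sqrt (l i n k) = 1" using lp[of k n i] by simp
      thus "complex_of_real (1 / sqrt (l i n k)) * complex_of_real (sqrt (l i n k)) = 1" by (metis of_real_1 of_real_mult)
    qed
    finally show ?thesis using sc[of i n] by (simp add: udiag_const[OF U])
  qed
  have pol: "abs_qalg t = abs_qalg u * \<Phi> (\<lambda>z. complex_of_real (sqrt (Re z)))"
    using fu fr by (simp add: \<Phi>_def abs_qalg_ops us st)
  have "conj_by W n (u i n) = u i n" if W: "real_structure W" and Wt: "\<And>i n. conj_by W n (t i n) = t i n" for W i n
  proof -
    have Ws: "conj_by W n (s i n) = s i n" 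
      using fam_carrier[OF t, of i n] by (simp add: s_def conj_by_add[OF W] conj_by_smult[OF W] conj_by_one[OF W] Wt)
    have "conj_by W n (mat_adjoint (s i n) * s i n) = mat_adjoint (s i n) * s i n"
      using sc[of i n] by (simp add: conj_by_mult[OF W] conj_by_adjoint[OF W] Ws)
    hence eq: "udiag n (W n * mat_cnj (U i n)) (\<lambda>k. complex_of_real (l i n k)) = udiag n (U i n) (\<lambda>k. complex_of_real (l i n k))"
      unfolding ss conj_by_udiag(2)[OF W U] by simp
    note UW = conj_by_udiag(1)[OF W U, of n i]
    have "udiag n (W n * mat_cnj (U i n)) (\<lambda>k. F (complex_of_real (l i n k))) = udiag n (U i n) (\<lambda>k. F (complex_of_real (l i n k)))" for F
    proof -
      have "udiag n (W n * mat_cnj (U i n)) (\<lambda>k. complex_of_real (l i n k)) * 1\<^sub>m n = 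
        1\<^sub>m n * udiag n (U i n) (\<lambda>k. complex_of_real (l i n k))"
        by (simp only: eq right_mult_one_mat[OF udiag_carrier[OF U]] left_mult_one_mat[OF udiag_carrier[OF U]])
      from udiag_intertwine[OF UW U one_carrier_mat this, of F] show ?thesis
        by (simp only: right_mult_one_mat[OF udiag_carrier[OF UW]] left_mult_one_mat[OF udiag_carrier[OF U]])
    qed
    \<comment> \<open>\<open>1 / sqrt\<close> has no bound on the eigenvalues that is uniform in
      \<open>i\<close> and \<open>n\<close>, so it is out of reach of \<open>\<Phi>\<close>; the
      comparison is made in each single matrix.\<close>
    from this[of "\<lambda>z. complex_of_real (1 / sqrt (Re z))"]
    have "conj_by W n (udiag n (U i n) (\<lambda>k. complex_of_real (1 / sqrt (l i n k)))) = udiag n (U i n) (\<lambda>k. complex_of_real (1 / sqrt (l i n k)))"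
      unfolding conj_by_udiag(2)[OF W U] by simp
    thus ?thesis unfolding u_def using sc[of i n] udiag_carrier[OF U] by (simp add: conj_by_mult[OF W] Ws)
  qed
  thus ?thesis using fu u c(1) calc pol by blast
qed

definition unitary :: "qalg \<Rightarrow> bool" where
  "unitary v \<longleftrightarrow> star v * v = 1 \<and> v * star v = 1"

lemma unitary_abs: "fam u \<Longrightarrow> (\<And>i n. unitary_mat n (u i n)) \<Longrightarrow> unitary (abs_qalg u)"
  by (simp add: unitary_def abs_qalg_ops unitary_mat_def)

lemma nb_unitary: "unitary v \<Longrightarrow> nb v 1"
  by (rule nb_pos) (simp_all add: unitary_def pos_0)

text \<open>If \<open>sig W x = x\<close>, a representative is first averaged with its image, so
  that it is fixed exactly; its polar factor is then fixed as well. Otherwise the last clause is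
  void and any representative will do.\<close>

lemma polar:
  assumes W: "real_structure W"
  obtains v \<Phi> c where "unitary v" "0 \<le> c" "calc (complex_of_real ` {0..c}) (star x * x) \<Phi>" 
    "x = v * \<Phi> (\<lambda>z. complex_of_real (sqrt (Re z)))" "sig W x = x \<Longrightarrow> sig W v = v"
proof (cases "sig W x = x")
  case True
  obtain y where y: "fam y" "x = abs_qalg y" using qalg_cases .
  define t where "t = (\<lambda>i n. (1/2) \<cdot>\<^sub>m 1\<^sub>m n * (y i n + conj_by W n (y i n)))"
  have ft: "fam t" unfolding t_def using y W by (intro fam_mult fam_add fam_conj_by) simp_all
  have "abs_qalg t = cof (1/2) * (x + sig W x)" using y W by (simp add: t_def abs_qalg_ops abs_qalg_sig)
  also have "\<dots> = cof (1/2 + 1/2) * x" by (simp only: True cof_add distrib_left distrib_right)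
  finally have xt: "x = abs_qalg t" by simp
  have "conj_by W n (t i n) = t i n" for i n
  proof -
    have yc: "y i n \<in> carrier_mat n n" using y(1) by simp
    have cy: "conj_by W n (y i n) \<in> carrier_mat n n" using yc W by simp
    have ym: "t i n = (1/2) \<cdot>\<^sub>m (y i n + conj_by W n (y i n))" unfolding t_def
      using yc cy by (intro scalar_mat_mult) auto
    show ?thesis unfolding ym using yc cy
      by (simp add: conj_by_smult[OF W] conj_by_add[OF W] conj_by_conj_by[OF W] comm_add_mat[OF cy yc])
  qed
  with polar_fam[OF ft] W obtain u \<Phi> c where u: "fam u" "\<And>i n. unitary_mat n (u i n)" "0 \<le> c"
    "calc (complex_of_real ` {0..c}) (star x * x) \<Phi>" "x = abs_qalg u * \<Phi> (\<lambda>z. complex_of_real (sqrt (Re z)))"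
    "\<And>i n. conj_by W n (u i n) = u i n" unfolding xt by blast
  have "sig W (abs_qalg u) = abs_qalg u" using u by (simp add: abs_qalg_sig W)
  thus ?thesis using that[OF unitary_abs[OF u(1,2)] u(3-5)] by blast
next
  case False
  obtain t where t: "fam t" "x = abs_qalg t" using qalg_cases .
  show ?thesis using polar_fam[OF t(1)] that unitary_abs False unfolding t(2)[symmetric] by blast
qed

text \<open>A unitary of the quotient lifts to a family of unitary matrices: it is its polar factor
  times the square root of \<open>star q * q = 1\<close>, which is \<open>1\<close>. Diagonalizing
  these matrices gives functions on the circle, jumps included.\<close>

lemma unitary_calc:
  assumes q: "unitary q"
  shows "\<exists>\<Phi>. calc (sphere 0 1) q \<Phi>"
proof -
  obtain t where t: "fam t" "q = abs_qalg t" using qalg_cases .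
  from polar_fam[OF t(1)] t(2) obtain u \<Phi> c where u: "fam u" "\<And>i n. unitary_mat n (u i n)" "0 \<le> c"
    "calc (complex_of_real ` {0..c}) (star q * q) \<Phi>" "q = abs_qalg u * \<Phi> (\<lambda>z. complex_of_real (sqrt (Re z)))" by blast
  have c1: "calc {1} (star q * q) (\<lambda>F. cof (F 1))" using calc_scalar[of 1] q by (simp add: unitary_def)
  have "\<Phi> (\<lambda>z. complex_of_real (sqrt (Re z))) = cof (complex_of_real (sqrt (Re 1)))"
    by (rule calc_unique[OF u(4) c1]) (intro continuous_intros)
  hence qu: "q = abs_qalg u" using u(5) by simp
  have "\<exists>U l. unitary_mat n U \<and> u i n = udiag n U l" for i n
    using normal_udiag[of "u i n" n] u(2)[of n i] by (simp add: unitary_mat_def)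
  from choice_pair[of "\<lambda>i n U l. unitary_mat n U \<and> u i n = udiag n U l", OF this]
  obtain U l where U: "\<And>i n. unitary_mat n (U i n)" and l: "\<And>i n. u i n = udiag n (U i n) (l i n)" by blast
  have "l i n k \<in> sphere 0 1" if "k < n" for i n k
    using udiag_unitary[OF U _ that, of i "l i n"] u(2)[of n i] by (simp add: l)
  hence "calc (sphere 0 1) (abs_qalg (\<lambda>i n. udiag n (U i n) (l i n))) 
    (\<lambda>F. abs_qalg (\<lambda>i n. udiag n (U i n) (\<lambda>k. F (l i n k))))"
    by (rule calc_exists[OF compact_sphere U])
  hence "\<exists>\<Phi>. calc (sphere 0 1) (abs_qalg (\<lambda>i n. udiag n (U i n) (l i n))) \<Phi>" by blast
  moreover have "(\<lambda>i n. udiag n (U i n) (l i n)) = u" using l by (intro ext) simp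
  ultimately show ?thesis by (simp add: qu)
qed

section \<open>Continuous functional calculus of self-adjoint elements\<close>

definition sa :: "qalg \<Rightarrow> bool" where "sa x \<longleftrightarrow> star x = x"

text \<open>A calculus is fixed once by choice; by \<open>hfc_eq\<close> its value at a continuous
  \<open>F\<close> does not depend on it. Functions live on the whole line, so that no norm bound
  for \<open>x\<close> has to be carried along.\<close>

definition hfc :: "qalg \<Rightarrow> (real \<Rightarrow> complex) \<Rightarrow> qalg" where
  "hfc x F = (SOME \<Phi>. \<exists>c. calc (complex_of_real ` {-c..c}) x \<Phi>) (\<lambda>z. F (Re z))"

abbreviation cont :: "(real \<Rightarrow> complex) \<Rightarrow> bool" where "cont F \<equiv> continuous_on UNIV F"

lemma cont_Re: "cont F \<Longrightarrow> continuous_on S (\<lambda>z. F (Re z))"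
  by (rule continuous_on_compose2[of UNIV]) (auto intro: continuous_intros)

lemma cont_real: "continuous_on UNIV f \<Longrightarrow> cont (\<lambda>t. complex_of_real (f t))"
  by (intro continuous_intros)

lemma hfc_calc:
  assumes "sa x"
  obtains \<Phi> c where "calc (complex_of_real ` {-c..c}) x \<Phi>" "\<And>F. hfc x F = \<Phi> (\<lambda>z. F (Re z))"
proof -
  obtain c where c: "c \<ge> 0" "nb x c" using nb_ex by blast
  obtain \<Phi> where "calc (complex_of_real ` {-(c+1)..c+1}) x \<Phi>"
    using sa_calc[of x c "c + 1"] assms c by (auto simp: sa_def)
  hence "\<exists>\<Phi> c. calc (complex_of_real ` {-c..c}) x \<Phi>" by blast
  hence "\<exists>c. calc (complex_of_real ` {-c..c}) x (SOME \<Phi>. \<exists>c. calc (complex_of_real ` {-c..c}) x \<Phi>)" by (rule someI_ex)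
  thus ?thesis using that by (auto simp: hfc_def)
qed

lemma hfc_eq:
  assumes "sa x" "calc S x \<Psi>" "cont F"
  shows "hfc x F = \<Psi> (\<lambda>z. F (Re z))"
proof -
  obtain \<Phi> c where c: "calc (complex_of_real ` {-c..c}) x \<Phi>" "\<And>F. hfc x F = \<Phi> (\<lambda>z. F (Re z))"
    using hfc_calc[OF assms(1)] by blast
  show ?thesis unfolding c(2) by (rule calc_unique[OF c(1) assms(2) cont_Re[OF assms(3)]])
qed

lemma bounded_cont_Re: "calc S x \<Phi> \<Longrightarrow> cont F \<Longrightarrow> bounded ((\<lambda>z. F (Re z)) ` S)"
  by (intro bounded_image_cont calc_compact cont_Re)

context
  fixes x assumes x: "sa x"
begin

lemma hfc_const [simp]: "hfc x (\<lambda>_. c) = cof c"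
  by (rule hfc_calc[OF x]) (simp add: calc_const)

lemma hfc_id: "hfc x complex_of_real = x"
proof (rule hfc_calc[OF x])
  fix \<Phi> c assume c: "calc (complex_of_real ` {-c..c}) x \<Phi>" "\<And>F. hfc x F = \<Phi> (\<lambda>z. F (Re z))"
  have "\<Phi> (\<lambda>z. complex_of_real (Re z)) = \<Phi> (\<lambda>z. z)" by (rule calc_cong[OF c(1)]) auto
  thus ?thesis using c by (simp add: calc_id[OF c(1)])
qed

lemma hfc_add: 
  assumes F: "cont F" and G: "cont G"
  shows "hfc x (\<lambda>t. F t + G t) = hfc x F + hfc x G"
proof (rule hfc_calc[OF x])
  fix \<Phi> c assume c: "calc (complex_of_real ` {-c..c}) x \<Phi>" "\<And>F. hfc x F = \<Phi> (\<lambda>z. F (Re z))"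
  show ?thesis using calc_add[OF c(1) bounded_cont_Re[OF c(1) F] bounded_cont_Re[OF c(1) G]] by (simp add: c(2))
qed

lemma hfc_minus: 
  assumes F: "cont F" and G: "cont G"
  shows "hfc x (\<lambda>t. F t - G t) = hfc x F - hfc x G"
proof (rule hfc_calc[OF x])
  fix \<Phi> c assume c: "calc (complex_of_real ` {-c..c}) x \<Phi>" "\<And>F. hfc x F = \<Phi> (\<lambda>z. F (Re z))"
  show ?thesis using calc_minus[OF c(1) bounded_cont_Re[OF c(1) F] bounded_cont_Re[OF c(1) G]] by (simp add: c(2))
qed

lemma hfc_mult: 
  assumes F: "cont F" and G: "cont G"
  shows "hfc x (\<lambda>t. F t * G t) = hfc x F * hfc x G"
proof (rule hfc_calc[OF x])
  fix \<Phi> c assume c: "calc (complex_of_real ` {-c..c}) x \<Phi>" "\<And>F. hfc x F = \<Phi> (\<lambda>z. F (Re z))"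
  show ?thesis using calc_mult[OF c(1) bounded_cont_Re[OF c(1) F] bounded_cont_Re[OF c(1) G]] by (simp add: c(2))
qed

lemma hfc_star: 
  assumes F: "cont F"
  shows "star (hfc x F) = hfc x (\<lambda>t. cnj (F t))"
proof (rule hfc_calc[OF x])
  fix \<Phi> c assume c: "calc (complex_of_real ` {-c..c}) x \<Phi>" "\<And>F. hfc x F = \<Phi> (\<lambda>z. F (Re z))"
  show ?thesis using calc_cnj[OF c(1) bounded_cont_Re[OF c(1) F]] by (simp add: c(2))
qed

lemma sa_hfc: "continuous_on UNIV f \<Longrightarrow> sa (hfc x (\<lambda>t. complex_of_real (f t)))"
  unfolding sa_def by (subst hfc_star) (auto intro: continuous_intros)

lemma hfc_sum: "finite A \<Longrightarrow> (\<And>a. a \<in> A \<Longrightarrow> cont (F a)) \<Longrightarrow> hfc x (\<lambda>t. \<Sum>a\<in>A. F a t) = (\<Sum>a\<in>A. hfc x (F a))"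
  by (induction A rule: finite_induct) (auto simp: hfc_add continuous_on_sum)

text \<open>Only the values of \<open>F\<close> on an interval slightly larger than the norm bound
  count, because the value may be computed with a calculus on that interval.\<close>

lemma hfc_nb:
  assumes "cont F" "nb x c" "c < c'" "0 \<le> c'" "\<And>t. \<bar>t\<bar> \<le> c' \<Longrightarrow> cmod (F t) \<le> B" "0 \<le> B"
  shows "nb (hfc x F) B"
proof -
  obtain \<Phi> where c: "calc (complex_of_real ` {-c'..c'}) x \<Phi>"
    using sa_calc[of x c c'] x assms by (auto simp: sa_def)
  show ?thesis unfolding hfc_eq[OF x c assms(1)] by (rule calc_nb[OF c]) (use assms in auto)
qed

lemma hfc_nb':
  assumes "cont F" "\<And>t. cmod (F t) \<le> B"
  shows "nb (hfc x F) B"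
proof -
  obtain c where c: "c \<ge> 0" "nb x c" using nb_ex by blast
  have "0 \<le> B" using assms(2)[of 0] norm_ge_zero order.trans by blast
  thus ?thesis using hfc_nb[OF assms(1) c(2), of "c + 1"] assms(2) c(1) by simp
qed

lemma hfc_cong:
  assumes "cont F" "cont G" "nb x c" "c < c'" "0 \<le> c'" "\<And>t. \<bar>t\<bar> \<le> c' \<Longrightarrow> F t = G t"
  shows "hfc x F = hfc x G"
proof -
  have "nb (hfc x (\<lambda>t. F t - G t)) 0" by (rule hfc_nb[OF _ assms(3-5)]) (use assms in \<open>auto intro: continuous_intros\<close>)
  hence "hfc x (\<lambda>t. F t - G t) = 0" by (rule nb_0_eq_0)
  thus ?thesis using assms by (simp add: hfc_minus)
qed

lemma hfc_pos:
  assumes "continuous_on UNIV f" "\<And>t. 0 \<le> f t"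
  shows "pos (hfc x (\<lambda>t. complex_of_real (f t)))"
proof (rule hfc_calc[OF x])
  fix \<Phi> c assume c: "calc (complex_of_real ` {-c..c}) x \<Phi>" "\<And>F. hfc x F = \<Phi> (\<lambda>z. F (Re z))"
  show ?thesis unfolding c(2)
    by (rule calc_pos[OF c(1) bounded_cont_Re[OF c(1)]]) (use assms in \<open>auto intro: continuous_intros\<close>)
qed

lemma sa_uminus: "sa (- x)" using x by (simp add: sa_def star_uminus)

lemma hfc_uminus: 
  assumes F: "cont F"
  shows "hfc (- x) F = hfc x (\<lambda>t. F (- t))"
proof (rule hfc_calc[OF x])
  fix \<Phi> c assume c: "calc (complex_of_real ` {-c..c}) x \<Phi>" "\<And>F. hfc x F = \<Phi> (\<lambda>z. F (Re z))"
  let ?S = "complex_of_real ` {-c..c}"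
  have b: "bounded ((\<lambda>z. z) ` ?S)" by (rule bounded_image_cont[OF calc_compact[OF c(1)]]) (intro continuous_intros)
  have "\<Phi> (\<lambda>z. -1 * z) = cof (-1) * x"
    using calc_mult[OF c(1) bounded_image_const b, of "-1"] by (simp add: calc_const[OF c(1)] calc_id[OF c(1)])
  hence m: "\<Phi> uminus = - x" by (simp add: cof_uminus) 
  have "calc (uminus ` ?S) (\<Phi> uminus) (\<lambda>F. \<Phi> (\<lambda>z. F (- z)))"
    by (rule calc_compose[OF c(1)]) (intro continuous_intros)
  from hfc_eq[OF sa_uminus this[unfolded m] F] show ?thesis by (simp add: c(2))
qed

lemma sa_sig: "real_structure W \<Longrightarrow> sa (sig W x)" using x by (simp add: sa_def flip: sig_star)

lemma hfc_sig:
  assumes W: "real_structure W" and F: "cont F"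
  shows "sig W (hfc x F) = hfc (sig W x) (\<lambda>t. cnj (F t))"
proof (rule hfc_calc[OF x])
  fix \<Phi> c assume c: "calc (complex_of_real ` {-c..c}) x \<Phi>" "\<And>F. hfc x F = \<Phi> (\<lambda>z. F (Re z))"
  let ?S = "complex_of_real ` {-c..c}"
  have bc: "bounded ((\<lambda>z. cnj (G z)) ` ?S)" if "bounded (G ` ?S)" for G :: "complex \<Rightarrow> complex"
    using that by (simp add: bounded_iff)
  \<comment> \<open>\<open>sig W\<close> and the conjugation of \<open>G\<close> are both
    antilinear, so their combination is again a calculus, now for \<open>sig W x\<close>.\<close>
  have cc: "calc ?S (sig W x) (\<lambda>G. sig W (\<Phi> (\<lambda>z. cnj (G z))))"
  proof (rule calcI)
    show "compact ?S" by (rule calc_compact[OF c(1)])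
    have "\<Phi> (\<lambda>z. cnj z) = \<Phi> (\<lambda>z. z)" by (rule calc_cong[OF c(1)]) auto
    thus "sig W (\<Phi> (\<lambda>z. cnj z)) = sig W x" by (simp add: calc_id[OF c(1)])
    show "sig W (\<Phi> (\<lambda>z. cnj k)) = cof k" for k by (simp add: calc_const[OF c(1)] sig_cof[OF W])
    show "sig W (\<Phi> (\<lambda>z. cnj (F z + G z))) = sig W (\<Phi> (\<lambda>z. cnj (F z))) + sig W (\<Phi> (\<lambda>z. cnj (G z)))"
      if "bounded (F ` ?S)" "bounded (G ` ?S)" for F G
      using calc_add[OF c(1) bc[OF that(1)] bc[OF that(2)]] by (simp add: sig_add[OF W])
    show "sig W (\<Phi> (\<lambda>z. cnj (F z * G z))) = sig W (\<Phi> (\<lambda>z. cnj (F z))) * sig W (\<Phi> (\<lambda>z. cnj (G z)))"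
      if "bounded (F ` ?S)" "bounded (G ` ?S)" for F G
      using calc_mult[OF c(1) bc[OF that(1)] bc[OF that(2)]] by (simp add: sig_mult[OF W])
    show "sig W (\<Phi> (\<lambda>z. cnj (cnj (F z)))) = star (sig W (\<Phi> (\<lambda>z. cnj (F z))))"
      if "bounded (F ` ?S)" for F
      using calc_cnj[OF c(1) bc[OF that]] by (simp flip: sig_star[OF W])
    show "sig W (\<Phi> (\<lambda>z. cnj (F z))) = sig W (\<Phi> (\<lambda>z. cnj (G z)))" if "\<And>z. z \<in> ?S \<Longrightarrow> F z = G z" for F G
      using calc_cong[OF c(1), of "\<lambda>z. cnj (F z)" "\<lambda>z. cnj (G z)"] that by simp
    show "nb (sig W (\<Phi> (\<lambda>z. cnj (F z)))) k" if "\<And>z. z \<in> ?S \<Longrightarrow> cmod (F z) \<le> k" "0 \<le> k" for F k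
      using calc_nb[OF c(1), of "\<lambda>z. cnj (F z)" k] that by (intro nb_sig[OF W]) simp
  qed
  have "cont (\<lambda>t. cnj (F t))" using F by (intro continuous_intros)
  from hfc_eq[OF sa_sig[OF W] cc this] show ?thesis by (simp add: c(2))
qed

end

lemma hfc_intertwine:
  assumes "sa x" "sa y" "x * b = b * y" "cont F"
  shows "hfc x F * b = b * hfc y F"
proof -
  obtain \<Phi> c where c: "calc (complex_of_real ` {-c..c}) x \<Phi>" "\<And>F. hfc x F = \<Phi> (\<lambda>z. F (Re z))"
    using hfc_calc[OF assms(1)] by blast
  obtain \<Psi> d where d: "calc (complex_of_real ` {-d..d}) y \<Psi>" "\<And>F. hfc y F = \<Psi> (\<lambda>z. F (Re z))"
    using hfc_calc[OF assms(2)] by blast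
  have "star x * b = b * star y" using assms by (simp add: sa_def)
  thus ?thesis unfolding c(2) d(2) by (intro calc_intertwine[OF c(1) d(1) assms(3) _ cont_Re[OF assms(4)]])
qed

lemma hfc_comm: "sa x \<Longrightarrow> x * b = b * x \<Longrightarrow> cont F \<Longrightarrow> hfc x F * b = b * hfc x F"
  by (rule hfc_intertwine)

section \<open>Cutting across a strip\<close>

definition clip :: "real \<Rightarrow> real \<Rightarrow> real \<Rightarrow> real" where "clip a b t = max a (min b t)"

lemma continuous_on_clip [continuous_intros]: "continuous_on S f \<Longrightarrow> continuous_on S (\<lambda>t. clip a b (f t))"
  unfolding clip_def by (intro continuous_intros)

text \<open>The curve \<open>x \<mapsto> (x - \<i> \<surd>(1-x\<^sup>2))\<^sup>2\<close> runs once around the unit circle for \<open>-1 \<le> x \<le> 1\<close>,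
  with \<open>x = 0\<close> mapped to \<open>-1\<close>.  A function of \<open>x\<close> supported in \<open>[-1/2, 1/2]\<close> is transported
  to the circle by \<open>circle_lift\<close>.\<close>

definition circle_curve :: "real \<Rightarrow> complex" where
  "circle_curve x = Complex (2 * x\<^sup>2 - 1) (- 2 * x * sqrt (1 - x\<^sup>2))"

text \<open>Inverse of \<open>circle_curve\<close> on the half circle \<open>Re z <= 0\<close>.
  Beyond it, the \<open>min\<close> keeps the denominator positive, also at the point
  \<open>1\<close>.\<close>

definition circle_coord :: "complex \<Rightarrow> real" where
  "circle_coord z = - Im z / sqrt (2 * (1 - min (Re z) 0))"

text \<open>The factor is \<open>1\<close> for \<open>Re z <= - 1 / 2\<close>, which on the curve
  means \<open>|x| <= 1 / 2\<close>, and \<open>0\<close> for \<open>Re z >= 0\<close>, where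
  \<open>circle_coord\<close> has lost its meaning.\<close>

definition circle_lift :: "(real \<Rightarrow> complex) \<Rightarrow> complex \<Rightarrow> complex" where
  "circle_lift \<phi> z = \<phi> (circle_coord z) * complex_of_real (clip 0 1 (- 2 * Re z))"

lemma circle_coord_sq:
  assumes "cmod z = 1" "Re z \<le> 0"
  shows "(circle_coord z)\<^sup>2 = (1 + Re z) / 2"
proof -
  have "(Re z)\<^sup>2 + (Im z)\<^sup>2 = 1" using assms(1) by (simp add: cmod_def)
  hence "(Im z)\<^sup>2 = (1 - Re z) * (1 + Re z)" by (simp add: algebra_simps power2_eq_square)
  thus ?thesis using assms(2) by (simp add: circle_coord_def power_divide min_def field_simps)
qed

lemma half_bounded_sq: "1 / 4 < x\<^sup>2 \<longleftrightarrow> 1 / 2 < \<bar>x :: real\<bar>"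
proof -
  have "(1 / 2)\<^sup>2 < \<bar>x\<bar>\<^sup>2" if "1 / 2 < \<bar>x\<bar>" using that by (intro power_strict_mono) auto
  moreover have "\<bar>x\<bar>\<^sup>2 \<le> (1 / 2)\<^sup>2" if "\<not> 1 / 2 < \<bar>x\<bar>" using that by (intro power_mono) auto
  ultimately show ?thesis by (simp add: power_divide) (smt (verit))
qed

text \<open>The cut-off fails to be idempotent only for \<open>- 1 / 2 < Re z < 0\<close>; there the
  coordinate exceeds \<open>1 / 2\<close> in modulus, so \<open>\<phi>\<close> vanishes.\<close>

lemma circle_lift_mult:
  assumes "cmod z = 1" and "\<And>x. 1 / 2 < \<bar>x\<bar> \<Longrightarrow> \<phi> x = 0"
  shows "circle_lift \<phi> z * circle_lift \<psi> z = circle_lift (\<lambda>x. \<phi> x * \<psi> x) z"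
proof -
  consider "Re z \<ge> 0" | "Re z \<le> - 1 / 2" | "- 1 / 2 < Re z" "Re z < 0" by linarith
  thus ?thesis
  proof cases
    case 3
    hence "1 / 4 < (circle_coord z)\<^sup>2" using circle_coord_sq[OF assms(1)] by simp
    hence "\<phi> (circle_coord z) = 0" using assms(2) half_bounded_sq by blast
    thus ?thesis by (simp add: circle_lift_def)
  qed (auto simp: circle_lift_def clip_def)
qed

lemma circle_curve_norm: "\<bar>x\<bar> \<le> 1 \<Longrightarrow> cmod (circle_curve x) = 1"
proof -
  assume "\<bar>x\<bar> \<le> 1"
  hence "x\<^sup>2 \<le> 1" by (simp add: abs_square_le_1)
  hence "(2 * x\<^sup>2 - 1)\<^sup>2 + (- 2 * x * sqrt (1 - x\<^sup>2))\<^sup>2 = 1"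
    by (simp add: power_mult_distrib) (simp add: algebra_simps power2_eq_square)
  thus ?thesis by (simp add: circle_curve_def cmod_def)
qed

lemma circle_lift_curve:
  assumes x: "\<bar>x\<bar> \<le> 1" and \<phi>: "\<And>x. 1 / 2 < \<bar>x\<bar> \<Longrightarrow> \<phi> x = 0"
  shows "circle_lift \<phi> (circle_curve x) = \<phi> x"
proof (cases "2 * x\<^sup>2 - 1 < 0")
  case True
  have s: "sqrt (2 * (1 - min (2 * x\<^sup>2 - 1) 0)) = 2 * sqrt (1 - x\<^sup>2)"
  proof -
    have "2 * (1 - min (2 * x\<^sup>2 - 1) 0) = 4 * (1 - x\<^sup>2)" using True by (simp add: min_def algebra_simps)
    thus ?thesis by (simp only: real_sqrt_mult real_sqrt_four)
  qed
  have "sqrt (1 - x\<^sup>2) > 0" using True by simp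
  hence c: "circle_coord (circle_curve x) = x" using s by (simp add: circle_coord_def circle_curve_def)
  show ?thesis
  proof (cases "1 / 2 < \<bar>x\<bar>")
    case True thus ?thesis using c \<phi> by (simp add: circle_lift_def)
  next
    case False
    hence "x\<^sup>2 \<le> 1 / 4" using half_bounded_sq[of x] by linarith
    thus ?thesis using c by (simp add: circle_lift_def circle_curve_def clip_def)
  qed
next
  case False
  hence "1 / 4 < x\<^sup>2" by linarith
  hence "\<phi> x = 0" using \<phi> half_bounded_sq by blast
  thus ?thesis using False by (simp add: circle_lift_def circle_curve_def clip_def)
qed

lemma circle_lift_1: "circle_lift \<phi> 1 = 0"
  by (simp add: circle_lift_def clip_def)

lemma continuous_on_circle_lift: "cont \<phi> \<Longrightarrow> continuous_on S (circle_lift \<phi>)"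
proof -
  assume \<phi>: "cont \<phi>"
  have "continuous_on S circle_coord"
    unfolding circle_coord_def by (intro continuous_intros) (auto simp: min_def)
  from continuous_on_compose2[OF \<phi> this] show ?thesis
    unfolding circle_lift_def by (intro continuous_intros) auto
qed

lemma continuous_on_circle_curve [continuous_intros]: 
  "continuous_on S f \<Longrightarrow> continuous_on S (\<lambda>t. circle_curve (f t))"
  unfolding circle_curve_def Complex_eq by (intro continuous_intros)

definition strip_coord :: "real \<Rightarrow> real \<Rightarrow> real \<Rightarrow> real" where
  "strip_coord a r h = clip (-1) 1 ((h - a) / r)"

text \<open>The constants are matched: \<open>step_fun\<close> moves only on
  \<open>[-1/4, 1/4]\<close>, where \<open>tent_fun\<close> is \<open>1\<close>, and
  \<open>tent_fun\<close> vanishes outside \<open>[-1/2, 1/2]\<close>, as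
  \<open>circle_lift_curve\<close> demands.\<close>

definition step_fun :: "real \<Rightarrow> real" where "step_fun x = clip 0 1 (2 * x + 1 / 2)"
definition tent_fun :: "real \<Rightarrow> real" where "tent_fun x = clip 0 1 (2 - 4 * \<bar>x\<bar>)"
text \<open>Continuous step minus sharp step: \<open>step_fun - jump_fun\<close> is the indicator
  function of \<open>x >= 0\<close>, hence idempotent. The jump at \<open>0\<close> sits at the
  point \<open>- 1\<close> of the circle.\<close>

definition jump_fun :: "real \<Rightarrow> real" where "jump_fun x = (if x < 0 then step_fun x else step_fun x - 1)"

lemma continuous_step_tent [continuous_intros]:
  "continuous_on S f \<Longrightarrow> continuous_on S (\<lambda>t. step_fun (f t))"
  "continuous_on S f \<Longrightarrow> continuous_on S (\<lambda>t. tent_fun (f t))"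
  "r \<noteq> 0 \<Longrightarrow> continuous_on S f \<Longrightarrow> continuous_on S (\<lambda>t. strip_coord a r (f t))"
  unfolding step_fun_def tent_fun_def strip_coord_def by (intro continuous_intros; simp)+

lemma abs_strip_coord: "\<bar>strip_coord a r h\<bar> \<le> 1"
  by (auto simp: strip_coord_def clip_def)

lemma strip_coord_inner: "r > 0 \<Longrightarrow> \<bar>strip_coord a r h\<bar> < 1 \<Longrightarrow> h = a + r * strip_coord a r h"
  by (auto simp: strip_coord_def clip_def field_simps max_def min_def split: if_splits)

abbreviation hole_at :: "real \<Rightarrow> real \<Rightarrow> (real \<Rightarrow> complex) \<Rightarrow> bool" where
  "hole_at a r f \<equiv> cont f \<and> (\<forall>h. r \<le> \<bar>h - a\<bar> \<longrightarrow> f h = 0)"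

text \<open>Where \<open>B\<close> is a projection, \<open>B (u - 1) + 1\<close> is a unitary that winds around the circle once
  across the strip; a discontinuous function of it, with jump at \<open>-1\<close>, cuts the strip sharply.\<close>

lemma band_cut:
  assumes H: "sa H" and B: "sa B" and HB: "H * B = B * H" and r: "r > 0"
    and hole: "\<And>f. hole_at a r f \<Longrightarrow> (B - B * B) * hfc H f = 0"
  defines "p \<equiv> B * hfc H (\<lambda>h. complex_of_real (tent_fun (strip_coord a r h)))"
    and "E \<equiv> hfc H (\<lambda>h. complex_of_real (step_fun (strip_coord a r h)))"
  shows "\<exists>J. star J = J \<and> J * p = J \<and> p * J = J \<and> H * J = J * H \<and> E * J = J * E \<and>
    (E * E - E) * B + J * J + J - 2 * (E * J) = 0"
proof -
  note r0 = less_imp_neq[OF r, symmetric]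
  let ?X = "strip_coord a r"
  define u where "u = hfc H (\<lambda>h. circle_curve (?X h))"
  have cu: "cont (\<lambda>h. circle_curve (?X h))" using r0 by (intro continuous_intros)
  have cuc: "cont (\<lambda>h. cnj (circle_curve (?X h)))" using cu by (rule continuous_on_cnj)
  have us: "star u = hfc H (\<lambda>h. cnj (circle_curve (?X h)))" unfolding u_def by (rule hfc_star[OF H cu])
  have cn: "circle_curve (?X h) * cnj (circle_curve (?X h)) = 1" for h
    using circle_curve_norm[OF abs_strip_coord[of a r h]] by (simp add: complex_norm_square[symmetric])
  have uu: "u * star u = 1" "star u * u = 1"
    using hfc_mult[OF H cu cuc] hfc_mult[OF H cuc cu] hfc_const[OF H, of 1] 
    by (simp_all add: us cn mult.commute[of "cnj _"]) (simp_all add: u_def)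
  have comB: "hfc H F * B = B * hfc H F" if "cont F" for F by (rule hfc_comm[OF H HB that])
  have uB: "u * B = B * u" using comB[OF cu] by (simp only: u_def)
  have usB: "star u * B = B * star u" using comB[OF cuc] by (simp only: us)
  \<comment> \<open>The curve is constantly \<open>1\<close> outside the strip, so
    \<open>u - 1\<close> is a function of \<open>H\<close> to which \<open>hole\<close>
    applies.\<close>
  have hu: "(B - B * B) * (u - 1) = 0"
  proof -
    have e1: "circle_curve (?X h) = 1" if "r \<le> \<bar>h - a\<bar>" for h
    proof -
      have "?X h = 1 \<or> ?X h = -1" using that r by (auto simp: strip_coord_def clip_def abs_if field_simps split: if_splits)
      thus ?thesis by (auto simp: circle_curve_def complex_eq_iff)
    qed
    have "hole_at a r (\<lambda>h. circle_curve (?X h) - 1)" using cu e1 by (auto intro: continuous_intros)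
    from hole[OF this] show ?thesis using hfc_minus[OF H cu, of "\<lambda>_. 1"] H by (simp add: u_def continuous_intros)
  qed
  define V where "V = 1 + B * (u - 1)"
  have BB: "star B = B" using B by (simp add: sa_def)
  have Vs: "star V = 1 + B * (star u - 1)"
    by (simp add: V_def star_add star_mult star_diff BB algebra_simps uB usB)
  have hus: "(B - B * B) * (star u - 1) = 0"
  proof -
    have "(B - B * B) * (star u - 1) = - ((B - B * B) * (u - 1)) * star u"
      using uu(1) by (simp add: algebra_simps mult.assoc)
    thus ?thesis using hu by simp
  qed
  have BBu: "B * B * (- (star u - 1) - (u - 1)) = - B * (star u - 1) - B * (u - 1)"
  proof -
    have "B * B * (u - 1) = B * (u - 1)" "B * B * (star u - 1) = B * (star u - 1)"
      using hu hus by (simp_all only: left_diff_distrib[of B "B * B"] right_minus_eq)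
    thus ?thesis
      by (simp only: right_diff_distrib[of "B * B" "- (star u - 1)" "u - 1"] mult_minus_right mult_minus_left)
  qed
  have "star V * V = 1" "V * star V = 1"
  proof -
    have "B * (star u - 1) * (B * (u - 1)) = B * B * ((star u - 1) * (u - 1))"
      using uB usB by (simp add: algebra_simps) (metis mult.assoc)?
    also have "(star u - 1) * (u - 1) = - (star u - 1) - (u - 1)" using uu by (simp add: algebra_simps)
    also have "B * B * (- (star u - 1) - (u - 1)) = - B * (star u - 1) - B * (u - 1)" by (rule BBu)
    finally have 1: "B * (star u - 1) * (B * (u - 1)) = - B * (star u - 1) - B * (u - 1)" .
    show "star V * V = 1" unfolding Vs unfolding V_def using 1 by (simp add: algebra_simps)
    have "B * (u - 1) * (B * (star u - 1)) = B * B * ((u - 1) * (star u - 1))"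
      using uB usB by (simp add: algebra_simps) (metis mult.assoc)?
    also have "(u - 1) * (star u - 1) = - (star u - 1) - (u - 1)" using uu by (simp add: algebra_simps)
    also have "B * B * (- (star u - 1) - (u - 1)) = - B * (star u - 1) - B * (u - 1)" by (rule BBu)
    finally have 2: "B * (u - 1) * (B * (star u - 1)) = - B * (star u - 1) - B * (u - 1)" .
    show "V * star V = 1" unfolding Vs unfolding V_def using 2 by (simp add: algebra_simps)
  qed
  hence "unitary V" by (simp add: unitary_def)
  then obtain \<Psi> where \<Psi>: "calc (sphere 0 1) V \<Psi>" using unitary_calc by blast
  obtain \<Phi> c where \<Phi>: "calc (complex_of_real ` {-c..c}) H \<Phi>" "\<And>F. hfc H F = \<Phi> (\<lambda>z. F (Re z))"
    using hfc_calc[OF H] by blast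
  let ?S = "complex_of_real ` {-c..c}"
  let ?E = "\<lambda>z. circle_curve (?X (Re z))"
  have cE: "continuous_on ?S ?E" by (rule cont_Re[OF cu])
  have ucalc: "calc (?E ` ?S) u (\<lambda>F. \<Phi> (\<lambda>z. F (?E z)))"
    using calc_compose[OF \<Phi>(1) cE] by (simp add: u_def \<Phi>(2))
  \<comment> \<open>\<open>V\<close> acts as \<open>u\<close> on the range of \<open>B\<close> and
    as \<open>1\<close> on that of \<open>1 - B\<close>, although \<open>B\<close> is idempotent
    only inside the strip.\<close>
  have VB: "V * B = B * u"
    using hu uB usB by (simp add: V_def algebra_simps) (metis mult.assoc)?
  have VsB: "star V * B = B * star u"
    using hus uB usB by (simp add: Vs algebra_simps) (metis mult.assoc)?
  have V1: "V * (1 - B) = (1 - B) * 1"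
    using VB by (simp add: V_def algebra_simps)
  have Vs1: "star V * (1 - B) = (1 - B) * star 1"
    using VsB by (simp add: Vs algebra_simps)
  have calc1: "calc {1} 1 (\<lambda>F. cof (F 1))" using calc_scalar[of 1] by simp
  \<comment> \<open>The two actions of \<open>V\<close> are evaluated separately, and on
    \<open>1 - B\<close> the value is \<open>circle_lift \<phi> 1 = 0\<close>. For continuous
    \<open>\<phi>\<close>, functions of \<open>V\<close> are thus functions of \<open>H\<close> cut
    down to the band.\<close>
  have L: "\<Psi> (circle_lift \<phi>) = B * hfc H (\<lambda>h. \<phi> (?X h))" 
    if \<phi>: "cont \<phi>" "\<And>x. 1 / 2 < \<bar>x\<bar> \<Longrightarrow> \<phi> x = 0" for \<phi>
  proof -
    have "\<Psi> (circle_lift \<phi>) * B = B * \<Phi> (\<lambda>z. circle_lift \<phi> (?E z))"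
      by (rule calc_intertwine[OF \<Psi> ucalc VB VsB continuous_on_circle_lift[OF \<phi>(1)]])
    also have "\<Phi> (\<lambda>z. circle_lift \<phi> (?E z)) = hfc H (\<lambda>h. \<phi> (?X h))"
      unfolding \<Phi>(2) by (simp add: circle_lift_curve[OF abs_strip_coord \<phi>(2)])
    finally have 1: "\<Psi> (circle_lift \<phi>) * B = B * hfc H (\<lambda>h. \<phi> (?X h))" .
    have "\<Psi> (circle_lift \<phi>) * (1 - B) = (1 - B) * cof (circle_lift \<phi> 1)"
      by (rule calc_intertwine[OF \<Psi> calc1 V1 Vs1 continuous_on_circle_lift[OF \<phi>(1)]])
    hence "\<Psi> (circle_lift \<phi>) * (1 - B) = 0" by (simp add: circle_lift_1)
    thus ?thesis using 1 by (simp add: algebra_simps)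
  qed
  have bl: "bounded (circle_lift \<phi> ` sphere 0 1)" if "\<And>x. cmod (\<phi> x) \<le> k" for \<phi> k
  proof -
    have "cmod (circle_lift \<phi> z) \<le> k * 1" for z
      unfolding circle_lift_def norm_mult using that order.trans[OF norm_ge_zero that]
      by (intro mult_mono) (auto simp: clip_def)
    thus ?thesis by (auto simp: bounded_iff)
  qed
  have Lm: "\<Psi> (circle_lift \<phi>) * \<Psi> (circle_lift \<psi>) = \<Psi> (circle_lift (\<lambda>x. \<phi> x * \<psi> x))"
    if "\<And>x. 1 / 2 < \<bar>x\<bar> \<Longrightarrow> \<phi> x = 0" "\<And>x. cmod (\<phi> x) \<le> k" "\<And>x. cmod (\<psi> x) \<le> k'" for \<phi> \<psi> k k'
  proof -
    have "\<Psi> (circle_lift \<phi>) * \<Psi> (circle_lift \<psi>) = \<Psi> (\<lambda>z. circle_lift \<phi> z * circle_lift \<psi> z)"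
      using calc_mult[OF \<Psi> bl[OF that(2)] bl[OF that(3)]] by simp
    also have "\<dots> = \<Psi> (circle_lift (\<lambda>x. \<phi> x * \<psi> x))"
      by (rule calc_cong[OF \<Psi>]) (use circle_lift_mult that(1) in auto)
    finally show ?thesis .
  qed
  have La: "\<Psi> (circle_lift \<phi>) + \<Psi> (circle_lift \<psi>) = \<Psi> (circle_lift (\<lambda>x. \<phi> x + \<psi> x))"
    if "\<And>x. cmod (\<phi> x) \<le> k" "\<And>x. cmod (\<psi> x) \<le> k'" for \<phi> \<psi> k k'
  proof -
    have "\<Psi> (circle_lift \<phi>) + \<Psi> (circle_lift \<psi>) = \<Psi> (\<lambda>z. circle_lift \<phi> z + circle_lift \<psi> z)"
      using calc_add[OF \<Psi> bl[OF that(1)] bl[OF that(2)]] by simp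
    moreover have "(\<lambda>z. circle_lift \<phi> z + circle_lift \<psi> z) = circle_lift (\<lambda>x. \<phi> x + \<psi> x)"
      by (rule ext) (simp add: circle_lift_def algebra_simps)
    ultimately show ?thesis by simp
  qed
  let ?st = "\<lambda>x. complex_of_real (step_fun x)" and ?te = "\<lambda>x. complex_of_real (tent_fun x)" 
    and ?ju = "\<lambda>x. complex_of_real (jump_fun x)"
  have b1: "cmod (?st x) \<le> 1" "cmod (?te x) \<le> 1" "cmod (?ju x) \<le> 1" for x
    by (auto simp: step_fun_def tent_fun_def jump_fun_def clip_def)
  have z1: "?te x = 0" if "1 / 2 < \<bar>x\<bar>" for x using that by (auto simp: tent_fun_def clip_def)
  have z2: "?ju x = 0" if "1 / 4 < \<bar>x\<bar>" for x using that by (auto simp: jump_fun_def step_fun_def clip_def)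
  have z2': "?ju x = 0" if "1 / 2 < \<bar>x\<bar>" for x using that by (intro z2) simp
  have tj: "?te x * ?ju x = ?ju x" for x 
    using z2[of x] by (cases "1 / 4 < \<bar>x\<bar>") (auto simp: tent_fun_def clip_def)
  have cte: "cont ?te" and cst: "cont ?st" by (auto intro!: continuous_intros)
  define J where "J = \<Psi> (circle_lift ?ju)"
  have p: "p = \<Psi> (circle_lift ?te)" unfolding p_def using L[OF cte z1] by simp
  have pJ: "p * J = J" using Lm[OF z1 b1(2,3)] by (simp only: p J_def tj)
  have Jp: "J * p = J" using Lm[OF z2' b1(3,2)] by (simp only: p J_def tj mult.commute[of "?ju x" "?te x" for x])
  have Js: "star J = J"
  proof -
    have "star J = \<Psi> (\<lambda>z. cnj (circle_lift ?ju z))" unfolding J_def using calc_cnj[OF \<Psi> bl[OF b1(3)]] by simp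
    moreover have "(\<lambda>z. cnj (circle_lift ?ju z)) = circle_lift ?ju" by (rule ext) (simp add: circle_lift_def)
    ultimately show ?thesis by (simp only: J_def)
  qed
  \<comment> \<open>On the support of the tent \<open>h = a + r x\<close>, so \<open>H * p\<close>
    is itself a function of \<open>V\<close>. This is why \<open>H\<close> commutes with
    \<open>J\<close>: for a function with a jump, commuting with \<open>V\<close> would not
    suffice.\<close>
  define \<xi> where "\<xi> = (\<lambda>x. complex_of_real ((a + r * x) * tent_fun x))"
  have cx: "cont \<xi>" unfolding \<xi>_def by (intro continuous_intros)
  have zx: "\<xi> x = 0" if "1 / 2 < \<bar>x\<bar>" for x using z1[OF that] by (simp add: \<xi>_def)
  have bx: "cmod (\<xi> x) \<le> \<bar>a\<bar> + r" for x
  proof (cases "1 / 2 < \<bar>x\<bar>")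
    case True thus ?thesis using zx[OF True] r by simp
  next
    case False
    have "\<bar>a + r * x\<bar> * \<bar>tent_fun x\<bar> \<le> (\<bar>a\<bar> + r * \<bar>x\<bar>) * 1"
      using r by (intro mult_mono order.trans[OF abs_triangle_ineq]) (auto simp: abs_mult tent_fun_def clip_def)
    also have "r * \<bar>x\<bar> \<le> r * 1" using False r by (intro mult_left_mono) auto
    finally show ?thesis by (simp add: \<xi>_def norm_mult abs_mult del: of_real_mult of_real_add)
  qed
  have ctX: "cont (\<lambda>h. ?te (?X h))" using r0 by (intro continuous_intros)
  have Hp: "H * p = \<Psi> (circle_lift \<xi>)"
  proof -
    have "H * p = B * (hfc H complex_of_real * hfc H (\<lambda>h. ?te (?X h)))"
      by (simp add: p_def hfc_id[OF H] HB[symmetric] mult.assoc[symmetric])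
    also have "hfc H complex_of_real * hfc H (\<lambda>h. ?te (?X h)) = hfc H (\<lambda>h. complex_of_real h * ?te (?X h))"
      by (rule hfc_mult[OF H _ ctX, symmetric]) (intro continuous_intros)
    also have "(\<lambda>h. complex_of_real h * ?te (?X h)) = (\<lambda>h. \<xi> (?X h))"
    proof
      fix h show "complex_of_real h * ?te (?X h) = \<xi> (?X h)"
      proof (cases "\<bar>?X h\<bar> < 1")
        case True 
        from strip_coord_inner[OF r True] show ?thesis by (simp add: \<xi>_def flip: of_real_mult of_real_add)
      next
        case False
        thus ?thesis using z1[of "?X h"] by (simp add: \<xi>_def)
      qed
    qed
    finally show ?thesis using L[OF cx zx] by simp
  qed
  have pH: "p * H = H * p"
    using comB[OF ctX] hfc_comm[OF H refl ctX] by (simp add: p_def mult.assoc) (metis HB mult.assoc)?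
  have HJ: "H * J = J * H"
  proof -
    have "H * J = \<Psi> (circle_lift \<xi>) * J" by (metis Hp pJ mult.assoc)
    also have "\<dots> = J * \<Psi> (circle_lift \<xi>)"
      using Lm[OF zx bx b1(3)] Lm[OF z2' b1(3) bx] by (simp only: J_def mult.commute[of "?ju x" "\<xi> x" for x])
    also have "\<dots> = J * H" by (metis Hp pH Jp mult.assoc)
    finally show ?thesis .
  qed
  have csX: "cont (\<lambda>h. ?st (?X h))" using r0 by (intro continuous_intros)
  have EJ': "E * J = J * E" unfolding E_def by (rule hfc_comm[OF H HJ csX])
  have Ep: "E * p = \<Psi> (circle_lift (\<lambda>x. ?st x * ?te x))"
  proof -
    have "E * p = B * (E * hfc H (\<lambda>h. ?te (?X h)))"
      using comB[OF csX] by (simp add: p_def E_def mult.assoc[symmetric])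
    also have "E * hfc H (\<lambda>h. ?te (?X h)) = hfc H (\<lambda>h. ?st (?X h) * ?te (?X h))"
      unfolding E_def by (rule hfc_mult[OF H csX ctX, symmetric])
    finally show ?thesis using L[of "\<lambda>x. ?st x * ?te x"] z1 cst cte by (simp add: continuous_intros)
  qed
  have bb: "cmod (?st x * ?te x) \<le> 1" for x using b1[of x] by (simp add: norm_mult mult_le_one)
  have EJ: "E * J = \<Psi> (circle_lift (\<lambda>x. ?st x * ?ju x))"
  proof -
    have "E * J = \<Psi> (circle_lift (\<lambda>x. ?st x * ?te x)) * J" by (metis Ep pJ mult.assoc)
    also have "\<dots> = \<Psi> (circle_lift (\<lambda>x. ?st x * ?te x * ?ju x))"
      unfolding J_def by (rule Lm[OF _ bb b1(3)]) (simp add: z1)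
    finally show ?thesis by (simp only: mult.assoc tj)
  qed
  have JJ: "J * J = \<Psi> (circle_lift (\<lambda>x. ?ju x * ?ju x))" unfolding J_def by (rule Lm[OF z2' b1(3) b1(3)])
  have EE: "(E * E - E) * B = \<Psi> (circle_lift (\<lambda>x. ?st x * ?st x - ?st x))"
  proof -
    have z: "?st x * ?st x - ?st x = 0" if "1 / 2 < \<bar>x\<bar>" for x using that by (auto simp: step_fun_def clip_def)
    have "E * E - E = hfc H (\<lambda>h. ?st (?X h) * ?st (?X h) - ?st (?X h))"
      unfolding E_def hfc_mult[OF H csX csX, symmetric] 
      by (rule hfc_minus[OF H _ csX, symmetric]) (intro continuous_intros csX)
    moreover have "hfc H (\<lambda>h. ?st (?X h) * ?st (?X h) - ?st (?X h)) * B = B * hfc H (\<lambda>h. ?st (?X h) * ?st (?X h) - ?st (?X h))"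
      by (rule comB) (intro continuous_intros csX r0)
    moreover have "\<Psi> (circle_lift (\<lambda>x. ?st x * ?st x - ?st x)) = B * hfc H (\<lambda>h. ?st (?X h) * ?st (?X h) - ?st (?X h))"
      by (rule L[OF _ z]) (intro continuous_intros cst)
    ultimately show ?thesis by simp
  qed
  have q: "cmod (?st x * ?st x) \<le> 1" "cmod (?ju x * ?ju x) \<le> 1" "cmod (?st x * ?ju x) \<le> 1" for x
    unfolding norm_mult by (simp_all only: mult_le_one norm_ge_zero b1)
  have bs: "cmod (?st x * ?st x - ?st x) \<le> 2" "cmod (?ju x * ?ju x) \<le> 1" "cmod (?st x * ?ju x) \<le> 1" for x
    using norm_triangle_ineq4[of "?st x * ?st x" "?st x"] b1(1)[of x] q[of x] by linarith+
  have bn: "cmod (- 2 * (?st x * ?ju x)) \<le> 2" for x using bs(3)[of x] by (simp add: norm_mult)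
  have m2: "- (2 * (E * J)) = \<Psi> (circle_lift (\<lambda>x. - 2 * (?st x * ?ju x)))"
  proof -
    have "- (2 * (E * J)) = cof (-2) * (E * J)"
    proof -
      have "cof (-2) = cof (- (1 + 1))" by simp
      also have "\<dots> = - (1 + 1)" by (simp only: cof_add cof_uminus cof_1)
      finally show ?thesis by (simp add: algebra_simps)
    qed
    also have "\<dots> = \<Psi> (\<lambda>z. -2 * circle_lift (\<lambda>x. ?st x * ?ju x) z)"
    proof -
      have "bounded (circle_lift (\<lambda>x. ?st x * ?ju x) ` sphere 0 1)" by (rule bl) (rule bs(3))
      from calc_mult[OF \<Psi> bounded_image_const this, of "-2"] show ?thesis
        by (simp only: EJ calc_const[OF \<Psi>])
    qed
    also have "(\<lambda>z. -2 * circle_lift (\<lambda>x. ?st x * ?ju x) z) = circle_lift (\<lambda>x. - 2 * (?st x * ?ju x))"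
      by (rule ext) (simp add: circle_lift_def)
    finally show ?thesis .
  qed
  have "(E * E - E) * B + J * J + J - 2 * (E * J) = 
    \<Psi> (circle_lift (\<lambda>x. ?st x * ?st x - ?st x)) + \<Psi> (circle_lift (\<lambda>x. ?ju x * ?ju x)) + \<Psi> (circle_lift ?ju) 
    + \<Psi> (circle_lift (\<lambda>x. - 2 * (?st x * ?ju x)))"
    by (simp only: diff_conv_add_uminus[of _ "2 * (E * J)"] EE m2 JJ) (simp only: J_def)
  also have "\<dots> = \<Psi> (circle_lift (\<lambda>x. (?st x * ?st x - ?st x + ?ju x * ?ju x) + (?ju x + - 2 * (?st x * ?ju x))))"
  proof -
    have k: "cmod (?st x * ?st x - ?st x + ?ju x * ?ju x) \<le> 3" "cmod (?ju x + - 2 * (?st x * ?ju x)) \<le> 3" for x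
      using norm_triangle_mono[OF bs(1,2)[of x]] norm_triangle_mono[OF b1(3)[of x] bn[of x]] by simp_all
    show ?thesis using La[OF bs(1,2)] La[OF b1(3) bn] La[OF k] by (simp add: add.assoc)
  qed
  \<comment> \<open>With \<open>s = step_fun x\<close> and \<open>j = jump_fun x\<close> the
    expression is \<open>(s - j)^2 - (s - j)\<close>, and \<open>s - j\<close> is \<open>0\<close>
    or \<open>1\<close>.\<close>
  also have "(\<lambda>x. (?st x * ?st x - ?st x + ?ju x * ?ju x) + (?ju x + - 2 * (?st x * ?ju x))) = (\<lambda>x. 0)"
  proof
    fix x
    show "(?st x * ?st x - ?st x + ?ju x * ?ju x) + (?ju x + - 2 * (?st x * ?ju x)) = 0"
      by (cases "x < 0") (auto simp: jump_fun_def algebra_simps)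
  qed
  also have "\<Psi> (circle_lift (\<lambda>x. 0)) = 0"
  proof -
    have "circle_lift (\<lambda>x. 0) = (\<lambda>_. 0)" by (rule ext) (simp add: circle_lift_def)
    thus ?thesis using calc_const[OF \<Psi>, of 0] by (simp only: cof_0)
  qed
  finally have "(E * E - E) * B + J * J + J - 2 * (E * J) = 0" .
  thus ?thesis using Js Jp pJ HJ EJ' by blast
qed

section \<open>Holes in the joint spectrum\<close>

lemma pos_sig:
  assumes W: "real_structure W" and "pos x" 
  shows "pos (sig W x)"
proof -
  obtain u where u: "fam u" "x = abs_qalg u" "\<And>i n. psd_mat n (u i n)" using assms(2) by (auto simp: pos_def)
  have "psd_mat n (conj_by W n (u i n))" for i n
  proof -
    note uc = fam_carrier[OF u(1), of i n]
    have "psd_mat n (mat_cnj (u i n))"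
      unfolding psd_mat_def
    proof
      fix v :: "complex vec" assume v: "v \<in> carrier_vec n"
      have cv: "conjugate v \<in> carrier_vec n" using v by simp
      have m: "mat_cnj (u i n) *\<^sub>v v = conjugate (u i n *\<^sub>v conjugate v)"
        using uc v by (intro eq_vecI) (auto simp: scalar_prod_def intro!: sum.cong)
      have "(conjugate (u i n *\<^sub>v conjugate v)) \<bullet>c v = cnj ((u i n *\<^sub>v conjugate v) \<bullet>c conjugate v)"
        using uc v by (auto simp: scalar_prod_def intro!: sum.cong)
      moreover have "0 \<le> Re ((u i n *\<^sub>v conjugate v) \<bullet>c conjugate v)"
        using u(3)[of n i] cv unfolding psd_mat_def by blast
      ultimately show "Re ((mat_cnj (u i n) *\<^sub>v v) \<bullet>c v) \<ge> 0" by (simp only: m cnj.simps)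
    qed
    hence "psd_mat n (mat_adjoint (mat_adjoint (W n)) * mat_cnj (u i n) * mat_adjoint (W n))"
      using uc real_structureD[OF W, of n] by (intro psd_mat_adjoint_mult) auto
    thus ?thesis by (simp add: conj_by_def)
  qed
  thus ?thesis using u W unfolding pos_def
    by (intro exI[of _ "\<lambda>i n. conj_by W n (u i n)"]) (auto simp: abs_qalg_sig)
qed

text \<open>In place of a joint calculus for \<open>H\<close> and \<open>N\<close>, positivity is
  used. On the product \<open>w\<close> in question, \<open>(H - a)^2\<close> agrees with a function
  of \<open>H\<close> that is at least \<open>9/4 r^2\<close>, and \<open>N\<close> with a function
  of \<open>N\<close> that is at most \<open>r^2\<close>. As \<open>N - (H - a)^2 = C\<close> is
  positive, \<open>w\<close> is annihilated by an element that is at least \<open>5/4 r^2\<close>,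
  and \<open>pos_cancel\<close> applies.\<close>

lemma hfc_vanish_order:
  assumes H: "sa H" and \<Phi>: "calc (complex_of_real ` {0..c}) N \<Phi>" and N: "sa N" 
    and NC: "N = (H - cof (complex_of_real a)) * (H - cof (complex_of_real a)) + C" and C: "pos C" 
    and HN: "H * N = N * H" and r: "r > 0" and f: "cont f" "\<And>h. \<bar>h - a\<bar> < 3 / 2 * r \<Longrightarrow> f h = 0"
  shows "hfc H f * \<Phi> (\<lambda>z. complex_of_real (max 0 (r - sqrt (Re z)))) = 0"
proof -
  let ?m = "\<lambda>z. complex_of_real (max 0 (r - sqrt (Re z)))" and ?S = "complex_of_real ` {0..c}"
  let ?q = "\<lambda>z. complex_of_real (min (Re z) (r\<^sup>2))"
  let ?p = "\<lambda>h. complex_of_real (max ((h - a)\<^sup>2) ((3 / 2 * r)\<^sup>2))"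
  define w where "w = hfc H f * \<Phi> ?m"
  have cm: "continuous_on A ?m" "continuous_on A ?q" for A by (intro continuous_intros)+
  have bm: "bounded (?m ` ?S)" "bounded (?q ` ?S)" "bounded ((\<lambda>z. z) ` ?S)"
    by (intro bounded_image_cont calc_compact[OF \<Phi>] cm continuous_intros)+
  have cp: "cont ?p" by (intro continuous_intros)
  have c2: "cont (\<lambda>h. complex_of_real (h - a))" by (intro continuous_intros)
  have Ha: "H - cof (complex_of_real a) = hfc H (\<lambda>h. complex_of_real (h - a))"
    using hfc_minus[OF H, of complex_of_real "\<lambda>_. complex_of_real a"] by (simp add: hfc_id[OF H] hfc_const[OF H] continuous_intros)
  have Pw: "hfc H ?p * w = (H - cof (complex_of_real a)) * (H - cof (complex_of_real a)) * w"
  proof -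
    have cc: "cont (\<lambda>h. complex_of_real (h - a) * complex_of_real (h - a))" by (intro continuous_intros)
    have "hfc H ?p * hfc H f = hfc H (\<lambda>h. ?p h * f h)" by (rule hfc_mult[OF H cp f(1), symmetric])
    also have "(\<lambda>h. ?p h * f h) = (\<lambda>h. (complex_of_real (h - a) * complex_of_real (h - a)) * f h)"
    proof
      fix h
      show "?p h * f h = (complex_of_real (h - a) * complex_of_real (h - a)) * f h"
      proof (cases "\<bar>h - a\<bar> < 3 / 2 * r")
        case True thus ?thesis using f(2) by simp
      next
        case False
        hence "(3 / 2 * r)\<^sup>2 \<le> \<bar>h - a\<bar>\<^sup>2" using r by (intro power_mono) auto
        hence "max ((h - a)\<^sup>2) ((3 / 2 * r)\<^sup>2) = (h - a) * (h - a)" by (simp add: power2_eq_square)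
        thus ?thesis by (simp only: of_real_mult)
      qed
    qed
    also have "hfc H \<dots> = hfc H (\<lambda>h. complex_of_real (h - a) * complex_of_real (h - a)) * hfc H f"
      by (rule hfc_mult[OF H cc f(1)])
    also have "hfc H (\<lambda>h. complex_of_real (h - a) * complex_of_real (h - a)) = (H - cof (complex_of_real a)) * (H - cof (complex_of_real a))"
      unfolding Ha by (rule hfc_mult[OF H c2 c2])
    finally show ?thesis unfolding w_def by (simp only: mult.assoc[symmetric])
  qed
  have fN: "N * hfc H f = hfc H f * N" by (rule hfc_comm[OF H HN f(1), symmetric])
  have sN: "star N = N" using N by (simp add: sa_def)
  have Qf: "\<Phi> ?q * hfc H f = hfc H f * \<Phi> ?q"
    by (rule calc_intertwine[OF \<Phi> \<Phi> fN _ cm(2)]) (simp add: sN fN)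
  have Qw: "\<Phi> ?q * w = N * w"
  proof -
    have "\<Phi> ?q * \<Phi> ?m = \<Phi> (\<lambda>z. ?q z * ?m z)" by (rule calc_mult[OF \<Phi> bm(2,1), symmetric])
    also have "\<dots> = \<Phi> (\<lambda>z. z * ?m z)"
    proof (rule calc_cong[OF \<Phi>])
      fix z assume "z \<in> ?S"
      then obtain t where t: "z = complex_of_real t" "t \<ge> 0" by auto
      show "?q z * ?m z = z * ?m z"
      proof (cases "t \<le> r\<^sup>2")
        case True thus ?thesis using t by simp
      next
        case False
        hence "sqrt (r\<^sup>2) \<le> sqrt t" by (intro real_sqrt_le_mono) simp
        hence "r \<le> sqrt t" using r by simp
        thus ?thesis using t by simp
      qed
    qed
    also have "\<dots> = N * \<Phi> ?m" using calc_mult[OF \<Phi> bm(3,1)] by (simp only: calc_id[OF \<Phi>])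
    finally have "\<Phi> ?q * \<Phi> ?m = N * \<Phi> ?m" .
    have "\<Phi> ?q * w = (\<Phi> ?q * hfc H f) * \<Phi> ?m" by (simp only: w_def mult.assoc)
    also have "\<dots> = hfc H f * (\<Phi> ?q * \<Phi> ?m)" by (simp only: Qf mult.assoc)
    also have "\<dots> = (hfc H f * N) * \<Phi> ?m" by (simp only: \<open>\<Phi> ?q * \<Phi> ?m = N * \<Phi> ?m\<close> mult.assoc)
    also have "\<dots> = N * w" by (simp only: fN[symmetric] w_def mult.assoc)
    finally show ?thesis .
  qed
  have z: "(hfc H ?p - \<Phi> ?q + C) * w = 0"
    using Pw Qw by (simp add: NC distrib_right left_diff_distrib)
  have p1: "pos (hfc H ?p - cof (complex_of_real (9 / 4 * r\<^sup>2)))"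
  proof -
    have "hfc H ?p - cof (complex_of_real (9 / 4 * r\<^sup>2)) = hfc H (\<lambda>h. complex_of_real (max ((h - a)\<^sup>2) ((3 / 2 * r)\<^sup>2) - 9 / 4 * r\<^sup>2))"
      using hfc_minus[OF H cp, of "\<lambda>_. complex_of_real (9 / 4 * r\<^sup>2)"] by (simp add: hfc_const[OF H])
    also have "pos \<dots>"
    proof (rule hfc_pos[OF H])
      show "continuous_on UNIV (\<lambda>h. max ((h - a)\<^sup>2) ((3 / 2 * r)\<^sup>2) - 9 / 4 * r\<^sup>2)" by (intro continuous_intros)
      show "0 \<le> max ((h - a)\<^sup>2) ((3 / 2 * r)\<^sup>2) - 9 / 4 * r\<^sup>2" for h by (simp add: power_mult_distrib power_divide)
    qed
    finally show ?thesis .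
  qed
  have p2: "pos (cof (complex_of_real (r\<^sup>2)) - \<Phi> ?q)"
  proof -
    have "cof (complex_of_real (r\<^sup>2)) - \<Phi> ?q = \<Phi> (\<lambda>z. complex_of_real (r\<^sup>2) - ?q z)"
      using calc_minus[OF \<Phi> bounded_image_const bm(2), of "complex_of_real (r\<^sup>2)"] by (simp only: calc_const[OF \<Phi>])
    also have "pos \<dots>"
    proof (rule calc_pos[OF \<Phi>])
      show "bounded ((\<lambda>z. complex_of_real (r\<^sup>2) - ?q z) ` ?S)"
        by (intro bounded_image_cont calc_compact[OF \<Phi>] continuous_intros)
    qed auto
    finally show ?thesis .
  qed
  have "pos ((hfc H ?p - \<Phi> ?q + C) - cof (complex_of_real (5 / 4 * r\<^sup>2)))"
  proof -
    have "(hfc H ?p - \<Phi> ?q + C) - cof (complex_of_real (5 / 4 * r\<^sup>2)) = 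
      (hfc H ?p - cof (complex_of_real (9 / 4 * r\<^sup>2))) + (cof (complex_of_real (r\<^sup>2)) - \<Phi> ?q) + C"
    proof -
      have "complex_of_real (9 / 4 * r\<^sup>2) = complex_of_real (5 / 4 * r\<^sup>2) + complex_of_real (r\<^sup>2)" by simp
      hence "cof (complex_of_real (9 / 4 * r\<^sup>2)) = cof (complex_of_real (5 / 4 * r\<^sup>2)) + cof (complex_of_real (r\<^sup>2))"
        by (simp only: cof_add)
      thus ?thesis by (simp only: add_diff_eq diff_add_eq diff_diff_eq2 add_ac diff_diff_eq) (simp add: algebra_simps)
    qed
    thus ?thesis using pos_add[OF pos_add[OF p1 p2] C] by (simp only:)
  qed
  from pos_cancel[OF this _ z] show ?thesis using r by (simp add: w_def)
qed

text \<open>\<open>X + D\<close> differs from \<open>X\<close> only near \<open>(a, b)\<close>, and has no spectrum in the disc of radius \<open>r\<close>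
  around this point.\<close>

definition hole_push :: "qalg \<Rightarrow> qalg \<Rightarrow> real \<Rightarrow> real \<Rightarrow> real \<Rightarrow> qalg \<Rightarrow> bool" where
  "hole_push H K r a b D \<longleftrightarrow> H * D = D * H \<and> K * D = D * K \<and> D * star D = star D * D \<and> nb D r \<and>
    (\<forall>f. cont f \<longrightarrow> (\<forall>h. \<bar>h - a\<bar> < 3 / 2 * r \<longrightarrow> f h = 0) \<longrightarrow> hfc H f * D = 0) \<and>
    (\<forall>f. cont f \<longrightarrow> (\<forall>h. \<bar>h - b\<bar> < 3 / 2 * r \<longrightarrow> f h = 0) \<longrightarrow> hfc K f * D = 0) \<and>
    pos (star (H + cof \<i> * K - cof (Complex a b) + D) * (H + cof \<i> * K - cof (Complex a b) + D) - cof (complex_of_real (r\<^sup>2)))"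

lemma commute_minus_cof:
  assumes "x * y = y * x"
  shows "(x - cof s) * (y - cof t) = (y - cof t) * (x - cof s)"
  by (simp only: left_diff_distrib right_diff_distrib assms cof_commute[of x] cof_commute[of y] cof_commute[of "cof s"])
    (simp add: algebra_simps)

lemma cart_norm_sq:
  fixes a b :: real
  assumes H: "sa H" and K: "sa K" and HK: "H * K = K * H"
  defines "T \<equiv> H + cof \<i> * K - cof (Complex a b)"
  shows "star T * T = (H - cof (complex_of_real a)) * (H - cof (complex_of_real a)) + (K - cof (complex_of_real b)) * (K - cof (complex_of_real b))"
    and "T * star T = star T * T"
proof -
  let ?A = "H - cof (complex_of_real a)" and ?B = "K - cof (complex_of_real b)"
  have AB: "?A * ?B = ?B * ?A" by (rule commute_minus_cof[OF HK])
  have "Complex a b = complex_of_real a + \<i> * complex_of_real b" by (simp add: complex_eq_iff)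
  hence "cof (Complex a b) = cof (complex_of_real a) + cof \<i> * cof (complex_of_real b)" by (simp only: cof_add cof_mult)
  hence T: "T = ?A + cof \<i> * ?B" by (simp add: T_def algebra_simps)
  have sAB: "star ?A = ?A" "star ?B = ?B" using H K by (simp_all add: star_diff star_cof sa_def)
  have Ts: "star T = ?A - cof \<i> * ?B"
    unfolding T star_add star_mult sAB star_cof by (simp add: cof_uminus cof_commute)
  have ii: "cof \<i> * cof \<i> = -1" by (simp flip: cof_mult cof_uminus) (simp add: cof_uminus)
  have iA: "cof \<i> * ?B * ?A = ?A * (cof \<i> * ?B)" 
    by (metis AB cof_commute mult.assoc)
  have iB: "cof \<i> * ?B * (cof \<i> * ?B) = - (?B * ?B)"
  proof -
    have "cof \<i> * ?B * (cof \<i> * ?B) = (cof \<i> * cof \<i>) * (?B * ?B)" by (metis cof_commute mult.assoc)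
    thus ?thesis by (simp add: ii)
  qed
  have sq: "(x - y) * (x + y) = x * x - y * y" "(x + y) * (x - y) = x * x - y * y" if "y * x = x * y" for x y :: qalg
    using that by (simp_all add: algebra_simps)
  show "star T * T = ?A * ?A + ?B * ?B"
    unfolding Ts unfolding T sq(1)[OF iA] iB by simp
  moreover have "T * star T = ?A * ?A + ?B * ?B"
    unfolding Ts unfolding T sq(2)[OF iA] iB by simp
  ultimately show "T * star T = star T * T" by simp
qed

text \<open>Let \<open>T = V |T|\<close> be the polar decomposition of \<open>X\<close> minus the
  point. Then \<open>D = V max (0, r - |T|)\<close> has norm at most \<open>r\<close>, and
  \<open>T + D = V max (|T|, r)\<close> is bounded below by \<open>r\<close>. Normality of
  \<open>T\<close> makes \<open>V\<close> commute with \<open>|T|\<close>, so \<open>D\<close> is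
  normal and commutes with \<open>T\<close> and its adjoint, hence with \<open>H\<close> and
  \<open>K\<close>. For \<open>b = 0\<close> the point is fixed by \<open>sig W\<close>, and with it
  \<open>T\<close>, \<open>V\<close> and \<open>D\<close>.\<close>

lemma hole_push_exists:
  assumes W: "real_structure W" and H: "sa H" and K: "sa K" and HK: "H * K = K * H" and r: "r > 0"
  shows "\<exists>D. hole_push H K r a b D \<and> (b = 0 \<longrightarrow> sig W H = H \<longrightarrow> sig W K = - K \<longrightarrow> sig W D = D)"
proof -
  define T where "T = H + cof \<i> * K - cof (Complex a b)"
  define N where "N = star T * T"
  have NC: "N = (H - cof (complex_of_real a)) * (H - cof (complex_of_real a)) + (K - cof (complex_of_real b)) * (K - cof (complex_of_real b))"
    and TT: "T * star T = N" unfolding N_def T_def by (rule cart_norm_sq[OF H K HK])+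
  have sN: "star N = N" by (simp add: N_def star_mult)
  hence saN: "sa N" by (simp add: sa_def)
  have HT: "H * T = T * H" "K * T = T * K"
    unfolding T_def using HK by (simp_all add: algebra_simps cof_commute) (metis cof_commute mult.assoc)+
  have HTs: "H * star T = star T * H" "K * star T = star T * K"
    using arg_cong[OF HT(1), of star] arg_cong[OF HT(2), of star] H K by (simp_all add: star_mult sa_def)
  have HN: "H * N = N * H" "K * N = N * K" unfolding N_def by (metis HT HTs mult.assoc)+
  obtain V \<Phi> c where V: "unitary V" and "0 \<le> c" and \<Phi>: "calc (complex_of_real ` {0..c}) N \<Phi>"
    and TV: "T = V * \<Phi> (\<lambda>z. complex_of_real (sqrt (Re z)))" and sV: "sig W T = T \<Longrightarrow> sig W V = V"
    using polar[OF W, of T] unfolding N_def by blast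
  let ?S = "complex_of_real ` {0..c}"
  have V1: "star V * V = 1" "V * star V = 1" using V by (auto simp: unitary_def)
  let ?s = "\<lambda>z. complex_of_real (sqrt (Re z))" and ?m = "\<lambda>z. complex_of_real (max 0 (r - sqrt (Re z)))"
  define R where "R = \<Phi> ?s"
  define M where "M = \<Phi> ?m"
  have cc: "continuous_on A ?s" "continuous_on A ?m" for A by (intro continuous_intros)+
  have bd: "bounded (?s ` ?S)" "bounded (?m ` ?S)" by (intro bounded_image_cont calc_compact[OF \<Phi>] cc)+
  have RR: "R * R = N"
  proof -
    have "R * R = \<Phi> (\<lambda>z. ?s z * ?s z)" unfolding R_def by (rule calc_mult[OF \<Phi> bd(1,1), symmetric])
    also have "\<dots> = \<Phi> (\<lambda>z. z)" by (rule calc_cong[OF \<Phi>]) (auto simp flip: of_real_mult)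
    finally show ?thesis by (simp only: calc_id[OF \<Phi>])
  qed
  have Rs: "star R = R" using calc_cnj[OF \<Phi> bd(1)] by (simp add: R_def)
  have Ms: "star M = M" using calc_cnj[OF \<Phi> bd(2)] by (simp add: M_def)
  have RM: "R * M = M * R" 
    using calc_mult[OF \<Phi> bd] calc_mult[OF \<Phi> bd(2,1)] by (simp add: R_def M_def mult.commute)
  have TVR: "T = V * R" using TV by (simp add: R_def)
  \<comment> \<open>Here normality enters: \<open>N\<close> is also \<open>T * star T\<close>, that
    is, \<open>V * N * star V\<close>.\<close>
  have VN: "N * V = V * N"
  proof -
    have "N = V * (R * R) * star V" using TT unfolding TVR star_mult Rs by (simp only: mult.assoc)
    hence "N * V = V * N * star V * V" unfolding RR by (rule arg_cong)
    also have "\<dots> = V * N * (star V * V)" by (simp only: mult.assoc)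
    finally show ?thesis by (simp only: V1 mult_1_right)
  qed
  have VR: "R * V = V * R"
    unfolding R_def by (rule calc_intertwine[OF \<Phi> \<Phi> VN _ cc(1)]) (simp add: sN VN)
  have VM: "M * V = V * M"
    unfolding M_def by (rule calc_intertwine[OF \<Phi> \<Phi> VN _ cc(2)]) (simp add: sN VN)
  have VsM: "M * star V = star V * M" using arg_cong[OF VM, of star] by (simp add: star_mult Ms)
  have VsR: "R * star V = star V * R" using arg_cong[OF VR, of star] by (simp add: star_mult Rs)
  define D where "D = V * M"
  have Ds: "star D = star V * M" by (simp add: D_def star_mult Ms VsM)
  have TD: "T * D = D * T" unfolding TVR D_def using RM VM VR by (metis mult.assoc)
  have TsD: "star T * D = D * star T"
  proof -
    have "star T * D = R * M" unfolding TVR star_mult Rs D_def by (metis V1(1) mult.assoc mult_1)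
    moreover have "D * star T = M * R" unfolding TVR star_mult Rs D_def 
      by (metis VM VR V1(2) VsR mult.assoc mult_1_right)
    ultimately show ?thesis by (simp add: RM)
  qed
  have cT: "T + cof (Complex a b) = H + cof \<i> * K" "star T + star (cof (Complex a b)) = H - cof \<i> * K"
  proof -
    show "T + cof (Complex a b) = H + cof \<i> * K" by (simp add: T_def)
    have "star T + star (cof (Complex a b)) = star (H + cof \<i> * K)" by (simp add: T_def star_diff)
    also have "\<dots> = H - cof \<i> * K" using H K by (simp add: sa_def star_add star_mult star_cof cof_uminus cof_commute)
    finally show "star T + star (cof (Complex a b)) = H - cof \<i> * K" .
  qed
  have X1: "(H + cof \<i> * K) * D = D * (H + cof \<i> * K)"
    unfolding cT(1)[symmetric] by (simp add: distrib_left distrib_right TD cof_commute)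
  have X2: "(H - cof \<i> * K) * D = D * (H - cof \<i> * K)"
    unfolding cT(2)[symmetric] by (simp add: distrib_left distrib_right TsD cof_commute star_cof)
  have half: "cof (1/2) * ((H + cof \<i> * K) + (H - cof \<i> * K)) = H"
  proof -
    have "(H + cof \<i> * K) + (H - cof \<i> * K) = cof (1 + 1) * H" 
      by (simp only: cof_add distrib_right cof_1 mult_1_left) simp
    thus ?thesis by (simp add: mult.assoc[symmetric] flip: cof_mult)
  qed
  have half': "cof (- \<i> / 2) * ((H + cof \<i> * K) - (H - cof \<i> * K)) = K"
  proof -
    have "(H + cof \<i> * K) - (H - cof \<i> * K) = cof (\<i> + \<i>) * K" 
      by (simp only: cof_add distrib_right) simp
    thus ?thesis by (simp add: mult.assoc[symmetric] flip: cof_mult)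
  qed
  have HD: "H * D = D * H"
    by (subst (1 2) half[symmetric]) (metis (no_types, lifting) X1 X2 cof_commute distrib_left distrib_right mult.assoc)
  have KD: "K * D = D * K"
    by (subst (1 2) half'[symmetric]) (metis (no_types, lifting) X1 X2 cof_commute right_diff_distrib left_diff_distrib mult.assoc)
  have DD: "D * star D = star D * D"
  proof -
    have "D * star D = M * M" unfolding Ds unfolding D_def by (metis V1(2) VM VsM mult.assoc mult_1_right)
    moreover have "star D * D = M * M" unfolding Ds unfolding D_def by (metis V1(1) VM VsM mult.assoc mult_1_right)
    ultimately show ?thesis by simp
  qed
  have "nb M r" unfolding M_def by (rule calc_nb[OF \<Phi>]) (use r in auto)
  hence nD: "nb D r" using nb_mult[OF nb_unitary[OF V], of M r] r by (simp add: D_def)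
  have sq: "pos ((x - cof (complex_of_real t)) * (x - cof (complex_of_real t)))" if "sa x" for x t
    using pos_star_mult[of "x - cof (complex_of_real t)"] that by (simp add: star_diff star_cof sa_def)
  have vH: "hfc H f * D = 0" if "cont f" "\<And>h. \<bar>h - a\<bar> < 3 / 2 * r \<Longrightarrow> f h = 0" for f
    using hfc_vanish_order[OF H \<Phi> saN NC sq[OF K] HN(1) r that] VM by (simp add: D_def M_def[symmetric]) (metis mult.assoc mult_zero_left)
  have NC': "N = (K - cof (complex_of_real b)) * (K - cof (complex_of_real b)) + (H - cof (complex_of_real a)) * (H - cof (complex_of_real a))"
    using NC by (simp add: add.commute)
  have vK: "hfc K f * D = 0" if "cont f" "\<And>h. \<bar>h - b\<bar> < 3 / 2 * r \<Longrightarrow> f h = 0" for f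
    using hfc_vanish_order[OF K \<Phi> saN NC' sq[OF H] HN(2) r that] VM by (simp add: D_def M_def[symmetric]) (metis mult.assoc mult_zero_left)
  have p: "pos (star (T + D) * (T + D) - cof (complex_of_real (r\<^sup>2)))"
  proof -
    let ?g = "\<lambda>z. ?s z + ?m z"
    have bg: "bounded (?g ` ?S)" by (rule bounded_image_add[OF bd])
    have g: "\<Phi> ?g = R + M" unfolding R_def M_def by (rule calc_add[OF \<Phi> bd])
    have "T + D = V * (R + M)" by (simp add: TVR D_def distrib_left)
    hence "star (T + D) * (T + D) = (R + M) * (star V * V) * (R + M)"
      by (simp add: star_mult star_add Rs Ms mult.assoc)
    hence "star (T + D) * (T + D) = \<Phi> (\<lambda>z. ?g z * ?g z)"
      using calc_mult[OF \<Phi> bg bg] by (simp add: V1 g)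
    hence "star (T + D) * (T + D) - cof (complex_of_real (r\<^sup>2)) = \<Phi> (\<lambda>z. ?g z * ?g z - complex_of_real (r\<^sup>2))"
      using calc_minus[OF \<Phi> bounded_image_mult[OF bg bg] bounded_image_const, of "complex_of_real (r\<^sup>2)"] 
      by (simp only: calc_const[OF \<Phi>])
    also have "pos \<dots>"
    proof (rule calc_pos[OF \<Phi>])
      show "bounded ((\<lambda>z. ?g z * ?g z - complex_of_real (r\<^sup>2)) ` ?S)"
        by (intro bounded_image_cont calc_compact[OF \<Phi>] continuous_intros)
      fix z assume "z \<in> ?S"
      then obtain t where t: "z = complex_of_real t" by auto
      let ?G = "sqrt t + max 0 (r - sqrt t)"
      have e: "?g z * ?g z - complex_of_real (r\<^sup>2) = complex_of_real (?G * ?G - r\<^sup>2)" by (simp add: t)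
      have "r * r \<le> ?G * ?G" using r by (intro mult_mono) auto
      thus "?g z * ?g z - complex_of_real (r\<^sup>2) \<in> \<real> \<and> 0 \<le> Re (?g z * ?g z - complex_of_real (r\<^sup>2))"
        unfolding e by (simp add: power2_eq_square)
    qed
    finally show ?thesis .
  qed
  have sD: "sig W D = D" if "b = 0" "sig W H = H" "sig W K = - K"
  proof -
    have "sig W T = T" using that 
      by (simp add: T_def sig_add[OF W] sig_diff[OF W] sig_mult[OF W] sig_cof[OF W] cof_uminus complex_cnj_complex_of_real Complex_eq)
    hence "sig W V = V" "sig W N = N" using sV by (auto simp: N_def sig_mult[OF W] sig_star[OF W])
    moreover have "M = hfc N (\<lambda>t. complex_of_real (max 0 (r - sqrt t)))"
      unfolding M_def by (rule hfc_eq[OF saN \<Phi>, symmetric]) (intro continuous_intros)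
    moreover have "sig W (hfc N (\<lambda>t. complex_of_real (max 0 (r - sqrt t)))) = hfc (sig W N) (\<lambda>t. complex_of_real (max 0 (r - sqrt t)))"
      by (subst hfc_sig[OF saN W]) (auto intro!: continuous_intros)
    ultimately show ?thesis by (simp add: D_def sig_mult[OF W])
  qed
  have "hole_push H K r a b D"
    unfolding hole_push_def T_def[symmetric] using HD KD DD nD vH vK p by blast
  thus ?thesis using sD by blast
qed

text \<open>\<open>sig W\<close> reflects the spectrum in the real axis: it fixes \<open>H\<close>,
  negates \<open>K\<close> and conjugates scalars.\<close>

lemma hole_push_sig:
  assumes W: "real_structure W" and H: "sa H" "sig W H = H" and K: "sa K" "sig W K = - K"
    and D: "hole_push H K r a b D"
  shows "hole_push H K r a (- b) (sig W D)"
proof -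
  have d: "H * D = D * H" "K * D = D * K" "D * star D = star D * D" "nb D r"
    "\<And>f. cont f \<Longrightarrow> (\<And>h. \<bar>h - a\<bar> < 3 / 2 * r \<Longrightarrow> f h = 0) \<Longrightarrow> hfc H f * D = 0"
    "\<And>f. cont f \<Longrightarrow> (\<And>h. \<bar>h - b\<bar> < 3 / 2 * r \<Longrightarrow> f h = 0) \<Longrightarrow> hfc K f * D = 0"
    "pos (star (H + cof \<i> * K - cof (Complex a b) + D) * (H + cof \<i> * K - cof (Complex a b) + D) - cof (complex_of_real (r\<^sup>2)))"
    using D unfolding hole_push_def by blast+
  have "H * sig W D = sig W D * H" using arg_cong[OF d(1), of "sig W"] by (simp add: sig_mult[OF W] H)
  moreover have "K * sig W D = sig W D * K" using arg_cong[OF d(2), of "sig W"] by (simp add: sig_mult[OF W] K)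
  moreover have "sig W D * star (sig W D) = star (sig W D) * sig W D" 
    using arg_cong[OF d(3), of "sig W"] by (simp add: sig_mult[OF W] sig_star[OF W])
  moreover have "nb (sig W D) r" by (rule nb_sig[OF W d(4)])
  moreover have "hfc H f * sig W D = 0" if f: "cont f" "\<And>h. \<bar>h - a\<bar> < 3 / 2 * r \<Longrightarrow> f h = 0" for f
  proof -
    have cf: "cont (\<lambda>h. cnj (f h))" using f(1) by (rule continuous_on_cnj)
    have "hfc H (\<lambda>h. cnj (f h)) * D = 0" by (rule d(5)[OF cf]) (use f(2) in auto)
    from arg_cong[OF this, of "sig W"] show ?thesis
      using hfc_sig[OF H(1) W cf] by (simp add: sig_mult[OF W] sig_0[OF W] H)
  qed
  moreover have "hfc K f * sig W D = 0" if f: "cont f" "\<And>h. \<bar>h - - b\<bar> < 3 / 2 * r \<Longrightarrow> f h = 0" for f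
  proof -
    have cf': "cont (\<lambda>h. f (- h))" by (rule continuous_on_compose2[OF f(1)]) (auto intro: continuous_intros)
    hence cf: "cont (\<lambda>h. cnj (f (- h)))" by (rule continuous_on_cnj)
    have "f (- h) = 0" if "\<bar>h - b\<bar> < 3 / 2 * r" for h using f(2)[of "- h"] that by (simp add: abs_minus_commute)
    hence "hfc K (\<lambda>h. cnj (f (- h))) * D = 0" by (intro d(6)[OF cf]) auto
    moreover have "sig W (hfc K (\<lambda>h. cnj (f (- h)))) = hfc K f"
      using hfc_sig[OF K(1) W cf] hfc_uminus[OF K(1) cf'] by (simp add: K)
    ultimately show ?thesis using arg_cong[of _ 0 "sig W"] by (metis sig_0[OF W] sig_mult[OF W])
  qed
  moreover have "pos (star (H + cof \<i> * K - cof (Complex a (- b)) + sig W D) * (H + cof \<i> * K - cof (Complex a (- b)) + sig W D) - cof (complex_of_real (r\<^sup>2)))"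
  proof -
    have "cnj (Complex a b) = Complex a (- b)" by (simp add: complex_eq_iff)
    hence "sig W (H + cof \<i> * K - cof (Complex a b) + D) = H + cof \<i> * K - cof (Complex a (- b)) + sig W D"
      by (simp add: sig_add[OF W] sig_diff[OF W] sig_mult[OF W] sig_cof[OF W] H K cof_uminus)
    thus ?thesis using pos_sig[OF W d(7)] by (simp add: sig_diff[OF W] sig_mult[OF W] sig_star[OF W] sig_cof[OF W])
  qed
  ultimately show ?thesis unfolding hole_push_def by blast
qed

section \<open>Simultaneous pushes at separated points\<close>

lemma sum_orthogonal:
  fixes f :: "'a \<Rightarrow> 'b \<Rightarrow> 'c :: comm_monoid_add"
  assumes "finite L" "\<And>l m. l \<in> L \<Longrightarrow> m \<in> L \<Longrightarrow> l \<noteq> m \<Longrightarrow> g l m = (0 :: 'c)"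
  shows "(\<Sum>l\<in>L. \<Sum>m\<in>L. g l m) = (\<Sum>l\<in>L. g l l)"
proof (rule sum.cong)
  fix l assume l: "l \<in> L"
  have "(\<Sum>m\<in>L. g l m) = g l l + (\<Sum>m\<in>L-{l}. g l m)" by (rule sum.remove[OF assms(1) l])
  also have "(\<Sum>m\<in>L-{l}. g l m) = 0" by (rule sum.neutral) (use assms l in auto)
  finally show "(\<Sum>m\<in>L. g l m) = g l l" by simp
qed simp

lemma sum_single:
  assumes "finite L" "l \<in> L" "\<And>m. m \<in> L \<Longrightarrow> m \<noteq> l \<Longrightarrow> g m = (0 :: 'c :: comm_monoid_add)"
  shows "(\<Sum>m\<in>L. g m) = g l"
proof -
  have "(\<Sum>m\<in>L. g m) = g l + (\<Sum>m\<in>L-{l}. g m)" by (rule sum.remove[OF assms(1,2)])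
  also have "(\<Sum>m\<in>L-{l}. g m) = 0" by (rule sum.neutral) (use assms in auto)
  finally show ?thesis by simp
qed

text \<open>It is \<open>1\<close> up to distance \<open>3/2 r\<close>, the range on which a
  \<open>hole_push\<close> is supported, and \<open>0\<close> from distance \<open>2 r\<close> on,
  so that bumps at points \<open>4 r\<close> apart have product zero.\<close>

definition bump :: "real \<Rightarrow> real \<Rightarrow> real \<Rightarrow> complex" where
  "bump r a h = complex_of_real (clip 0 1 (4 - 2 * \<bar>h - a\<bar> / r))"

lemma cont_bump: "r > 0 \<Longrightarrow> cont (bump r a)"
  unfolding bump_def by (intro continuous_intros) auto

lemma bump_1: "r > 0 \<Longrightarrow> \<bar>h - a\<bar> \<le> 3 / 2 * r \<Longrightarrow> bump r a h = 1"
  by (auto simp: bump_def clip_def field_simps min_def)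

lemma bump_0: "r > 0 \<Longrightarrow> 2 * r \<le> \<bar>h - a\<bar> \<Longrightarrow> bump r a h = 0"
  by (auto simp: bump_def clip_def field_simps min_def max_def)

lemma commute_mult: "x * y = y * x \<Longrightarrow> x * z = z * x \<Longrightarrow> x * (y * z) = (y * z) * (x :: 'a :: semigroup_mult)"
  by (metis mult.assoc)

lemma commute_add: "x * y = y * x \<Longrightarrow> x * z = z * x \<Longrightarrow> x * (y + z) = (y + z) * (x :: 'a :: ring)"
  by (simp add: algebra_simps)

lemma commute_diff: "x * y = y * x \<Longrightarrow> x * z = z * x \<Longrightarrow> x * (y - z) = (y - z) * (x :: 'a :: ring)"
  by (simp add: algebra_simps)

lemma commute_sum: "(\<And>l. l \<in> L \<Longrightarrow> x * f l = f l * x) \<Longrightarrow> x * sum f L = sum f L * (x :: 'a :: ring)"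
  by (simp add: sum_distrib_left sum_distrib_right)

lemma hfc_mult_bump:
  assumes "sa x" "cont f" "r > 0" "\<And>h. 3 / 2 * r < \<bar>h - a\<bar> \<Longrightarrow> f h = 0"
  shows "hfc x f * hfc x (bump r a) = hfc x f"
proof -
  have "(\<lambda>h. f h * bump r a h) = f"
  proof
    fix h show "f h * bump r a h = f h" using assms(4)[of h] bump_1[OF assms(3), of h a] by (cases "3 / 2 * r < \<bar>h - a\<bar>") auto
  qed
  thus ?thesis using hfc_mult[OF assms(1,2) cont_bump[OF assms(3)], of a] by simp
qed

lemma hfc_mult_0:
  assumes "sa x" "cont f" "cont g" "\<And>h. f h * g h = 0"
  shows "hfc x f * hfc x g = 0"
  using hfc_mult[OF assms(1-3)] assms(4) hfc_const[OF assms(1), of 0] by simp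

text \<open>Where \<open>f\<close> is nonzero, \<open>h - a\<close> equals its clipping to
  \<open>[-k, k]\<close>; \<open>y\<close> is this clipped function of \<open>x\<close>.\<close>

lemma hfc_approx:
  assumes x: "sa x" and f: "cont f" "\<And>h. k < \<bar>h - a\<bar> \<Longrightarrow> f h = 0" and k: "0 \<le> k"
  shows "\<exists>y. nb y k \<and> x * hfc x f = (cof (complex_of_real a) + y) * hfc x f"
proof -
  let ?c = "\<lambda>h. complex_of_real (clip (-k) k (h - a))"
  have cc: "cont ?c" by (intro continuous_intros)
  have "hfc x complex_of_real * hfc x f = hfc x (\<lambda>h. complex_of_real h * f h)"
    by (rule hfc_mult[OF x _ f(1), symmetric]) (intro continuous_intros)
  also have "(\<lambda>h. complex_of_real h * f h) = (\<lambda>h. (complex_of_real a + ?c h) * f h)"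
  proof
    fix h
    show "complex_of_real h * f h = (complex_of_real a + ?c h) * f h"
    proof (cases "k < \<bar>h - a\<bar>")
      case False
      hence "clip (-k) k (h - a) = h - a" by (auto simp: clip_def)
      thus ?thesis by simp
    qed (simp add: f(2))
  qed
  also have "hfc x \<dots> = hfc x (\<lambda>h. complex_of_real a + ?c h) * hfc x f"
    by (rule hfc_mult[OF x _ f(1)]) (intro continuous_intros)
  also have "hfc x (\<lambda>h. complex_of_real a + ?c h) = cof (complex_of_real a) + hfc x ?c"
    using hfc_add[OF x _ cc, of "\<lambda>_. complex_of_real a"] hfc_const[OF x] by simp
  finally have "x * hfc x f = (cof (complex_of_real a) + hfc x ?c) * hfc x f" by (simp only: hfc_id[OF x])
  moreover have "nb (hfc x ?c) k" by (rule hfc_nb'[OF x cc]) (use k in \<open>auto simp: clip_def\<close>)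
  ultimately show ?thesis by blast
qed

text \<open>If \<open>x\<close> is close to \<open>a'\<close> on the range of \<open>e\<close>, spectral parts of \<open>x\<close> away from \<open>a'\<close> annihilate \<open>e\<close>.\<close>

lemma hfc_vanish_local:
  assumes x: "sa x" and f: "cont f" "\<And>h. k < \<bar>h - a\<bar> \<Longrightarrow> f h = 0" and k: "0 \<le> k"
    and e: "x * e = e * x" "x * e = (cof (complex_of_real a') + y) * e" and y: "nb y k'" "0 \<le> k'"
    and d: "k + k' < \<bar>a' - a\<bar>"
  shows "hfc x f * e = 0"
proof -
  obtain z where z: "nb z k" "x * hfc x f = (cof (complex_of_real a) + z) * hfc x f" using hfc_approx[OF x f k] by blast
  have fe: "hfc x f * e = e * hfc x f" by (rule hfc_comm[OF x e(1) f(1)])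
  have "(cof (complex_of_real a') + y) * (hfc x f * e) = (cof (complex_of_real a) + z) * (hfc x f * e)"
  proof -
    have "(cof (complex_of_real a') + y) * (hfc x f * e) = (x * e) * hfc x f" by (simp only: e(2) fe mult.assoc)
    also have "\<dots> = x * hfc x f * e" by (simp only: fe mult.assoc)
    finally show ?thesis by (simp only: z(2) mult.assoc)
  qed
  hence "cof (complex_of_real (a' - a)) * (hfc x f * e) = (z - y) * (hfc x f * e)"
    by (simp add: cof_diff distrib_right left_diff_distrib) (simp add: algebra_simps)
  thus ?thesis
    by (rule nb_contract[OF _ nb_diff[OF z(1) y(1)]]) (use d k y in \<open>auto simp del: of_real_diff\<close>)
qed

text \<open>An open square of half side \<open>r\<close> around each point misses the joint
  spectrum; products of functions of one variable express this without a joint calculus.\<close>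

definition hole_family :: "(real \<times> real) set \<Rightarrow> real \<Rightarrow> qalg \<Rightarrow> qalg \<Rightarrow> bool" where
  "hole_family L r H K \<longleftrightarrow> (\<forall>(a,b)\<in>L. \<forall>f g. hole_at a r f \<longrightarrow> hole_at b r g \<longrightarrow> hfc H f * hfc K g = 0)"

text \<open>The pushes do not interfere: \<open>D l\<close> lives under the cut-off
  \<open>e l\<close>, a product of bumps in \<open>H\<close> and \<open>K\<close>, and distinct
  cut-offs have product zero. To see that a product \<open>w\<close> supported at a hole vanishes,
  \<open>1\<close> is split into the cut-offs and the rest \<open>z\<close>. The disc of radius
  \<open>r\<close> becomes a square of half side \<open>r / 2\<close>, whose corners are at distance
  less than \<open>r\<close>.\<close>

lemma holes_exist:
  assumes W: "real_structure W" and H: "sa H" "sig W H = H" and K: "sa K" "sig W K = - K" and HK: "H * K = K * H"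
    and r: "r > 0" and d: "4 * r \<le> d" and L: "finite L" "\<And>a b. (a, b) \<in> L \<Longrightarrow> (a, - b) \<in> L"
    "\<And>a b a' b'. (a, b) \<in> L \<Longrightarrow> (a', b') \<in> L \<Longrightarrow> (a, b) \<noteq> (a', b') \<Longrightarrow> d \<le> \<bar>a - a'\<bar> \<or> d \<le> \<bar>b - b'\<bar>"
  shows "\<exists>H' K'. sa H' \<and> sa K' \<and> H' * K' = K' * H' \<and> sig W H' = H' \<and> sig W K' = - K' \<and>
    nb (H' - H) (real (card L) * r) \<and> nb (K' - K) (real (card L) * r) \<and> hole_family L (r / 2) H' K'"
proof -
  have "\<forall>a b. \<exists>D. hole_push H K r a b D \<and> (b = 0 \<longrightarrow> sig W H = H \<longrightarrow> sig W K = - K \<longrightarrow> sig W D = D)"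
    using hole_push_exists[OF W H(1) K(1) HK r] by blast
  then obtain D0 where D0: "\<And>a b. hole_push H K r a b (D0 a b)" "\<And>a. sig W (D0 a 0) = D0 a 0"
    using H K by metis
  \<comment> \<open>Pushes below the real axis are the images of those above it, and those on the
    axis are invariant, so the sum is fixed by \<open>sig W\<close>.\<close>
  define D where "D = (\<lambda>(a,b). if b < 0 then sig W (D0 a (- b)) else D0 a b)"
  have D: "hole_push H K r a b (D (a, b))" for a b
    using D0(1)[of a b] hole_push_sig[OF W H K D0(1)[of a "- b"]] by (simp add: D_def)
  have sD: "sig W (D (a, b)) = D (a, - b)" for a b
    using D0(2)[of a] by (cases "b = 0") (auto simp: D_def sig_sig[OF W])
  have dH: "H * D l = D l * H" and dK: "K * D l = D l * K" and dD: "D l * star (D l) = star (D l) * D l"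
    and dn: "nb (D l) r" for l
    using D[of "fst l" "snd l"] by (simp_all add: hole_push_def)
  have dHs: "H * star (D l) = star (D l) * H" and dKs: "K * star (D l) = star (D l) * K" for l
    using arg_cong[OF dH[of l], of star] arg_cong[OF dK[of l], of star] H K by (simp_all add: star_mult sa_def)
  define X where "X = H + cof \<i> * K"
  have Xs: "star X = H - cof \<i> * K" using H K by (simp add: X_def star_add star_mult star_cof sa_def cof_uminus cof_commute)
  have dX: "X * D l = D l * X" "star X * D l = D l * star X" "X * star (D l) = star (D l) * X" "star X * star (D l) = star (D l) * star X" for l
    unfolding Xs unfolding X_def
    using dH[of l] dK[of l] dHs[of l] dKs[of l] commute_mult[of "D l" "cof \<i>" K] commute_mult[of "star (D l)" "cof \<i>" K]
    by (simp_all add: distrib_left distrib_right right_diff_distrib left_diff_distrib cof_commute)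
  define e where "e = (\<lambda>(a,b). hfc H (bump r a) * hfc K (bump r b))"
  note cb = cont_bump[OF r]
  have hH: "hfc H (bump r a) * z = z * hfc H (bump r a)" if "H * z = z * H" for a z by (rule hfc_comm[OF H(1) that cb])
  have hK: "hfc K (bump r a) * z = z * hfc K (bump r a)" if "K * z = z * K" for a z by (rule hfc_comm[OF K(1) that cb])
  have hHK: "hfc H (bump r a) * hfc K (bump r b) = hfc K (bump r b) * hfc H (bump r a)" for a b
    by (rule hH, rule hK[symmetric]) (rule HK[symmetric])
  have ce: "e l * z = z * e l" if "H * z = z * H" "K * z = z * K" for l z
    using hH[OF that(1)] hK[OF that(2)] by (cases l) (simp add: e_def, metis mult.assoc)
  have eH: "e l * H = H * e l" and eK: "e l * K = K * e l" for l using HK by (auto intro: ce)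
  have eD: "e l * D m = D m * e l" for l m by (rule ce[OF dH dK])
  have eDs: "e l * star (D m) = star (D m) * e l" for l m by (rule ce[OF dHs dKs])
  have cX: "Z * X = X * Z" "Z * star X = star X * Z" if "Z * H = H * Z" "Z * K = K * Z" for Z
    unfolding Xs unfolding X_def by (intro commute_add commute_diff commute_mult that cof_commute)+
  have eX: "e l * X = X * e l" "e l * star X = star X * e l" for l
    by (rule cX[OF eH eK])+
  have es: "star (e l) = e l" for l
  proof -
    have "sa (hfc H (bump r a))" "sa (hfc K (bump r a))" for a
      unfolding bump_def using r by (auto intro!: sa_hfc H K continuous_intros)
    thus ?thesis using hHK by (cases l) (simp add: e_def star_mult sa_def)
  qed
  have eDD: "e l * D l = D l" for l
  proof -
    obtain a b where l: "l = (a, b)" by (cases l) blast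
    have 1: "hfc H (bump r a) * D l = D l"
    proof -
      have v: "hfc H f * D l = 0" if "cont f" "\<forall>h. \<bar>h - a\<bar> < 3 / 2 * r \<longrightarrow> f h = 0" for f
        using D[of a b] that unfolding hole_push_def l by blast
      have "hfc H (\<lambda>h. 1 - bump r a h) * D l = 0"
        by (rule v) (intro continuous_intros cb, simp add: bump_1[OF r])
      thus ?thesis using hfc_minus[OF H(1) _ cb, of "\<lambda>_. 1"] hfc_const[OF H(1), of 1] by (simp add: left_diff_distrib)
    qed
    have 2: "hfc K (bump r b) * D l = D l"
    proof -
      have v: "hfc K f * D l = 0" if "cont f" "\<forall>h. \<bar>h - b\<bar> < 3 / 2 * r \<longrightarrow> f h = 0" for f
        using D[of a b] that unfolding hole_push_def l by blast
      have "hfc K (\<lambda>h. 1 - bump r b h) * D l = 0"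
        by (rule v) (intro continuous_intros cb, simp add: bump_1[OF r])
      thus ?thesis using hfc_minus[OF K(1) _ cb, of "\<lambda>_. 1"] hfc_const[OF K(1), of 1] by (simp add: left_diff_distrib)
    qed
    show ?thesis using 1 2 by (simp add: l e_def mult.assoc)
  qed
  have eDDs: "e l * star (D l) = star (D l)" for l
    using arg_cong[OF eDD[of l], of star] eDs[of l l] by (simp add: star_mult es)
  have b0: "bump r a h * bump r a' h = 0" if "d \<le> \<bar>a - a'\<bar>" for a a' h
  proof (cases "2 * r \<le> \<bar>h - a\<bar>")
    case True thus ?thesis using bump_0[OF r True] by simp
  next
    case False
    hence "2 * r \<le> \<bar>h - a'\<bar>" using that d by linarith
    thus ?thesis using bump_0[OF r] by simp
  qed
  have ee: "e l * e m = 0" if "l \<in> L" "m \<in> L" "l \<noteq> m" for l m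
  proof -
    obtain a b a' b' where lm: "l = (a, b)" "m = (a', b')" by (cases l, cases m) blast
    have "e l * e m = (hfc H (bump r a) * hfc H (bump r a')) * (hfc K (bump r b) * hfc K (bump r b'))"
      unfolding lm e_def using hHK[of a' b] by (simp, metis mult.assoc)
    moreover have "hfc H (bump r a) * hfc H (bump r a') = 0 \<or> hfc K (bump r b) * hfc K (bump r b') = 0"
      using L(3)[of a b a' b'] that lm b0 hfc_mult_0[OF H(1) cb cb] hfc_mult_0[OF K(1) cb cb] by blast
    ultimately show ?thesis by auto
  qed
  have De: "D l * e m = (if l = m then D l else 0)" "star (D l) * e m = (if l = m then star (D l) else 0)" if "l \<in> L" "m \<in> L" for l m
  proof -
    have "D l * e m = D l * (e l * e m)" "star (D l) * e m = star (D l) * (e l * e m)"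
      using eDD[of l] eDDs[of l] eD[of l l] eDs[of l l] by (metis mult.assoc)+
    thus "D l * e m = (if l = m then D l else 0)" "star (D l) * e m = (if l = m then star (D l) else 0)"
      using ee[OF that] eDD[of l] eDDs[of l] eD[of l l] eDs[of l l] by auto
  qed
  define S where "S = (\<Sum>l\<in>L. D l)"
  have Ss: "star S = (\<Sum>l\<in>L. star (D l))" by (simp add: S_def star_sum)
  have oD: "D l * star (D m) = 0" "star (D l) * D m = 0" if "l \<in> L" "m \<in> L" "l \<noteq> m" for l m
    using De[OF that(1,2)] that(3) eDD[of m] eDDs[of m] by (metis mult.assoc mult_zero_left)+
  have "S * star S = (\<Sum>l\<in>L. D l * star (D l))" "star S * S = (\<Sum>l\<in>L. star (D l) * D l)"
    unfolding Ss unfolding S_def sum_product using oD by (intro sum_orthogonal L(1); blast)+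
  hence SS: "S * star S = star S * S" by (simp add: dD)
  have XS: "X * S = S * X" "star X * S = S * star X" "X * star S = star S * X" "star X * star S = star S * star X"
    unfolding Ss unfolding S_def by (intro commute_sum dX)+
  have XX: "X * star X = star X * X"
  proof (rule cX(2))
    show "X * H = H * X" by (rule cX(1)[symmetric]) (simp_all add: HK)
    show "X * K = K * X" by (rule cX(1)[symmetric]) (simp_all add: HK)
  qed
  define Y where "Y = X + S"
  have YY: "Y * star Y = star Y * Y" by (simp add: Y_def star_add algebra_simps XX XS SS)
  define H' where "H' = cof (1/2) * (Y + star Y)"
  define K' where "K' = cof (- \<i> / 2) * (Y - star Y)"
  have H': "sa H'" by (simp add: H'_def sa_def star_mult star_add star_cof add.commute flip: cof_commute)
  have K': "sa K'" 
    by (simp add: K'_def sa_def star_mult star_diff star_cof cof_uminus cof_commute algebra_simps)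
  have H'K': "H' * K' = K' * H'"
  proof -
    have "(Y + star Y) * (Y - star Y) = (Y - star Y) * (Y + star Y)" by (simp add: algebra_simps YY)
    thus ?thesis unfolding H'_def K'_def by (metis cof_commute mult.assoc)
  qed
  have sS: "sig W S = S"
  proof -
    have "sig W S = (\<Sum>l\<in>L. D (fst l, - snd l))" unfolding S_def sig_sum[OF W] using sD by (intro sum.cong) auto
    also have "\<dots> = (\<Sum>l\<in>L. D l)"
      by (rule sum.reindex_bij_witness[of _ "\<lambda>l. (fst l, - snd l)" "\<lambda>l. (fst l, - snd l)"]) (use L(2) in auto)
    finally show ?thesis by (simp add: S_def)
  qed
  have sX: "sig W X = X" by (simp add: X_def sig_add[OF W] sig_mult[OF W] sig_cof[OF W] H K cof_uminus)
  have sY: "sig W Y = Y" by (simp add: Y_def sig_add[OF W] sS sX)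
  have sH': "sig W H' = H'" by (simp add: H'_def sig_mult[OF W] sig_add[OF W] sig_star[OF W] sig_cof[OF W] sY)
  have sK': "sig W K' = - K'"
  proof -
    have "sig W K' = cof (cnj (- \<i> / 2)) * (Y - star Y)"
      by (simp only: K'_def sig_mult[OF W] sig_diff[OF W] sig_star[OF W] sig_cof[OF W] sY)
    also have "cnj (- \<i> / 2) = - (- \<i> / 2)" by (simp add: complex_eq_iff)
    finally show ?thesis by (simp only: cof_uminus[of "- \<i> / 2"] mult_minus_left K'_def)
  qed
  have half: "cof (1/2) * (X + star X) = H" "cof (- \<i> / 2) * (X - star X) = K"
  proof -
    have "X + star X = cof (1 + 1) * H" unfolding Xs unfolding X_def by (simp only: cof_add distrib_right cof_1 mult_1_left) simp
    thus "cof (1/2) * (X + star X) = H" by (simp add: mult.assoc[symmetric] flip: cof_mult)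
    have "X - star X = cof (\<i> + \<i>) * K" unfolding Xs unfolding X_def by (simp only: cof_add distrib_right) simp
    thus "cof (- \<i> / 2) * (X - star X) = K" by (simp add: mult.assoc[symmetric] flip: cof_mult)
  qed
  have H'S: "H' = H + cof (1/2) * (S + star S)" and K'S: "K' = K + cof (- \<i> / 2) * (S - star S)"
  proof -
    have "H' = cof (1/2) * (X + star X) + cof (1/2) * (S + star S)" 
      by (simp only: H'_def Y_def star_add distrib_left[symmetric]) (simp add: algebra_simps)
    thus "H' = H + cof (1/2) * (S + star S)" by (simp only: half)
    have "K' = cof (- \<i> / 2) * (X - star X) + cof (- \<i> / 2) * (S - star S)" 
      by (simp only: K'_def Y_def star_add distrib_left[symmetric]) (simp add: algebra_simps)
    thus "K' = K + cof (- \<i> / 2) * (S - star S)" by (simp only: half)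
  qed
  have nS: "nb S (real (card L) * r)" unfolding S_def using nb_sum[of L D "\<lambda>_. r"] dn by simp
  have nS2: "nb (cof (1/2) * (Z + star Z)) c" "nb (cof (- \<i> / 2) * (Z - star Z)) c" if "nb Z c" "0 \<le> c" for Z c
  proof -
    have "nb (cof (1/2) * (Z + star Z)) (cmod (1/2) * (c + c))"
      by (intro nb_mult nb_cof nb_add nb_star that) (use that in auto)
    thus "nb (cof (1/2) * (Z + star Z)) c" by (simp add: norm_divide)
    have "nb (cof (- \<i> / 2) * (Z - star Z)) (cmod (- \<i> / 2) * (c + c))"
      by (intro nb_mult nb_cof nb_diff nb_star that) (use that in auto)
    thus "nb (cof (- \<i> / 2) * (Z - star Z)) c" by (simp add: norm_divide)
  qed
  have nH: "nb (H' - H) (real (card L) * r)" unfolding H'S using nS2(1)[OF nS] r by simp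
  have nK: "nb (K' - K) (real (card L) * r)" unfolding K'S using nS2(2)[OF nS] r by simp
  have Se: "S * e l = D l" "star S * e l = star (D l)" if "l \<in> L" for l
  proof -
    have "(\<Sum>m\<in>L. D m * e l) = D l * e l" by (rule sum_single[OF L(1) that]) (use De that in auto)
    thus "S * e l = D l" using De(1)[OF that that] by (simp add: S_def sum_distrib_right)
    have "(\<Sum>m\<in>L. star (D m) * e l) = star (D l) * e l" by (rule sum_single[OF L(1) that]) (use De that in auto)
    thus "star S * e l = star (D l)" using De(2)[OF that that] by (simp add: Ss sum_distrib_right)
  qed
  have H'e: "H' * e l = (H + cof (1/2) * (D l + star (D l))) * e l" if "l \<in> L" for l
    unfolding H'S using Se[OF that] De[OF that that] by (simp add: algebra_simps)
  have K'e: "K' * e l = (K + cof (- \<i> / 2) * (D l - star (D l))) * e l" if "l \<in> L" for l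
    unfolding K'S using Se[OF that] De[OF that that] by (simp add: algebra_simps)
  have Ye: "Y * e l = (X + D l) * e l" "star Y * e l = star (X + D l) * e l" if "l \<in> L" for l
    using Se[OF that] De[OF that that] by (simp_all add: Y_def star_add distrib_right)
  have eS: "e l * S = S * e l" "e l * star S = star S * e l" for l
    unfolding Ss unfolding S_def by (intro commute_sum eD eDs)+
  have eY: "e l * Y = Y * e l" "e l * star Y = star Y * e l" for l
    unfolding Y_def star_add by (intro commute_add eX eS)+
  have eH': "H' * e l = e l * H'" and eK': "K' * e l = e l * K'" for l
    unfolding H'_def K'_def
    by (intro commute_mult[symmetric] commute_add commute_diff eY cof_commute)+
  define z where "z = 1 - (\<Sum>l\<in>L. e l)"
  have Sz: "S * z = 0" "star S * z = 0"
    unfolding z_def using Se by (simp_all add: right_diff_distrib sum_distrib_left S_def[symmetric] Ss[symmetric])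
  have H'z: "H' * z = z * H" and K'z: "K' * z = z * K"
  proof -
    have "H' * z = H * z" unfolding H'S using Sz by (simp add: distrib_right mult.assoc)
    moreover have "z * H = H * z" unfolding z_def using commute_sum[of L H e] eH by (simp add: algebra_simps)
    ultimately show "H' * z = z * H" by simp
    have "K' * z = K * z" unfolding K'S using Sz by (simp add: distrib_right left_diff_distrib mult.assoc)
    moreover have "z * K = K * z" unfolding z_def using commute_sum[of L K e] eK by (simp add: algebra_simps)
    ultimately show "K' * z = z * K" by simp
  qed
  have hole: "hfc H' f * hfc K' g = 0" if l: "(a, b) \<in> L" and f: "hole_at a (r / 2) f" and g: "hole_at b (r / 2) g" for a b f g
  proof -
    have f1: "cont f" "\<And>h. r / 2 \<le> \<bar>h - a\<bar> \<Longrightarrow> f h = 0" and g1: "cont g" "\<And>h. r / 2 \<le> \<bar>h - b\<bar> \<Longrightarrow> g h = 0"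
      using f g by auto
    define w where "w = hfc H' f * hfc K' g"
    have fg: "hfc H' f * hfc K' g = hfc K' g * hfc H' f"
      by (rule hfc_comm[OF H' _ f1(1)], rule hfc_comm[OF K' _ g1(1), symmetric]) (rule H'K'[symmetric])
    \<comment> \<open>At its own hole: under the cut-off the squared distance of \<open>Y\<close>
      from the point is at least \<open>r^2\<close>, but on \<open>w\<close> it is at most
      \<open>r^2 / 4 + r^2 / 4\<close>. The gap \<open>r^2 / 2\<close> feeds
      \<open>pos_cancel\<close>.\<close>
    have we0: "w * e (a, b) = 0"
    proof -
      let ?e = "e (a, b)" and ?Z = "X - cof (Complex a b) + D (a, b)" and ?N = "star (Y - cof (Complex a b)) * (Y - cof (Complex a b))"
      have Ze: "?e * ?Z = ?Z * ?e" by (intro commute_add commute_diff eX eD cof_commute)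
      have 1: "?N * ?e = (star ?Z * ?Z) * ?e"
      proof -
        have "(Y - cof (Complex a b)) * ?e = ?Z * ?e" using Ye(1)[OF l] by (simp add: left_diff_distrib distrib_right)
        hence "?N * ?e = star (Y - cof (Complex a b)) * ?e * ?Z" by (simp only: mult.assoc Ze)
        also have "star (Y - cof (Complex a b)) * ?e = star ?Z * ?e"
          using Ye(2)[OF l] by (simp add: star_diff star_add left_diff_distrib distrib_right)
        finally show ?thesis by (simp only: mult.assoc Ze)
      qed
      have Ycart: "Y = H' + cof \<i> * K'"
      proof -
        have "cof \<i> * K' = cof (1/2) * (Y - star Y)" unfolding K'_def by (simp add: mult.assoc[symmetric] flip: cof_mult)
        hence "H' + cof \<i> * K' = cof (1/2) * (Y + Y)" by (simp add: H'_def algebra_simps)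
        also have "\<dots> = cof (1/2 + 1/2) * Y" by (simp only: cof_add distrib_left distrib_right)
        finally show ?thesis by simp
      qed
      let ?A = "H' - cof (complex_of_real a)" and ?B = "K' - cof (complex_of_real b)"
      have 2: "?N = ?A * ?A + ?B * ?B" unfolding Ycart by (rule cart_norm_sq(1)[OF H' K' H'K'])
      let ?q = "\<lambda>c h. complex_of_real (min ((h - c)\<^sup>2) ((r / 2)\<^sup>2))"
      have cq: "cont (?q c)" for c by (intro continuous_intros)
      have Q: "hfc x (?q c) * hfc x u = (x - cof (complex_of_real c)) * (x - cof (complex_of_real c)) * hfc x u"
        if x: "sa x" and u: "cont u" "\<And>h. r / 2 \<le> \<bar>h - c\<bar> \<Longrightarrow> u h = 0" for x c u
      proof -
        have c2: "cont (\<lambda>h. complex_of_real (h - c))" by (intro continuous_intros)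
        have c3: "cont (\<lambda>h. complex_of_real (h - c) * complex_of_real (h - c))" by (intro continuous_intros)
        have xa: "x - cof (complex_of_real c) = hfc x (\<lambda>h. complex_of_real (h - c))"
          using hfc_minus[OF x, of complex_of_real "\<lambda>_. complex_of_real c"] by (simp add: hfc_id[OF x] hfc_const[OF x] continuous_intros)
        have "(\<lambda>h. ?q c h * u h) = (\<lambda>h. complex_of_real (h - c) * complex_of_real (h - c) * u h)"
        proof
          fix h show "?q c h * u h = complex_of_real (h - c) * complex_of_real (h - c) * u h"
          proof (cases "r / 2 \<le> \<bar>h - c\<bar>")
            case False
            hence "\<bar>h - c\<bar>\<^sup>2 \<le> (r / 2)\<^sup>2" by (intro power_mono) auto
            hence "min ((h - c)\<^sup>2) ((r / 2)\<^sup>2) = (h - c) * (h - c)" by (simp add: power2_eq_square)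
            thus ?thesis by (simp only: of_real_mult)
          qed (simp add: u(2))
        qed
        hence "hfc x (?q c) * hfc x u = hfc x (\<lambda>h. complex_of_real (h - c) * complex_of_real (h - c) * u h)"
          using hfc_mult[OF x cq[of c] u(1)] by (simp only:)
        also have "\<dots> = hfc x (\<lambda>h. complex_of_real (h - c) * complex_of_real (h - c)) * hfc x u" by (rule hfc_mult[OF x c3 u(1)])
        also have "hfc x (\<lambda>h. complex_of_real (h - c) * complex_of_real (h - c)) = (x - cof (complex_of_real c)) * (x - cof (complex_of_real c))"
          unfolding xa by (rule hfc_mult[OF x c2 c2])
        finally show ?thesis .
      qed
      have q1: "hfc H' (?q a) * w = ?A * ?A * w" using Q[OF H' f1] by (simp only: w_def mult.assoc[symmetric])
      have q2: "hfc K' (?q b) * w = ?B * ?B * w" using Q[OF K' g1] by (simp only: w_def fg mult.assoc[symmetric])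
      have wee: "w * ?e = ?e * w"
        unfolding w_def by (metis hfc_comm[OF H' eH' f1(1)] hfc_comm[OF K' eK' g1(1)] mult.assoc)
      have "(star ?Z * ?Z - hfc H' (?q a) - hfc K' (?q b)) * (w * ?e) = 0"
      proof -
        have "star ?Z * ?Z * (w * ?e) = (star ?Z * ?Z * ?e) * w" by (simp only: wee mult.assoc)
        also have "\<dots> = (?N * ?e) * w" by (simp only: 1)
        also have "\<dots> = ?N * (w * ?e)" by (simp only: wee mult.assoc)
        also have "\<dots> = (hfc H' (?q a) * w + hfc K' (?q b) * w) * ?e" 
          unfolding 2 q1 q2 by (simp only: distrib_right mult.assoc)
        finally show ?thesis by (simp only: left_diff_distrib distrib_right mult.assoc) simp
      qed
      moreover have "pos (star ?Z * ?Z - hfc H' (?q a) - hfc K' (?q b) - cof (complex_of_real (r\<^sup>2 / 2)))"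
      proof -
        have p1: "pos (star ?Z * ?Z - cof (complex_of_real (r\<^sup>2)))" using D[of a b] by (simp add: hole_push_def X_def)
        have p2: "pos (cof (complex_of_real (r\<^sup>2 / 4)) - hfc x (?q c))" if x: "sa x" for x c
        proof -
          have "cof (complex_of_real (r\<^sup>2 / 4)) - hfc x (?q c) = hfc x (\<lambda>h. complex_of_real (r\<^sup>2 / 4 - min ((h - c)\<^sup>2) ((r / 2)\<^sup>2)))"
            using hfc_minus[OF x _ cq, of "\<lambda>_. complex_of_real (r\<^sup>2 / 4)"] by (simp add: hfc_const[OF x])
          also have "pos \<dots>"
          proof (rule hfc_pos[OF x])
            show "continuous_on UNIV (\<lambda>h. r\<^sup>2 / 4 - min ((h - c)\<^sup>2) ((r / 2)\<^sup>2))" by (intro continuous_intros)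
            show "0 \<le> r\<^sup>2 / 4 - min ((h - c)\<^sup>2) ((r / 2)\<^sup>2)" for h by (simp add: power_divide)
          qed
          finally show ?thesis .
        qed
        have "cof (complex_of_real (r\<^sup>2)) = cof (complex_of_real (r\<^sup>2 / 4)) + cof (complex_of_real (r\<^sup>2 / 4)) + cof (complex_of_real (r\<^sup>2 / 2))"
          unfolding cof_add[symmetric] by simp
        hence "star ?Z * ?Z - hfc H' (?q a) - hfc K' (?q b) - cof (complex_of_real (r\<^sup>2 / 2)) = 
          (star ?Z * ?Z - cof (complex_of_real (r\<^sup>2))) + (cof (complex_of_real (r\<^sup>2 / 4)) - hfc H' (?q a)) + (cof (complex_of_real (r\<^sup>2 / 4)) - hfc K' (?q b))"
          by (simp only:) (simp add: algebra_simps)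
        thus ?thesis using pos_add[OF pos_add[OF p1 p2[OF H']] p2[OF K']] by (simp only:)
      qed
      ultimately show ?thesis using pos_cancel[of _ "r\<^sup>2 / 2"] r by (metis half_gt_zero zero_less_power)
    qed
    \<comment> \<open>At another point one coordinate differs by at least \<open>4 r\<close>. Under
      \<open>e m\<close> that coordinate of \<open>Y\<close> is known up to \<open>2 r\<close> from
      the bump and \<open>r\<close> from the push, and \<open>r / 2 + 3 r < 4 r\<close>.\<close>
    have wem: "w * e m = 0" if m: "m \<in> L" "m \<noteq> (a, b)" for m
    proof -
      obtain a' b' where ab: "m = (a', b')" by (cases m) blast
      have nD: "nb (cof (1/2) * (D m + star (D m))) r" "nb (cof (- \<i> / 2) * (D m - star (D m))) r"
        using nS2[OF dn[of m]] r by auto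
      from L(3)[OF l, of a' b'] m ab consider "d \<le> \<bar>a - a'\<bar>" | "d \<le> \<bar>b - b'\<bar>" by auto
      thus ?thesis
      proof cases
        case 1
        obtain y where y: "nb y (2 * r)" "H * hfc H (bump r a') = (cof (complex_of_real a') + y) * hfc H (bump r a')"
          using hfc_approx[OF H(1) cb, of "2 * r" a' a'] bump_0[OF r] r by auto
        have "H * e m = (cof (complex_of_real a') + y) * e m" unfolding ab e_def using y(2) by (simp add: mult.assoc[symmetric])
        hence "H' * e m = (cof (complex_of_real a') + (y + cof (1/2) * (D m + star (D m)))) * e m"
          using H'e[OF m(1)] by (simp add: distrib_right add.assoc)
        from hfc_vanish_local[OF H' f1(1) _ _ eH' this nb_add[OF y(1) nD(1)], of "r / 2" a]
        have "hfc H' f * e m = 0" using f1(2) r 1 d by (auto simp: abs_minus_commute)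
        thus ?thesis unfolding w_def fg by (simp add: mult.assoc)
      next
        case 2
        obtain y where y: "nb y (2 * r)" "K * hfc K (bump r b') = (cof (complex_of_real b') + y) * hfc K (bump r b')"
          using hfc_approx[OF K(1) cb, of "2 * r" b' b'] bump_0[OF r] r by auto
        have "K * e m = (cof (complex_of_real b') + y) * e m" unfolding ab e_def using y(2) by (simp add: hHK mult.assoc[symmetric])
        hence "K' * e m = (cof (complex_of_real b') + (y + cof (- \<i> / 2) * (D m - star (D m)))) * e m"
          using K'e[OF m(1)] by (simp add: distrib_right add.assoc)
        from hfc_vanish_local[OF K' g1(1) _ _ eK' this nb_add[OF y(1) nD(2)], of "r / 2" b]
        have "hfc K' g * e m = 0" using g1(2) r 2 d by (auto simp: abs_minus_commute)
        thus ?thesis unfolding w_def by (simp add: mult.assoc)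
      qed
    qed
    \<comment> \<open>Away from all points nothing has moved, so \<open>w * z\<close> is
      \<open>z\<close> times the same product for the old \<open>H\<close> and \<open>K\<close>.
      That product lies under the cut-off at \<open>(a, b)\<close>, and is killed by
      \<open>z\<close>.\<close>
    have wz: "w * z = 0"
    proof -
      have fz: "hfc H' f * z = z * hfc H f" by (rule hfc_intertwine[OF H' H(1) H'z f1(1)])
      have gz: "hfc K' g * z = z * hfc K g" by (rule hfc_intertwine[OF K' K(1) K'z g1(1)])
      let ?v = "hfc H f * hfc K g"
      have wzv: "w * z = z * ?v" unfolding w_def by (metis fz gz mult.assoc)
      have ev: "e (a, b) * ?v = ?v"
      proof -
        have "hfc H f * hfc H (bump r a) = hfc H f" by (rule hfc_mult_bump[OF H(1) f1(1) r]) (use f1(2) r in auto)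
        hence 1: "hfc H (bump r a) * hfc H f = hfc H f" using hfc_comm[OF H(1) _ cb] hfc_comm[OF H(1) refl f1(1)] by metis
        have "hfc K g * hfc K (bump r b) = hfc K g" by (rule hfc_mult_bump[OF K(1) g1(1) r]) (use g1(2) r in auto)
        hence 2: "hfc K (bump r b) * hfc K g = hfc K g" using hfc_comm[OF K(1) _ cb] hfc_comm[OF K(1) refl g1(1)] by metis
        have 3: "hfc K (bump r b) * hfc H f = hfc H f * hfc K (bump r b)"
          by (rule hK, rule hfc_comm[OF H(1) HK f1(1), symmetric])
        show ?thesis unfolding e_def using 1 2 3 by (simp, metis mult.assoc)
      qed
      have ev0: "e m * ?v = 0" if "m \<in> L" "m \<noteq> (a, b)" for m
      proof -
        have "e m * e (a, b) * ?v = 0" using ee[OF that(1) l that(2)] by simp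
        thus ?thesis using ev by (simp add: mult.assoc)
      qed
      have "(\<Sum>m\<in>L. e m) * ?v = ?v"
        unfolding sum_distrib_right using sum_single[OF L(1) l, of "\<lambda>m. e m * ?v"] ev ev0 by simp
      thus ?thesis by (simp only: wzv) (simp add: z_def left_diff_distrib)
    qed
    have "w = w * z + (\<Sum>m\<in>L. w * e m)" unfolding z_def by (simp add: right_diff_distrib sum_distrib_left)
    moreover have "(\<Sum>m\<in>L. w * e m) = 0" by (rule sum.neutral) (metis we0 wem)
    ultimately show ?thesis using wz by (simp add: w_def)
  qed
  have "hole_family L (r / 2) H' K'" unfolding hole_family_def using hole by blast
  thus ?thesis using H' K' H'K' sH' sK' nH nK by blast
qed

section \<open>Separating projections\<close>

text \<open>The range \<open>-N..N\<close> makes the grid symmetric in the second coordinate and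
  puts points on the axis, so the axis separates two bands instead of running through the middle of
  one.\<close>

definition grid :: "nat \<Rightarrow> real \<Rightarrow> (real \<times> real) set" where
  "grid N d = (\<lambda>(l,k). (real_of_int l * d, real_of_int k * d)) ` ({- int N..int N} \<times> {- int N..int N})"

definition tau :: "real \<Rightarrow> real \<Rightarrow> int \<Rightarrow> real \<Rightarrow> real" where
  "tau d \<rho> k y = clip 0 1 ((y - real_of_int k * d) / \<rho> + 1 / 2)"

definition band :: "real \<Rightarrow> real \<Rightarrow> int \<Rightarrow> real \<Rightarrow> real" where
  "band d \<rho> k y = tau d \<rho> k y - tau d \<rho> (k + 1) y"

lemma tau_0: "\<rho> > 0 \<Longrightarrow> y \<le> real_of_int k * d - \<rho> / 2 \<Longrightarrow> tau d \<rho> k y = 0"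
  by (auto simp: tau_def clip_def field_simps max_def min_def)

lemma tau_1: "\<rho> > 0 \<Longrightarrow> real_of_int k * d + \<rho> / 2 \<le> y \<Longrightarrow> tau d \<rho> k y = 1"
  by (auto simp: tau_def clip_def field_simps max_def min_def)

lemma continuous_tau [continuous_intros]: "\<rho> > 0 \<Longrightarrow> continuous_on S (tau d \<rho> k)"
  "\<rho> > 0 \<Longrightarrow> continuous_on S (band d \<rho> k)"
  unfolding band_def tau_def by (intro continuous_intros; simp)+

lemma band_nonzero:
  assumes "\<rho> > 0" "\<rho> \<le> d" "band d \<rho> k y \<noteq> 0"
  shows "real_of_int k * d - \<rho> / 2 < y" "y < real_of_int (k + 1) * d + \<rho> / 2"
proof -
  have "tau d \<rho> k y = 0 \<and> tau d \<rho> (k+1) y = 0" if "y \<le> real_of_int k * d - \<rho> / 2"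
    using that assms by (intro conjI tau_0) (auto simp: algebra_simps)
  thus "real_of_int k * d - \<rho> / 2 < y" using assms(3) by (force simp: band_def)
  have "tau d \<rho> k y = 1 \<and> tau d \<rho> (k+1) y = 1" if "real_of_int (k + 1) * d + \<rho> / 2 \<le> y"
    using that assms by (intro conjI tau_1) (auto simp: algebra_simps)
  thus "y < real_of_int (k + 1) * d + \<rho> / 2" using assms(3) by (force simp: band_def)
qed

lemma band_nonneg: "\<rho> > 0 \<Longrightarrow> d \<ge> 0 \<Longrightarrow> 0 \<le> band d \<rho> k y"
proof -
  assume "\<rho> > 0" "d \<ge> 0"
  hence "(y - real_of_int (k + 1) * d) / \<rho> \<le> (y - real_of_int k * d) / \<rho>"
    by (intro divide_right_mono) (auto simp: algebra_simps)
  thus ?thesis by (auto simp: band_def tau_def clip_def)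
qed

text \<open>Away from its two edges a band function takes only the values \<open>0\<close> and
  \<open>1\<close>; the holes will cover the edges.\<close>

lemma band_idem:
  assumes "\<rho> > 0" "\<rho> \<le> d" "\<rho> / 2 \<le> \<bar>y - real_of_int k * d\<bar>" "\<rho> / 2 \<le> \<bar>y - real_of_int (k + 1) * d\<bar>"
  shows "band d \<rho> k y * band d \<rho> k y = band d \<rho> k y"
proof -
  have t: "tau d \<rho> j y = 0 \<or> tau d \<rho> j y = 1" if "\<rho> / 2 \<le> \<bar>y - real_of_int j * d\<bar>" for j
    using that tau_0[OF assms(1), of y j d] tau_1[OF assms(1), of j d y] by (auto simp: abs_if split: if_splits)
  have "0 \<le> band d \<rho> k y" by (rule band_nonneg) (use assms in auto)
  thus ?thesis using t[OF assms(3)] t[OF assms(4)] by (auto simp: band_def)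
qed

lemma band_orthogonal:
  assumes "\<rho> > 0" "\<rho> \<le> d" "k < l" "\<rho> / 2 \<le> \<bar>y - real_of_int (k + 1) * d\<bar>"
  shows "band d \<rho> k y * band d \<rho> l y = 0"
proof (rule ccontr)
  assume "\<not> ?thesis"
  hence n: "band d \<rho> k y \<noteq> 0" "band d \<rho> l y \<noteq> 0" by auto
  have "real_of_int (k + 1) * d \<le> real_of_int l * d" using assms by (intro mult_right_mono) auto
  thus False using band_nonzero[OF assms(1,2) n(1)] band_nonzero[OF assms(1,2) n(2)] assms(4) by linarith
qed

text \<open>Reflection turns the step at \<open>k d\<close> into \<open>1\<close> minus the step at
  \<open>- k d\<close>, which exchanges the two edges of a band. The index map sending
  \<open>k\<close> to \<open>- 1 - k\<close> has no fixed point, and the invariant choice of cuts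
  rests on this.\<close>

lemma band_reflect: "band d \<rho> k (- y) = band d \<rho> (- 1 - k) y"
proof -
  have t: "tau d \<rho> j (- y) = 1 - tau d \<rho> (- j) y" for j
  proof -
    have "(- y - real_of_int j * d) / \<rho> + 1 / 2 = 1 - ((y - real_of_int (- j) * d) / \<rho> + 1 / 2)"
      by (simp add: diff_divide_distrib add_divide_distrib)
    moreover have "clip 0 1 (1 - s) = 1 - clip 0 1 s" for s by (auto simp: clip_def)
    ultimately show ?thesis unfolding tau_def by (simp only:)
  qed
  have k: "- (k + 1) = - 1 - k" "(- 1 - k) + 1 = - k" by simp_all
  show ?thesis unfolding band_def t k by simp
qed

lemma sum_telescope_int:
  fixes f :: "int \<Rightarrow> 'a :: ab_group_add"
  shows "(\<Sum>k\<in>{- int N..<int N}. f k - f (k + 1)) = f (- int N) - f (int N)"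
proof -
  have "(\<Sum>k\<in>{- int N..<- int N + int m}. f k - f (k + 1)) = f (- int N) - f (- int N + int m)" for m
  proof (induction m)
    case (Suc m)
    have "{- int N..<- int N + int (Suc m)} = insert (- int N + int m) {- int N..<- int N + int m}" by auto
    thus ?case using Suc by (simp add: algebra_simps)
  qed simp
  from this[of "2 * N"] show ?thesis by simp
qed

lemma sum_band: "(\<Sum>k\<in>{- int N..<int N}. band d \<rho> k y) = tau d \<rho> (- int N) y - tau d \<rho> (int N) y"
  unfolding band_def by (rule sum_telescope_int)

text \<open>The bound \<open>c + \<rho> < real N * d\<close> keeps the spectra of \<open>H\<close>
  and \<open>K\<close> inside the grid, so that the bands add up to \<open>1\<close> and the
  outermost separators are trivial.\<close>

locale holes =
  fixes W N d \<rho> H K c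
  assumes W: "real_structure W" and H: "sa H" "sig W H = H" and K: "sa K" "sig W K = - K" and HK: "H * K = K * H"
    and \<rho>: "\<rho> > 0" "4 * \<rho> \<le> d" and hole_fam: "hole_family (grid N d) \<rho> H K"
    and c: "nb H c" "nb K c" "0 \<le> c" "c + \<rho> < real N * d" 
begin

abbreviation "bands \<equiv> {- int N..<int N}"
abbreviation "bf k \<equiv> (\<lambda>y. complex_of_real (band d \<rho> k y))"

definition B :: "int \<Rightarrow> qalg" where "B k = hfc K (bf k)"

text \<open>\<open>K\<close> is rounded to the midpoints of the bands. The midpoints of
  \<open>k\<close> and \<open>- 1 - k\<close> are opposite, so \<open>sig W\<close> still negates
  the result; and a correction inside a single band sees only a scalar.\<close>

definition K2 :: qalg where "K2 = (\<Sum>k\<in>bands. cof (complex_of_real ((real_of_int k + 1 / 2) * d)) * B k)"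

lemma d0: "d > 0" using \<rho> by linarith

lemma cbf: "cont (bf k)" using \<rho>(1) by (intro cont_real continuous_intros)

lemma commHK: "cont f \<Longrightarrow> cont g \<Longrightarrow> hfc H f * hfc K g = hfc K g * hfc H f"
  by (rule hfc_comm[OF H(1)], rule hfc_comm[OF K(1) HK[symmetric], symmetric])

text \<open>\<open>g\<close> is cut into pieces near the single holes by bumps of radius
  \<open>\<rho> / 2\<close>, which are \<open>1\<close> wherever \<open>g\<close> can be nonzero and
  vanish at distance \<open>\<rho>\<close>; each piece then falls under
  \<open>hole_fam\<close>.\<close>

lemma hole_bands:
  assumes l: "l \<in> {- int N..int N}" and f: "hole_at (real_of_int l * d) \<rho> f" and g: "cont g"
    and g0: "\<And>y. (\<And>k. k \<in> {- int N..int N} \<Longrightarrow> \<rho> / 2 \<le> \<bar>y - real_of_int k * d\<bar>) \<Longrightarrow> g y = 0"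
  shows "hfc H f * hfc K g = 0"
proof -
  let ?b = "\<lambda>k. bump (\<rho> / 2) (real_of_int k * d)" and ?I = "{- int N..int N}"
  have r2: "\<rho> / 2 > 0" using \<rho> by simp
  have "g y = (\<Sum>k\<in>?I. g y * ?b k y)" for y
  proof (cases "\<exists>k\<in>?I. \<bar>y - real_of_int k * d\<bar> < \<rho> / 2")
    case True
    then obtain k where k: "k \<in> ?I" "\<bar>y - real_of_int k * d\<bar> < \<rho> / 2" by blast
    have "?b j y = 0" if "j \<noteq> k" for j
    proof (rule bump_0[OF r2])
      have "1 \<le> \<bar>real_of_int k - real_of_int j\<bar>" using that by linarith
      hence "1 * d \<le> \<bar>real_of_int k - real_of_int j\<bar> * d" using d0 by (intro mult_right_mono) auto
      hence "d \<le> \<bar>real_of_int k * d - real_of_int j * d\<bar>" using d0 by (simp add: abs_mult left_diff_distrib[symmetric])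
      thus "2 * (\<rho> / 2) \<le> \<bar>y - real_of_int j * d\<bar>" using k(2) \<rho> by linarith
    qed
    hence "(\<Sum>k\<in>?I. g y * ?b k y) = g y * ?b k y" using k(1) by (intro sum_single) auto
    also have "?b k y = 1" by (rule bump_1[OF r2]) (use k(2) \<rho> in linarith)
    finally show ?thesis by simp
  next
    case False
    hence "g y = 0" by (intro g0) (auto simp: not_less)
    thus ?thesis by simp
  qed
  hence "hfc K g = hfc K (\<lambda>y. \<Sum>k\<in>?I. g y * ?b k y)" by simp
  also have "\<dots> = (\<Sum>k\<in>?I. hfc K (\<lambda>y. g y * ?b k y))"
    by (rule hfc_sum[OF K(1)]) (auto intro!: continuous_intros g cont_bump r2)
  finally have "hfc H f * hfc K g = (\<Sum>k\<in>?I. hfc H f * hfc K (\<lambda>y. g y * ?b k y))" by (simp add: sum_distrib_left)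
  also have "\<dots> = 0"
  proof (rule sum.neutral, rule ballI)
    fix k assume k: "k \<in> ?I"
    have "hole_at (real_of_int k * d) \<rho> (\<lambda>y. g y * ?b k y)"
      using g cont_bump[OF r2] bump_0[OF r2] by (auto intro: continuous_intros)
    moreover have "(real_of_int l * d, real_of_int k * d) \<in> grid N d" using l k by (auto simp: grid_def)
    ultimately show "hfc H f * hfc K (\<lambda>y. g y * ?b k y) = 0" using hole_fam f unfolding hole_family_def by blast
  qed
  finally show ?thesis .
qed

lemma \<rho>d: "\<rho> \<le> d" using \<rho> by linarith

text \<open>The defect of idempotence sits at the edges \<open>k d\<close> and
  \<open>(k + 1) d\<close>. For \<open>k\<close> in \<open>bands\<close> both are grid lines, so the
  column has a hole at each of them.\<close>

lemma B_idem:
  assumes "l \<in> {- int N..int N}" "hole_at (real_of_int l * d) \<rho> f" "k \<in> bands"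
  shows "hfc H f * (B k * B k) = hfc H f * B k"
proof -
  have cc: "cont (\<lambda>y. bf k y * bf k y)" by (intro continuous_intros cbf)
  have "hfc H f * hfc K (\<lambda>y. bf k y * bf k y - bf k y) = 0"
  proof (rule hole_bands[OF assms(1,2)])
    show "cont (\<lambda>y. bf k y * bf k y - bf k y)" by (intro continuous_intros \<rho>(1))
    fix y assume y: "\<And>k. k \<in> {- int N..int N} \<Longrightarrow> \<rho> / 2 \<le> \<bar>y - real_of_int k * d\<bar>"
    have "band d \<rho> k y * band d \<rho> k y = band d \<rho> k y"
      by (rule band_idem[OF \<rho>(1) \<rho>d y y]) (use assms(3) in auto)
    thus "bf k y * bf k y - bf k y = 0" by (simp flip: of_real_mult)
  qed
  thus ?thesis using hfc_minus[OF K(1) cc cbf] hfc_mult[OF K(1) cbf cbf] by (simp add: B_def right_diff_distrib)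
qed

lemma B_orthogonal:
  assumes "l \<in> {- int N..int N}" "hole_at (real_of_int l * d) \<rho> f" "j \<in> bands" "k \<in> bands" "j \<noteq> k"
  shows "hfc H f * (B j * B k) = 0"
proof -
  have *: "hfc H f * (B j * B k) = 0" if "j \<in> bands" "k \<in> bands" "j < k" for j k
  proof -
    have "hfc H f * hfc K (\<lambda>y. bf j y * bf k y) = 0"
    proof (rule hole_bands[OF assms(1,2)])
      show "cont (\<lambda>y. bf j y * bf k y)" by (intro continuous_intros \<rho>(1))
      fix y assume y: "\<And>k. k \<in> {- int N..int N} \<Longrightarrow> \<rho> / 2 \<le> \<bar>y - real_of_int k * d\<bar>"
      have "band d \<rho> j y * band d \<rho> k y = 0"
        by (rule band_orthogonal[OF \<rho>(1) \<rho>d that(3) y]) (use that in auto)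
      thus "bf j y * bf k y = 0" by (simp flip: of_real_mult)
    qed
    thus ?thesis using hfc_mult[OF K(1) cbf cbf] by (simp add: B_def)
  qed
  have "B j * B k = B k * B j" unfolding B_def by (rule hfc_comm[OF K(1) hfc_comm[OF K(1) refl cbf, symmetric] cbf])
  thus ?thesis using *[of j k] *[of k j] assms by (cases "j < k") auto
qed

lemma sum_B: "(\<Sum>k\<in>bands. B k) = 1"
proof -
  have "(\<Sum>k\<in>bands. B k) = hfc K (\<lambda>y. \<Sum>k\<in>bands. bf k y)"
    unfolding B_def by (rule hfc_sum[OF K(1), symmetric]) (simp, rule cbf)
  also have "\<dots> = hfc K (\<lambda>_. 1)"
  proof (rule hfc_cong[OF K(1) _ _ c(2)])
    show "cont (\<lambda>y. \<Sum>k\<in>bands. bf k y)" by (intro continuous_intros cbf)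
    \<comment> \<open>On this interval the two outermost steps are already constant.\<close>
    show "c < real N * d - \<rho> / 2" "0 \<le> real N * d - \<rho> / 2" using c \<rho> by auto
    fix y assume y: "\<bar>y\<bar> \<le> real N * d - \<rho> / 2"
    have "tau d \<rho> (- int N) y = 1" by (rule tau_1[OF \<rho>(1)]) (use y in auto)
    moreover have "tau d \<rho> (int N) y = 0" by (rule tau_0[OF \<rho>(1)]) (use y in auto)
    ultimately show "(\<Sum>k\<in>bands. bf k y) = 1" using sum_band[of d \<rho> y N] by (simp flip: of_real_sum)
  qed (intro continuous_intros)
  finally show ?thesis using hfc_const[OF K(1), of 1] by simp
qed

lemma sig_B: "sig W (B k) = B (- 1 - k)"
proof -
  have "sig W (B k) = hfc (- K) (bf k)" unfolding B_def using hfc_sig[OF K(1) W cbf, of k] K(2) by simp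
  also have "\<dots> = hfc K (\<lambda>y. bf k (- y))" by (rule hfc_uminus[OF K(1) cbf])
  finally show ?thesis by (simp add: band_reflect B_def)
qed

lemma sa_B: "sa (B k)" unfolding B_def using \<rho>(1) by (intro sa_hfc K continuous_intros)

lemma HB: "H * B k = B k * H"
  unfolding B_def by (rule hfc_comm[OF K(1) HK[symmetric] cbf, symmetric])

lemma sa_K2: "sa K2"
  using sa_B by (simp add: sa_def K2_def star_sum star_mult star_cof cof_commute)

lemma sig_K2: "sig W K2 = - K2"
proof -
  let ?s = "\<lambda>k. cof (complex_of_real ((real_of_int k + 1 / 2) * d))"
  have s: "?s (- 1 - k) = - ?s k" for k
  proof -
    have "complex_of_real ((real_of_int (- 1 - k) + 1 / 2) * d) = - complex_of_real ((real_of_int k + 1 / 2) * d)"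
      unfolding of_real_minus[symmetric] of_real_eq_iff by (simp add: algebra_simps)
    thus ?thesis by (simp only: cof_uminus)
  qed
  have "sig W K2 = (\<Sum>k\<in>bands. ?s k * B (- 1 - k))"
    by (simp add: K2_def sig_sum[OF W] sig_mult[OF W] sig_cof[OF W] sig_B)
  also have "\<dots> = (\<Sum>k\<in>bands. ?s (- 1 - k) * B k)"
    by (rule sum.reindex_bij_witness[of _ "\<lambda>k. - 1 - k" "\<lambda>k. - 1 - k"]) auto
  finally show ?thesis unfolding s by (simp add: K2_def sum_negf)
qed

text \<open>At \<open>y\<close> the rounded value is an average of midpoints with weights
  \<open>band d \<rho> k y\<close>, and a midpoint of nonzero weight lies within
  \<open>d / 2 + \<rho> / 2\<close> of \<open>y\<close>.\<close>

lemma nb_K2: "nb (K2 - K) d"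
proof -
  let ?s = "\<lambda>k. complex_of_real ((real_of_int k + 1 / 2) * d)"
  let ?F = "\<lambda>y. (\<Sum>k\<in>bands. ?s k * bf k y) - complex_of_real y"
  have cF: "cont ?F" by (intro continuous_intros \<rho>(1))
  have "hfc K (\<lambda>y. \<Sum>k\<in>bands. ?s k * bf k y) = (\<Sum>k\<in>bands. hfc K (\<lambda>y. ?s k * bf k y))"
    by (rule hfc_sum[OF K(1)]) (auto intro!: continuous_intros cbf)
  also have "\<dots> = K2"
    unfolding K2_def B_def using hfc_mult[OF K(1) _ cbf, of "\<lambda>_. ?s k" for k] hfc_const[OF K(1)]
    by (intro sum.cong refl) simp
  finally have "K2 - K = hfc K (\<lambda>y. \<Sum>k\<in>bands. ?s k * bf k y) - hfc K complex_of_real" by (simp add: hfc_id[OF K(1)])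
  also have "\<dots> = hfc K ?F" by (rule hfc_minus[OF K(1), symmetric]) (intro continuous_intros continuous_on_of_real_id \<rho>(1))+
  also have "nb \<dots> d"
  proof (rule hfc_nb[OF K(1) cF c(2)])
    show "c < real N * d - \<rho> / 2" "0 \<le> real N * d - \<rho> / 2" "0 \<le> d" using c \<rho> by auto
    fix y assume y: "\<bar>y\<bar> \<le> real N * d - \<rho> / 2"
    have "tau d \<rho> (- int N) y = 1" by (rule tau_1[OF \<rho>(1)]) (use y in auto)
    moreover have "tau d \<rho> (int N) y = 0" by (rule tau_0[OF \<rho>(1)]) (use y in auto)
    ultimately have s1: "(\<Sum>k\<in>bands. band d \<rho> k y) = 1" using sum_band[of d \<rho> y N] by simp
    let ?t = "\<lambda>k. (real_of_int k + 1 / 2) * d"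
    have "?F y = complex_of_real ((\<Sum>k\<in>bands. ?t k * band d \<rho> k y) - y * (\<Sum>k\<in>bands. band d \<rho> k y))"
      by (simp add: s1)
    also have "(\<Sum>k\<in>bands. ?t k * band d \<rho> k y) - y * (\<Sum>k\<in>bands. band d \<rho> k y) = (\<Sum>k\<in>bands. (?t k - y) * band d \<rho> k y)"
      by (simp add: sum_distrib_left left_diff_distrib sum_subtractf)
    finally have "cmod (?F y) = \<bar>\<Sum>k\<in>bands. (?t k - y) * band d \<rho> k y\<bar>" by (simp only: norm_of_real)
    also have "\<dots> \<le> (\<Sum>k\<in>bands. \<bar>(?t k - y) * band d \<rho> k y\<bar>)" by (rule sum_abs)
    also have "\<dots> \<le> (\<Sum>k\<in>bands. d * band d \<rho> k y)"
    proof (rule sum_mono)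
      fix k
      have b: "0 \<le> band d \<rho> k y" by (rule band_nonneg) (use \<rho> d0 in auto)
      show "\<bar>(?t k - y) * band d \<rho> k y\<bar> \<le> d * band d \<rho> k y"
      proof (cases "band d \<rho> k y = 0")
        case False
        from band_nonzero[OF \<rho>(1) \<rho>d False] have "\<bar>?t k - y\<bar> \<le> d" using \<rho> by (simp add: algebra_simps) 
        thus ?thesis using b by (simp add: abs_mult mult_right_mono)
      qed simp
    qed
    also have "\<dots> = d" by (simp add: sum_distrib_left[symmetric] s1)
    finally show "cmod (?F y) \<le> d" .
  qed
  finally show ?thesis .
qed

definition E :: "real \<Rightarrow> qalg" where "E a = hfc H (\<lambda>h. complex_of_real (step_fun (strip_coord a \<rho> h)))"
definition Tn :: "real \<Rightarrow> qalg" where "Tn a = hfc H (\<lambda>h. complex_of_real (tent_fun (strip_coord a \<rho> h)))"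

text \<open>The last equation says that \<open>E a - J\<close> is idempotent where the band \<open>B k\<close> is \<open>1\<close>.\<close>

definition cutter :: "real \<Rightarrow> int \<Rightarrow> qalg \<Rightarrow> bool" where
  "cutter a k J \<longleftrightarrow> star J = J \<and> J * (B k * Tn a) = J \<and> (B k * Tn a) * J = J \<and> H * J = J * H \<and> E a * J = J * E a \<and>
    (E a * E a - E a) * B k + J * J + J - 2 * (E a * J) = 0"

lemma ct: "cont (\<lambda>h. complex_of_real (step_fun (strip_coord a \<rho> h)))" "cont (\<lambda>h. complex_of_real (tent_fun (strip_coord a \<rho> h)))"
  using \<rho>(1) by (auto intro!: continuous_intros)

lemma sig_E: "sig W (E a) = E a" "sig W (Tn a) = Tn a"
  unfolding E_def Tn_def using hfc_sig[OF H(1) W ct(1)] hfc_sig[OF H(1) W ct(2)] H(2) by simp_all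

lemma cutter_exists:
  assumes l: "l \<in> {- int N..int N}" and k: "k \<in> bands"
  shows "\<exists>J. cutter (real_of_int l * d) k J"
  unfolding cutter_def E_def Tn_def
proof (rule band_cut[OF H(1) sa_B HB \<rho>(1)])
  fix f assume f: "hole_at (real_of_int l * d) \<rho> f"
  have "hfc H f * B k = B k * hfc H f" unfolding B_def using f by (intro commHK cbf) auto
  thus "(B k - B k * B k) * hfc H f = 0" using B_idem[OF l f k] by (simp add: left_diff_distrib) (metis mult.assoc)
qed

lemma cutter_sig:
  assumes "cutter a k J" shows "cutter a (- 1 - k) (sig W J)"
proof -
  note s = sig_mult[OF W] sig_add[OF W] sig_diff[OF W] sig_star[OF W] sig_B sig_E H(2)
  have c: "star J = J" "J * (B k * Tn a) = J" "(B k * Tn a) * J = J" "H * J = J * H" "E a * J = J * E a"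
    "(E a * E a - E a) * B k + J * J + J - (E a * J + E a * J) = 0" using assms by (auto simp: cutter_def mult_2)
  show ?thesis unfolding cutter_def mult_2
    using arg_cong[OF c(1), of "sig W"] arg_cong[OF c(2), of "sig W"] arg_cong[OF c(3), of "sig W"] 
      arg_cong[OF c(4), of "sig W"] arg_cong[OF c(5), of "sig W"] arg_cong[OF c(6), of "sig W"]
    by (simp add: s sig_0[OF W])
qed

text \<open>The projection \<open>P\<close> separates the spectral subspaces of \<open>H\<close> on the two sides of a column of holes.\<close>

definition separator :: "real \<Rightarrow> qalg \<Rightarrow> bool" where
  "separator a P \<longleftrightarrow> star P = P \<and> P * P = P \<and> H * P = P * H \<and> K2 * P = P * K2 \<and> sig W P = P \<and>
    (\<forall>f. cont f \<longrightarrow> (\<forall>h. h < a + \<rho> \<longrightarrow> f h = 0) \<longrightarrow> P * hfc H f = hfc H f) \<and>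
    (\<forall>f. cont f \<longrightarrow> (\<forall>h. a - \<rho> < h \<longrightarrow> f h = 0) \<longrightarrow> P * hfc H f = 0)"

text \<open>\<open>E\<close> is corrected by some \<open>J k\<close> in every band. Each correction
  lies in its own band, so corrections of different bands have product zero; as the bands add up to
  \<open>1\<close>, the identities of the single bands sum to idempotence of \<open>E\<close> minus
  all corrections.\<close>

lemma separator_exists:
  assumes l: "l \<in> {- int N..int N}"
  shows "\<exists>P. separator (real_of_int l * d) P"
proof -
  let ?a = "real_of_int l * d"
  obtain J0 where J0: "\<And>k. k \<in> bands \<Longrightarrow> cutter ?a k (J0 k)" using cutter_exists[OF l] by metis
  \<comment> \<open>Free choice for \<open>k >= 0\<close> and mirror images for
    \<open>k < 0\<close>: consistent because the reflection leaves no band fixed.\<close>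
  define J where "J = (\<lambda>k. if 0 \<le> k then J0 k else sig W (J0 (- 1 - k)))"
  have J: "cutter ?a k (J k)" if "k \<in> bands" for k
    using J0[of k] cutter_sig[OF J0[of "- 1 - k"]] that by (simp add: J_def)
  have sJ: "sig W (J k) = J (- 1 - k)" for k by (auto simp: J_def sig_sig[OF W])
  let ?p = "\<lambda>k. B k * Tn ?a"
  have j: "star (J k) = J k" "J k * ?p k = J k" "?p k * J k = J k" "H * J k = J k * H" "E ?a * J k = J k * E ?a"
    "(E ?a * E ?a - E ?a) * B k + J k * J k + J k - 2 * (E ?a * J k) = 0" if "k \<in> bands" for k
    using J[OF that] by (auto simp: cutter_def)
  have hole: "hole_at ?a \<rho> (\<lambda>h. complex_of_real (tent_fun (strip_coord ?a \<rho> h)))"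
  proof -
    have "tent_fun (strip_coord ?a \<rho> h) = 0" if "\<rho> \<le> \<bar>h - ?a\<bar>" for h
    proof -
      have "\<bar>strip_coord ?a \<rho> h\<bar> = 1"
        using that \<rho>(1) by (auto simp: strip_coord_def clip_def abs_if field_simps min_def max_def split: if_splits)
      thus ?thesis by (simp add: tent_fun_def clip_def)
    qed
    thus ?thesis using ct by auto
  qed
  have TB: "Tn ?a * B k = B k * Tn ?a" for k unfolding Tn_def B_def by (rule commHK[OF ct(2) cbf])
  \<comment> \<open>The tent is supported in the strip of the column, where the \<open>B k\<close>
    are orthogonal idempotents.\<close>
  have pp: "B i * ?p k = (if i = k then ?p k else 0)" if "i \<in> bands" "k \<in> bands" for i k
    using B_idem[OF l hole that(2)] B_orthogonal[OF l hole that] TB[of k] TB[of i]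
    by (auto simp: Tn_def[symmetric]) (metis mult.assoc)+
  have BJ: "B i * J k = (if i = k then J k else 0)" if "i \<in> bands" "k \<in> bands" for i k
    using pp[OF that] j(3)[OF that(2)] by (metis mult.assoc mult_zero_left)
  have JB: "J k * B i = (if i = k then J k else 0)" if "i \<in> bands" "k \<in> bands" for i k
    using arg_cong[OF BJ[OF that], of star] j(1)[OF that(2)] sa_B[of i] by (auto simp: star_mult sa_def)
  have JJ: "J i * J k = 0" if "i \<in> bands" "k \<in> bands" "i \<noteq> k" for i k
    using JB[OF that(2,1)] BJ[OF that(2,2)] that(3) by (metis JB that(1,2) mult.assoc mult_zero_left)
  define S where "S = (\<Sum>k\<in>bands. J k)"
  have SS: "S * S = (\<Sum>k\<in>bands. J k * J k)"
    unfolding S_def sum_product using JJ by (intro sum_orthogonal) auto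
  have ES: "E ?a * S = S * E ?a" unfolding S_def by (rule commute_sum) (rule j(5))
  have id: "(E ?a * E ?a - E ?a) + S * S + S - (E ?a * S + E ?a * S) = 0"
  proof -
    have "(\<Sum>k\<in>bands. (E ?a * E ?a - E ?a) * B k + J k * J k + J k - (E ?a * J k + E ?a * J k)) = 0"
      using j(6) by (intro sum.neutral) (simp add: mult_2)
    moreover have "(\<Sum>k\<in>bands. (E ?a * E ?a - E ?a) * B k) = E ?a * E ?a - E ?a"
      by (simp add: sum_distrib_left[symmetric] sum_B)
    ultimately show ?thesis 
      by (simp add: sum.distrib sum_subtractf SS S_def[symmetric] sum_distrib_left[symmetric] del: mult_2)
  qed
  define P where "P = E ?a - S"
  have sE: "star (E ?a) = E ?a" 
    using sa_hfc[OF H(1), of "\<lambda>h. step_fun (strip_coord ?a \<rho> h)"] \<rho>(1) by (simp add: E_def sa_def continuous_intros)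
  have "star S = S" unfolding S_def star_sum by (rule sum.cong) (auto simp: j(1))
  hence Ps: "star P = P" by (simp add: P_def star_diff sE)
  have "(e - S) * (e - S) - (e - S) = (e * e - e) + S * S + S - (e * S + e * S)" if "e * S = S * e" for e
    using that by (simp add: algebra_simps)
  from this[OF ES] have "P * P - P = (E ?a * E ?a - E ?a) + S * S + S - (E ?a * S + E ?a * S)"
    by (simp only: P_def)
  hence PP: "P * P = P" by (simp add: id)
  have HE: "H * E ?a = E ?a * H" unfolding E_def by (rule hfc_comm[OF H(1) refl ct(1), symmetric])
  have HP: "H * P = P * H" unfolding P_def S_def by (intro commute_diff commute_sum HE j(4))
  have EB: "E ?a * B k = B k * E ?a" for k unfolding E_def B_def by (rule commHK[OF ct(1) cbf])
  have KE: "K2 * E ?a = E ?a * K2"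
    unfolding K2_def by (rule commute_sum[symmetric], rule commute_mult) (simp_all add: cof_commute EB)
  \<comment> \<open>\<open>J k\<close> lies in the band \<open>k\<close>, on which \<open>K2\<close>
    is the scalar \<open>?s k\<close>.\<close>
  have KJ: "K2 * J k = J k * K2" if k: "k \<in> bands" for k
  proof -
    let ?s = "\<lambda>k. cof (complex_of_real ((real_of_int k + 1 / 2) * d))"
    have "K2 * J k = (\<Sum>i\<in>bands. ?s i * (B i * J k))" by (simp add: K2_def sum_distrib_right mult.assoc)
    also have "\<dots> = ?s k * (B k * J k)" by (rule sum_single) (use BJ k in auto)
    finally have 1: "K2 * J k = ?s k * J k" using BJ[OF k k] by simp
    from arg_cong[OF this, of star] have "J k * K2 = J k * ?s k" 
      using j(1)[OF k] sa_K2 by (simp add: star_mult star_cof sa_def)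
    thus ?thesis using 1 by (simp add: cof_commute)
  qed
  have KP: "K2 * P = P * K2" unfolding P_def S_def by (intro commute_diff commute_sum KE KJ)
  have "sig W S = (\<Sum>k\<in>bands. J (- 1 - k))" by (simp add: S_def sig_sum[OF W] sJ)
  also have "\<dots> = S" unfolding S_def
    by (rule sum.reindex_bij_witness[of _ "\<lambda>k. - 1 - k" "\<lambda>k. - 1 - k"]) auto
  finally have sP: "sig W P = P" by (simp add: P_def sig_diff[OF W] sig_E)
  have Sf: "S * hfc H f = 0" if f: "cont f" "\<And>h. \<bar>h - ?a\<bar> < \<rho> \<Longrightarrow> f h = 0" for f
  proof -
    have "Tn ?a * hfc H f = 0"
      unfolding Tn_def
    proof (rule hfc_mult_0[OF H(1) ct(2) f(1)])
      fix h show "complex_of_real (tent_fun (strip_coord ?a \<rho> h)) * f h = 0"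
        using hole f(2)[of h] by (cases "\<bar>h - ?a\<bar> < \<rho>") auto
    qed
    hence "J k * hfc H f = 0" if "k \<in> bands" for k using j(2)[OF that] by (metis mult.assoc mult_zero_right)
    thus ?thesis by (simp add: S_def sum_distrib_right)
  qed
  have P1: "P * hfc H f = hfc H f" if f: "cont f" "\<And>h. h < ?a + \<rho> \<Longrightarrow> f h = 0" for f
  proof -
    have "S * hfc H f = 0" by (rule Sf[OF f(1)]) (use f(2) in auto)
    moreover have "E ?a * hfc H f = hfc H f"
    proof -
      have "(\<lambda>h. complex_of_real (step_fun (strip_coord ?a \<rho> h)) * f h) = f"
      proof
        fix h
        have "step_fun (strip_coord ?a \<rho> h) = 1" if "?a + \<rho> \<le> h"
        proof -
          have "1 \<le> (h - ?a) / \<rho>" using that \<rho>(1) by (simp add: field_simps)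
          thus ?thesis by (simp add: strip_coord_def step_fun_def clip_def)
        qed
        thus "complex_of_real (step_fun (strip_coord ?a \<rho> h)) * f h = f h" using f(2)[of h] by (cases "h < ?a + \<rho>") auto
      qed
      thus ?thesis using hfc_mult[OF H(1) ct(1) f(1), of ?a] by (simp add: E_def)
    qed
    ultimately show ?thesis by (simp add: P_def left_diff_distrib)
  qed
  have P0: "P * hfc H f = 0" if f: "cont f" "\<And>h. ?a - \<rho> < h \<Longrightarrow> f h = 0" for f
  proof -
    have "S * hfc H f = 0" by (rule Sf[OF f(1)]) (use f(2) in auto)
    moreover have "E ?a * hfc H f = 0"
      unfolding E_def
    proof (rule hfc_mult_0[OF H(1) ct(1) f(1)])
      fix h
      have "step_fun (strip_coord ?a \<rho> h) = 0" if "h \<le> ?a - \<rho>"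
      proof -
        have "(h - ?a) / \<rho> \<le> -1" using that \<rho>(1) by (simp add: field_simps)
        thus ?thesis by (simp add: strip_coord_def step_fun_def clip_def)
      qed
      thus "complex_of_real (step_fun (strip_coord ?a \<rho> h)) * f h = 0" using f(2)[of h] by (cases "?a - \<rho> < h") auto
    qed
    ultimately show ?thesis by (simp add: P_def left_diff_distrib)
  qed
  have "separator ?a P" unfolding separator_def using Ps PP HP KP sP P1 P0 by blast
  thus ?thesis by blast
qed

end

section \<open>From nested separators to an orthogonal partition\<close>

context holes begin

text \<open>The columns at \<open>- N d\<close> and \<open>N d\<close> lie beyond the spectrum of
  \<open>H\<close>. Having the constants \<open>1\<close> and \<open>0\<close> there makes
  consecutive differences of separators add up to \<open>1\<close>.\<close>

lemma separator_trivial: "separator (- (real N * d)) 1" "separator (real N * d) 0"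
proof -
  have z: "hfc H f = 0" if f: "cont f" "\<And>h. \<bar>h\<bar> \<le> real N * d - \<rho> \<Longrightarrow> f h = 0" for f
  proof -
    have "hfc H f = hfc H (\<lambda>_. 0)"
      by (rule hfc_cong[OF H(1) f(1) _ c(1), of _ "real N * d - \<rho>"]) (use f(2) c in \<open>auto intro: continuous_intros\<close>)
    thus ?thesis using hfc_const[OF H(1), of 0] by simp
  qed
  show "separator (- (real N * d)) 1" unfolding separator_def
    using \<rho>(1) by (auto simp: sig_1[OF W] intro!: z)
  show "separator (real N * d) 0" unfolding separator_def
    using \<rho>(1) by (auto simp: sig_0[OF W] intro!: z)
qed

text \<open>Separators of different columns are nested, so their differences \<open>R l\<close> are
  orthogonal projections. On \<open>R l\<close> the one-sided conditions at both columns confine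
  \<open>H\<close> to distance \<open>d\<close> from the midpoint, and by orthogonality the bound
  for the single parts bounds the sum.\<close>

lemma spectral_steps:
  "\<exists>R. (\<forall>l\<in>bands. star (R l) = R l \<and> sig W (R l) = R l \<and> K2 * R l = R l * K2) \<and>
     (\<forall>l\<in>bands. \<forall>m\<in>bands. R l * R m = (if l = m then R l else 0)) \<and> (\<Sum>l\<in>bands. R l) = 1 \<and>
     nb (H - (\<Sum>l\<in>bands. cof (complex_of_real ((real_of_int l + 1 / 2) * d)) * R l)) d"
proof -
  obtain P0 where P0: "\<And>l. l \<in> {- int N..int N} \<Longrightarrow> separator (real_of_int l * d) (P0 l)"
    using separator_exists by metis
  define P where "P = (\<lambda>l. if l = - int N then 1 else if l = int N then 0 else P0 l)"
  have N: "N > 0" using c \<rho> by (cases N) auto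
  have P: "separator (real_of_int l * d) (P l)" if "l \<in> {- int N..int N}" for l
    using P0[OF that] separator_trivial by (auto simp: P_def)
  have p: "star (P l) = P l" "P l * P l = P l" "H * P l = P l * H" "K2 * P l = P l * K2" "sig W (P l) = P l"
    "\<And>f. cont f \<Longrightarrow> (\<And>h. h < real_of_int l * d + \<rho> \<Longrightarrow> f h = 0) \<Longrightarrow> P l * hfc H f = hfc H f"
    "\<And>f. cont f \<Longrightarrow> (\<And>h. real_of_int l * d - \<rho> < h \<Longrightarrow> f h = 0) \<Longrightarrow> P l * hfc H f = 0" if "l \<in> {- int N..int N}" for l
    using P[OF that] unfolding separator_def by blast+
  have nest: "P l * P m = P m" "P m * P l = P m" if lm: "l \<in> {- int N..int N}" "m \<in> {- int N..int N}" "l < m" for l m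
  proof -
    \<comment> \<open>\<open>0\<close> up to \<open>l d + \<rho>\<close> and \<open>1\<close> from
      \<open>l d + 3 \<rho>\<close> on, which is at most \<open>m d - \<rho>\<close> as
      \<open>4 \<rho> <= d\<close>. So \<open>P l\<close> fixes this function of \<open>H\<close>,
      and it acts as \<open>1\<close> on \<open>P m\<close>.\<close>
    let ?f = "\<lambda>h. complex_of_real (clip 0 1 ((h - real_of_int l * d - \<rho>) / (2 * \<rho>)))"
    have cf: "cont ?f" using \<rho>(1) by (intro continuous_intros) auto
    have "1 * d \<le> (real_of_int m - real_of_int l) * d" using lm d0 by (intro mult_right_mono) auto
    hence dd: "real_of_int l * d + 4 * \<rho> \<le> real_of_int m * d" using \<rho>(2) by (simp add: left_diff_distrib)
    have 1: "P l * hfc H ?f = hfc H ?f"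
      by (rule p(6)[OF lm(1) cf]) (use \<rho>(1) in \<open>auto simp: clip_def divide_less_0_iff max_def min_def field_simps\<close>)
    have "P m * hfc H (\<lambda>h. 1 - ?f h) = 0"
    proof (rule p(7)[OF lm(2)])
      show "cont (\<lambda>h. 1 - ?f h)" by (intro continuous_on_diff continuous_on_const cf)
      fix h assume "real_of_int m * d - \<rho> < h"
      hence "1 \<le> (h - real_of_int l * d - \<rho>) / (2 * \<rho>)" using \<rho>(1) dd by (simp add: pos_le_divide_eq)
      thus "1 - ?f h = 0" by (simp add: clip_def)
    qed
    moreover have "hfc H (\<lambda>h. 1 - ?f h) = 1 - hfc H ?f" using hfc_minus[OF H(1) continuous_on_const cf, of 1] hfc_const[OF H(1), of 1] by simp
    ultimately have "P m = P m * hfc H ?f" by (simp add: right_diff_distrib)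
    hence 2: "P m = hfc H ?f * P m" using hfc_comm[OF H(1) p(3)[OF lm(2)] cf] by simp
    have "P l * P m = P l * (hfc H ?f * P m)" using 2 by (rule arg_cong)
    also have "\<dots> = hfc H ?f * P m" by (simp only: mult.assoc[symmetric] 1)
    also have "\<dots> = P m" by (rule 2[symmetric])
    finally show *: "P l * P m = P m" .
    show "P m * P l = P m" using arg_cong[OF *, of star] p(1)[OF lm(1)] p(1)[OF lm(2)] by (simp add: star_mult)
  qed
  define R where "R = (\<lambda>l. P l - P (l + 1))"
  have in1: "l \<in> {- int N..int N}" "l + 1 \<in> {- int N..int N}" "l < l + 1" if "l \<in> bands" for l using that by auto
  have r1: "star (R l) = R l" "sig W (R l) = R l" "K2 * R l = R l * K2" "H * R l = R l * H" if "l \<in> bands" for l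
    using p(1,3-5)[OF in1(1)[OF that]] p(1,3-5)[OF in1(2)[OF that]]
    by (simp_all add: R_def star_diff sig_diff[OF W] left_diff_distrib right_diff_distrib)
  have RR: "R l * R l = R l" if "l \<in> bands" for l
    using p(2)[OF in1(1)[OF that]] p(2)[OF in1(2)[OF that]] nest[OF in1[OF that]]
    by (simp add: R_def left_diff_distrib right_diff_distrib)
  have R0: "R l * R m = 0 \<and> R m * R l = 0" if lm: "l \<in> bands" "m \<in> bands" "l < m" for l m
  proof -
    have a: "P l * P m = P m" "P m * P l = P m" "P l * P (m + 1) = P (m + 1)" "P (m + 1) * P l = P (m + 1)"
       "P (l + 1) * P (m + 1) = P (m + 1)" "P (m + 1) * P (l + 1) = P (m + 1)"
      using nest[of l m] nest[of l "m + 1"] nest[of "l + 1" "m + 1"] lm by auto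
    have b: "P (l + 1) * P m = P m" "P m * P (l + 1) = P m"
      using nest[of "l + 1" m] p(2)[of m] lm by (cases "l + 1 = m"; auto)+
    show ?thesis unfolding R_def left_diff_distrib right_diff_distrib a b by simp
  qed
  have orth: "R l * R m = (if l = m then R l else 0)" if "l \<in> bands" "m \<in> bands" for l m
    using RR[OF that(1)] R0[OF that] R0[OF that(2,1)] by (cases l m rule: linorder_cases) auto
  have "(\<Sum>l\<in>bands. R l) = P (- int N) - P (int N)" unfolding R_def by (rule sum_telescope_int)
  hence sum1: "(\<Sum>l\<in>bands. R l) = 1" using N by (simp add: P_def)
  let ?a = "\<lambda>l. (real_of_int l + 1 / 2) * d"
  define g where "g = (\<lambda>l h. complex_of_real (clip (- d) d (h - ?a l)))"
  have cg: "cont (g l)" for l unfolding g_def by (intro continuous_intros)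
  have HR: "(H - cof (complex_of_real (?a l))) * R l = hfc H (g l) * R l" if l: "l \<in> bands" for l
  proof -
    \<comment> \<open>The parts of \<open>H\<close> beyond distance \<open>d\<close> on either side:
      \<open>P l\<close> and \<open>P (l + 1)\<close> both act as \<open>1\<close> on the first and
      as \<open>0\<close> on the second, so their difference kills both.\<close>
    let ?u = "\<lambda>h. complex_of_real (max 0 (h - ?a l - d))" and ?v = "\<lambda>h. complex_of_real (min 0 (h - ?a l + d))"
    have cu: "cont ?u" "cont ?v" by (intro continuous_intros)+
    have "R l * hfc H ?u = 0"
    proof -
      have "P l * hfc H ?u = hfc H ?u" 
        by (rule p(6)[OF in1(1)[OF l] cu(1)]) (use \<rho> d0 in \<open>auto simp: algebra_simps max_def\<close>)
      moreover have "P (l + 1) * hfc H ?u = hfc H ?u" 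
        by (rule p(6)[OF in1(2)[OF l] cu(1)]) (use \<rho> d0 in \<open>auto simp: algebra_simps max_def\<close>)
      ultimately show ?thesis by (simp add: R_def left_diff_distrib)
    qed
    hence u: "hfc H ?u * R l = 0" using hfc_comm[OF H(1) r1(4)[OF l] cu(1)] by simp
    have "R l * hfc H ?v = 0"
    proof -
      have "P l * hfc H ?v = 0" 
        by (rule p(7)[OF in1(1)[OF l] cu(2)]) (use \<rho> d0 in \<open>auto simp: algebra_simps min_def\<close>)
      moreover have "P (l + 1) * hfc H ?v = 0" 
        by (rule p(7)[OF in1(2)[OF l] cu(2)]) (use \<rho> d0 in \<open>auto simp: algebra_simps min_def\<close>)
      ultimately show ?thesis by (simp add: R_def left_diff_distrib)
    qed
    hence v: "hfc H ?v * R l = 0" using hfc_comm[OF H(1) r1(4)[OF l] cu(2)] by simp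
    have "hfc H (\<lambda>h. complex_of_real h - complex_of_real (?a l)) = hfc H complex_of_real - hfc H (\<lambda>_. complex_of_real (?a l))"
      by (rule hfc_minus[OF H(1)]) (intro continuous_intros continuous_on_of_real_id)+
    hence "H - cof (complex_of_real (?a l)) = hfc H (\<lambda>h. complex_of_real h - complex_of_real (?a l))"
      by (simp only: hfc_id[OF H(1)] hfc_const[OF H(1)])
    also have "(\<lambda>h. complex_of_real h - complex_of_real (?a l)) = (\<lambda>h. g l h + (?u h + ?v h))"
    proof
      fix h
      have "h - ?a l = clip (- d) d (h - ?a l) + (max 0 (h - ?a l - d) + min 0 (h - ?a l + d))"
        using d0 by (auto simp: clip_def)
      from arg_cong[OF this, of complex_of_real]
      show "complex_of_real h - complex_of_real (?a l) = g l h + (?u h + ?v h)" 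
        unfolding g_def by (simp only: of_real_diff of_real_add)
    qed
    also have "hfc H \<dots> = hfc H (g l) + (hfc H ?u + hfc H ?v)"
      by (subst hfc_add[OF H(1) cg continuous_on_add[OF cu]], subst hfc_add[OF H(1) cu]) (rule refl)
    finally show ?thesis using u v by (simp add: distrib_right)
  qed
  define S where "S = (\<Sum>l\<in>bands. cof (complex_of_real (?a l)) * R l)"
  have "H - S = H * (\<Sum>l\<in>bands. R l) - S" by (simp only: sum1 mult_1_right)
  also have "\<dots> = (\<Sum>l\<in>bands. (H - cof (complex_of_real (?a l))) * R l)"
    by (simp only: S_def sum_distrib_left left_diff_distrib sum_subtractf)
  finally have HS: "H - S = (\<Sum>l\<in>bands. hfc H (g l) * R l)" using HR by simp
  have Rg: "R l * hfc H (g m) = hfc H (g m) * R l" if "l \<in> bands" for l m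
    by (rule hfc_comm[OF H(1) r1(4)[OF that] cg, symmetric])
  have gs: "star (hfc H (g l)) = hfc H (g l)" for l
    unfolding g_def using sa_hfc[OF H(1), of "\<lambda>h. clip (- d) d (h - ?a l)"] by (simp add: sa_def continuous_intros)
  have "star (H - S) = (\<Sum>l\<in>bands. hfc H (g l) * R l)"
    unfolding HS star_sum using r1(1) Rg gs by (intro sum.cong) (simp_all add: star_mult)
  hence "star (H - S) * (H - S) = (\<Sum>l\<in>bands. \<Sum>m\<in>bands. hfc H (g l) * R l * (hfc H (g m) * R m))"
    unfolding HS by (simp only: sum_product)
  also have "\<dots> = (\<Sum>l\<in>bands. \<Sum>m\<in>bands. if l = m then R l * (hfc H (g l) * hfc H (g l)) * R l else 0)"
  proof (intro sum.cong refl)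
    fix l m assume lm: "l \<in> bands" "m \<in> bands"
    have "hfc H (g l) * R l * (hfc H (g m) * R m) = hfc H (g l) * hfc H (g m) * (R l * R m)"
      using Rg[OF lm(1), of m] by (metis mult.assoc)
    also have "\<dots> = (if l = m then R l * (hfc H (g l) * hfc H (g l)) * R l else 0)"
    proof (cases "l = m")
      case True
      have "R l * (hfc H (g l) * hfc H (g l)) = hfc H (g l) * hfc H (g l) * R l"
        using Rg[OF lm(1), of l] by (metis mult.assoc)
      thus ?thesis using True by (simp add: mult.assoc)
    qed (simp add: orth[OF lm])
    finally show "hfc H (g l) * R l * (hfc H (g m) * R m) = (if l = m then R l * (hfc H (g l) * hfc H (g l)) * R l else 0)" .
  qed
  also have "\<dots> = (\<Sum>l\<in>bands. R l * (hfc H (g l) * hfc H (g l)) * R l)"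
    by (intro sum.cong refl) (simp add: sum.delta')
  finally have 1: "star (H - S) * (H - S) = (\<Sum>l\<in>bands. R l * (hfc H (g l) * hfc H (g l)) * R l)" .
  have "cof (complex_of_real (d\<^sup>2)) = (\<Sum>l\<in>bands. cof (complex_of_real (d\<^sup>2)) * R l)"
    by (simp only: sum_distrib_left[symmetric] sum1 mult_1_right)
  also have "\<dots> = (\<Sum>l\<in>bands. R l * cof (complex_of_real (d\<^sup>2)) * R l)"
    by (intro sum.cong refl) (simp only: cof_commute mult.assoc RR)
  finally have "cof (complex_of_real (d\<^sup>2)) - star (H - S) * (H - S) = 
      (\<Sum>l\<in>bands. star (R l) * (cof (complex_of_real (d\<^sup>2)) - hfc H (g l) * hfc H (g l)) * R l)"
    unfolding 1 using r1(1) by (simp add: sum_subtractf left_diff_distrib right_diff_distrib)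
  also have "pos \<dots>"
  proof (intro pos_sum pos_conj)
    fix l
    let ?k = "\<lambda>h. clip (- d) d (h - ?a l)"
    have "cof (complex_of_real (d\<^sup>2)) - hfc H (g l) * hfc H (g l) = hfc H (\<lambda>h. complex_of_real (d\<^sup>2)) - hfc H (\<lambda>h. g l h * g l h)"
      by (simp only: hfc_const[OF H(1)] hfc_mult[OF H(1) cg cg])
    also have "\<dots> = hfc H (\<lambda>h. complex_of_real (d\<^sup>2) - g l h * g l h)"
      by (rule hfc_minus[OF H(1), symmetric]) (intro continuous_intros cg)+
    also have "\<dots> = hfc H (\<lambda>h. complex_of_real (d\<^sup>2 - ?k h * ?k h))" by (simp add: g_def)
    also have "pos \<dots>"
    proof (rule hfc_pos[OF H(1)])
      show "continuous_on UNIV (\<lambda>h. d\<^sup>2 - ?k h * ?k h)" by (intro continuous_intros)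
      fix h
      have "\<bar>?k h\<bar> \<le> \<bar>d\<bar>" using d0 by (auto simp: clip_def)
      from power_mono[OF this, of 2] show "0 \<le> d\<^sup>2 - ?k h * ?k h" by (simp add: power2_eq_square)
    qed
    finally show "pos (cof (complex_of_real (d\<^sup>2)) - hfc H (g l) * hfc H (g l))" .
  qed
  finally have "nb (H - S) d" by (rule nb_pos) (use d0 in simp)
  thus ?thesis using r1(1-3) orth sum1 unfolding S_def by blast
qed

end

lemma quantize:
  assumes W: "real_structure W" and H: "sa H" "sig W H = H" "nb H 1" and K: "sa K" "sig W K = - K" "nb K 1"
    and HK: "H * K = K * H" and e: "e > 0"
  shows "\<exists>(I :: int set) a R K'. finite I \<and> sa K' \<and> sig W K' = - K' \<and>
    (\<forall>l\<in>I. star (R l) = R l \<and> sig W (R l) = R l \<and> K' * R l = R l * K') \<and>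
    (\<forall>l\<in>I. \<forall>m\<in>I. R l * R m = (if l = m then R l else 0)) \<and> (\<Sum>l\<in>I. R l) = 1 \<and>
    nb (H + cof \<i> * K - ((\<Sum>l\<in>I. cof (complex_of_real (a l)) * R l) + cof \<i> * K')) e"
proof -
  \<comment> \<open>The errors add up to \<open>5/2 d\<close>: for each of the two coordinates
    \<open>d / 4\<close> from making the holes and \<open>d\<close> from rounding.\<close>
  define d where "d = min 1 (e / 4)"
  have d: "d > 0" "d \<le> 1" "d \<le> e / 4" using e by (auto simp: d_def)
  obtain N where N: "2 / d \<le> real N" using real_arch_simple by blast
  \<comment> \<open>Room for the norm bound \<open>1 + d / 4\<close> after making the holes, and for
    the width of the holes.\<close>
  have Nd: "2 \<le> real N * d" using N d by (simp add: divide_le_eq)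
  let ?L = "grid N d"
  have fin: "finite ?L" unfolding grid_def by simp
  have L: "(0, 0) \<in> ?L" unfolding grid_def by (auto intro!: image_eqI[of _ _ "(0,0)"])
  hence card: "card ?L \<ge> 1" using fin by (metis One_nat_def Suc_leI card_gt_0_iff empty_iff)
  \<comment> \<open>All pushes together then move the element by at most \<open>d / 4\<close>,
    however many grid points there are.\<close>
  define r where "r = d / 4 / real (card ?L)"
  have r: "r > 0" "real (card ?L) * r = d / 4" using d card by (auto simp: r_def)
  have r4: "4 * r \<le> d"
  proof -
    have "1 * r \<le> real (card ?L) * r" using card r(1) by (intro mult_right_mono) auto
    thus ?thesis using r by simp
  qed
  have sym: "(a, - b) \<in> ?L" if "(a, b) \<in> ?L" for a b
  proof -
    from that obtain l k where lk: "l \<in> {- int N..int N}" "k \<in> {- int N..int N}" "a = real_of_int l * d" "b = real_of_int k * d"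
      unfolding grid_def by auto
    show ?thesis unfolding grid_def by (rule image_eqI[of _ _ "(l, - k)"]) (use lk in auto)
  qed
  have sep: "d \<le> \<bar>a - a'\<bar> \<or> d \<le> \<bar>b - b'\<bar>" if "(a, b) \<in> ?L" "(a', b') \<in> ?L" "(a, b) \<noteq> (a', b')" for a b a' b'
  proof -
    have *: "d \<le> \<bar>real_of_int l * d - real_of_int k * d\<bar>" if "l \<noteq> k" for l k :: int
    proof -
      have "1 * d \<le> \<bar>real_of_int l - real_of_int k\<bar> * d" using that d by (intro mult_right_mono) linarith+
      thus ?thesis using d by (simp add: abs_mult left_diff_distrib[symmetric])
    qed
    from that obtain l k l' k' where "a = real_of_int l * d" "b = real_of_int k * d" "a' = real_of_int l' * d" "b' = real_of_int k' * d"
      unfolding grid_def by auto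
    thus ?thesis using * that(3) by (cases "l = l'") auto
  qed
  obtain H' K' where HK': "sa H'" "sa K'" "H' * K' = K' * H'" "sig W H' = H'" "sig W K' = - K'"
      "nb (H' - H) (d / 4)" "nb (K' - K) (d / 4)" "hole_family ?L (r / 2) H' K'"
    using holes_exist[OF W H(1,2) K(1,2) HK r(1) r4 fin sym sep] unfolding r(2) by blast
  have n1: "nb H' (1 + d / 4)" "nb K' (1 + d / 4)" using nb_add[OF H(3) HK'(6)] nb_add[OF K(3) HK'(7)] by simp_all
  interpret holes W N d "r / 2" H' K' "1 + d / 4"
    by unfold_locales (use W HK' n1 r r4 Nd d in auto)
  obtain R where R: "\<forall>l\<in>bands. star (R l) = R l \<and> sig W (R l) = R l \<and> K2 * R l = R l * K2"
     "\<forall>l\<in>bands. \<forall>m\<in>bands. R l * R m = (if l = m then R l else 0)" "(\<Sum>l\<in>bands. R l) = 1"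
     "nb (H' - (\<Sum>l\<in>bands. cof (complex_of_real ((real_of_int l + 1 / 2) * d)) * R l)) d"
    using spectral_steps by blast
  let ?S = "\<Sum>l\<in>bands. cof (complex_of_real ((real_of_int l + 1 / 2) * d)) * R l"
  have "nb (((H' - ?S) - (H' - H)) + cof \<i> * (- (K2 - K') - (K' - K))) ((d + d / 4) + 1 * (d + d / 4))"
    by (intro nb_add nb_diff nb_mult nb_uminus R(4) HK' nb_K2 nb_mono[OF nb_cof]) (use d in auto)
  moreover have "((H' - ?S) - (H' - H)) + cof \<i> * (- (K2 - K') - (K' - K)) = H + cof \<i> * K - (?S + cof \<i> * K2)"
    by (simp add: algebra_simps)
  ultimately have "nb (H + cof \<i> * K - (?S + cof \<i> * K2)) ((d + d / 4) + 1 * (d + d / 4))" by (simp only:)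
  hence "nb (H + cof \<i> * K - (?S + cof \<i> * K2)) e" by (rule nb_mono) (use d in simp)
  thus ?thesis using R(1-3) sa_K2 sig_K2 
    by (intro exI[of _ "bands"] exI[of _ "\<lambda>l. (real_of_int l + 1 / 2) * d"] exI[of _ R] exI[of _ K2]) simp
qed

section \<open>Lifting to matrices\<close>

lemma fam_smult [simp]: "fam x \<Longrightarrow> fam (\<lambda>i n. c \<cdot>\<^sub>m x i n)"
  using fam_mult[OF fam_scalar[of c], of x] by (simp add: scalar_mat_mult[OF fam_carrier])

lemma abs_qalg_smult: "fam x \<Longrightarrow> abs_qalg (\<lambda>i n. c \<cdot>\<^sub>m x i n) = cof c * abs_qalg x"
  by (simp add: abs_qalg_ops scalar_mat_mult[OF fam_carrier])

text \<open>A self-adjoint representative is averaged with \<open>t\<close> times its image; the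
  sign covers both the fixed element \<open>S\<close> and the negated \<open>K\<close>.\<close>

lemma sa_rep_sig:
  assumes W: "real_structure W" and q: "star q = q" "sig W q = cof t * q" and t: "t = 1 \<or> t = - 1"
  obtains y where "fam y" "q = abs_qalg y" "\<And>i n. mat_adjoint (y i n) = y i n" "\<And>i n. conj_by W n (y i n) = t \<cdot>\<^sub>m y i n"
proof -
  obtain x where x: "fam x" "q = abs_qalg x" "\<And>i n. mat_adjoint (x i n) = x i n" using sa_rep[OF q(1)] by blast
  have tt: "t * t = 1" "cnj t = t" using t by auto
  have c: "x i n \<in> carrier_mat n n" "conj_by W n (x i n) \<in> carrier_mat n n" for i n using x(1) W by auto
  let ?y = "\<lambda>i n. (1/2) \<cdot>\<^sub>m (x i n + t \<cdot>\<^sub>m conj_by W n (x i n))"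
  show thesis
  proof
    show "fam ?y" using x(1) W by simp
    have "abs_qalg ?y = cof (1/2) * (abs_qalg x + cof t * sig W (abs_qalg x))"
      using x(1) W by (simp add: abs_qalg_smult abs_qalg_sig flip: abs_qalg_simps(3))
    also have "\<dots> = cof (1/2) * (q + q)"
      by (simp only: x(2)[symmetric] q(2) mult.assoc[symmetric] cof_mult[symmetric] tt) simp
    also have "\<dots> = cof (1/2 + 1/2) * q" by (simp only: cof_add distrib_left distrib_right)
    finally show "q = abs_qalg ?y" by simp
    fix i n
    have c: "x i n \<in> carrier_mat n n" "conj_by W n (x i n) \<in> carrier_mat n n" by (rule c)+
    have "mat_adjoint (conj_by W n (x i n)) = conj_by W n (x i n)"
      using conj_by_adjoint[OF W c(1)] x(3) by simp
    thus "mat_adjoint (?y i n) = ?y i n"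
      using c tt(2) by (simp add: mat_adjoint_smult mat_adjoint_add[of _ n n] x(3))
    have "conj_by W n (?y i n) = (1/2) \<cdot>\<^sub>m (conj_by W n (x i n) + t \<cdot>\<^sub>m x i n)"
      using c tt(2) by (simp add: conj_by_smult[OF W] conj_by_add[OF W] conj_by_conj_by[OF W])
    also have "\<dots> = t \<cdot>\<^sub>m ?y i n"
    proof (rule eq_matI)
      fix j k assume "j < dim_row (t \<cdot>\<^sub>m ?y i n)" "k < dim_col (t \<cdot>\<^sub>m ?y i n)"
      hence jk: "j < n" "k < n" using c by auto
      have "t * (t * u) = u" for u using tt(1) by (simp flip: mult.assoc)
      thus "((1/2) \<cdot>\<^sub>m (conj_by W n (x i n) + t \<cdot>\<^sub>m x i n)) $$ (j, k) = (t \<cdot>\<^sub>m ?y i n) $$ (j, k)"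
        using c jk by (auto simp: algebra_simps)
    qed (use c in auto)
    finally show "conj_by W n (?y i n) = t \<cdot>\<^sub>m ?y i n" .
  qed
qed

lemma normal_cartesian:
  assumes P: "P \<in> carrier_mat n n" "mat_adjoint P = P" and M: "M \<in> carrier_mat n n" "mat_adjoint M = M" and c: "P * M = M * P"
  shows "normal_matrix (P + \<i> \<cdot>\<^sub>m M)"
proof -
  have a: "mat_adjoint (P + \<i> \<cdot>\<^sub>m M) = P + (- \<i>) \<cdot>\<^sub>m M"
    using P M by (simp add: mat_adjoint_add[of _ n n] mat_adjoint_smult)
  have e: "(P + s \<cdot>\<^sub>m M) * (P + t \<cdot>\<^sub>m M) = P * P + (s + t) \<cdot>\<^sub>m (P * M) + (s * t) \<cdot>\<^sub>m (M * M)" for s t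
  proof -
    have "(P + s \<cdot>\<^sub>m M) * (P + t \<cdot>\<^sub>m M) = (P * P + s \<cdot>\<^sub>m (P * M)) + (t \<cdot>\<^sub>m (P * M) + (s * t) \<cdot>\<^sub>m (M * M))"
      using P(1) M(1) c by (simp add: mult_add_distrib_mat[of _ n n _ n] add_mult_distrib_mat[of _ n n _ _ n] 
          mult_smult_distrib[of _ n n _ n] mult_smult_assoc_mat[of _ n n _ n] smult_smult_mat mult.commute add_smult_distrib_left_mat[of _ n n]
          mult_carrier_mat[of _ n n _ n])
    also have "\<dots> = P * P + (s + t) \<cdot>\<^sub>m (P * M) + (s * t) \<cdot>\<^sub>m (M * M)"
      using P(1) M(1) by (intro eq_matI) (auto simp: algebra_simps)
    finally show ?thesis .
  qed
  show ?thesis unfolding normal_matrix_def a e by (simp add: mult.commute)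
qed

text \<open>\<open>z\<close> lives in the corner cut out by \<open>E\<close> and \<open>y\<close> in
  the complementary one, so all mixed products, with and without adjoints, vanish.\<close>

lemma normal_add_orthogonal:
  assumes y: "y \<in> carrier_mat n n" "normal_matrix y" and z: "z \<in> carrier_mat n n" "normal_matrix z" "E * z = z" "z * E = z"
    and E: "E \<in> carrier_mat n n" "mat_adjoint E = E" "E * y = 0\<^sub>m n n" "y * E = 0\<^sub>m n n"
  shows "normal_matrix (y + z)"
proof -
  let ?y = "mat_adjoint y" and ?z = "mat_adjoint z"
  have c: "?y \<in> carrier_mat n n" "?z \<in> carrier_mat n n" using y z by auto
  note as = assoc_mult_mat[of _ n n _ n _ n]
  have z0: "mat_adjoint (0\<^sub>m n n) = (0\<^sub>m n n :: complex mat)" by (intro eq_matI) auto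
  have s: "?z * E = ?z" "E * ?z = ?z" "?y * E = 0\<^sub>m n n" "E * ?y = 0\<^sub>m n n"
    using mat_adjoint_mult[OF E(1) z(1)] mat_adjoint_mult[OF z(1) E(1)] mat_adjoint_mult[OF E(1) y(1)] mat_adjoint_mult[OF y(1) E(1)]
    unfolding E z z0 by simp_all
  have 1: "y * ?z = 0\<^sub>m n n" using as[OF y(1) E(1) c(2)] E(4) s(2) c by (simp add: left_mult_zero_mat[of _ n n])
  have 2: "z * ?y = 0\<^sub>m n n" using as[OF z(1) E(1) c(1)] z(4) s(4) z by (simp add: right_mult_zero_mat[of _ n n])
  have 3: "?y * z = 0\<^sub>m n n" using as[OF c(1) E(1) z(1)] z(3) s(3) z by (simp add: left_mult_zero_mat[of _ n n])
  have 4: "?z * y = 0\<^sub>m n n" using as[OF c(2) E(1) y(1)] E(3) s(1) c by (simp add: right_mult_zero_mat[of _ n n])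
  show ?thesis
    using y z c unfolding normal_matrix_def
    by (simp add: mat_adjoint_add[of _ n n] mult_add_distrib_mat[of _ n n _ n] add_mult_distrib_mat[of _ n n _ _ n] 1 2 3 4
        mult_carrier_mat[of _ n n _ n])
qed

text \<open>\<open>E\<close> is the unit of its corner, so it commutes with the compression of
  \<open>K\<close>; a real multiple of the unit plus \<open>\<i>\<close> times a self-adjoint
  element is normal. Under a real structure the signs coming from \<open>\<i>\<close> and from
  \<open>K\<close> cancel.\<close>

lemma normal_block:
  fixes a :: real
  assumes E: "E \<in> carrier_mat n n" "mat_adjoint E = E" "E * E = E" and K: "K \<in> carrier_mat n n" "mat_adjoint K = K"
  defines "z \<equiv> complex_of_real a \<cdot>\<^sub>m E + \<i> \<cdot>\<^sub>m (E * K * E)"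
  shows "z \<in> carrier_mat n n" "normal_matrix z" "E * z = z" "z * E = z"
    "real_structure W \<Longrightarrow> conj_by W n E = E \<Longrightarrow> conj_by W n K = - K \<Longrightarrow> conj_by W n z = z"
proof -
  let ?M = "E * K * E"
  note as = assoc_mult_mat[of _ n n _ n _ n]
  have M: "?M \<in> carrier_mat n n" using E K by auto
  have EM: "E * ?M = ?M" "?M * E = ?M"
    using as[OF E(1) mult_carrier_mat[OF E(1) K(1)] E(1)] as[OF E(1) E(1) K(1)] as[OF mult_carrier_mat[OF E(1) K(1)] E(1) E(1)] E(3) by simp_all
  have Ms: "mat_adjoint ?M = ?M" using E K as[OF E(1) K(1) E(1)] by (simp add: mat_adjoint_mult[of _ n n _ n])
  show "z \<in> carrier_mat n n" using E M by (simp add: z_def)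
  show "normal_matrix z" unfolding z_def
  proof (rule normal_cartesian[of _ n])
    show "complex_of_real a \<cdot>\<^sub>m E * ?M = ?M * (complex_of_real a \<cdot>\<^sub>m E)"
      using E(1) M EM by (simp add: mult_smult_distrib[of _ n n _ n] mult_smult_assoc_mat[of _ n n _ n] del: assoc_mult_mat)
  qed (use E M Ms in \<open>auto simp: mat_adjoint_smult\<close>)
  show "E * z = z" "z * E = z"
    using E M EM unfolding z_def
    by (simp_all add: mult_add_distrib_mat[of _ n n _ n] add_mult_distrib_mat[of _ n n _ _ n] mult_smult_distrib[of _ n n _ n] mult_smult_assoc_mat[of _ n n _ n] del: assoc_mult_mat)
  assume W: "real_structure W" and c: "conj_by W n E = E" "conj_by W n K = - K"
  have "conj_by W n ?M = - ?M"
    using E K by (simp add: conj_by_mult[OF W] c mult_carrier_mat[of _ n n _ n] del: assoc_mult_mat)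
  moreover have "conj_by W n z = complex_of_real a \<cdot>\<^sub>m E + (- \<i>) \<cdot>\<^sub>m conj_by W n ?M"
    unfolding z_def using E M by (simp add: conj_by_add[OF W] conj_by_smult[OF W] c)
  moreover have "(- \<i>) \<cdot>\<^sub>m (- ?M) = \<i> \<cdot>\<^sub>m ?M" using M by (intro eq_matI) auto
  ultimately show "conj_by W n z = z" by (simp add: z_def)
qed

lemma conj_by_zero:
  assumes W: "real_structure W" shows "conj_by W n (0\<^sub>m n n) = 0\<^sub>m n n"
proof -
  have "0 \<cdot>\<^sub>m 1\<^sub>m n = (0\<^sub>m n n :: complex mat)" by (intro eq_matI) auto
  thus ?thesis using conj_by_smult[OF W one_carrier_mat, of n 0] by (simp add: conj_by_one[OF W])
qed

text \<open>The induction carries along that \<open>y\<close> is annihilated by \<open>E m\<close>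
  for \<open>m\<close> outside \<open>I\<close>; this is what \<open>normal_add_orthogonal\<close>
  asks for when the next block is added.\<close>

lemma lift_blocks:
  fixes E :: "int \<Rightarrow> nat \<Rightarrow> nat \<Rightarrow> complex mat"
  assumes W: "real_structure W"
    and E: "\<And>l. fam (E l)" "\<And>l i n. mat_adjoint (E l i n) = E l i n" "\<And>l i n. E l i n * E l i n = E l i n"
      "\<And>l m i n. l \<noteq> m \<Longrightarrow> E l i n * E m i n = 0\<^sub>m n n" "\<And>l i n. conj_by W n (E l i n) = E l i n"
    and K: "fam k" "\<And>i n. mat_adjoint (k i n) = k i n" "\<And>i n. conj_by W n (k i n) = - k i n"
    and I: "finite I"
  shows "\<exists>y. fam y \<and> abs_qalg y = (\<Sum>l\<in>I. cof (complex_of_real (a l)) * abs_qalg (E l) + 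
        cof \<i> * (abs_qalg (E l) * abs_qalg k * abs_qalg (E l))) \<and>
      (\<forall>i n. normal_matrix (y i n) \<and> conj_by W n (y i n) = y i n \<and> 
        (\<forall>m. m \<notin> I \<longrightarrow> E m i n * y i n = 0\<^sub>m n n \<and> y i n * E m i n = 0\<^sub>m n n))"
  using I
proof (induction I rule: finite_induct)
  case empty
  have "normal_matrix (0\<^sub>m n n)" for n
  proof -
    have "mat_adjoint (0\<^sub>m n n) = (0\<^sub>m n n :: complex mat)" by (intro eq_matI) auto
    thus ?thesis by (simp add: normal_matrix_def)
  qed
  moreover have "E m i n \<in> carrier_mat n n" for m i n using E(1) by simp
  ultimately show ?case by (intro exI[of _ "\<lambda>i n. 0\<^sub>m n n"])
      (simp add: conj_by_zero[OF W] abs_qalg_simps left_mult_zero_mat[of _ n n for n] right_mult_zero_mat[of _ n n for n])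
next
  case (insert l I)
  then obtain y where y: "fam y" "abs_qalg y = (\<Sum>l\<in>I. cof (complex_of_real (a l)) * abs_qalg (E l) + 
        cof \<i> * (abs_qalg (E l) * abs_qalg k * abs_qalg (E l)))"
      "\<And>i n. normal_matrix (y i n)" "\<And>i n. conj_by W n (y i n) = y i n" 
      "\<And>i n m. m \<notin> I \<Longrightarrow> E m i n * y i n = 0\<^sub>m n n" "\<And>i n m. m \<notin> I \<Longrightarrow> y i n * E m i n = 0\<^sub>m n n"
    by blast
  let ?z = "\<lambda>i n. complex_of_real (a l) \<cdot>\<^sub>m E l i n + \<i> \<cdot>\<^sub>m (E l i n * k i n * E l i n)"
  have ec: "E m i n \<in> carrier_mat n n" "k i n \<in> carrier_mat n n" "y i n \<in> carrier_mat n n" for m i n using E(1) K(1) y(1) by auto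
  note b = normal_block[OF ec(1) E(2,3) ec(2) K(2)]
  have fz: "fam ?z" using E(1) K(1) by simp
  have "abs_qalg ?z = cof (complex_of_real (a l)) * abs_qalg (E l) + cof \<i> * (abs_qalg (E l) * abs_qalg k * abs_qalg (E l))"
    using E(1) K(1) by (simp add: abs_qalg_smult flip: abs_qalg_simps(3,4))
  hence "abs_qalg (\<lambda>i n. y i n + ?z i n) = (\<Sum>l\<in>insert l I. cof (complex_of_real (a l)) * abs_qalg (E l) + 
        cof \<i> * (abs_qalg (E l) * abs_qalg k * abs_qalg (E l)))"
    unfolding sum.insert[OF insert(1,2)] abs_qalg_simps(3)[OF y(1) fz, symmetric] y(2)[symmetric] by (simp only: add.commute)
  moreover have "fam (\<lambda>i n. y i n + ?z i n)" using y(1) fz by simp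
  moreover have "normal_matrix (y i n + ?z i n)" for i n
    using normal_add_orthogonal[OF ec(3) y(3) b(1-4) ec(1) E(2) y(5,6)] insert by simp
  moreover have "conj_by W n (y i n + ?z i n) = y i n + ?z i n" for i n
    using conj_by_add[OF W ec(3) b(1)] y(4) b(5)[OF W E(5) K(3)] by simp
  moreover have "E m i n * (y i n + ?z i n) = 0\<^sub>m n n \<and> (y i n + ?z i n) * E m i n = 0\<^sub>m n n" if m: "m \<notin> insert l I" for m i n
  proof -
    have z: "?z i n \<in> carrier_mat n n" "E l i n * ?z i n = ?z i n" "?z i n * E l i n = ?z i n" by (rule b)+
    have "E m i n * (E l i n * ?z i n) = (E m i n * E l i n) * ?z i n" "(?z i n * E l i n) * E m i n = ?z i n * (E l i n * E m i n)"
      by (rule assoc_mult_mat[OF ec(1) ec(1) z(1), symmetric], rule assoc_mult_mat[OF z(1) ec(1) ec(1)])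
    moreover have "E m i n * E l i n = 0\<^sub>m n n" "E l i n * E m i n = 0\<^sub>m n n" using m E(4) by auto
    ultimately have "E m i n * ?z i n = 0\<^sub>m n n" "?z i n * E m i n = 0\<^sub>m n n" 
      unfolding z(2,3) left_mult_zero_mat[OF z(1)] right_mult_zero_mat[OF z(1)] by (simp_all only: left_mult_zero_mat[OF z(1)] right_mult_zero_mat[OF z(1)])
    thus ?thesis using m y(5,6)[of m] ec b(1)
      by (simp add: mult_add_distrib_mat[OF ec(1) ec(3) b(1)] add_mult_distrib_mat[OF ec(3) b(1) ec(1)])
  qed
  ultimately show ?case by blast
qed

text \<open>All \<open>R l\<close> are encoded in one self-adjoint \<open>S\<close>. In a
  self-adjoint lift of \<open>S\<close> they become the spectral projections of disjoint intervals
  around the integers, hence exactly orthogonal, which separate lifts of the \<open>R l\<close>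
  would not be. In the quotient the compressions \<open>R l * K * R l\<close> add up to
  \<open>K\<close> again, because \<open>K\<close> commutes with every \<open>R l\<close>.\<close>

lemma lift_normal:
  fixes a :: "int \<Rightarrow> real"
  assumes W: "real_structure W" and I: "finite I" and K: "star K = K" "sig W K = - K"
    and R: "\<And>l. l \<in> I \<Longrightarrow> star (R l) = R l" "\<And>l. l \<in> I \<Longrightarrow> sig W (R l) = R l" "\<And>l. l \<in> I \<Longrightarrow> K * R l = R l * K"
      "\<And>l m. l \<in> I \<Longrightarrow> m \<in> I \<Longrightarrow> R l * R m = (if l = m then R l else 0)" "(\<Sum>l\<in>I. R l) = 1"
  shows "\<exists>y. fam y \<and> abs_qalg y = (\<Sum>l\<in>I. cof (complex_of_real (a l)) * R l) + cof \<i> * K \<and>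
     (\<forall>i n. normal_matrix (y i n) \<and> conj_by W n (y i n) = y i n)"
proof -
  define S where "S = (\<Sum>l\<in>I. cof (complex_of_int l) * R l)"
  have S: "star S = S" "sig W S = cof 1 * S"
    using R(1,2) by (simp_all add: S_def star_sum sig_sum[OF W] star_mult sig_mult[OF W] star_cof sig_cof[OF W] cof_commute)
  obtain s where s: "fam s" "S = abs_qalg s" "\<And>i n. mat_adjoint (s i n) = s i n" "\<And>i n. conj_by W n (s i n) = 1 \<cdot>\<^sub>m s i n"
    using sa_rep_sig[OF W S] by blast
  have K': "sig W K = cof (- 1) * K" using K(2) by (simp add: cof_uminus)
  obtain k where k: "fam k" "K = abs_qalg k" "\<And>i n. mat_adjoint (k i n) = k i n" "\<And>i n. conj_by W n (k i n) = (- 1) \<cdot>\<^sub>m k i n"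
    using sa_rep_sig[OF W K(1) K'] by blast
  have k4: "conj_by W n (k i n) = - k i n" for i n unfolding k(4) by (intro eq_matI) auto
  have "\<exists>U l. unitary_mat n U \<and> s i n = udiag n U l" for i n
    using normal_udiag[of "s i n" n] s by simp
  from choice_pair[of "\<lambda>i n U l. unitary_mat n U \<and> s i n = udiag n U l", OF this]
  obtain U \<mu> where U: "\<And>i n. unitary_mat n (U i n)" and sU: "\<And>i n. s i n = udiag n (U i n) (\<mu> i n)" by blast
  have real: "\<mu> i n j \<in> \<real>" if "j < n" for i n j
    using udiag_hermitian[OF U[of n i], of "\<mu> i n" j] s(3)[of i n] that by (simp add: sU)
  obtain c where c: "c \<ge> 0" "\<And>i n. op_norm (s i n) \<le> c" using fam_bound[OF s(1)] by blast
  let ?D = "complex_of_real ` {-c..c}"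
  have D: "\<mu> i n j \<in> ?D" if j: "j < n" for i n j
  proof -
    have "cmod (\<mu> i n j) \<le> c" using cmod_le_op_norm_udiag[OF U j, of "\<mu> i n" i] c(2)[of i n] by (simp add: sU)
    hence "\<bar>Re (\<mu> i n j)\<bar> \<le> c" using abs_Re_le_cmod order.trans by blast
    thus ?thesis using real[OF j, of i] by (intro image_eqI[of _ _ "Re (\<mu> i n j)"]) (auto elim!: Reals_cases)
  qed
  have cD: "compact ?D" by (intro compact_continuous_image continuous_intros) auto
  let ?Phi = "\<lambda>F. abs_qalg (\<lambda>i n. udiag n (U i n) (\<lambda>j. F (\<mu> i n j)))"
  have sU': "s = (\<lambda>i n. udiag n (U i n) (\<mu> i n))" by (intro ext) (rule sU)
  have Phi: "calc ?D S ?Phi" unfolding s(2) sU'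
    by (rule calc_exists[of ?D U \<mu>]) (rule cD U D | assumption)+
  \<comment> \<open>The sharp indicator \<open>F l\<close> gives exact projections in every matrix;
    the continuous \<open>G l\<close>, which vanishes unless \<open>F l\<close> is \<open>1\<close>,
    is what can be evaluated in the quotient.\<close>
  define F where "F = (\<lambda>(l::int) z. if \<bar>Re z - real_of_int l\<bar> < 1 / 2 then 1 else 0 :: complex)"
  define G where "G = (\<lambda>(l::int) z. bump (1/8) (real_of_int l) (Re z))"
  have bF: "bounded (F l ` A)" for l A by (rule bounded_subset[of "{0, 1}"]) (auto simp: F_def)
  have cG: "continuous_on A (G l)" for l A unfolding G_def by (intro cont_Re cont_bump) simp
  have FF: "F l z * F m z = (if l = m then F l z else 0)" for l m z
  proof (cases "l = m")
    case False
    hence "1 \<le> \<bar>real_of_int l - real_of_int m\<bar>" by linarith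
    hence "\<not> (\<bar>Re z - real_of_int l\<bar> < 1 / 2 \<and> \<bar>Re z - real_of_int m\<bar> < 1 / 2)" by linarith
    thus ?thesis using False by (auto simp: F_def)
  qed (simp add: F_def)
  have G0: "G l z = 0 \<or> F l z = 1" for l z
    using bump_0[of "1/8" "Re z" "real_of_int l"] unfolding F_def G_def by (cases "\<bar>Re z - real_of_int l\<bar> < 1 / 2") auto
  have FG: "F l z * G m z = (if l = m then G m z else 0)" for l m z
    using G0[of m z] FF[of l z m] by (cases "l = m") auto
  define E where "E = (\<lambda>l i n. udiag n (U i n) (\<lambda>j. F l (\<mu> i n j)))"
  have fE: "fam (E l)" for l unfolding E_def by (rule fam_udiag[OF U D bF])
  have Eadj: "mat_adjoint (E l i n) = E l i n" for l i n
  proof -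
    have "cnj (F l z) = F l z" for z by (simp add: F_def)
    thus ?thesis by (simp add: E_def udiag_adjoint[OF U])
  qed
  have Eidem: "E l i n * E l i n = E l i n" for l i n
    by (simp add: E_def udiag_mult[OF U] FF)
  have Eorth: "E l i n * E m i n = 0\<^sub>m n n" if "l \<noteq> m" for l m i n
  proof -
    have "0 \<cdot>\<^sub>m 1\<^sub>m n = (0\<^sub>m n n :: complex mat)" by (intro eq_matI) auto
    thus ?thesis using that by (simp add: E_def udiag_mult[OF U] FF udiag_const[OF U])
  qed
  \<comment> \<open>\<open>F l\<close> has jumps, so exact invariance is obtained matrix by matrix;
    \<open>F l\<close> is real-valued and depends on the real part only, so conjugating eigenvalues
    does not matter.\<close>
  have Econj: "conj_by W n (E l i n) = E l i n" for l i n
  proof -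
    let ?V = "W n * mat_cnj (U i n)"
    have V: "unitary_mat n ?V" by (rule conj_by_udiag(1)[OF W U])
    have "udiag n ?V (\<lambda>j. cnj (\<mu> i n j)) = s i n"
      using s(4)[of n i] conj_by_udiag(2)[OF W U, of n i "\<mu> i n"] by (simp add: sU)
    hence eq: "udiag n ?V (\<lambda>j. cnj (\<mu> i n j)) * 1\<^sub>m n = 1\<^sub>m n * udiag n (U i n) (\<mu> i n)"
      using U[of n i] by (simp add: sU left_mult_one_mat[of _ n n] right_mult_one_mat[of _ n n])
    have "udiag n ?V (\<lambda>j. F l (cnj (\<mu> i n j))) = E l i n"
      using udiag_intertwine[OF V U one_carrier_mat eq, of "F l"] V U[of n i]
      by (simp add: E_def left_mult_one_mat[of _ n n] right_mult_one_mat[of _ n n])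
    moreover have "conj_by W n (E l i n) = udiag n ?V (\<lambda>j. cnj (F l (\<mu> i n j)))"
      unfolding E_def by (rule conj_by_udiag(2)[OF W U])
    moreover have "cnj (F l z) = F l (cnj z)" for z by (simp add: F_def)
    ultimately show ?thesis by simp
  qed
  have ER: "abs_qalg (E l) = R l" if l: "l \<in> I" for l
  proof -
    have E: "abs_qalg (E l) = ?Phi (F l)" by (simp add: E_def)
    \<comment> \<open>\<open>S\<close> acts on \<open>R m\<close> as the scalar \<open>m\<close>, so
      \<open>G m\<close> acts there as \<open>1\<close>, and \<open>F l\<close> may be replaced by
      \<open>F l * G m\<close>.\<close>
    have PR: "?Phi (F l) * R m = (if l = m then R m else 0)" if m: "m \<in> I" for m
    proof -
      have SR: "S * R m = R m * cof (complex_of_int m)"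
      proof -
        have "S * R m = (\<Sum>l\<in>I. cof (complex_of_int l) * (R l * R m))" by (simp add: S_def sum_distrib_right mult.assoc)
        also have "\<dots> = cof (complex_of_int m) * (R m * R m)" by (rule sum_single[OF I m]) (use R(4) m in auto)
        finally show ?thesis using R(4)[OF m m] by (simp add: cof_commute)
      qed
      have "?Phi (G m) * R m = R m * cof (G m (complex_of_int m))"
        by (rule calc_intertwine[OF Phi calc_scalar SR _ cG]) (use SR S(1) in \<open>simp add: star_cof\<close>)
      hence GR: "?Phi (G m) * R m = R m" by (simp add: G_def bump_1)
      have "?Phi (F l) * R m = ?Phi (F l) * ?Phi (G m) * R m" using GR by (simp add: mult.assoc)
      also have "?Phi (F l) * ?Phi (G m) = ?Phi (\<lambda>z. F l z * G m z)"
        by (rule calc_mult[OF Phi bF bounded_image_cont[OF cD cG], symmetric])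
      finally have *: "?Phi (F l) * R m = ?Phi (\<lambda>z. if l = m then G m z else 0) * R m" by (simp only: FG)
      show ?thesis
      proof (cases "l = m")
        case True
        from * GR show ?thesis unfolding True by (simp only: refl if_True)
      next
        case False
        thus ?thesis using * calc_const[OF Phi, of 0] by (simp only: if_False cof_0 mult_zero_left)
      qed
    qed
    have "?Phi (F l) * (\<Sum>m\<in>I. R m) = (\<Sum>m\<in>I. if l = m then R m else 0)"
      unfolding sum_distrib_left by (rule sum.cong[OF refl PR])
    also have "\<dots> = R l" using I l by simp
    finally show ?thesis unfolding R(5) E by simp
  qed
  have "\<exists>y. fam y \<and> abs_qalg y = (\<Sum>l\<in>I. cof (complex_of_real (a l)) * abs_qalg (E l) + 
        cof \<i> * (abs_qalg (E l) * abs_qalg k * abs_qalg (E l))) \<and>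
      (\<forall>i n. normal_matrix (y i n) \<and> conj_by W n (y i n) = y i n \<and> 
        (\<forall>m. m \<notin> I \<longrightarrow> E m i n * y i n = 0\<^sub>m n n \<and> y i n * E m i n = 0\<^sub>m n n))"
    by (rule lift_blocks[OF W fE Eadj Eidem _ Econj k(1,3) k4 I]) (rule Eorth)
  then obtain y where y: "fam y" "abs_qalg y = (\<Sum>l\<in>I. cof (complex_of_real (a l)) * abs_qalg (E l) + 
        cof \<i> * (abs_qalg (E l) * abs_qalg k * abs_qalg (E l)))"
      "\<And>i n. normal_matrix (y i n)" "\<And>i n. conj_by W n (y i n) = y i n" by blast
  have "abs_qalg y = (\<Sum>l\<in>I. cof (complex_of_real (a l)) * R l + cof \<i> * (K * R l))"
    unfolding y(2) 
  proof (rule sum.cong[OF refl])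
    fix l assume l: "l \<in> I"
    have "R l * K * R l = K * (R l * R l)" by (simp only: R(3)[OF l, symmetric] mult.assoc)
    thus "cof (complex_of_real (a l)) * abs_qalg (E l) + cof \<i> * (abs_qalg (E l) * abs_qalg k * abs_qalg (E l)) =
      cof (complex_of_real (a l)) * R l + cof \<i> * (K * R l)" using R(4)[OF l l] by (simp add: ER[OF l] flip: k(2))
  qed
  also have "\<dots> = (\<Sum>l\<in>I. cof (complex_of_real (a l)) * R l) + cof \<i> * (K * (\<Sum>l\<in>I. R l))"
    by (simp only: sum.distrib sum_distrib_left)
  finally show ?thesis using y R(5) by auto
qed

lemma evsmall_decreasing: "evsmall (\<lambda>i n. 1 / real (Suc i))"
  unfolding evsmall_def
proof (intro allI impI)
  fix e :: real assume "e > 0"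
  then obtain i0 where i0: "1 / real (Suc i0) < e" using nat_approx_posE by blast
  have "1 / real (Suc i) \<le> e" if "i0 \<le> i" for i
    using i0 that by (intro order.trans[OF _ less_imp_le[OF i0]] divide_left_mono) auto
  thus "\<exists>i0. \<forall>i\<ge>i0. \<forall>n::nat. 1 / real (Suc i) \<le> e" by blast
qed

lemma qalg_near_normal:
  assumes W: "real_structure W" and q: "q * star q = star q * q" "sig W q = q" "nb q 1" and e: "e > 0"
  shows "\<exists>y. fam y \<and> nb (q - abs_qalg y) e \<and> (\<forall>i n. normal_matrix (y i n) \<and> conj_by W n (y i n) = y i n)"
proof -
  define H where "H = cof (1/2) * (q + star q)"
  define K where "K = cof (- \<i> / 2) * (q - star q)"
  have H: "sa H" by (simp add: H_def sa_def star_mult star_add star_cof add.commute flip: cof_commute)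
  have K: "sa K" by (simp add: K_def sa_def star_mult star_diff star_cof cof_uminus cof_commute algebra_simps)
  have HK: "H * K = K * H"
  proof -
    have "(q + star q) * (q - star q) = (q - star q) * (q + star q)" by (simp add: algebra_simps q(1))
    thus ?thesis unfolding H_def K_def by (metis cof_commute mult.assoc)
  qed
  have sH: "sig W H = H" by (simp add: H_def sig_mult[OF W] sig_add[OF W] sig_star[OF W] sig_cof[OF W] q(2))
  have sK: "sig W K = - K"
  proof -
    have "sig W K = cof (cnj (- \<i> / 2)) * (q - star q)"
      by (simp only: K_def sig_mult[OF W] sig_diff[OF W] sig_star[OF W] sig_cof[OF W] q(2))
    also have "cnj (- \<i> / 2) = - (- \<i> / 2)" by (simp add: complex_eq_iff)
    finally show ?thesis by (simp only: cof_uminus[of "- \<i> / 2"] mult_minus_left K_def)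
  qed
  have "nb H (cmod (1/2) * (1 + 1))" unfolding H_def by (intro nb_mult nb_cof nb_add nb_star q) auto
  hence nH: "nb H 1" by (simp add: norm_divide)
  have "nb K (cmod (- \<i> / 2) * (1 + 1))" unfolding K_def by (intro nb_mult nb_cof nb_diff nb_star q) auto
  hence nK: "nb K 1" by (simp add: norm_divide)
  have "cof \<i> * K = cof (1/2) * (q - star q)" unfolding K_def by (simp add: mult.assoc[symmetric] flip: cof_mult)
  hence "H + cof \<i> * K = cof (1/2) * (q + q)" by (simp add: H_def algebra_simps)
  also have "\<dots> = cof (1/2 + 1/2) * q" by (simp only: cof_add distrib_left distrib_right)
  finally have HqK: "H + cof \<i> * K = q" by simp
  obtain I :: "int set" and a R K' where I: "finite I" "sa K'" "sig W K' = - K'"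
    "\<forall>l\<in>I. star (R l) = R l \<and> sig W (R l) = R l \<and> K' * R l = R l * K'"
    "\<forall>l\<in>I. \<forall>m\<in>I. R l * R m = (if l = m then R l else 0)" "(\<Sum>l\<in>I. R l) = 1"
    "nb (H + cof \<i> * K - ((\<Sum>l\<in>I. cof (complex_of_real (a l)) * R l) + cof \<i> * K')) e"
    using quantize[OF W H sH nH K sK nK HK e] by blast
  have "star K' = K'" using I(2) by (simp add: sa_def)
  then obtain y where "fam y" "abs_qalg y = (\<Sum>l\<in>I. cof (complex_of_real (a l)) * R l) + cof \<i> * K'"
     "\<forall>i n. normal_matrix (y i n) \<and> conj_by W n (y i n) = y i n"
    using lift_normal[OF W I(1) _ I(3), of R a] I(4-6) by auto
  thus ?thesis using I(7) unfolding HqK by (intro exI[of _ y]) simp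
qed

theorem lin_real_structure:
  assumes W: "real_structure W" and e: "e > 0"
  shows "\<exists>\<delta>>0. \<forall>n. \<forall>X\<in>carrier_mat n n. conj_by W n X = X \<and> op_norm X \<le> 1 \<and>
      op_norm (X * mat_adjoint X - mat_adjoint X * X) \<le> \<delta> \<longrightarrow>
    (\<exists>X'\<in>carrier_mat n n. conj_by W n X' = X' \<and> normal_matrix X' \<and> op_norm X' \<le> 1 \<and> op_norm (X - X') \<le> e)"
proof (rule ccontr)
  assume contr: "\<not> ?thesis"
  have "\<exists>n X. X \<in> carrier_mat n n \<and> conj_by W n X = X \<and> op_norm X \<le> 1 \<and> 
      op_norm (X * mat_adjoint X - mat_adjoint X * X) \<le> 1 / real (Suc i) \<and>
    \<not> (\<exists>X'\<in>carrier_mat n n. conj_by W n X' = X' \<and> normal_matrix X' \<and> op_norm X' \<le> 1 \<and> op_norm (X - X') \<le> e)" for i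
  proof -
    have "1 / real (Suc i) > 0" by simp
    thus ?thesis using contr by blast
  qed
  then obtain N X where X: "\<And>i. X i \<in> carrier_mat (N i) (N i)" "\<And>i. conj_by W (N i) (X i) = X i" "\<And>i. op_norm (X i) \<le> 1"
      "\<And>i. op_norm (X i * mat_adjoint (X i) - mat_adjoint (X i) * X i) \<le> 1 / real (Suc i)"
    and bad: "\<And>i. \<not> (\<exists>X'\<in>carrier_mat (N i) (N i). conj_by W (N i) X' = X' \<and> normal_matrix X' \<and> op_norm X' \<le> 1 \<and> op_norm (X i - X') \<le> e)"
    by metis
  \<comment> \<open>Filling the other sizes with zero keeps the commutators small uniformly in the
    size.\<close>
  define x where "x = (\<lambda>i n. if n = N i then X i else 0\<^sub>m n n)"
  have x: "fam x" by (rule famI[of _ 1]) (use X in \<open>auto simp: x_def\<close>)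
  have z: "mat_adjoint (0\<^sub>m n n) = (0\<^sub>m n n :: complex mat)" for n by (intro eq_matI) auto
  have z2: "0\<^sub>m n n - 0\<^sub>m n n = (0\<^sub>m n n :: complex mat)" for n by (intro eq_matI) auto
  have ax: "fam (\<lambda>i n. mat_adjoint (x i n))" using x by simp
  have "evsmall (\<lambda>i n. op_norm (x i n * mat_adjoint (x i n) - mat_adjoint (x i n) * x i n))"
    by (rule evsmall_mono[OF evsmall_decreasing]) (use X(4) in \<open>auto simp: x_def z z2\<close>)
  hence n: "abs_qalg x * star (abs_qalg x) = star (abs_qalg x) * abs_qalg x"
    using x ax by (simp add: abs_qalg_star abs_qalg_simps(4) abs_qalg_eq_iff fam_rel_def)
  have "conj_by W n (x i n) = x i n" for i n using X(2) by (simp add: x_def conj_by_zero[OF W])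
  hence s: "sig W (abs_qalg x) = abs_qalg x" using x by (simp add: abs_qalg_sig[OF W])
  have nb: "nb (abs_qalg x) 1" unfolding abs_qalg_nb[OF x] by (rule evsmall_nonpos) (use X(3) in \<open>auto simp: x_def\<close>)
  \<comment> \<open>A bound \<open>e / 4\<close> in the quotient gives \<open>e / 2\<close> for the
    matrices at a late index; the other half of \<open>e\<close> is kept for rescaling.\<close>
  obtain y where y: "fam y" "nb (abs_qalg x - abs_qalg y) (e / 4)" "\<And>i n. normal_matrix (y i n)" "\<And>i n. conj_by W n (y i n) = y i n"
    using qalg_near_normal[OF W n s nb, of "e / 4"] e by auto
  have "evsmall (\<lambda>i n. op_norm (x i n - y i n) - e / 4)" 
    using y(2) x y(1) by (simp add: abs_qalg_minus abs_qalg_nb)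
  moreover have "e / 4 > 0" using e by simp
  ultimately obtain i where i: "\<And>n. op_norm (x i n - y i n) - e / 4 \<le> e / 4" unfolding evsmall_def by blast
  define n where "n = N i"
  define Y where "Y = y i n"
  have c: "X i \<in> carrier_mat n n" "Y \<in> carrier_mat n n" using X(1)[of i] y(1) by (auto simp: n_def Y_def)
  have d: "op_norm (X i - Y) \<le> e / 2" using i[of n] by (simp add: x_def n_def Y_def)
  have "Y = X i + - (X i - Y)" using c by (intro eq_matI) auto
  hence "op_norm Y \<le> op_norm (X i) + op_norm (X i - Y)" 
    using op_norm_add[OF c(1), of "- (X i - Y)"] op_norm_uminus[of "X i - Y" n] c by simp
  hence nY: "op_norm Y \<le> 1 + e / 2" using X(3)[of i] d by linarith
  \<comment> \<open>The norm of \<open>Y\<close> is at most \<open>1 + e / 2\<close>; rescaling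
    brings it down to \<open>1\<close> and costs
    \<open>(1 - t) * (1 + e / 2) = e / 2\<close>.\<close>
  define t where "t = 1 / (1 + e / 2)"
  have t: "0 < t" "t \<le> 1" "t * (1 + e / 2) = 1" using e by (auto simp: t_def)
  let ?X = "complex_of_real t \<cdot>\<^sub>m Y"
  have "op_norm ?X \<le> t * op_norm Y" using op_norm_smult[OF c(2), of "complex_of_real t"] t by simp
  also have "\<dots> \<le> t * (1 + e / 2)" using nY t by (intro mult_left_mono) auto
  finally have 1: "op_norm ?X \<le> 1" using t by simp
  have "X i - ?X = (X i - Y) + complex_of_real (1 - t) \<cdot>\<^sub>m Y" using c by (intro eq_matI) (auto simp: algebra_simps)
  hence "op_norm (X i - ?X) \<le> op_norm (X i - Y) + op_norm (complex_of_real (1 - t) \<cdot>\<^sub>m Y)"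
    using op_norm_add[of "X i - Y" n "complex_of_real (1 - t) \<cdot>\<^sub>m Y"] c by simp
  also have "op_norm (complex_of_real (1 - t) \<cdot>\<^sub>m Y) \<le> (1 - t) * op_norm Y"
    using op_norm_smult[OF c(2), of "complex_of_real (1 - t)"] t by (simp only: norm_of_real)
  also have "\<dots> \<le> (1 - t) * (1 + e / 2)" using nY t by (intro mult_left_mono) auto
  also have "(1 - t) * (1 + e / 2) = (1 + e / 2) - t * (1 + e / 2)" by (simp only: left_diff_distrib mult_1_left)
  finally have 2: "op_norm (X i - ?X) \<le> e" using d t(3) by linarith
  have 3: "normal_matrix ?X" using y(3)[of i n] c unfolding normal_matrix_def Y_def[symmetric]
    by (simp add: mat_adjoint_smult mult_smult_distrib[of _ n n _ n] mult_smult_assoc_mat[of _ n n _ n])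
  have 4: "conj_by W n ?X = ?X" using conj_by_smult[OF W c(2), of "complex_of_real t"] y(4)[of n i] by (simp add: Y_def)
  show False using bad[of i] 1 2 3 4 c by (auto simp flip: n_def)
qed

section \<open>Real and quaternionic matrices\<close>

lemma real_matrix_iff: "real_matrix X \<longleftrightarrow> mat_cnj X = X"
proof
  assume r: "real_matrix X"
  have "cnj (X $$ (i, j)) = X $$ (i, j)" if "i < dim_row X" "j < dim_col X" for i j
    using r elements_matI[OF carrier_matI[OF refl refl] that refl] unfolding real_matrix_def by (simp add: subset_iff flip: Reals_cnj_iff)
  thus "mat_cnj X = X" by (intro eq_matI) auto
next
  assume r: "mat_cnj X = X"
  have "X $$ (i, j) \<in> \<real>" if "i < dim_row X" "j < dim_col X" for i j
    using mat_cnj_index[OF that] unfolding r by (simp add: Reals_cnj_iff)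
  thus "real_matrix X" unfolding real_matrix_def by (auto simp: elements_mat_def)
qed

definition symplectic :: "nat \<Rightarrow> complex mat" where
  "symplectic m = four_block_mat (0\<^sub>m m m) (1\<^sub>m m) (- 1\<^sub>m m) (0\<^sub>m m m)"

lemma mat_adjoint_symplectic: "mat_adjoint (symplectic m) = four_block_mat (0\<^sub>m m m) (- 1\<^sub>m m) (1\<^sub>m m) (0\<^sub>m m m)"
  unfolding symplectic_def by (intro eq_matI) auto

lemma symplectic_mult:
  "symplectic m * symplectic m = - 1\<^sub>m (2 * m)" 
  "mat_adjoint (symplectic m) * symplectic m = 1\<^sub>m (2 * m)" "symplectic m * mat_adjoint (symplectic m) = 1\<^sub>m (2 * m)"
proof -
  have b: "four_block_mat (1\<^sub>m m) (0\<^sub>m m m) (0\<^sub>m m m) (1\<^sub>m m) = (1\<^sub>m (2 * m) :: complex mat)"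
    "four_block_mat (- 1\<^sub>m m) (0\<^sub>m m m) (0\<^sub>m m m) (- 1\<^sub>m m) = - (1\<^sub>m (2 * m) :: complex mat)"
    by (intro eq_matI; auto)+
  have z: "0\<^sub>m m m * A = 0\<^sub>m m m" "A * 0\<^sub>m m m = 0\<^sub>m m m" if "A \<in> carrier_mat m m" for A :: "complex mat" using that by auto
  have c: "- 1\<^sub>m m \<in> carrier_mat m m" "(- 1\<^sub>m m) * (- 1\<^sub>m m) = (1\<^sub>m m :: complex mat)"
    "- 0\<^sub>m m m = (0\<^sub>m m m :: complex mat)" "1\<^sub>m (m + m) = (1\<^sub>m (2 * m) :: complex mat)"
    by (auto simp: mult_2)
  note mb = mult_four_block_mat[of _ m m _ m _ m _ _ m _ m]
  show "symplectic m * symplectic m = - 1\<^sub>m (2 * m)" 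
    unfolding symplectic_def b(2)[symmetric] by (subst mb) (auto simp: z)
  show "mat_adjoint (symplectic m) * symplectic m = 1\<^sub>m (2 * m)" 
    unfolding mat_adjoint_symplectic b(1)[symmetric] unfolding symplectic_def by (subst mb) (auto simp: z c)
  show "symplectic m * mat_adjoint (symplectic m) = 1\<^sub>m (2 * m)" 
    unfolding mat_adjoint_symplectic b(1)[symmetric] unfolding symplectic_def by (subst mb) (auto simp: z c)
qed

text \<open>A real structure has a matrix in every size; odd sizes get the identity as default
  value.\<close>

definition quat :: "nat \<Rightarrow> complex mat" where
  "quat n = (if even n then symplectic (n div 2) else 1\<^sub>m n)"

lemma real_structure_quat: "real_structure quat"
  unfolding real_structure_def
proof
  fix n
  show "unitary_mat n (quat n) \<and> mat_cnj (quat n) = quat n \<and> (quat n * quat n = 1\<^sub>m n \<or> quat n * quat n = - 1\<^sub>m n)"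
  proof (cases "even n")
    case True
    then obtain m where n: "n = 2 * m" by blast
    have "mat_cnj (symplectic m) = symplectic m" unfolding symplectic_def by (intro eq_matI) auto
    moreover have "symplectic m \<in> carrier_mat (2 * m) (2 * m)" unfolding symplectic_def by auto
    ultimately show ?thesis using symplectic_mult[of m] by (simp add: quat_def n unitary_mat_def)
  qed (simp add: quat_def)
qed

text \<open>Multiplication by the symplectic matrix and its adjoint swaps and signs the blocks as in
  \<open>sharp\<close>, and entrywise conjugation is the transpose of the adjoint. The matrices
  fixed by the involution are therefore those whose \<open>sharp\<close> is their adjoint.\<close>

lemma conj_by_quat:
  assumes X: "X \<in> carrier_mat (2 * m) (2 * m)"
  shows "conj_by quat (2 * m) X = mat_adjoint (sharp m X)"
proof -
  obtain A B C D where s: "split_block X m m = (A, B, C, D)" by (cases "split_block X m m") blast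
  have X': "A \<in> carrier_mat m m" "B \<in> carrier_mat m m" "C \<in> carrier_mat m m" "D \<in> carrier_mat m m" 
    "X = four_block_mat A B C D"
    using split_block[OF s, of m m] X by auto
  have cX: "mat_cnj X = four_block_mat (mat_cnj A) (mat_cnj B) (mat_cnj C) (mat_cnj D)"
    unfolding X'(5) using X'(1-4) by (intro eq_matI) auto
  have cc: "mat_cnj A \<in> carrier_mat m m" "mat_cnj B \<in> carrier_mat m m" "mat_cnj C \<in> carrier_mat m m" "mat_cnj D \<in> carrier_mat m m"
    using X' by auto
  note mb = mult_four_block_mat[of _ m m _ m _ m _ _ m _ m]
  have n1: "- 1\<^sub>m m * M = - M" "M * - 1\<^sub>m m = - M" "0\<^sub>m m m * M = 0\<^sub>m m m" "M * 0\<^sub>m m m = 0\<^sub>m m m"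
     "0\<^sub>m m m + M = M" "M + 0\<^sub>m m m = M" if "M \<in> carrier_mat m m" for M :: "complex mat" 
    using that by auto
  have "symplectic m * mat_cnj X = four_block_mat (mat_cnj C) (mat_cnj D) (- mat_cnj A) (- mat_cnj B)"
    unfolding symplectic_def cX by (subst mb) (use cc in \<open>auto simp: n1\<close>)
  hence "conj_by quat (2 * m) X = four_block_mat (mat_cnj C) (mat_cnj D) (- mat_cnj A) (- mat_cnj B) * 
      four_block_mat (0\<^sub>m m m) (- 1\<^sub>m m) (1\<^sub>m m) (0\<^sub>m m m)"
    by (simp add: conj_by_def quat_def mat_adjoint_symplectic)
  also have "\<dots> = four_block_mat (mat_cnj D) (- mat_cnj C) (- mat_cnj B) (mat_cnj A)"
    by (subst mb) (use cc in \<open>auto simp: n1\<close>)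
  also have "\<dots> = mat_adjoint (sharp m X)"
    unfolding sharp_def s prod.case using X'(1-4) by (intro eq_matI) auto
  finally show ?thesis .
qed

lemma quaternionic_mat_iff: "X \<in> quaternionic_mat m \<longleftrightarrow> X \<in> carrier_mat (2 * m) (2 * m) \<and> conj_by quat (2 * m) X = X"
proof (cases "X \<in> carrier_mat (2 * m) (2 * m)")
  case True
  have "sharp m X = mat_adjoint X \<longleftrightarrow> mat_adjoint (sharp m X) = X" by (metis mat_adjoint_adjoint)
  thus ?thesis using True by (simp add: quaternionic_mat_def conj_by_quat)
qed (simp add: quaternionic_mat_def)

theorem theorem1p2:
  shows "(\<forall>\<epsilon>::real. \<epsilon> > 0 \<longrightarrow>
            (\<exists>\<delta>::real. \<delta> > 0 \<and>
              (\<forall>n::nat. n \<ge> 1 \<longrightarrow>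
                (\<forall>X \<in> carrier_mat n n.
                   real_matrix X \<and> op_norm X \<le> 1 \<and>
                   op_norm (X * mat_adjoint X - mat_adjoint X * X) \<le> \<delta> \<longrightarrow>
                   (\<exists>X' \<in> carrier_mat n n.
                      real_matrix X' \<and> normal_matrix X' \<and>
                      op_norm X' \<le> 1 \<and> op_norm (X - X') \<le> \<epsilon>)))))
       \<and>
         (\<forall>\<epsilon>::real. \<epsilon> > 0 \<longrightarrow>
            (\<exists>\<delta>::real. \<delta> > 0 \<and>
              (\<forall>n::nat. n \<ge> 1 \<longrightarrow>
                (\<forall>X \<in> quaternionic_mat n.
                   op_norm X \<le> 1 \<and>
                   op_norm (X * mat_adjoint X - mat_adjoint X * X) \<le> \<delta> \<longrightarrow>
                   (\<exists>X' \<in> quaternionic_mat n.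
                      normal_matrix X' \<and>
                      op_norm X' \<le> 1 \<and> op_norm (X - X') \<le> \<epsilon>)))))"
proof (intro conjI allI impI)
  fix e :: real assume e: "e > 0"
  have one: "real_structure (\<lambda>n. 1\<^sub>m n)" by (simp add: real_structure_def)
  have cj: "conj_by (\<lambda>n. 1\<^sub>m n) n X = X \<longleftrightarrow> real_matrix X" if "X \<in> carrier_mat n n" for n X
    using that by (simp add: conj_by_def real_matrix_iff left_mult_one_mat[of _ n n] right_mult_one_mat[of _ n n])
  show "\<exists>\<delta>::real. \<delta> > 0 \<and> (\<forall>n::nat. n \<ge> 1 \<longrightarrow> (\<forall>X \<in> carrier_mat n n.
       real_matrix X \<and> op_norm X \<le> 1 \<and> op_norm (X * mat_adjoint X - mat_adjoint X * X) \<le> \<delta> \<longrightarrow>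
       (\<exists>X' \<in> carrier_mat n n. real_matrix X' \<and> normal_matrix X' \<and> op_norm X' \<le> 1 \<and> op_norm (X - X') \<le> e)))"
  proof -
    from lin_real_structure[OF one e] obtain \<delta> where "\<delta> > 0" and d: "\<And>n X. X \<in> carrier_mat n n \<Longrightarrow> conj_by (\<lambda>n. 1\<^sub>m n) n X = X \<Longrightarrow>
        op_norm X \<le> 1 \<Longrightarrow> op_norm (X * mat_adjoint X - mat_adjoint X * X) \<le> \<delta> \<Longrightarrow>
        \<exists>X'\<in>carrier_mat n n. conj_by (\<lambda>n. 1\<^sub>m n) n X' = X' \<and> normal_matrix X' \<and> op_norm X' \<le> 1 \<and> op_norm (X - X') \<le> e"
      by blast
    show ?thesis
    proof (intro exI[of _ \<delta>] conjI allI impI ballI \<open>\<delta> > 0\<close>, elim conjE)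
      fix n X assume X: "X \<in> carrier_mat n n" "real_matrix X" "op_norm X \<le> 1" "op_norm (X * mat_adjoint X - mat_adjoint X * X) \<le> \<delta>"
      from d[OF X(1) _ X(3,4)] obtain X' where "X' \<in> carrier_mat n n" "conj_by (\<lambda>n. 1\<^sub>m n) n X' = X'" "normal_matrix X'" "op_norm X' \<le> 1" "op_norm (X - X') \<le> e"
        using cj[OF X(1)] X(2) by blast
      thus "\<exists>X'\<in>carrier_mat n n. real_matrix X' \<and> normal_matrix X' \<and> op_norm X' \<le> 1 \<and> op_norm (X - X') \<le> e"
        using cj by blast
    qed
  qed
next
  fix e :: real assume e: "e > 0"
  show "\<exists>\<delta>::real. \<delta> > 0 \<and> (\<forall>n::nat. n \<ge> 1 \<longrightarrow> (\<forall>X \<in> quaternionic_mat n.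
       op_norm X \<le> 1 \<and> op_norm (X * mat_adjoint X - mat_adjoint X * X) \<le> \<delta> \<longrightarrow>
       (\<exists>X' \<in> quaternionic_mat n. normal_matrix X' \<and> op_norm X' \<le> 1 \<and> op_norm (X - X') \<le> e)))"
  proof -
    from lin_real_structure[OF real_structure_quat e] obtain \<delta> where "\<delta> > 0" and d: "\<And>n X. X \<in> carrier_mat n n \<Longrightarrow> conj_by quat n X = X \<Longrightarrow>
        op_norm X \<le> 1 \<Longrightarrow> op_norm (X * mat_adjoint X - mat_adjoint X * X) \<le> \<delta> \<Longrightarrow>
        \<exists>X'\<in>carrier_mat n n. conj_by quat n X' = X' \<and> normal_matrix X' \<and> op_norm X' \<le> 1 \<and> op_norm (X - X') \<le> e"
      by blast
    show ?thesis
    proof (intro exI[of _ \<delta>] conjI allI impI ballI \<open>\<delta> > 0\<close>, elim conjE)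
      fix n X assume X: "X \<in> quaternionic_mat n" "op_norm X \<le> 1" "op_norm (X * mat_adjoint X - mat_adjoint X * X) \<le> \<delta>"
      \<comment> \<open>The bound \<open>\<delta>\<close> serves all sizes, in particular
        \<open>2 * n\<close>.\<close>
      have "X \<in> carrier_mat (2 * n) (2 * n)" "conj_by quat (2 * n) X = X" using X(1) by (simp_all add: quaternionic_mat_iff)
      from d[OF this X(2,3)] show "\<exists>X'\<in>quaternionic_mat n. normal_matrix X' \<and> op_norm X' \<le> 1 \<and> op_norm (X - X') \<le> e"
        using quaternionic_mat_iff by blast
    qed
  qed
qed

end
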